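(* Let $a\in C^1(\mathbb R^m,\mathbb R^m)$ satisfy the linear growth condition and let $X(x,\cdot)$ be the solution of $X(x,t)=x+\int_0^t a(X(x,s))\,ds+U_t-U_0$, $t\ge 0$, where $U$ is a Lévy process in $\mathbb R^m$ without Gaussian component and with Lévy measure $\Pi$. Let $x_*\in\mathbb R^m$ be given and suppose there exists $\varepsilon_*>0$ such that for every $v\in\mathbb R^m\setminus\{0\}$ and every $x\in\bar B(x_*,\varepsilon_* )=\{y:\|y-x_*\|\le\varepsilon_*\}$ $$\Pi\bigl(u:\ (a(x+u)-a(x),v)_{\mathbb R^m}\neq 0\bigr)=+\infty .$$ Then for every $t>0$ the law of $X(x_*,t)$ is absolutely continuous with respect to the Lebesgue measure $\lambda^m$ on $\mathbb R^m$.
   Context: Linear growth condition: there is $K$ with $\|a(x)\|^2\le K(1+\|x\|^2)$ for all $x$. The Lévy process is $U_t=U_0+\int_0^t\int_{\|u\|>1}u\,\nu(ds,du)+\int_0^t\int_{\|u\|\le1}u\,\tilde\nu(ds,du)$, where $\nu$ is a Poisson point measure on $[0,\infty)\times(\mathbb R^m\setminus\{0\})$ with intensity $dt\,\Pi(du)$, $\tilde\nu(dt,du)=\nu(dt,du)-dt\,\Pi(du)$, and $\Pi$ is a Lévy measure ($\int(\|u\|^2\wedge1)\Pi(du)<\infty$). No further assumption on $\Pi$ is made. *)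

theory Defs
  imports "HOL-Probability.Probability"
begin

definition C1_map :: "('a::real_normed_vector \<Rightarrow> 'b::real_normed_vector) \<Rightarrow> bool" where
  "C1_map a \<longleftrightarrow>
    (\<exists>a' :: 'a \<Rightarrow> 'a \<Rightarrow>\<^sub>L 'b.
      (\<forall>x. (a has_derivative blinfun_apply (a' x)) (at x)) \<and> continuous_on UNIV a')"

definition linear_growth :: "('a::real_normed_vector \<Rightarrow> 'b::real_normed_vector) \<Rightarrow> bool" where
  "linear_growth a \<longleftrightarrow> (\<exists>K. \<forall>x. (norm (a x))\<^sup>2 \<le> K * (1 + (norm x)\<^sup>2))"

definition cadlag :: "(real \<Rightarrow> 'a::topological_space) \<Rightarrow> bool" where
  "cadlag f \<longleftrightarrow>
    (\<forall>t\<ge>0. (f \<longlongrightarrow> f t) (at_right t)) \<and> (\<forall>t>0. \<exists>l. (f \<longlongrightarrow> l) (at_left t))"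

text \<open>A Levy measure lives on the space without the origin. It is represented by a Borel measure
  on the whole space that does not charge the origin.\<close>

definition levy_measure :: "'a::euclidean_space measure \<Rightarrow> bool" where
  "levy_measure \<mu> \<longleftrightarrow>
    sets \<mu> = sets borel \<and> emeasure \<mu> {0} = 0 \<and>
    (\<integral>\<^sup>+u. ennreal (min ((norm u)\<^sup>2) 1) \<partial>\<mu>) < \<infinity>"

text \<open>The measure \<open>dt \<mu>(du)\<close> on \<open>[0,\<infinity>) \<times> (V - {0})\<close>.\<close>

definition levy_intensity :: "'a::euclidean_space measure \<Rightarrow> (real \<times> 'a) measure" where
  "levy_intensity \<mu> = restrict_space lborel {0..} \<Otimes>\<^sub>M restrict_space \<mu> (- {0})"

text \<open>In the last conjunct, finite families of disjoint sets are covered by padding with empty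
  sets. The Poisson weights are written out because \<^const>\<open>poisson_pmf\<close> is specified only for
  positive rates.\<close>

definition poisson_point_measure ::
    "'w measure \<Rightarrow> 'z measure \<Rightarrow> ('w \<Rightarrow> 'z measure) \<Rightarrow> bool" where
  "poisson_point_measure M \<Lambda> \<nu> \<longleftrightarrow>
    (\<forall>\<omega>\<in>space M. sets (\<nu> \<omega>) = sets \<Lambda>) \<and>
    (\<forall>\<omega>\<in>space M. \<forall>A\<in>sets \<Lambda>. emeasure (\<nu> \<omega>) A = \<infinity> \<or> (\<exists>k::nat. emeasure (\<nu> \<omega>) A = of_nat k)) \<and>
    (\<forall>A\<in>sets \<Lambda>. (\<lambda>\<omega>. emeasure (\<nu> \<omega>) A) \<in> borel_measurable M) \<and>
    (\<forall>A\<in>sets \<Lambda>. emeasure \<Lambda> A < \<infinity> \<longrightarrow>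
      (\<forall>k::nat. measure M {\<omega>\<in>space M. emeasure (\<nu> \<omega>) A = of_nat k}
        = exp (- measure \<Lambda> A) * measure \<Lambda> A ^ k / fact k)) \<and>
    (\<forall>A\<in>sets \<Lambda>. emeasure \<Lambda> A = \<infinity> \<longrightarrow> (AE \<omega> in M. emeasure (\<nu> \<omega>) A = \<infinity>)) \<and>
    (\<forall>A::nat \<Rightarrow> 'z set. range A \<subseteq> sets \<Lambda> \<longrightarrow> disjoint_family A \<longrightarrow>
      prob_space.indep_vars M (\<lambda>_. borel) (\<lambda>i \<omega>. emeasure (\<nu> \<omega>) (A i)) UNIV)"

text \<open>\<open>Z = \<integral> f d(\<nu> - \<Lambda>)\<close> for a deterministic \<open>f\<close> that is square integrable with respect to \<open>\<Lambda>\<close>.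
  Since \<open>\<nu> - \<Lambda>\<close> is not a measure in general, the integral is the limit in \<open>L\<^sup>2\<close> of the
  integrals over the sets \<open>{norm f > \<epsilon>}\<close>; these have finite \<open>\<Lambda>\<close>-measure, so that
  the integrals against \<open>\<nu>\<close> and \<open>\<Lambda>\<close> exist separately.\<close>

definition has_compensated_integral ::
    "'w measure \<Rightarrow> 'z measure \<Rightarrow> ('w \<Rightarrow> 'z measure) \<Rightarrow> ('z \<Rightarrow> 'a::euclidean_space) \<Rightarrow>
      ('w \<Rightarrow> 'a) \<Rightarrow> bool" where
  "has_compensated_integral M \<Lambda> \<nu> f Z \<longleftrightarrow>
    Z \<in> borel_measurable M \<and>
    ((\<lambda>\<epsilon>. \<integral>\<^sup>+\<omega>. ennreal ((norm (Z \<omega> -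
          ((LINT z:{z \<in> space \<Lambda>. \<epsilon> < norm (f z)}|\<nu> \<omega>. f z)
           - (LINT z:{z \<in> space \<Lambda>. \<epsilon> < norm (f z)}|\<Lambda>. f z))))\<^sup>2) \<partial>M)
      \<longlongrightarrow> 0) (at_right 0)"

text \<open>The stochastic integral over small jumps is determined, for each \<open>t\<close>, only up to a null set;
  the \<^const>\<open>cadlag\<close> paths make \<open>U - U 0\<close> unique up to indistinguishability. There is no Gaussian
  component, and no assumption on the initial value.\<close>

definition levy_process ::
    "'w measure \<Rightarrow> 'a::euclidean_space measure \<Rightarrow> ('w \<Rightarrow> (real \<times> 'a) measure) \<Rightarrow>
      (real \<Rightarrow> 'w \<Rightarrow> 'a) \<Rightarrow> bool" where
  "levy_process M \<mu> \<nu> U \<longleftrightarrow>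
    (\<forall>t\<ge>0. U t \<in> borel_measurable M) \<and>
    (AE \<omega> in M. cadlag (\<lambda>t. U t \<omega>)) \<and>
    (\<forall>t\<ge>0. \<exists>Z.
      has_compensated_integral M (levy_intensity \<mu>) \<nu>
        (\<lambda>z. indicator ({0<..t} \<times> {u. norm u \<le> 1}) z *\<^sub>R snd z) Z \<and>
      (AE \<omega> in M. U t \<omega> = U 0 \<omega> + (LINT z:{0<..t} \<times> {u. norm u > 1}|\<nu> \<omega>. snd z) + Z \<omega>))"

text \<open>The noise is additive, so the equation is solved path by path and no filtration is needed;
  integrability of \<open>a \<circ> Y\<close> makes \<open>Y - U\<close> continuous in time.\<close>

definition sde_solution ::
    "'w measure \<Rightarrow> ('a::euclidean_space \<Rightarrow> 'a) \<Rightarrow> (real \<Rightarrow> 'w \<Rightarrow> 'a) \<Rightarrow> 'a \<Rightarrow>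
      (real \<Rightarrow> 'w \<Rightarrow> 'a) \<Rightarrow> bool" where
  "sde_solution M a U x Y \<longleftrightarrow>
    (\<forall>t\<ge>0. Y t \<in> borel_measurable M) \<and>
    (AE \<omega> in M. \<forall>t\<ge>0.
      set_integrable lborel {0..t} (\<lambda>s. a (Y s \<omega>)) \<and>
      Y t \<omega> = x + (LINT s:{0..t}|lborel. a (Y s \<omega>)) + U t \<omega> - U 0 \<omega>)"

end

theory Submission
  imports Defs
begin

text \<open>Integration by parts over the jump times. Fix a short horizon \<open>h\<close>, cut \<open>(0, h]\<close> into \<open>n\<close> cells and
  keep the jumps of size above \<open>\<delta>\<close>. Up to small probability each cell contains at most one such jump;
  given the marks and the remaining noise, the times of these jumps are independent and uniform in
  their cells. Shifting the time of a jump \<open>u\<close> made at \<open>y\<close> moves the solution at the terminal time along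
  the image of \<open>a(y + u) - a(y)\<close> under the linearized flow. If these vectors span, then the
  terminal position has a law without singular part by the change of variables in the jump times. Spanning fails only
  with small probability: as long as the vectors found so far do not span, the nondegeneracy condition
  makes the next cell increase their rank with probability at least \<open>c\<close>, and \<open>c n\<close> can be made as large
  as desired, because compactness gives a large intensity of useful jumps for small \<open>\<delta>\<close>. Truncating
  the drift reduces to bounded \<open>a\<close> with bounded derivative.\<close>

section \<open>Integral equations\<close>

text \<open>Apart from nondegeneracy nothing restricts the Levy measure, so jump sizes cannot be
  varied; the jump times are the only smooth randomness. The remaining noise is merely cadlag, hence
  the terminal position is differentiable in the jump times only where that noise is continuous, and
  the derivative has no reason to be continuous. The inverse function theorem is out of reach; an
  expansion estimate at single points replaces it and already makes preimages of null sets null. The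
  horizon is short for two reasons: the linearized flow stays so close to the identity that it
  cannot destroy a nonzero direction, and the path stays in the ball where nondegeneracy is assumed.
  The gradient of a jump is built from this jump and earlier ones only, so that one jump can be
  resampled while the vectors found before it stay fixed. Since the rank can increase at most
  \<open>DIM('a)\<close> times over n cells, a per-cell gain of c with large c n leaves little
  probability for a deficient rank.\<close>

lemma norm_set_integral_le:
  fixes f :: "'b \<Rightarrow> 'a::euclidean_space"
  assumes "set_integrable M A f" "set_integrable M A g" "\<And>x. x \<in> A \<Longrightarrow> norm (f x) \<le> g x"
  shows "norm (LINT x:A|M. f x) \<le> (LINT x:A|M. g x)"
  by (rule order_trans[OF set_integral_norm_bound set_integral_mono])
     (use assms in \<open>auto intro: set_integrable_norm\<close>)

lemma set_integral_real_mono: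
  fixes f g :: "'b \<Rightarrow> real"
  assumes "set_integrable M A f" "set_integrable M A g" "\<And>x. x \<in> A \<Longrightarrow> f x \<le> g x"
  shows "(LINT x:A|M. f x) \<le> (LINT x:A|M. g x)"
  by (rule set_integral_mono) (use assms in auto)

lemma set_integrable_bounded_interval:
  fixes f :: "real \<Rightarrow> 'a::euclidean_space"
  assumes "f \<in> borel_measurable borel" "\<And>r. r \<in> {a..b} \<Longrightarrow> norm (f r) \<le> B"
  shows "set_integrable lborel {a..b} f"
  unfolding set_integrable_def
  by (rule integrableI_bounded_set_indicator[where B = B]) (use assms in \<open>auto simp: emeasure_lborel_Icc_eq\<close>)

lemma set_integral_exp:
  fixes c :: real
  assumes "c \<noteq> 0" "0 \<le> s"
  shows "set_integrable lborel {0..s} (\<lambda>r. exp (c * r))"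
    "(LINT r:{0..s}|lborel. exp (c * r)) = (exp (c * s) - 1) / c"
proof -
  show "set_integrable lborel {0..s} (\<lambda>r. exp (c * r))"
    by (intro borel_integrable_atLeastAtMost' continuous_intros)
  have "((\<lambda>r. exp (c * r)) has_integral (exp (c * s) / c - exp (c * 0) / c)) {0..s}"
    by (rule fundamental_theorem_of_calculus)
       (use assms in \<open>auto intro!: derivative_eq_intros simp: has_real_derivative_iff_has_vector_derivative[symmetric]\<close>)
  then show "(LINT r:{0..s}|lborel. exp (c * r)) = (exp (c * s) - 1) / c"
    using set_borel_integral_eq_integral(2)[OF \<open>set_integrable lborel {0..s} (\<lambda>r. exp (c * r))\<close>]
    by (simp add: integral_unique diff_divide_distrib)
qed

text \<open>The function exp(-L s) (c + L * integral of u up to s) has derivative L exp(-L s) (u s -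
  c - L * integral), which the hypothesis makes nonpositive; so it stays below its initial value
  c.\<close>

lemma gronwall:
  fixes u :: "real \<Rightarrow> real"
  assumes cont: "continuous_on {0..T} u" and L: "0 \<le> L"
    and le: "\<And>s. s \<in> {0..T} \<Longrightarrow> u s \<le> c + L * (LINT r:{0..s}|lborel. u r)"
    and s: "s \<in> {0..T}"
  shows "u s \<le> c * exp (L * s)"
proof -
  let ?U = "\<lambda>s. integral {0..s} u"
  have U: "(LINT r:{0..s}|lborel. u r) = ?U s" if "s \<in> {0..T}" for s
    by (rule set_borel_integral_eq_integral(2))
       (use that cont in \<open>auto intro!: borel_integrable_atLeastAtMost' intro: continuous_on_subset\<close>)
  define m where "m s = exp (- L * s) * (c + L * ?U s)" for s
  have dU: "(?U has_real_derivative u r) (at r within {0..T})" if "r \<in> {0..T}" for r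
    using integral_has_real_derivative[OF cont that] .
  have cU: "continuous_on {0..T} ?U"
    using dU by (meson DERIV_continuous continuous_on_eq_continuous_within)
  have "m s \<le> m 0"
  proof (rule DERIV_nonpos_imp_decreasing_open[of 0 s m])
    fix x assume x: "0 < x" "x < s"
    then have "x \<in> {0..T}" using s by auto
    have "(?U has_real_derivative u x) (at x)"
      using dU[OF \<open>x \<in> {0..T}\<close>] x s at_within_Icc_at[of 0 x T] by auto
    then have "DERIV m x :> exp (- L * x) * (L * u x) + (- L * exp (- L * x)) * (c + L * ?U x)"
      unfolding m_def by (auto intro!: derivative_eq_intros)
    moreover have "exp (- L * x) * (L * u x) + (- L * exp (- L * x)) * (c + L * ?U x) \<le> 0"
    proof -
      have "(exp (- L * x) * L) * (u x - (c + L * ?U x)) \<le> 0"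
        using le[OF \<open>x \<in> {0..T}\<close>] U[OF \<open>x \<in> {0..T}\<close>] L by (intro mult_nonneg_nonpos) auto
      then show ?thesis by (simp add: right_diff_distrib mult_ac)
    qed
    ultimately show "\<exists>y. DERIV m x :> y \<and> y \<le> 0" by blast
  qed (use s in \<open>auto simp: m_def intro!: continuous_intros intro: continuous_on_subset[OF cU]\<close>)
  then have "exp (- L * s) * (c + L * ?U s) \<le> c" by (simp add: m_def)
  then have "c + L * ?U s \<le> c * exp (L * s)"
    by (simp add: exp_minus field_simps)
  then show ?thesis using le[OF s] U[OF s] by simp
qed

text \<open>The equation is kept in integral form because the right-hand sides that occur depend on
  time only measurably, through a cadlag noise.\<close>

definition solves :: "(real \<Rightarrow> 'a \<Rightarrow> 'a) \<Rightarrow> 'a \<Rightarrow> real \<Rightarrow> (real \<Rightarrow> 'a::euclidean_space) \<Rightarrow> bool" where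
  "solves f x T z \<longleftrightarrow> (\<forall>s\<in>{0..T}. set_integrable lborel {0..s} (\<lambda>r. f r (z r)) \<and>
     z s = x + (LINT r:{0..s}|lborel. f r (z r)))"

lemma continuous_on_set_integral:
  fixes f :: "real \<Rightarrow> 'a::euclidean_space"
  assumes "set_integrable lborel {0..T} f"
  shows "continuous_on {0..T} (\<lambda>s. LINT r:{0..s}|lborel. f r)"
proof -
  have "continuous_on {0..T} (\<lambda>s. integral {0..s} f)"
    by (rule indefinite_integral_continuous_1) (use set_borel_integral_eq_integral(1)[OF assms] in auto)
  moreover have "integral {0..s} f = (LINT r:{0..s}|lborel. f r)" if "s \<in> {0..T}" for s
    by (rule set_borel_integral_eq_integral(2)[symmetric])
       (rule set_integrable_subset[OF assms], use that in auto)
  ultimately show ?thesis by (rule continuous_on_eq)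
qed

lemma solves_continuous:
  assumes "solves f x T z" shows "continuous_on {0..T} z"
proof (cases "0 \<le> T")
  case True
  then have "continuous_on {0..T} (\<lambda>s. x + (LINT r:{0..s}|lborel. f r (z r)))"
    using assms by (auto simp: solves_def intro!: continuous_intros continuous_on_set_integral)
  then show ?thesis
    by (rule continuous_on_eq) (use assms in \<open>auto simp: solves_def\<close>)
qed auto

lemma set_integral_diff_real:
  fixes f g :: "'b \<Rightarrow> 'a::euclidean_space"
  assumes "set_integrable M A f" "set_integrable M A g"
  shows "set_integrable M A (\<lambda>x. f x - g x)"
    "(LINT x:A|M. f x) - (LINT x:A|M. g x) = (LINT x:A|M. f x - g x)"
  using assms by (auto simp: set_integral_diff)

text \<open>Gronwall applied to the distance of the two solutions. The coefficients are compared
  only before T, so that two noises that differ by a jump at T itself still give the same value at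
  T.\<close>

lemma solves_unique:
  assumes 1: "solves f x T z1" and 2: "solves g x T z2"
    and eq: "\<And>r z. r \<in> {0..<T} \<Longrightarrow> f r z = g r z"
    and lip: "\<And>r z z'. norm (f r z - f r z') \<le> L * norm (z - z')" and L: "0 \<le> L"
    and s: "s \<in> {0..T}"
  shows "z1 s = z2 s"
proof -
  let ?u = "\<lambda>s. norm (z1 s - z2 s)"
  have cu: "continuous_on {0..T} ?u"
    using solves_continuous[OF 1] solves_continuous[OF 2] by (intro continuous_intros)
  have "?u s \<le> 0 * exp (L * s)"
  proof (rule gronwall[OF cu L _ s])
    fix s assume s: "s \<in> {0..T}"
    have i: "set_integrable lborel {0..s} (\<lambda>r. f r (z1 r))" "set_integrable lborel {0..s} (\<lambda>r. g r (z2 r))"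
      using 1 2 s by (auto simp: solves_def)
    have iu: "set_integrable lborel {0..s} ?u"
      by (intro borel_integrable_atLeastAtMost' continuous_on_subset[OF cu]) (use s in auto)
    have ae: "AE r in lborel. r \<noteq> T" by (rule AE_lborel_singleton)
    have "z1 s - z2 s = (LINT r:{0..s}|lborel. f r (z1 r) - g r (z2 r))"
      using 1 2 s set_integral_diff_real(2)[OF i] by (auto simp: solves_def)
    then have "?u s \<le> (LINT r:{0..s}|lborel. norm (f r (z1 r) - g r (z2 r)))"
      using set_integral_norm_bound[OF set_integral_diff_real(1)[OF i]] by simp
    also have "\<dots> \<le> (LINT r:{0..s}|lborel. L * ?u r)"
      unfolding set_lebesgue_integral_def
    proof (rule integral_mono_AE)
      show "AE r in lborel. indicator {0..s} r *\<^sub>R norm (f r (z1 r) - g r (z2 r))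
          \<le> indicator {0..s} r *\<^sub>R (L * ?u r)"
        using ae
      proof eventually_elim
        case (elim r)
        show ?case
        proof (cases "r \<in> {0..s}")
          case True
          then have "r \<in> {0..<T}" using elim s by auto
          then show ?thesis using True lip[of r "z1 r" "z2 r"] eq by simp
        qed simp
      qed
      show "integrable lborel (\<lambda>r. indicator {0..s} r *\<^sub>R norm (f r (z1 r) - g r (z2 r)))"
        using set_integrable_norm[OF set_integral_diff_real(1)[OF i]] by (simp add: set_integrable_def)
      show "integrable lborel (\<lambda>r. indicator {0..s} r *\<^sub>R (L * ?u r))"
        using set_integrable_mult_right[of L, OF iu] by (simp add: set_integrable_def)
    qed
    also have "\<dots> = 0 + L * (LINT r:{0..s}|lborel. ?u r)" by simp
    finally show "?u s \<le> 0 + L * (LINT r:{0..s}|lborel. ?u r)" .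
  qed
  then show ?thesis by simp
qed

section \<open>Picard iteration with measurable dependence on parameters\<close>

primrec picard :: "(real \<Rightarrow> 'a \<Rightarrow> 'a) \<Rightarrow> 'a \<Rightarrow> nat \<Rightarrow> real \<Rightarrow> 'a::euclidean_space" where
  "picard f x 0 s = x"
| "picard f x (Suc k) s = x + (LINT r:{0..s}|lborel. f r (picard f x k r))"

text \<open>An explicit limit of iterates, rather than a chosen solution, carries measurability in
  the coefficients over to the solution.\<close>

definition ode_sol :: "(real \<Rightarrow> 'a \<Rightarrow> 'a) \<Rightarrow> 'a \<Rightarrow> real \<Rightarrow> 'a::euclidean_space" where
  "ode_sol f x s = lim (\<lambda>k. picard f x k s)"

lemma measurable_picard:
  fixes f :: "'w \<Rightarrow> real \<Rightarrow> 'a \<Rightarrow> 'a::euclidean_space"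
  assumes [measurable]: "(\<lambda>(w, s, z). f w s z) \<in> borel_measurable (S \<Otimes>\<^sub>M borel \<Otimes>\<^sub>M borel)"
  shows "(\<lambda>(w, s). picard (f w) x k s) \<in> borel_measurable (S \<Otimes>\<^sub>M borel)"
proof (induction k)
  case (Suc k)
  note Suc[measurable]
  have "(\<lambda>(ws, r). indicator {0..snd ws} r *\<^sub>R f (fst ws) r (picard (f (fst ws)) x k r))
      \<in> borel_measurable ((S \<Otimes>\<^sub>M borel) \<Otimes>\<^sub>M lborel)"
  proof -
    have [measurable]: "(\<lambda>(ws, r). picard (f (fst ws)) x k r) \<in> borel_measurable ((S \<Otimes>\<^sub>M borel) \<Otimes>\<^sub>M lborel)"
    proof -
      have "(\<lambda>p. (\<lambda>(w, s). picard (f w) x k s) (fst (fst p), snd p)) \<in> borel_measurable ((S \<Otimes>\<^sub>M (borel::real measure)) \<Otimes>\<^sub>M (lborel::real measure))"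
        by measurable
      then show ?thesis by (simp add: case_prod_unfold)
    qed
    have "(\<lambda>p. (\<lambda>(w, s, z). f w s z) (fst (fst p), snd p, picard (f (fst (fst p))) x k (snd p))) \<in> borel_measurable ((S \<Otimes>\<^sub>M (borel::real measure)) \<Otimes>\<^sub>M (lborel::real measure))"
      using \<open>(\<lambda>(ws, r). picard (f (fst ws)) x k r) \<in> _\<close>
      by (intro measurable_compose[OF _ assms] measurable_Pair) (auto simp: case_prod_unfold)
    then have [measurable]: "(\<lambda>p. f (fst (fst p)) (snd p) (picard (f (fst (fst p))) x k (snd p))) \<in> borel_measurable ((S \<Otimes>\<^sub>M (borel::real measure)) \<Otimes>\<^sub>M (lborel::real measure))"
      by simp
    have "(\<lambda>p. (if 0 \<le> snd p \<and> snd p \<le> snd (fst p) then 1 else 0::real) *\<^sub>R f (fst (fst p)) (snd p) (picard (f (fst (fst p))) x k (snd p))) \<in> borel_measurable ((S \<Otimes>\<^sub>M (borel::real measure)) \<Otimes>\<^sub>M (lborel::real measure))"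
      by measurable
    then show ?thesis by (simp add: case_prod_unfold indicator_def)
  qed
  then have "(\<lambda>ws. LINT r|lborel. indicator {0..snd ws} r *\<^sub>R f (fst ws) r (picard (f (fst ws)) x k r))
      \<in> borel_measurable (S \<Otimes>\<^sub>M borel)"
    by (rule lborel.borel_measurable_lebesgue_integral)
  then show ?case by (simp add: set_lebesgue_integral_def case_prod_unfold)
qed simp

lemma measurable_ode_sol:
  fixes f :: "'w \<Rightarrow> real \<Rightarrow> 'a \<Rightarrow> 'a::euclidean_space"
  assumes "(\<lambda>(w, s, z). f w s z) \<in> borel_measurable (S \<Otimes>\<^sub>M borel \<Otimes>\<^sub>M borel)"
  shows "(\<lambda>(w, s). ode_sol (f w) x s) \<in> borel_measurable (S \<Otimes>\<^sub>M borel)"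
  unfolding ode_sol_def case_prod_unfold
  by (rule borel_measurable_lim_metric) (use measurable_picard[OF assms] in \<open>simp add: case_prod_unfold\<close>)

lemma measurable_ode_sol_single:
  fixes f :: "real \<Rightarrow> 'a \<Rightarrow> 'a::euclidean_space"
  assumes "(\<lambda>(s, z). f s z) \<in> borel_measurable (borel \<Otimes>\<^sub>M borel)"
  shows "picard f x k \<in> borel_measurable borel" "ode_sol f x \<in> borel_measurable borel"
proof -
  have m: "(\<lambda>(w::unit, s, z). f s z) \<in> borel_measurable (count_space UNIV \<Otimes>\<^sub>M borel \<Otimes>\<^sub>M borel)"
    using measurable_compose[OF measurable_snd assms] by (simp add: case_prod_unfold)
  have "(\<lambda>s. (\<lambda>(w::unit, s). picard f x k s) ((), s)) \<in> borel_measurable borel"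
    by (rule measurable_compose[OF _ measurable_picard[OF m]]) measurable
  then show "picard f x k \<in> borel_measurable borel" by simp
  have "(\<lambda>s. (\<lambda>(w::unit, s). ode_sol f x s) ((), s)) \<in> borel_measurable borel"
    by (rule measurable_compose[OF _ measurable_ode_sol[OF m]]) measurable
  then show "ode_sol f x \<in> borel_measurable borel" by simp
qed

text \<open>In the norm weighted by exp(-2 L s) the Picard map contracts with factor 1/2, because
  integrating L exp(2 L r) up to s gives at most exp(2 L s) / 2. This yields convergence on the
  whole half-line at once, whatever T is.\<close>

lemma ode_sol_solves:
  fixes f :: "real \<Rightarrow> 'a \<Rightarrow> 'a::euclidean_space"
  assumes meas: "(\<lambda>(s, z). f s z) \<in> borel_measurable (borel \<Otimes>\<^sub>M borel)"
    and lip: "\<And>r z z'. norm (f r z - f r z') \<le> L * norm (z - z')" and L: "0 < L"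
    and B: "\<And>r. norm (f r x) \<le> B"
  shows "solves f x T (ode_sol f x)"
proof -
  let ?Z = "picard f x"
  \<comment> \<open>Since s is at most exp(2 L s) / (2 L), the integral of the constant B up to s is
    at most C exp(2 L s).\<close>
  define C where "C = B / (2 * L)"
  have B0: "0 \<le> B" using B[of 0] norm_ge_zero order_trans by blast
  have C: "0 \<le> C" "B = 2 * L * C" using B0 L by (auto simp: C_def)
  note [measurable] = measurable_ode_sol_single(1)[OF meas, of x]
  have mf[measurable]: "(\<lambda>r. f r (h r)) \<in> borel_measurable borel" if [measurable]: "h \<in> borel_measurable borel" for h
    using measurable_compose[OF measurable_Pair[OF measurable_ident that] meas] by simp
  have fb: "norm (f r z) \<le> B + L * norm (z - x)" for r z
    using norm_triangle_sub[of "f r z" "f r x"] B[of r] lip[of r z x] by linarith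
  have lin: "2 * L * s \<le> exp (2 * L * s)" for s
    using exp_ge_add_one_self[of "2 * L * s"] by linarith
  have expm: "exp (2 * L * r) \<le> exp (2 * L * s)" if "r \<le> s" for r s
    using that L by simp
  have intexp: "set_integrable lborel {0..s} (\<lambda>r. c * exp (2 * L * r))"
    "(LINT r:{0..s}|lborel. c * exp (2 * L * r)) \<le> c / (2 * L) * exp (2 * L * s)" if "0 \<le> s" "0 \<le> c" for s c
  proof -
    show "set_integrable lborel {0..s} (\<lambda>r. c * exp (2 * L * r))"
      using set_integral_exp(1)[of "2 * L" s] that L by simp
    have "(LINT r:{0..s}|lborel. c * exp (2 * L * r)) = c * ((exp (2 * L * s) - 1) / (2 * L))"
      using set_integral_exp(2)[of "2 * L" s] that L by simp
    also have "\<dots> \<le> c * (exp (2 * L * s) / (2 * L))"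
      using that L by (intro mult_left_mono divide_right_mono) auto
    finally show "(LINT r:{0..s}|lborel. c * exp (2 * L * r)) \<le> c / (2 * L) * exp (2 * L * s)" by simp
  qed
  have intc: "(LINT r:{0..s}|lborel. B) \<le> C * exp (2 * L * s)" "set_integrable lborel {0..s} (\<lambda>r. B)" if "0 \<le> s" for s
    using that mult_left_mono[OF lin[of s], of C] C by (auto simp: set_lebesgue_integral_def set_integrable_def mult_ac)
  \<comment> \<open>The factor 2 is the one that the induction reproduces: the step from
    \<open>k\<close> to \<open>Suc k\<close> turns the bound into C + L * 2 C / (2 L) = 2 C.\<close>
  have bd: "norm (?Z k s - x) \<le> 2 * C * exp (2 * L * s)" if "0 \<le> s" for k s
    using that
  proof (induction k arbitrary: s)
    case (Suc k)
    have b: "norm (f r (?Z k r)) \<le> B + L * (2 * C) * exp (2 * L * r)" if "r \<in> {0..s}" for r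
      proof -
      have "norm (?Z k r - x) \<le> 2 * C * exp (2 * L * r)" using Suc.IH that by simp
      then have "L * norm (?Z k r - x) \<le> L * (2 * C * exp (2 * L * r))"
        using L by (intro mult_left_mono) auto
      then show ?thesis using fb[of r "?Z k r"] by (simp add: mult.assoc)
    qed
    have i1: "set_integrable lborel {0..s} (\<lambda>r. B + L * (2 * C) * exp (2 * L * r))"
      using intc(2)[OF Suc.prems] intexp(1)[OF Suc.prems, of "L * (2 * C)"] C L by (intro set_integral_add) auto
    have "set_integrable lborel {0..s} (\<lambda>r. f r (?Z k r))"
      by (rule set_integrable_bounded_interval[where B = "B + L * (2 * C) * exp (2 * L * s)"])
         (use b C L in \<open>auto intro!: order_trans[OF b] mult_left_mono\<close>)
    then have "norm (?Z (Suc k) s - x) \<le> (LINT r:{0..s}|lborel. B + L * (2 * C) * exp (2 * L * r))"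
      using norm_set_integral_le[OF _ i1 b] by simp
    also have "\<dots> = (LINT r:{0..s}|lborel. B) + (LINT r:{0..s}|lborel. L * (2 * C) * exp (2 * L * r))"
      using intc(2)[OF Suc.prems] intexp(1)[OF Suc.prems, of "L * (2 * C)"] C L by (intro set_integral_add) auto
    also have "\<dots> \<le> C * exp (2 * L * s) + L * (2 * C) / (2 * L) * exp (2 * L * s)"
      using intc(1)[OF Suc.prems] intexp(2)[OF Suc.prems, of "L * (2 * C)"] C L by (intro add_mono) auto
    finally show ?case using L by simp
  qed (use C in simp)
  have int: "set_integrable lborel {0..s} (\<lambda>r. f r (?Z k r))" for s k
    by (rule set_integrable_bounded_interval[where B = "B + L * (2 * C * exp (2 * L * s))"])
       (use C L in \<open>auto intro!: order_trans[OF fb] mult_left_mono order_trans[OF bd]\<close>)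
  have diff: "norm (?Z (Suc k) s - ?Z k s) \<le> 2 * C * (1/2)^k * exp (2 * L * s)" if "0 \<le> s" for k s
    using that
  proof (induction k arbitrary: s)
    case 0
    then show ?case using bd[of s "Suc 0"] by simp
  next
    case (Suc k)
    let ?c = "L * (2 * C * (1/2)^k)"
    have b: "norm (f r (?Z (Suc k) r) - f r (?Z k r)) \<le> ?c * exp (2 * L * r)" if "r \<in> {0..s}" for r
      using order_trans[OF lip mult_left_mono[OF Suc.IH[of r], of L]] that L by (auto simp: mult_ac)
    have "?Z (Suc (Suc k)) s - ?Z (Suc k) s = (LINT r:{0..s}|lborel. f r (?Z (Suc k) r) - f r (?Z k r))"
      using set_integral_diff_real(2)[OF int[of s "Suc k"] int[of s k]] by simp
    then have "norm (?Z (Suc (Suc k)) s - ?Z (Suc k) s) \<le> (LINT r:{0..s}|lborel. ?c * exp (2 * L * r))"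
      using norm_set_integral_le[OF set_integral_diff_real(1)[OF int[of s "Suc k"] int[of s k]] intexp(1)[OF Suc.prems] b] C L by simp
    also have "\<dots> \<le> ?c / (2 * L) * exp (2 * L * s)"
      using intexp(2)[OF Suc.prems, of ?c] C L by auto
    finally show ?case using L by (simp add: field_simps)
  qed
  have conv: "(\<lambda>k. ?Z k s) \<longlonglongrightarrow> ode_sol f x s" if "0 \<le> s" for s
  proof -
    have "summable (\<lambda>k. ?Z (Suc k) s - ?Z k s)"
      by (rule summable_comparison_test'[where g = "\<lambda>k. (2 * C * exp (2 * L * s)) * (1/2)^k" and N = 0, OF summable_mult[OF summable_geometric]])
         (use diff[OF that] in \<open>simp_all add: mult_ac del: picard.simps\<close>)
    then have "(\<lambda>n. \<Sum>k<n. ?Z (Suc k) s - ?Z k s) \<longlonglongrightarrow> (\<Sum>k. ?Z (Suc k) s - ?Z k s)"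
      using summable_LIMSEQ by blast
    then have "(\<lambda>n. ?Z n s - x) \<longlonglongrightarrow> (\<Sum>k. ?Z (Suc k) s - ?Z k s)"
      by (simp only: sum_lessThan_telescope[of "\<lambda>k. ?Z k s"] picard.simps(1))
    then have "convergent (\<lambda>n. ?Z n s - x)" by (rule convergentI)
    then have "convergent (\<lambda>n. ?Z n s)" by (simp only: convergent_diff_const_right_iff)
    then show ?thesis unfolding ode_sol_def by (simp add: convergent_LIMSEQ_iff)
  qed
  have [measurable]: "ode_sol f x \<in> borel_measurable borel"
    by (rule measurable_ode_sol_single[OF meas])
  have bd': "norm (ode_sol f x s - x) \<le> 2 * C * exp (2 * L * s)" if "0 \<le> s" for s
    by (rule LIMSEQ_le_const2[OF tendsto_norm[OF tendsto_diff[OF conv[OF that] tendsto_const]]])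
       (use bd[OF that] in auto)
  have "ode_sol f x s = x + (LINT r:{0..s}|lborel. f r (ode_sol f x r))" if s: "0 \<le> s" for s
  proof (rule LIMSEQ_unique)
    show "(\<lambda>k. ?Z (Suc k) s) \<longlonglongrightarrow> ode_sol f x s"
      using conv[OF s] by (rule LIMSEQ_Suc)
    have "(\<lambda>k. LINT r:{0..s}|lborel. f r (?Z k r)) \<longlonglongrightarrow> (LINT r:{0..s}|lborel. f r (ode_sol f x r))"
      unfolding set_lebesgue_integral_def
    proof (rule integral_dominated_convergence[where w = "\<lambda>r. indicator {0..s} r *\<^sub>R (B + L * (2 * C * exp (2 * L * s)))"])
      show "AE r in lborel. (\<lambda>k. indicator {0..s} r *\<^sub>R f r (?Z k r)) \<longlonglongrightarrow> indicator {0..s} r *\<^sub>R f r (ode_sol f x r)"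
      proof (rule AE_I2)
        fix r :: real
        show "(\<lambda>k. indicator {0..s} r *\<^sub>R f r (?Z k r)) \<longlonglongrightarrow> indicator {0..s} r *\<^sub>R f r (ode_sol f x r)"
        proof (cases "r \<in> {0..s}")
          case True
          have "(\<lambda>k. f r (?Z k r) - f r (ode_sol f x r)) \<longlonglongrightarrow> 0"
          proof (rule Lim_null_comparison)
            show "\<forall>\<^sub>F k in sequentially. norm (f r (?Z k r) - f r (ode_sol f x r)) \<le> L * norm (?Z k r - ode_sol f x r)"
              using lip by simp
            show "(\<lambda>k. L * norm (?Z k r - ode_sol f x r)) \<longlonglongrightarrow> 0"
              using tendsto_mult_right_zero[OF tendsto_norm_zero[OF LIM_zero[OF conv[of r]]], of L] True by simp
          qed
          then have "(\<lambda>k. f r (?Z k r)) \<longlonglongrightarrow> f r (ode_sol f x r)" by (rule LIM_zero_cancel)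
          then show ?thesis using True by simp
        qed simp
      qed
      show "AE r in lborel. norm (indicator {0..s} r *\<^sub>R f r (?Z k r)) \<le> indicator {0..s} r *\<^sub>R (B + L * (2 * C * exp (2 * L * s)))" for k
        using C L by (intro AE_I2) (auto simp: indicator_def intro!: order_trans[OF fb] mult_left_mono order_trans[OF bd])
      show "integrable lborel (\<lambda>r. indicator {0..s} r *\<^sub>R (B + L * (2 * C * exp (2 * L * s))))"
        by (rule set_integrable_bounded_interval[unfolded set_integrable_def]) auto
    qed simp_all
    then show "(\<lambda>k. ?Z (Suc k) s) \<longlonglongrightarrow> x + (LINT r:{0..s}|lborel. f r (ode_sol f x r))"
      by (auto intro: tendsto_intros)
  qed
  moreover have "set_integrable lborel {0..s} (\<lambda>r. f r (ode_sol f x r))" for s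
    by (rule set_integrable_bounded_interval[where B = "B + L * (2 * C * exp (2 * L * s))"])
       (use C L in \<open>auto intro!: order_trans[OF fb] mult_left_mono order_trans[OF bd']\<close>)
  ultimately show ?thesis by (auto simp: solves_def)
qed

section \<open>Cadlag paths, truncation and orthogonalization\<close>

text \<open>Split A according to how large c and r can be chosen. On a piece of small diameter F is
  injective with Lipschitz inverse, and Lipschitz maps between subsets of one Euclidean space
  preserve null sets; countably many pieces remain. The expansion is used only as seen from the
  single points of A.\<close>

lemma expansive_negligible:
  fixes F :: "'a::euclidean_space \<Rightarrow> 'a"
  assumes N: "negligible N"
    and A: "\<And>x. x \<in> A \<Longrightarrow> F x \<in> N \<and> (\<exists>c>0. \<exists>r>0. \<forall>y. norm (y - x) < r \<longrightarrow> c * norm (y - x) \<le> norm (F y - F x))"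
  shows "negligible A"
proof -
  define Ak where "Ak k = {x \<in> A. \<forall>y. norm (y - x) < 1 / Suc k \<longrightarrow> norm (y - x) \<le> Suc k * norm (F y - F x)}" for k :: nat
  have "A \<subseteq> (\<Union>k. Ak k)"
  proof
    fix x assume x: "x \<in> A"
    then obtain c r where cr: "0 < c" "0 < r" "\<And>y. norm (y - x) < r \<Longrightarrow> c * norm (y - x) \<le> norm (F y - F x)"
      using A by blast
    obtain k :: nat where k: "max (1/c) (1/r) < k" using reals_Archimedean2 by blast
    then have k1: "1 / c \<le> Suc k" "1 / r \<le> Suc k" by auto
    have "norm (y - x) \<le> Suc k * norm (F y - F x)" if "norm (y - x) < 1 / Suc k" for y
    proof -
      have "1 / Suc k \<le> r" using k1(2) cr(2) by (simp add: field_simps)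
      then have "c * norm (y - x) \<le> norm (F y - F x)" using cr(3) that by auto
      then have "norm (y - x) \<le> (1 / c) * norm (F y - F x)" using cr(1) by (simp add: field_simps)
      also have "\<dots> \<le> Suc k * norm (F y - F x)" using k1(1) by (intro mult_right_mono) auto
      finally show ?thesis .
    qed
    then show "x \<in> (\<Union>k. Ak k)" using x by (auto simp: Ak_def)
  qed
  moreover have "negligible (Ak k)" for k
  proof (subst locally_negligible_alt, rule ballI)
    fix x assume x: "x \<in> Ak k"
    \<comment> \<open>Half the radius, so that any two points of U are within
      \<open>1 / Suc k\<close> of each other and the bound defining \<open>Ak k\<close> applies to
      the pair.\<close>
    define U where "U = Ak k \<inter> ball x (1 / (2 * Suc k))"
    have exp: "norm (y - z) \<le> Suc k * norm (F y - F z)" if "y \<in> U" "z \<in> U" for y z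
    proof -
      have "dist y z < 1 / (2 * Suc k) + 1 / (2 * Suc k)"
        using that dist_triangle_less_add[of y x "1 / (2 * Suc k)" z "1 / (2 * Suc k)"]
        by (auto simp: U_def dist_commute)
      then have "norm (y - z) < 1 / Suc k" by (simp add: dist_norm field_simps)
      then show ?thesis using that by (auto simp: U_def Ak_def)
    qed
    have inj: "inj_on F U"
      using exp by (fastforce intro!: inj_onI)
    define G where "G = inv_into U F"
    have G: "G (F y) = y" if "y \<in> U" for y using inj that by (simp add: G_def)
    have "negligible (F ` U)"
      by (rule negligible_subset[OF N]) (use A in \<open>auto simp: U_def Ak_def\<close>)
    then have "negligible (G ` F ` U)"
    proof (rule negligible_locally_Lipschitz_image[rotated])
      fix x assume "x \<in> F ` U"
      then show "\<exists>T B. open T \<and> x \<in> T \<and> (\<forall>y\<in>F ` U \<inter> T. norm (G y - G x) \<le> B * norm (y - x))"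
        using exp G by (intro exI[of _ UNIV] exI[of _ "real (Suc k)"]) auto
    qed simp
    moreover have "G ` F ` U = U" using G by force
    ultimately have "negligible U" by simp
    moreover have "openin (top_of_set (Ak k)) U" by (auto simp: U_def)
    ultimately show "\<exists>U. openin (top_of_set (Ak k)) U \<and> x \<in> U \<and> negligible U"
      using x by (auto simp: U_def intro!: exI[of _ U])
  qed
  moreover have "negligible (\<Union>k. Ak k)"
    by (rule negligible_countable_Union) (use calculation(2) in auto)
  ultimately show ?thesis using negligible_subset by blast
qed

section \<open>Cadlag functions\<close>

lemma cadlag_add:
  fixes f g :: "real \<Rightarrow> 'a::real_normed_vector"
  assumes "cadlag f" "cadlag g" shows "cadlag (\<lambda>s. f s + g s)"
  unfolding cadlag_def
proof safe
  fix t :: real assume "0 \<le> t"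
  then show "((\<lambda>s. f s + g s) \<longlongrightarrow> f t + g t) (at_right t)"
    using assms by (intro tendsto_add) (auto simp: cadlag_def)
next
  fix t :: real assume "0 < t"
  then obtain l m where "(f \<longlongrightarrow> l) (at_left t)" "(g \<longlongrightarrow> m) (at_left t)"
    using assms unfolding cadlag_def by blast
  then show "\<exists>l. ((\<lambda>s. f s + g s) \<longlongrightarrow> l) (at_left t)"
    by (intro exI[of _ "l + m"] tendsto_add)
qed

text \<open>Right continuity and the left limit bound f near every point; compactness of the
  interval does the rest.\<close>

lemma cadlag_bounded:
  fixes f :: "real \<Rightarrow> 'a::real_normed_vector"
  assumes "cadlag f" shows "bounded (f ` {0..T})"
proof -
  have "\<exists>d>0. bounded (f ` (ball t d \<inter> {0..}))" if t: "t \<in> {0..T}" for t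
  proof -
    have "\<forall>\<^sub>F s in at_right t. dist (f s) (f t) < 1"
      using assms t by (auto simp: cadlag_def intro: tendstoD)
    then obtain b where b: "t < b" "\<And>s. t < s \<Longrightarrow> s < b \<Longrightarrow> dist (f s) (f t) < 1"
      by (auto simp: eventually_at_right_field)
    obtain a l where a: "a < t" "\<And>s. a < s \<Longrightarrow> s < t \<Longrightarrow> 0 \<le> s \<Longrightarrow> dist (f s) l < 1"
    proof (cases "t = 0")
      case True
      then show ?thesis using that[of "-1"] by force
    next
      case False
      then have "0 < t" using t by auto
      then obtain l where "(f \<longlongrightarrow> l) (at_left t)" using assms unfolding cadlag_def by blast
      then have "\<forall>\<^sub>F s in at_left t. dist (f s) l < 1" by (auto intro: tendstoD)
      then obtain a where "a < t" "\<And>s. a < s \<Longrightarrow> s < t \<Longrightarrow> dist (f s) l < 1"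
        by (auto simp: eventually_at_left_field)
      then show ?thesis using that by blast
    qed
    define d where "d = min (b - t) (t - a)"
    have "f ` (ball t d \<inter> {0..}) \<subseteq> cball (f t) 1 \<union> cball l 1"
    proof safe
      fix s assume s: "s \<in> ball t d" "0 \<le> s" "f s \<notin> cball l 1"
      then have "a < s" "s < b" by (auto simp: d_def dist_real_def)
      then show "f s \<in> cball (f t) 1" using s a(2)[of s] b(2)[of s]
        by (cases "s < t"; cases "s = t") (auto simp: dist_commute less_imp_le)
    qed
    then have "bounded (f ` (ball t d \<inter> {0..}))"
      by (rule bounded_subset[rotated]) auto
    moreover have "d > 0" using a b by (auto simp: d_def)
    ultimately show ?thesis by blast
  qed
  then obtain d where d: "\<And>t. t \<in> {0..T} \<Longrightarrow> 0 < d t \<and> bounded (f ` (ball t (d t) \<inter> {0..}))" by metis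
  obtain C where C: "C \<subseteq> {0..T}" "finite C" "{0..T} \<subseteq> (\<Union>t\<in>C. ball t (d t))"
  proof (rule compactE_image[of "{0..T}" "{0..T}" "\<lambda>t. ball t (d t)"])
    show "{0..T} \<subseteq> (\<Union>t\<in>{0..T}. ball t (d t))"
    proof
      fix t assume "t \<in> {0..T}"
      then have "t \<in> ball t (d t)" using d by simp
      then show "t \<in> (\<Union>t\<in>{0..T}. ball t (d t))" using \<open>t \<in> {0..T}\<close> by blast
    qed
  qed auto
  have "bounded (\<Union>t\<in>C. f ` (ball t (d t) \<inter> {0..}))"
    using C d by (intro bounded_UN) auto
  moreover have "f ` {0..T} \<subseteq> (\<Union>t\<in>C. f ` (ball t (d t) \<inter> {0..}))"
  proof
    fix y assume "y \<in> f ` {0..T}"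
    then obtain s where s: "s \<in> {0..T}" "y = f s" by blast
    then obtain t where "t \<in> C" "s \<in> ball t (d t)" using C(3) by blast
    then show "y \<in> (\<Union>t\<in>C. f ` (ball t (d t) \<inter> {0..}))" using s
      by (intro UN_I[of t] image_eqI[of _ _ s]) auto
  qed
  ultimately show ?thesis by (rule bounded_subset)
qed

text \<open>On a bounded interval only finitely many jumps exceed a given size: near an accumulation
  point of such jumps the one-sided limits leave no room for them.\<close>

lemma cadlag_countable_discontinuities:
  fixes f :: "real \<Rightarrow> 'a::real_normed_vector"
  assumes f: "cadlag f" shows "countable {s. 0 < s \<and> \<not> isCont f s}"
proof -
  define l where "l s = (SOME l. (f \<longlongrightarrow> l) (at_left s))" for s
  have l: "(f \<longlongrightarrow> l s) (at_left s)" if "0 < s" for s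
    using f that unfolding cadlag_def l_def by (metis (mono_tags, lifting) someI_ex)
  have r: "(f \<longlongrightarrow> f s) (at_right s)" if "0 \<le> s" for s
    using f that by (auto simp: cadlag_def)
  define D where "D n k = {s \<in> {0..real n}. 0 < s \<and> 1 / Suc k < dist (l s) (f s)}" for n k :: nat
  have "finite (D n k)" for n k
  proof (rule ccontr)
    assume "infinite (D n k)"
    then obtain x where x: "x \<in> {0..real n}" "x islimpt D n k"
    proof -
      have "D n k \<subseteq> {0..real n}" by (auto simp: D_def)
      then show ?thesis
        using Heine_Borel_imp_Bolzano_Weierstrass[OF compact_Icc \<open>infinite (D n k)\<close>] that by blast
    qed
    \<comment> \<open>A quarter of the jump size: the left limit and the value at y would both be
      within e of p, hence at most 2 e apart.\<close>
    define e where "e = 1 / real (Suc k) / 4"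
    have e: "e > 0" by (simp add: e_def)
    have close: "dist (l y) (f y) \<le> 1 / Suc k"
      if ab: "a < y" "y < b" "0 < y" and p: "\<And>s. a < s \<Longrightarrow> s < b \<Longrightarrow> 0 < s \<Longrightarrow> dist (f s) p < e" for a b y p
    proof -
      have "\<forall>\<^sub>F s in at_left y. dist (f s) p \<le> e"
        by (rule eventually_at_leftI[of "max a 0" y]) (use ab p in \<open>auto intro!: less_imp_le\<close>)
      then have "dist (l y) p \<le> e"
        using tendsto_upperbound[OF tendsto_dist[OF l[OF ab(3)] tendsto_const]] by auto
      moreover have "dist (f y) p < e" using p ab by auto
      moreover have "1 / real (Suc k) = 4 * e" by (simp add: e_def del: of_nat_Suc)
      ultimately show ?thesis using dist_triangle2[of "l y" "f y" p] e by linarith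
    qed
    have "\<forall>\<^sub>F s in at_right x. dist (f s) (f x) < e"
      using r x e by (auto intro: tendstoD)
    then obtain b where b: "x < b" "\<And>s. x < s \<Longrightarrow> s < b \<Longrightarrow> dist (f s) (f x) < e"
      by (auto simp: eventually_at_right_field)
    obtain a p where a: "a < x" "\<And>s. a < s \<Longrightarrow> s < x \<Longrightarrow> 0 < s \<Longrightarrow> dist (f s) p < e"
    proof (cases "x = 0")
      case True
      then show ?thesis using that[of "-1"] by force
    next
      case False
      then have "\<forall>\<^sub>F s in at_left x. dist (f s) (l x) < e" using x l[of x] e by (auto intro: tendstoD)
      then obtain a where "a < x" "\<And>s. a < s \<Longrightarrow> s < x \<Longrightarrow> dist (f s) (l x) < e"
        by (auto simp: eventually_at_left_field)
      then show ?thesis using that by blast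
    qed
    obtain y where y: "y \<in> D n k" "y \<noteq> x" "y \<in> {a<..<b}"
      using x(2) a(1) b(1) open_greaterThanLessThan[of a b] greaterThanLessThan_iff[of x a b]
      unfolding islimpt_def by blast
    then have "dist (l y) (f y) \<le> 1 / Suc k"
      using close[of a y x p] close[of x y b "f x"] a b
      by (cases "y < x") (auto simp: D_def)
    then show False using y by (auto simp: D_def)
  qed
  moreover have "{s. 0 < s \<and> \<not> isCont f s} \<subseteq> (\<Union>n k. D n k)"
  proof safe
    fix s :: real assume s: "0 < s" "\<not> isCont f s"
    have "l s \<noteq> f s"
      using s l[of s] r[of s] by (auto simp: isCont_def filterlim_at_split)
    then obtain k where "1 / real (Suc k) < dist (l s) (f s)"
      using nat_approx_posE[of "dist (l s) (f s)"] by auto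
    moreover obtain n where "s \<le> real n" using real_arch_simple by blast
    ultimately show "s \<in> (\<Union>n k. D n k)" using s by (auto simp: D_def)
  qed
  ultimately show ?thesis
    by (meson countable_UN countable_finite countable_subset countableI_type)
qed

text \<open>Multiplication by a compactly supported continuously differentiable cutoff. Boundedness
  of b and of its derivative then comes from compactness of a ball and vanishing outside it.\<close>

lemma C1_truncation:
  fixes a :: "'a::euclidean_space \<Rightarrow> 'b::euclidean_space"
  assumes "C1_map a"
  obtains b b' B where "\<And>x. norm x \<le> K \<Longrightarrow> b x = a x"
    "\<And>x. (b has_derivative blinfun_apply (b' x)) (at x)" "continuous_on UNIV b'"
    "\<And>x. norm (b x) \<le> B" "\<And>x. norm (b' x) \<le> B"
proof -
  obtain a' where a': "\<And>x. (a has_derivative blinfun_apply (a' x)) (at x)" "continuous_on UNIV a'"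
    using assms by (auto simp: C1_map_def)
  \<comment> \<open>The square of the positive part is a simple continuously differentiable function
    that vanishes on a half-line. Composing it with itself gives the cutoff.\<close>
  define q :: "real \<Rightarrow> real" where "q s = (max 0 s)\<^sup>2" for s
  have dq: "(q has_real_derivative 2 * max 0 s) (at s)" for s
  proof -
    consider "s < 0" | "s = 0" | "s > 0" by linarith
    then show ?thesis
    proof cases
      case 1
      have "((\<lambda>s. 0::real) has_real_derivative 0) (at s)" by simp
      then have "(q has_real_derivative 0) (at s)"
        by (rule has_field_derivative_transform_within[where d = "- s"]) (use 1 in \<open>auto simp: q_def dist_real_def\<close>)
      then show ?thesis using 1 by (simp add: max_def)
    next
      case 3
      have "((\<lambda>s. s\<^sup>2::real) has_real_derivative 2 * s) (at s)" by (auto intro!: derivative_eq_intros)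
      then have "(q has_real_derivative 2 * s) (at s)"
        by (rule has_field_derivative_transform_within[where d = s]) (use 3 in \<open>auto simp: q_def dist_real_def max_def\<close>)
      then show ?thesis using 3 by (simp add: max_def)
    next
      case 2
      have "((\<lambda>h. q h / h) \<longlongrightarrow> 0) (at 0)"
      proof (rule Lim_null_comparison)
        show "((\<lambda>h. \<bar>h\<bar>) \<longlongrightarrow> (0::real)) (at 0)" by (auto intro!: tendsto_eq_intros)
        show "\<forall>\<^sub>F h in at 0. norm (q h / h) \<le> \<bar>h\<bar>"
          by (auto simp: q_def max_def power2_eq_square)
      qed
      then show ?thesis using 2 by (simp add: DERIV_def q_def)
    qed
  qed
  \<comment> \<open>Equals 1 where norm x \<le> K, since there the inner q vanishes, and 0 where
    (norm x)^2 \<ge> K^2 + 1, since there the inner q is at least 1.\<close>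
  define ch where "ch x = q (1 - q (x \<bullet> x - K\<^sup>2))" for x :: 'a
  define c where "c x = 2 * max 0 (1 - q (x \<bullet> x - K\<^sup>2)) * (- (2 * max 0 (x \<bullet> x - K\<^sup>2))) * 2" for x :: 'a
  have dch: "(ch has_derivative (\<lambda>h. c x * (x \<bullet> h))) (at x)" for x
  proof -
    have d1: "((\<lambda>x. x \<bullet> x - K\<^sup>2) has_derivative (\<lambda>h. 2 * (x \<bullet> h))) (at x)"
      by (auto intro!: derivative_eq_intros simp: inner_commute)
    have d2: "((\<lambda>x. 1 - q (x \<bullet> x - K\<^sup>2)) has_derivative (\<lambda>h. - (2 * max 0 (x \<bullet> x - K\<^sup>2) * (2 * (x \<bullet> h))))) (at x)"
      using has_derivative_compose[OF d1 dq[THEN has_field_derivative_imp_has_derivative]]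
      by (auto intro!: derivative_eq_intros)
    show ?thesis
      using has_derivative_compose[OF d2 dq[THEN has_field_derivative_imp_has_derivative]]
      unfolding ch_def c_def by (simp add: mult_ac)
  qed
  have contq: "continuous_on UNIV q" unfolding q_def by (intro continuous_intros)
  have contch: "continuous_on UNIV ch" unfolding ch_def
    by (intro continuous_on_compose2[OF contq] continuous_intros) auto
  have contc: "continuous_on UNIV c" unfolding c_def
    by (intro continuous_on_compose2[OF contq] continuous_intros) auto
  have conta: "continuous_on UNIV a"
    using a'(1) by (auto intro!: has_derivative_continuous_on)
  define b where "b x = ch x *\<^sub>R a x" for x
  define b' where "b' x = ch x *\<^sub>R a' x + (blinfun_scaleR_left (a x) o\<^sub>L (c x *\<^sub>R blinfun_inner_right x))" for x
  have deriv: "(b has_derivative blinfun_apply (b' x)) (at x)" for x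
  proof -
    have "(b has_derivative (\<lambda>h. ch x *\<^sub>R a' x h + (c x * (x \<bullet> h)) *\<^sub>R a x)) (at x)"
      unfolding b_def by (rule has_derivative_scaleR[OF dch a'(1)])
    moreover have "(\<lambda>h. ch x *\<^sub>R a' x h + (c x * (x \<bullet> h)) *\<^sub>R a x) = blinfun_apply (b' x)"
      by (auto simp: b'_def blinfun.add_left blinfun.scaleR_left)
    ultimately show ?thesis by simp
  qed
  have contb: "continuous_on UNIV b" unfolding b_def by (intro continuous_intros contch conta)
  have contb': "continuous_on UNIV b'"
  proof (rule continuous_on_blinfun_componentwise)
    fix i :: 'a
    have "continuous_on UNIV (\<lambda>x. ch x *\<^sub>R a' x i + (c x * (x \<bullet> i)) *\<^sub>R a x)"
      by (intro continuous_intros contch conta contc a'(2))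
    then show "continuous_on UNIV (\<lambda>x. blinfun_apply (b' x) i)"
      by (simp add: b'_def blinfun.add_left blinfun.scaleR_left)
  qed
  define R where "R = sqrt (K\<^sup>2 + 1)"
  have out: "b x = 0 \<and> b' x = 0" if "norm x > R" for x
  proof -
    have "R\<^sup>2 < (norm x)\<^sup>2" using that by (intro power_strict_mono) (auto simp: R_def)
    then have x: "x \<bullet> x - K\<^sup>2 > 1" by (simp add: R_def power2_norm_eq_inner)
    then have "q (x \<bullet> x - K\<^sup>2) \<ge> 1" by (simp add: q_def max_def)
    then have "ch x = 0" "c x = 0" by (auto simp: ch_def c_def q_def)
    then show ?thesis by (auto simp: b_def b'_def intro!: blinfun_eqI)
  qed
  have "bounded (b ` cball 0 R)" "bounded (b' ` cball 0 R)"
    by (intro compact_imp_bounded compact_continuous_image continuous_on_subset[OF contb]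
        continuous_on_subset[OF contb']; simp)+
  then obtain B1 B2 where "\<forall>x\<in>cball 0 R. norm (b x) \<le> B1" "\<forall>x\<in>cball 0 R. norm (b' x) \<le> B2"
    by (auto simp: bounded_iff)
  then have bb: "\<And>x. norm x \<le> R \<Longrightarrow> norm (b x) \<le> B1" "\<And>x. norm x \<le> R \<Longrightarrow> norm (b' x) \<le> B2" by auto
  have "norm (b x) \<le> max 0 (max B1 B2)" "norm (b' x) \<le> max 0 (max B1 B2)" for x
    using bb[of x] out[of x] by (cases "norm x > R"; simp add: le_max_iff_disj not_less)+
  moreover have "b x = a x" if "norm x \<le> K" for x
  proof -
    have "x \<bullet> x \<le> K\<^sup>2" using power_mono[OF that, of 2] by (simp add: power2_norm_eq_inner)
    then have "q (x \<bullet> x - K\<^sup>2) = 0" by (simp add: q_def)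
    then show ?thesis by (simp add: b_def ch_def) (simp add: q_def)
  qed
  ultimately show ?thesis using that deriv contb' by blast
qed

text \<open>Gram-Schmidt without normalization. A vector that depends linearly on its predecessors
  gives 0, and division by 0 being 0 makes such entries drop out of all later projections. So
  \<open>gs w j \<noteq> 0\<close> says that \<open>w j\<close> increases the rank, and the number
  of such j is the rank of the family. Entry j is determined by the vectors with index at most
  j.\<close>

fun gs :: "(nat \<Rightarrow> 'a::euclidean_space) \<Rightarrow> nat \<Rightarrow> 'a" where
  "gs w j = w j - (\<Sum>i<j. ((w j \<bullet> gs w i) / (gs w i \<bullet> gs w i)) *\<^sub>R gs w i)"

declare gs.simps[simp del]

lemma gs_cong: "(\<And>i. i \<le> j \<Longrightarrow> w i = w' i) \<Longrightarrow> gs w j = gs w' j"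
proof (induction j rule: less_induct)
  case (less j)
  have "gs w i = gs w' i" if "i < j" for i by (rule less.IH) (use that less.prems in auto)
  then show ?case using less.prems[of j] by (subst (1 2) gs.simps) simp
qed

text \<open>The projections removed from \<open>w j\<close> are orthogonal to v. Hence one direction
  v orthogonal to the past with \<open>w j \<bullet> v \<noteq> 0\<close> certifies a rank
  increase.\<close>

lemma gs_inner:
  assumes "\<And>i. i < j \<Longrightarrow> v \<bullet> gs w i = 0" shows "w j \<bullet> v = gs w j \<bullet> v"
  using assms by (simp add: gs.simps[of w j] inner_diff_right inner_sum_right inner_commute[of _ v])

text \<open>By induction only the term with index i survives in the sum of projections, and it
  cancels the inner product of \<open>w j\<close> with \<open>gs w i\<close>. If
  \<open>gs w i\<close> is 0, both sides vanish.\<close>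

lemma gs_orthogonal: "i < j \<Longrightarrow> gs w j \<bullet> gs w i = 0"
proof (induction j arbitrary: i rule: less_induct)
  case (less j)
  have o: "gs w k \<bullet> gs w i = 0" if "k < j" "k \<noteq> i" for k
    using less.IH[of k i] less.IH[of i k] that less.prems by (cases "k < i") (auto simp: inner_commute)
  have "gs w j \<bullet> gs w i = w j \<bullet> gs w i - (\<Sum>k<j. ((w j \<bullet> gs w k) / (gs w k \<bullet> gs w k)) * (gs w k \<bullet> gs w i))"
    by (subst gs.simps) (simp add: inner_diff_left inner_sum_left)
  also have "(\<Sum>k<j. ((w j \<bullet> gs w k) / (gs w k \<bullet> gs w k)) * (gs w k \<bullet> gs w i))
      = (\<Sum>k\<in>{i}. ((w j \<bullet> gs w k) / (gs w k \<bullet> gs w k)) * (gs w k \<bullet> gs w i))"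
    by (rule sum.mono_neutral_right) (use less.prems o in auto)
  also have "\<dots> = w j \<bullet> gs w i" by (cases "gs w i = 0") auto
  finally show ?case by simp
qed

lemma gs_orthogonal': "i \<noteq> j \<Longrightarrow> gs w j \<bullet> gs w i = 0"
  by (metis gs_orthogonal inner_commute nat_neq_iff)

lemma gs_card_le: "card {i. i < n \<and> gs w i \<noteq> 0} \<le> DIM('a)" for w :: "nat \<Rightarrow> 'a::euclidean_space"
proof -
  let ?J = "{i. i < n \<and> gs w i \<noteq> 0}"
  have inj: "inj_on (gs w) ?J"
    by (rule inj_onI) (metis (mono_tags, lifting) gs_orthogonal' inner_eq_zero_iff mem_Collect_eq)
  have "independent (gs w ` ?J)"
    by (rule pairwise_orthogonal_independent)
       (auto simp: pairwise_def orthogonal_def, metis gs_orthogonal')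
  then have "card (gs w ` ?J) \<le> DIM('a)" by (rule independent_card_le)
  then show ?thesis using card_image[OF inj] by simp
qed

text \<open>Supplies the direction to which the nondegeneracy condition is applied as long as the
  rank is deficient.\<close>

lemma gs_deficient:
  fixes w :: "nat \<Rightarrow> 'a::euclidean_space"
  assumes "card {i. i < n \<and> gs w i \<noteq> 0} < DIM('a)"
  obtains v where "v \<noteq> 0" "\<And>i. i < n \<Longrightarrow> v \<bullet> gs w i = 0"
proof -
  let ?S = "gs w ` {i. i < n \<and> gs w i \<noteq> 0}"
  have "dim ?S \<le> card ?S" by (rule dim_le_card') simp
  also have "\<dots> \<le> card {i. i < n \<and> gs w i \<noteq> 0}" by (rule card_image_le) simp
  finally have "dim ?S < DIM('a)" using assms by simp
  then obtain v where v: "v \<noteq> 0" "\<And>y. y \<in> span ?S \<Longrightarrow> orthogonal v y"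
    using orthogonal_to_subspace_exists by blast
  have "v \<bullet> gs w i = 0" if "i < n" for i
    using v(2)[of "gs w i"] that by (cases "gs w i = 0") (auto simp: orthogonal_def intro: span_base)
  then show ?thesis using that v(1) by blast
qed

text \<open>Pair the relation with \<open>gs w m\<close> for the largest m that has a nonzero
  coefficient: earlier vectors are orthogonal to it, and \<open>w m\<close> contributes the squared
  norm of \<open>gs w m\<close>.\<close>

lemma gs_independent:
  assumes "finite J" "\<And>j. j \<in> J \<Longrightarrow> gs w j \<noteq> 0" "(\<Sum>j\<in>J. x j *\<^sub>R w j) = 0" "j \<in> J"
  shows "x j = 0"
proof (rule ccontr)
  assume "x j \<noteq> 0"
  let ?P = "{j\<in>J. x j \<noteq> 0}"
  define m where "m = Max ?P"
  have fin: "finite ?P" "?P \<noteq> {}" using assms \<open>x j \<noteq> 0\<close> by auto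
  then have m: "m \<in> J" "x m \<noteq> 0" using Max_in[OF fin] by (auto simp: m_def)
  have big: "x i = 0" if "i \<in> J" "m < i" for i
    using Max_ge[OF fin(1), of i] that by (auto simp: m_def)
  have wi: "w i \<bullet> gs w m = 0" if "i < m" for i
    using gs_inner[of i "gs w m" w] gs_orthogonal[of _ m w] that by (simp add: inner_commute)
  have wm: "w m \<bullet> gs w m = gs w m \<bullet> gs w m"
    by (rule gs_inner) (rule gs_orthogonal)
  have "0 = (\<Sum>j\<in>J. x j *\<^sub>R w j) \<bullet> gs w m" using assms by simp
  also have "\<dots> = (\<Sum>j\<in>J. x j * (w j \<bullet> gs w m))" by (simp add: inner_sum_left)
  also have "\<dots> = (\<Sum>j\<in>{m}. x j * (w j \<bullet> gs w m))"
    by (rule sum.mono_neutral_right)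
       (use assms m big wi in \<open>auto, metis linorder_neqE_nat\<close>)
  finally show False using m wm assms(2)[OF m(1)] by simp
qed

lemma measurable_gs:
  fixes w :: "'w \<Rightarrow> nat \<Rightarrow> 'a::euclidean_space"
  assumes "\<And>i. i \<le> j \<Longrightarrow> (\<lambda>x. w x i) \<in> borel_measurable M"
  shows "(\<lambda>x. gs (w x) j) \<in> borel_measurable M"
  using assms
proof (induction j rule: less_induct)
  case (less j)
  have [measurable]: "(\<lambda>x. gs (w x) i) \<in> borel_measurable M" if "i \<in> {..<j}" for i
    by (rule less.IH) (use that less.prems in auto)
  have [measurable]: "(\<lambda>x. w x j) \<in> borel_measurable M" by (rule less.prems) simp
  show ?case by (subst gs.simps) measurable
qed

section \<open>The flow and its linearization\<close>

lemma set_integral_split: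
  fixes f :: "real \<Rightarrow> 'a::euclidean_space"
  assumes "set_integrable lborel {0..t} f" "0 \<le> r" "r \<le> t"
  shows "(LINT s:{0..t}|lborel. f s) - (LINT s:{0..r}|lborel. f s) = (LINT s:{r<..t}|lborel. f s)"
proof -
  have "{0..t} = {0..r} \<union> {r<..t}" using assms by auto
  moreover have "set_integrable lborel {0..r} f" "set_integrable lborel {r<..t} f"
    by (rule set_integrable_subset[OF assms(1)]; use assms in force)+
  moreover have "{0..r} \<inter> {r<..t} = {}" by auto
  ultimately show ?thesis using set_integral_Un[of "{0..r}" "{r<..t}" lborel f] by simp
qed

lemma inner_integration_by_parts:
  fixes \<phi> \<psi> d p :: "real \<Rightarrow> 'a::euclidean_space"
  assumes [measurable]: "\<phi> \<in> borel_measurable borel" "\<psi> \<in> borel_measurable borel"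
    and bd: "\<And>r. r \<in> {0..t} \<Longrightarrow> norm (\<phi> r) \<le> C" "\<And>r. r \<in> {0..t} \<Longrightarrow> norm (\<psi> r) \<le> D"
    and d: "\<And>s. s \<in> {0..t} \<Longrightarrow> d s = (LINT r:{0..s}|lborel. \<phi> r)"
    and p: "\<And>s. s \<in> {0..t} \<Longrightarrow> p s = b + (LINT r:{0..s}|lborel. \<psi> r)"
    and t: "0 \<le> t"
  shows "p t \<bullet> d t = (LINT r:{0..t}|lborel. p r \<bullet> \<phi> r) + (LINT r:{0..t}|lborel. \<psi> r \<bullet> d r)"
proof -
  have C0: "0 \<le> C" "0 \<le> D" using bd[of 0] t norm_ge_zero order_trans by (meson atLeastAtMost_iff order_refl)+
  have i\<phi>: "set_integrable lborel {0..t} \<phi>" and i\<psi>: "set_integrable lborel {0..t} \<psi>"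
    using set_integrable_bounded_interval[of \<phi> 0 t C] set_integrable_bounded_interval[of \<psi> 0 t D] bd by auto
  have cd: "continuous_on {0..t} d"
    by (rule continuous_on_eq[OF continuous_on_set_integral[OF i\<phi>]]) (use d in auto)
  have cp: "continuous_on {0..t} p"
    by (rule continuous_on_eq[OF continuous_on_add[OF continuous_on_const[of _ b] continuous_on_set_integral[OF i\<psi>]]])
       (use p in auto)
  define F where "F r s = indicator {0..t} r * (indicator {0..t} s * (if r < s then \<psi> r \<bullet> \<phi> s else 0))" for r s
  have "integrable (lborel \<Otimes>\<^sub>M lborel) (case_prod F)"
  proof (rule integrableI_bounded_set[where A = "{0..t} \<times> {0..t}" and B = "D * C"])
    show "case_prod F \<in> borel_measurable (lborel \<Otimes>\<^sub>M lborel)" unfolding F_def by measurable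
    show "emeasure (lborel \<Otimes>\<^sub>M lborel) ({0..t} \<times> {0..t}) < \<infinity>"
      using t by (subst lborel.emeasure_pair_measure_Times) (auto simp: ennreal_mult_less_top)
    show "AE x in lborel \<Otimes>\<^sub>M lborel. x \<in> {0..t} \<times> {0..t} \<longrightarrow> norm (case_prod F x) \<le> D * C"
    proof (rule AE_I2)
      fix x :: "real \<times> real"
      have "norm (F r s) \<le> D * C" for r s
        using Cauchy_Schwarz_ineq2[of "\<psi> r" "\<phi> s"] mult_mono[OF bd(2)[of r] bd(1)[of s]] C0
        by (auto simp: F_def indicator_def)
      then show "x \<in> {0..t} \<times> {0..t} \<longrightarrow> norm (case_prod F x) \<le> D * C"
        by (simp add: case_prod_unfold)
    qed
    show "AE x in lborel \<Otimes>\<^sub>M lborel. x \<notin> {0..t} \<times> {0..t} \<longrightarrow> case_prod F x = 0"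
      by (rule AE_I2) (auto simp: F_def indicator_def)
  qed measurable
  then have fub: "(LINT s|lborel. LINT r|lborel. F r s) = (LINT r|lborel. LINT s|lborel. F r s)"
    by (rule lborel_pair.Fubini_integral)
  have "(LINT s|lborel. F r s) = indicator {0..t} r * (\<psi> r \<bullet> d t - \<psi> r \<bullet> d r)" for r
  proof (cases "r \<in> {0..t}")
    case True
    have i: "set_integrable lborel {r<..t} \<phi>"
      by (rule set_integrable_subset[OF i\<phi>]) (use True in auto)
    have "(LINT s|lborel. F r s) = (LINT s|lborel. \<psi> r \<bullet> (indicator {r<..t} s *\<^sub>R \<phi> s))"
      by (rule Bochner_Integration.integral_cong) (use True in \<open>auto simp: F_def indicator_def\<close>)
    also have "\<dots> = \<psi> r \<bullet> (LINT s:{r<..t}|lborel. \<phi> s)"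
      unfolding set_lebesgue_integral_def
      by (rule integral_inner_right) (use i in \<open>auto simp: set_integrable_def\<close>)
    also have "(LINT s:{r<..t}|lborel. \<phi> s) = d t - d r"
      using set_integral_split[OF i\<phi>, of r] True d by auto
    finally show ?thesis using True by (simp add: inner_diff_right)
  qed (simp add: F_def)
  then have "(LINT r|lborel. LINT s|lborel. F r s) = (LINT r:{0..t}|lborel. \<psi> r \<bullet> d t - \<psi> r \<bullet> d r)"
    by (simp add: set_lebesgue_integral_def)
  also have "\<dots> = (LINT r:{0..t}|lborel. \<psi> r \<bullet> d t) - (LINT r:{0..t}|lborel. \<psi> r \<bullet> d r)"
  proof (rule set_integral_diff)
    show "set_integrable lborel {0..t} (\<lambda>r. \<psi> r \<bullet> d t)"
      using integrable_inner_left[of "d t" lborel "\<lambda>r. indicator {0..t} r *\<^sub>R \<psi> r"] i\<psi>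
      unfolding set_integrable_def by simp
    obtain K where K: "\<And>r. r \<in> {0..t} \<Longrightarrow> norm (d r) \<le> K"
      using compact_imp_bounded[OF compact_continuous_image[OF cd compact_Icc]] unfolding bounded_iff by blast
    have dm: "set_borel_measurable borel {0..t} d"
      using cd by (simp add: borel_measurable_continuous_on_indicator set_borel_measurable_def)
    then have [measurable]: "(\<lambda>r. indicator {0..t} r *\<^sub>R d r) \<in> borel_measurable borel"
      by (simp add: set_borel_measurable_def)
    have "set_integrable lborel {0..t} (\<lambda>r. \<psi> r \<bullet> (indicator {0..t} r *\<^sub>R d r))"
    proof (rule set_integrable_bounded_interval[where B = "D * K"])
      fix r assume r: "r \<in> {0..t}"
      then show "norm (\<psi> r \<bullet> (indicator {0..t} r *\<^sub>R d r)) \<le> D * K"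
        using Cauchy_Schwarz_ineq2[of "\<psi> r" "d r"] mult_mono[OF bd(2)[OF r] K[OF r]] C0 by auto
    qed measurable
    then show "set_integrable lborel {0..t} (\<lambda>r. \<psi> r \<bullet> d r)"
      using set_integrable_cong[OF refl refl, of "{0..t}" "\<lambda>r. \<psi> r \<bullet> (indicator {0..t} r *\<^sub>R d r)" "\<lambda>r. \<psi> r \<bullet> d r" lborel] by simp
  qed
  also have "(LINT r:{0..t}|lborel. \<psi> r \<bullet> d t) = (p t - b) \<bullet> d t"
  proof -
    have "(LINT r:{0..t}|lborel. \<psi> r \<bullet> d t) = (LINT r|lborel. (indicator {0..t} r *\<^sub>R \<psi> r) \<bullet> d t)"
      by (simp add: set_lebesgue_integral_def)
    also have "\<dots> = (LINT r:{0..t}|lborel. \<psi> r) \<bullet> d t"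
      unfolding set_lebesgue_integral_def
      by (rule integral_inner_left) (use i\<psi> in \<open>auto simp: set_integrable_def\<close>)
    finally show ?thesis using p[of t] t by simp
  qed
  finally have 1: "(LINT r|lborel. LINT s|lborel. F r s) = (p t - b) \<bullet> d t - (LINT r:{0..t}|lborel. \<psi> r \<bullet> d r)" .
  have "(LINT r|lborel. F r s) = indicator {0..t} s * (p s \<bullet> \<phi> s - b \<bullet> \<phi> s)" for s
  proof (cases "s \<in> {0..t}")
    case True
    have i: "set_integrable lborel {0..s} \<psi>"
      by (rule set_integrable_subset[OF i\<psi>]) (use True in auto)
    have "(LINT r|lborel. F r s) = (LINT r|lborel. (indicator {0..s} r *\<^sub>R \<psi> r) \<bullet> \<phi> s)"
    proof (rule integral_cong_AE)
      \<comment> \<open>The triangle is open at the diagonal while the interval {0..s} is closed;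
        they differ by the single point r = s.\<close>
      show "AE r in lborel. F r s = (indicator {0..s} r *\<^sub>R \<psi> r) \<bullet> \<phi> s"
        using AE_lborel_singleton[of s]
        by eventually_elim (use True in \<open>auto simp: F_def indicator_def\<close>)
    qed (simp_all add: F_def)
    also have "\<dots> = (LINT r:{0..s}|lborel. \<psi> r) \<bullet> \<phi> s"
      unfolding set_lebesgue_integral_def
      by (rule integral_inner_left) (use i in \<open>auto simp: set_integrable_def\<close>)
    also have "(LINT r:{0..s}|lborel. \<psi> r) = p s - b" using p True by simp
    finally show ?thesis using True by (simp add: inner_diff_left)
  qed (simp add: F_def)
  then have "(LINT s|lborel. LINT r|lborel. F r s) = (LINT r:{0..t}|lborel. p r \<bullet> \<phi> r - b \<bullet> \<phi> r)"
    by (simp add: set_lebesgue_integral_def)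
  also have "\<dots> = (LINT r:{0..t}|lborel. p r \<bullet> \<phi> r) - (LINT r:{0..t}|lborel. b \<bullet> \<phi> r)"
  proof (rule set_integral_diff)
    show "set_integrable lborel {0..t} (\<lambda>r. b \<bullet> \<phi> r)"
      using integrable_inner_right[of b lborel "\<lambda>r. indicator {0..t} r *\<^sub>R \<phi> r"] i\<phi>
      unfolding set_integrable_def by simp
    obtain K where K: "\<And>r. r \<in> {0..t} \<Longrightarrow> norm (p r) \<le> K"
      using compact_imp_bounded[OF compact_continuous_image[OF cp compact_Icc]] unfolding bounded_iff by blast
    have [measurable]: "(\<lambda>r. indicator {0..t} r *\<^sub>R p r) \<in> borel_measurable borel"
      using cp by (simp add: borel_measurable_continuous_on_indicator)
    have "set_integrable lborel {0..t} (\<lambda>r. (indicator {0..t} r *\<^sub>R p r) \<bullet> \<phi> r)"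
    proof (rule set_integrable_bounded_interval[where B = "K * C"])
      fix r assume r: "r \<in> {0..t}"
      have "0 \<le> K" using K[OF r] norm_ge_zero order_trans by blast
      then show "norm ((indicator {0..t} r *\<^sub>R p r) \<bullet> \<phi> r) \<le> K * C"
        using r Cauchy_Schwarz_ineq2[of "p r" "\<phi> r"] mult_mono[OF K[OF r] bd(1)[OF r]] C0 by auto
    qed measurable
    then show "set_integrable lborel {0..t} (\<lambda>r. p r \<bullet> \<phi> r)"
      using set_integrable_cong[OF refl refl, of "{0..t}" "\<lambda>r. (indicator {0..t} r *\<^sub>R p r) \<bullet> \<phi> r" "\<lambda>r. p r \<bullet> \<phi> r" lborel] by simp
  qed
  also have "(LINT r:{0..t}|lborel. b \<bullet> \<phi> r) = b \<bullet> d t"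
  proof -
    have "(LINT r:{0..t}|lborel. b \<bullet> \<phi> r) = (LINT r|lborel. b \<bullet> (indicator {0..t} r *\<^sub>R \<phi> r))"
      by (simp add: set_lebesgue_integral_def)
    also have "\<dots> = b \<bullet> (LINT r:{0..t}|lborel. \<phi> r)"
      unfolding set_lebesgue_integral_def
      by (rule integral_inner_right) (use i\<phi> in \<open>auto simp: set_integrable_def\<close>)
    finally show ?thesis using d[of t] t by simp
  qed
  finally show ?thesis using fub 1 by (simp add: inner_diff_left)
qed

locale smooth_drift =
  fixes a :: "'a::euclidean_space \<Rightarrow> 'a" and a' :: "'a \<Rightarrow> 'a \<Rightarrow>\<^sub>L 'a" and L B :: real
  assumes deriv: "\<And>x. (a has_derivative blinfun_apply (a' x)) (at x)"
    and cont: "continuous_on UNIV a'"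
    and bound: "\<And>x. norm (a x) \<le> B"
    and bound': "\<And>x. norm (a' x) \<le> L"
    and Lpos: "0 < L"
begin

text \<open>The noise is additive, so subtracting it leaves an ordinary integral equation for z = y
  - V; V is added back at the end.\<close>

definition flow :: "'a \<Rightarrow> (real \<Rightarrow> 'a) \<Rightarrow> real \<Rightarrow> 'a" where
  "flow x V s = ode_sol (\<lambda>r z. a (z + V r)) x s + V s"

text \<open>The transpose of the derivative, written out in coordinates so that measurability in
  both arguments can be read off.\<close>

definition adjoint :: "'a \<Rightarrow> 'a \<Rightarrow> 'a" where
  "adjoint x p = (\<Sum>i\<in>Basis. (p \<bullet> a' x i) *\<^sub>R i)"

text \<open>\<open>costate y b s\<close> is \<open>G(s)\<^sup>T b\<close> for the inverse \<open>G\<close> of the linearized flow along the path \<open>y\<close>.\<close>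

definition costate :: "(real \<Rightarrow> 'a) \<Rightarrow> 'a \<Rightarrow> real \<Rightarrow> 'a" where
  "costate y b s = ode_sol (\<lambda>r p. - adjoint (y r) p) b s"

lemma B_nonneg: "0 \<le> B" using bound[of 0] norm_ge_zero order_trans by blast

lemma lip: "norm (a x - a y) \<le> L * norm (x - y)"
  by (rule differentiable_bound[of UNIV a "\<lambda>x. blinfun_apply (a' x)"])
     (use deriv bound' in \<open>auto simp: norm_blinfun.rep_eq[symmetric]\<close>)

lemma lip_add: "norm (a (z + v) - a (z' + v)) \<le> L * norm (z - z')"
  using lip[of "z + v" "z' + v"] by simp

lemma cont_a: "continuous_on UNIV a"
  using deriv by (auto intro!: has_derivative_continuous_on)

lemma measurable_a[measurable]: "a \<in> borel_measurable borel"
  using cont_a by (rule borel_measurable_continuous_onI)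

lemma measurable_a'[measurable]: "(\<lambda>x. blinfun_apply (a' x) i) \<in> borel_measurable borel"
  by (intro borel_measurable_continuous_onI continuous_intros cont)

lemma measurable_adjoint[measurable]:
  "(\<lambda>(x, p). adjoint x p) \<in> borel_measurable (borel \<Otimes>\<^sub>M borel)"
  unfolding adjoint_def case_prod_unfold by measurable

lemma adjoint_inner: "adjoint x p \<bullet> h = p \<bullet> a' x h"
proof -
  have "adjoint x p \<bullet> h = (\<Sum>i\<in>Basis. (h \<bullet> i) * (p \<bullet> a' x i))"
    by (simp add: adjoint_def inner_sum_left inner_commute[of h] mult.commute)
  also have "\<dots> = p \<bullet> a' x (\<Sum>i\<in>Basis. (h \<bullet> i) *\<^sub>R i)"
    by (simp add: blinfun.sum_right blinfun.scaleR_right inner_sum_right)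
  finally show ?thesis by (simp add: euclidean_representation)
qed

lemma norm_adjoint: "norm (adjoint x p) \<le> L * norm p"
proof (cases "adjoint x p = 0")
  case False
  have "norm (adjoint x p) * norm (adjoint x p) = p \<bullet> a' x (adjoint x p)"
    using adjoint_inner[of x p "adjoint x p"] by (simp add: power2_norm_eq_inner[symmetric] power2_eq_square)
  also have "\<dots> \<le> norm p * norm (a' x (adjoint x p))" by (rule norm_cauchy_schwarz)
  also have "\<dots> \<le> norm p * (L * norm (adjoint x p))"
    using norm_blinfun[of "a' x" "adjoint x p"] mult_right_mono[OF bound'[of x], of "norm (adjoint x p)"]
    by (intro mult_left_mono) auto
  finally show ?thesis using False by (simp add: mult_ac)
qed (use Lpos in simp)

lemma adjoint_diff: "adjoint x p - adjoint x q = adjoint x (p - q)"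
  by (simp add: adjoint_def sum_subtractf[symmetric] algebra_simps)

lemma flow_solves:
  assumes [measurable]: "V \<in> borel_measurable borel"
  shows "solves (\<lambda>r z. a (z + V r)) x T (\<lambda>s. flow x V s - V s)"
proof -
  have "solves (\<lambda>r z. a (z + V r)) x T (ode_sol (\<lambda>r z. a (z + V r)) x)"
    by (rule ode_sol_solves[where L = L and B = B])
       (use lip_add Lpos bound in auto)
  moreover have "ode_sol (\<lambda>r z. a (z + V r)) x = (\<lambda>s. flow x V s - V s)"
    by (simp add: flow_def fun_eq_iff)
  ultimately show ?thesis by simp
qed

text \<open>The noises may differ at T itself. There only the drift parts agree, which is why V is
  subtracted on both sides; this is the situation at a jump time.\<close>

lemma flow_cong:
  assumes [measurable]: "V \<in> borel_measurable borel" "V' \<in> borel_measurable borel"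
    and eq: "\<And>r. 0 \<le> r \<Longrightarrow> r < T \<Longrightarrow> V r = V' r" and s: "s \<in> {0..T}"
  shows "flow x V s - V s = flow x V' s - V' s"
  by (rule solves_unique[OF flow_solves flow_solves, where L = L and T = T])
     (use lip_add Lpos eq s in auto)

lemma flow_eqI:
  assumes [measurable]: "V \<in> borel_measurable borel" and s: "s \<in> {0..T}"
    and "solves (\<lambda>r z. a (z + V r)) x T (\<lambda>s. Y s - V s)"
  shows "flow x V s = Y s"
  using solves_unique[OF flow_solves[OF assms(1)] assms(3) refl, where L = L] lip_add Lpos s by auto

lemma measurable_flow:
  assumes [measurable]: "(\<lambda>(w, s). V w s) \<in> borel_measurable (S \<Otimes>\<^sub>M borel)"
  shows "(\<lambda>(w, s). flow x (V w) s) \<in> borel_measurable (S \<Otimes>\<^sub>M borel)"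
proof -
  have "(\<lambda>(w, s, z). a (z + V w s)) \<in> borel_measurable (S \<Otimes>\<^sub>M borel \<Otimes>\<^sub>M borel)"
  proof -
    have "(\<lambda>p. (\<lambda>(w, s). V w s) (fst p, fst (snd p))) \<in> borel_measurable (S \<Otimes>\<^sub>M (borel::real measure) \<Otimes>\<^sub>M (borel::'a measure))"
      by measurable
    then have [measurable]: "(\<lambda>p. V (fst p) (fst (snd p))) \<in> borel_measurable (S \<Otimes>\<^sub>M (borel::real measure) \<Otimes>\<^sub>M (borel::'a measure))"
      by simp
    have "(\<lambda>p. a (snd (snd p) + V (fst p) (fst (snd p)))) \<in> borel_measurable (S \<Otimes>\<^sub>M (borel::real measure) \<Otimes>\<^sub>M (borel::'a measure))"
      by measurable
    then show ?thesis by (simp add: case_prod_unfold)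
  qed
  from measurable_ode_sol[OF this] have [measurable]: "(\<lambda>p. ode_sol (\<lambda>s z. a (z + V (fst p) s)) x (snd p)) \<in> borel_measurable (S \<Otimes>\<^sub>M borel)"
    by (simp add: case_prod_unfold)
  have [measurable]: "(\<lambda>p. V (fst p) (snd p)) \<in> borel_measurable (S \<Otimes>\<^sub>M borel)"
    using assms by (simp add: case_prod_unfold)
  show ?thesis unfolding flow_def case_prod_unfold by measurable
qed

lemma measurable_flow_single:
  assumes [measurable]: "V \<in> borel_measurable borel" shows "flow x V \<in> borel_measurable borel"
proof -
  have "(\<lambda>(w::unit, s). V s) \<in> borel_measurable (count_space UNIV \<Otimes>\<^sub>M borel)" by measurable
  from measurable_flow[OF this]
  have "(\<lambda>s. (\<lambda>(w::unit, s). flow x V s) ((), s)) \<in> borel_measurable borel"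
    by (rule measurable_compose[rotated]) measurable
  then show ?thesis by simp
qed

lemma costate_solves:
  assumes [measurable]: "y \<in> borel_measurable borel"
  shows "solves (\<lambda>r p. - adjoint (y r) p) b T (costate y b)"
proof -
  have [measurable]: "(\<lambda>x. adjoint (y (fst x)) (snd x)) \<in> borel_measurable (borel \<Otimes>\<^sub>M borel)"
    unfolding adjoint_def by measurable
  have "solves (\<lambda>r p. - adjoint (y r) p) b T (ode_sol (\<lambda>r p. - adjoint (y r) p) b)"
  proof (rule ode_sol_solves[where L = L and B = "L * norm b"])
    show "(\<lambda>(s, z). - adjoint (y s) z) \<in> borel_measurable (borel \<Otimes>\<^sub>M borel)"
      unfolding case_prod_unfold by measurable
    show "norm (- adjoint (y r) z - - adjoint (y r) z') \<le> L * norm (z - z')" for r z z'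
      using norm_adjoint[of "y r" "z' - z"] by (simp add: adjoint_diff norm_minus_commute)
  qed (use norm_adjoint Lpos in auto)
  then show ?thesis by (simp add: costate_def[abs_def])
qed

lemma costate_cong:
  assumes [measurable]: "y \<in> borel_measurable borel" "y' \<in> borel_measurable borel"
    and eq: "\<And>r. 0 \<le> r \<Longrightarrow> r < T \<Longrightarrow> y r = y' r" and s: "s \<in> {0..T}"
  shows "costate y b s = costate y' b s"
proof (rule solves_unique[OF costate_solves costate_solves, where L = L and T = T])
  show "norm (- adjoint (y r) z - - adjoint (y r) z') \<le> L * norm (z - z')" for r z z'
    using norm_adjoint[of "y r" "z' - z"] by (simp add: adjoint_diff norm_minus_commute)
qed (use Lpos eq s in auto)

lemma measurable_costate:
  assumes [measurable]: "(\<lambda>(w, s). y w s) \<in> borel_measurable (S \<Otimes>\<^sub>M borel)"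
  shows "(\<lambda>(w, s). costate (y w) b s) \<in> borel_measurable (S \<Otimes>\<^sub>M borel)"
proof -
  have "(\<lambda>(w, s, z). - adjoint (y w s) z) \<in> borel_measurable (S \<Otimes>\<^sub>M borel \<Otimes>\<^sub>M borel)"
  proof -
    have "(\<lambda>p. (\<lambda>(w, s). y w s) (fst p, fst (snd p))) \<in> borel_measurable (S \<Otimes>\<^sub>M (borel::real measure) \<Otimes>\<^sub>M (borel::'a measure))"
      by measurable
    then have [measurable]: "(\<lambda>p. y (fst p) (fst (snd p))) \<in> borel_measurable (S \<Otimes>\<^sub>M (borel::real measure) \<Otimes>\<^sub>M (borel::'a measure))"
      by simp
    show ?thesis unfolding case_prod_unfold adjoint_def by measurable
  qed
  from measurable_ode_sol[OF this] show ?thesis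
    unfolding costate_def by (simp add: case_prod_unfold)
qed

text \<open>The first bound is Gronwall, the second integrates it. The second is what makes a short
  horizon useful: there the transposed inverse flow is a small perturbation of the identity.\<close>

lemma costate_bound:
  assumes [measurable]: "y \<in> borel_measurable borel" and s: "0 \<le> s"
  shows "norm (costate y b s) \<le> norm b * exp (L * s)"
    "norm (costate y b s - b) \<le> norm b * (exp (L * s) - 1)"
proof -
  let ?p = "costate y b"
  have sol: "solves (\<lambda>r p. - adjoint (y r) p) b s ?p" by (rule costate_solves) fact
  have cp: "continuous_on {0..s} ?p" by (rule solves_continuous[OF sol])
  have 1: "norm (?p r - b) \<le> L * (LINT r:{0..r}|lborel. norm (?p r))" if "r \<in> {0..s}" for r
  proof -
    have i: "set_integrable lborel {0..r} (\<lambda>r. norm (?p r))"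
      by (intro borel_integrable_atLeastAtMost' continuous_on_subset[OF cp] continuous_intros) (use that in auto)
    have "?p r - b = (LINT r:{0..r}|lborel. - adjoint (y r) (?p r))"
      using sol that by (auto simp: solves_def)
    then have "norm (?p r - b) \<le> (LINT r:{0..r}|lborel. L * norm (?p r))"
      using norm_set_integral_le[of lborel "{0..r}" "\<lambda>r. - adjoint (y r) (?p r)" "\<lambda>r. L * norm (?p r)"]
        sol that i norm_adjoint by (auto simp: solves_def)
    then show ?thesis by simp
  qed
  have 2: "norm (?p r) \<le> norm b * exp (L * r)" if "r \<in> {0..s}" for r
  proof (rule gronwall[OF _ _ _ that])
    show "continuous_on {0..s} (\<lambda>r. norm (?p r))" using cp by (intro continuous_intros)
    show "norm (?p r) \<le> norm b + L * (LINT r:{0..r}|lborel. norm (?p r))" if "r \<in> {0..s}" for r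
      using 1[OF that] norm_triangle_sub[of "?p r" b] by simp
  qed (use Lpos in simp)
  show "norm (?p s) \<le> norm b * exp (L * s)" using 2 s by simp
  have "(LINT r:{0..s}|lborel. norm (?p r)) \<le> (LINT r:{0..s}|lborel. norm b * exp (L * r))"
  proof (rule set_integral_real_mono)
    show "set_integrable lborel {0..s} (\<lambda>r. norm (?p r))"
      by (intro borel_integrable_atLeastAtMost' cp continuous_intros)
    show "set_integrable lborel {0..s} (\<lambda>r. norm b * exp (L * r))"
      by (intro borel_integrable_atLeastAtMost' continuous_intros)
  qed (use 2 in auto)
  also have "\<dots> = norm b * ((exp (L * s) - 1) / L)" using set_integral_exp[of L s] Lpos s by simp
  finally have "L * (LINT r:{0..s}|lborel. norm (?p r)) \<le> L * (norm b * ((exp (L * s) - 1) / L))"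
    using Lpos by (intro mult_left_mono) auto
  then show "norm (?p s - b) \<le> norm b * (exp (L * s) - 1)"
    using 1[of s] s Lpos by simp
qed

end

text \<open>A frozen background path g plus n marked jumps, with time \<open>fst (z j)\<close> and
  size \<open>snd (z j)\<close>. A jump of size 0 leaves no trace wherever it is placed.\<close>

definition noise :: "(real \<Rightarrow> 'a) \<Rightarrow> nat \<Rightarrow> (nat \<Rightarrow> real \<times> 'a) \<Rightarrow> real \<Rightarrow> 'a::real_normed_vector" where
  "noise g n z s = g s + (\<Sum>j<n. if fst (z j) \<le> s then snd (z j) else 0)"

lemma measurable_noise[measurable]:
  fixes g :: "real \<Rightarrow> 'a::euclidean_space"
  assumes [measurable]: "g \<in> borel_measurable borel"
  shows "noise g n z \<in> borel_measurable borel"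
  unfolding noise_def[abs_def] by measurable

section \<open>First-order expansion of the solution in the jump times\<close>

lemma set_integral_finite_sum:
  fixes f :: "'j \<Rightarrow> 'b \<Rightarrow> 'a::euclidean_space"
  assumes "\<And>j. j \<in> J \<Longrightarrow> set_integrable M A (f j)"
  shows "set_integrable M A (\<lambda>x. \<Sum>j\<in>J. f j x)" "(LINT x:A|M. \<Sum>j\<in>J. f j x) = (\<Sum>j\<in>J. LINT x:A|M. f j x)"
  using assms unfolding set_lebesgue_integral_def set_integrable_def scaleR_sum_right
  by (auto intro!: Bochner_Integration.integrable_sum Bochner_Integration.integral_sum)

context smooth_drift begin

lemma measurable_costate_single:
  assumes [measurable]: "y \<in> borel_measurable borel" shows "costate y b \<in> borel_measurable borel"
proof -
  have "(\<lambda>(w::unit, s). y s) \<in> borel_measurable (count_space UNIV \<Otimes>\<^sub>M borel)" by measurable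
  from measurable_costate[OF this]
  have "(\<lambda>s. (\<lambda>(w::unit, s). costate y b s) ((), s)) \<in> borel_measurable borel"
    by (rule measurable_compose[rotated]) measurable
  then show ?thesis by simp
qed

lemma isCont_costate:
  assumes "y \<in> borel_measurable borel" "0 < s" shows "isCont (costate y b) s"
proof -
  have "continuous_on {0..s+1} (costate y b)"
    by (rule solves_continuous[OF costate_solves]) fact
  then show ?thesis
    by (rule continuous_on_interior) (use assms in auto)
qed

lemma isCont_drift_part:
  assumes "V \<in> borel_measurable borel" "0 < s" shows "isCont (\<lambda>s. flow x V s - V s) s"
proof -
  have "continuous_on {0..s+1} (\<lambda>s. flow x V s - V s)"
    by (rule solves_continuous[OF flow_solves]) fact
  then show ?thesis
    by (rule continuous_on_interior) (use assms in auto)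
qed

text \<open>Delaying a jump by \<theta> withholds the drift increment \<open>\<Delta> j\<close> for
  a time \<theta>; afterwards the linearized flow transports the defect. Pairing with the costate q
  removes the transport: if D is the difference of the drift parts, integration by parts turns
  \<open>q t \<bullet> D t\<close> into the integral of q \<bullet> (a(y') - a(y) - a'(y) D), whose
  main part sits on the short windows between old and new jump times. The error is o(\<eta>).
  Continuity of g at the jump times keeps the state without the jump nearly constant over a window.
  Since this holds at almost all times, but in general on no open set of times, the expansion is
  stated around one fixed configuration z.\<close>

lemma flow_first_order:
  fixes g :: "real \<Rightarrow> 'a" and z :: "nat \<Rightarrow> real \<times> 'a" and \<theta> :: "nat \<Rightarrow> nat \<Rightarrow> real"
    and n :: nat and x b :: 'a and t :: real
  defines "z' i j \<equiv> (fst (z j) + \<theta> i j, snd (z j))"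
  defines "y \<equiv> flow x (noise g n z)" and "y' i \<equiv> flow x (noise g n (z' i))"
  defines "q \<equiv> costate y b" and "\<eta> i \<equiv> (\<Sum>j<n. \<bar>\<theta> i j\<bar>)"
  defines "yr j r \<equiv> y r - (if fst (z j) \<le> r then snd (z j) else 0)"
  defines "\<Delta> j \<equiv> a (yr j (fst (z j)) + snd (z j)) - a (yr j (fst (z j)))"
  assumes g[measurable]: "g \<in> borel_measurable borel"
    and t: "\<And>j. j < n \<Longrightarrow> 0 < fst (z j) \<and> fst (z j) < t \<and> isCont g (fst (z j))"
    and inj: "inj_on (\<lambda>j. fst (z j)) {..<n}"
    and tpos: "0 < t"
    and \<eta>0: "\<eta> \<longlonglongrightarrow> 0" and \<eta>pos: "\<And>i. 0 < \<eta> i"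
  shows "(\<lambda>i. (q t \<bullet> (y' i t - y t) + (\<Sum>j<n. \<theta> i j * (q (fst (z j)) \<bullet> \<Delta> j))) / \<eta> i) \<longlonglongrightarrow> 0"
proof -
  let ?\<tau> = "\<lambda>j. fst (z j)"
  let ?V = "noise g n z" and ?V' = "\<lambda>i. noise g n (z' i)"
  \<comment> \<open>Signed indicator of the window between old and new time of jump j: +1 while a
    delayed jump is still missing, -1 while an advanced one is already present.\<close>
  define s where "s i j r = (if ?\<tau> j \<le> r then 1 else 0) - (if ?\<tau> j + \<theta> i j \<le> r then 1 else 0 :: real)" for i j r
  define D where "D i r = (y' i r - ?V' i r) - (y r - ?V r)" for i r
  define \<phi> where "\<phi> i r = a (y' i r) - a (y r)" for i r
  \<comment> \<open>Gronwall constants: \<open>C * \<eta> i\<close> will bound D on [0, t], and Q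
    will bound the costate there.\<close>
  define C where "C = 2 * B * exp (L * t)"
  define Q where "Q = norm b * exp (L * t)"
  have C0: "0 \<le> C" "0 \<le> Q" using B_nonneg by (auto simp: C_def Q_def)
  note [simp] = z'_def
  have [measurable]: "y \<in> borel_measurable borel" "y' i \<in> borel_measurable borel" for i
    unfolding y_def y'_def by (intro measurable_flow_single measurable_noise g)+
  have [measurable]: "D i \<in> borel_measurable borel" for i unfolding D_def[abs_def] by measurable
  have [measurable]: "\<phi> i \<in> borel_measurable borel" for i unfolding \<phi>_def[abs_def] by measurable
  have [measurable]: "s i j \<in> borel_measurable borel" for i j unfolding s_def[abs_def] by measurable
  have [measurable]: "q \<in> borel_measurable borel" unfolding q_def by (rule measurable_costate_single) measurable
  have [measurable]: "(\<lambda>r. blinfun_apply (a' (y r)) (D i r)) \<in> borel_measurable borel" for i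
  proof -
    have "(\<lambda>r. \<Sum>k\<in>Basis. (D i r \<bullet> k) *\<^sub>R a' (y r) k) \<in> borel_measurable borel" by measurable
    moreover have "(\<Sum>k\<in>Basis. (D i r \<bullet> k) *\<^sub>R a' (y r) k) = a' (y r) (D i r)" for r
      by (simp add: blinfun.sum_right[symmetric] blinfun.scaleR_right[symmetric] euclidean_representation)
    ultimately show ?thesis by simp
  qed
  have \<phi>b: "norm (\<phi> i r) \<le> 2 * B" for i r
    using norm_triangle_ineq4[of "a (y' i r)" "a (y r)"] bound[of "y' i r"] bound[of "y r"] by (simp add: \<phi>_def)
  have a'b: "norm (a' w h) \<le> L * norm h" for w h
    using norm_blinfun[of "a' w" h] mult_right_mono[OF bound'[of w], of "norm h"] by simp
  have Deq: "D i r = (LINT r:{0..r}|lborel. \<phi> i r)" if "0 \<le> r" for i r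
  proof -
    have 1: "solves (\<lambda>r w. a (w + ?V r)) x r (\<lambda>s. y s - ?V s)" "solves (\<lambda>r w. a (w + ?V' i r)) x r (\<lambda>s. y' i s - ?V' i s)"
      unfolding y_def y'_def by (intro flow_solves; measurable)+
    have i: "set_integrable lborel {0..r} (\<lambda>r. a (y' i r))" "set_integrable lborel {0..r} (\<lambda>r. a (y r))"
      and e: "y r - ?V r = x + (LINT r:{0..r}|lborel. a (y r))" "y' i r - ?V' i r = x + (LINT r:{0..r}|lborel. a (y' i r))"
      using 1 that by (auto simp: solves_def)
    show ?thesis using e set_integral_diff_real(2)[OF i] by (simp add: D_def \<phi>_def)
  qed
  have y'eq: "y' i r = y r + D i r - (\<Sum>j<n. s i j r *\<^sub>R snd (z j))" for i r
  proof -
    have "?V' i r - ?V r = - (\<Sum>j<n. s i j r *\<^sub>R snd (z j))"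
      unfolding noise_def sum_negf[symmetric]
      by (simp add: sum_subtractf[symmetric]) (intro sum.cong refl, auto simp: s_def)
    then show ?thesis by (simp add: D_def algebra_simps)
  qed
  have sabs: "\<bar>s i j r\<bar> = indicator {min (?\<tau> j) (?\<tau> j + \<theta> i j)..<max (?\<tau> j) (?\<tau> j + \<theta> i j)} r" for i j r
    by (auto simp: s_def indicator_def)
  have s_sgn: "s i j r = sgn (\<theta> i j) * \<bar>s i j r\<bar>" for i j r
    by (auto simp: s_def sgn_real_def)
  have s_int: "set_integrable lborel {0..r} (\<lambda>r. \<bar>s i j r\<bar>)" "set_integrable lborel {0..r} (s i j)" for i j r
    by (rule set_integrable_bounded_interval[where B = 1]; auto simp: s_def)+
  have s_le: "(LINT r:{0..r}|lborel. \<bar>s i j r\<bar>) \<le> \<bar>\<theta> i j\<bar>" for i j r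
  proof -
    let ?I = "{min (?\<tau> j) (?\<tau> j + \<theta> i j)..<max (?\<tau> j) (?\<tau> j + \<theta> i j)}"
    have "(LINT r:{0..r}|lborel. \<bar>s i j r\<bar>) \<le> (LINT r|lborel. indicator ?I r)"
      unfolding set_lebesgue_integral_def
    proof (rule integral_mono)
      show "integrable lborel (\<lambda>r'. indicator {0..r} r' *\<^sub>R \<bar>s i j r'\<bar>)"
        using s_int by (simp add: set_integrable_def)
      show "integrable lborel (indicator ?I :: real \<Rightarrow> real)"
        by (simp add: emeasure_lborel_Ico)
    qed (unfold sabs, auto simp: indicator_def)
    also have "\<dots> = \<bar>\<theta> i j\<bar>" by (auto simp: min_def max_def)
    finally show ?thesis .
  qed
  have s_eq: "(LINT r:{0..t}|lborel. s i j r) = \<theta> i j" if "j < n" "0 \<le> ?\<tau> j + \<theta> i j" "?\<tau> j + \<theta> i j \<le> t" for i j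
  proof -
    let ?I = "{min (?\<tau> j) (?\<tau> j + \<theta> i j)..<max (?\<tau> j) (?\<tau> j + \<theta> i j)}"
    have "(LINT r:{0..t}|lborel. s i j r) = (LINT r|lborel. sgn (\<theta> i j) * indicator ?I r)"
      unfolding set_lebesgue_integral_def
    proof (rule Bochner_Integration.integral_cong)
      fix r
      have "r \<notin> {0..t} \<Longrightarrow> r \<notin> ?I" using that t[OF that(1)] by auto
      then show "indicator {0..t} r *\<^sub>R s i j r = sgn (\<theta> i j) * indicator ?I r"
        using s_sgn[of i j r] unfolding sabs by (cases "r \<in> {0..t}") auto
    qed simp
    also have "\<dots> = sgn (\<theta> i j) * \<bar>\<theta> i j\<bar>" by (auto simp: min_def max_def)
    finally show ?thesis by (simp add: sgn_real_def)
  qed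
  have s01: "\<bar>s i j r\<bar> \<le> 1" "0 \<le> \<bar>s i j r\<bar>" for i j r by (auto simp: s_def)
  \<comment> \<open>Off the windows the two paths differ by D alone and a is Lipschitz. On a window
    only boundedness of a helps, but the windows have total length at most \<eta>.\<close>
  have \<phi>le: "norm (\<phi> i r) \<le> L * norm (D i r) + 2 * B * (\<Sum>j<n. \<bar>s i j r\<bar>)" for i r
  proof (cases "\<exists>j<n. s i j r \<noteq> 0")
    case True
    then obtain j where j: "j < n" "s i j r \<noteq> 0" by auto
    then have "1 \<le> \<bar>s i j r\<bar>" by (auto simp: s_def split: if_splits)
    also have "\<dots> \<le> (\<Sum>j<n. \<bar>s i j r\<bar>)" using j by (intro member_le_sum) auto
    finally have "2 * B * 1 \<le> 2 * B * (\<Sum>j<n. \<bar>s i j r\<bar>)" using B_nonneg by (intro mult_left_mono) auto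
    moreover have "0 \<le> L * norm (D i r)" using Lpos by simp
    ultimately show ?thesis using \<phi>b[of i r] by linarith
  next
    case False
    then have "y' i r = y r + D i r" by (simp add: y'eq)
    then show ?thesis using False lip[of "y r + D i r" "y r"] by (simp add: \<phi>_def)
  qed
  have Dcont: "continuous_on {0..t} (D i)" for i
    by (rule continuous_on_eq[OF continuous_on_set_integral[of t "\<phi> i"]])
       (use Deq \<phi>b in \<open>auto intro!: set_integrable_bounded_interval[where B = "2 * B"]\<close>)
  have Dle: "norm (D i r) \<le> C * \<eta> i" if r: "r \<in> {0..t}" for i r
  proof -
    have "norm (D i r) \<le> (2 * B * \<eta> i) * exp (L * r)"
    proof (rule gronwall[OF _ _ _ r])
      show "continuous_on {0..t} (\<lambda>r. norm (D i r))" by (intro continuous_intros Dcont)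
      fix r assume r: "r \<in> {0..t}"
      have iD: "set_integrable lborel {0..r} (\<lambda>r. L * norm (D i r))"
        by (intro borel_integrable_atLeastAtMost' continuous_intros continuous_on_subset[OF Dcont]) (use r in auto)
      have iss: "set_integrable lborel {0..r} (\<lambda>r. 2 * B * (\<Sum>j<n. \<bar>s i j r\<bar>))"
        by (rule set_integrable_bounded_interval[where B = "2 * B * n"])
           (use B_nonneg sum_mono[of "{..<n}" "\<lambda>j. \<bar>s i j _\<bar>" "\<lambda>j. 1"] s01
             in \<open>auto simp: abs_mult sum_nonneg intro!: mult_left_mono\<close>)
      have "norm (D i r) = norm (LINT r:{0..r}|lborel. \<phi> i r)" using Deq r by simp
      also have "\<dots> \<le> (LINT r:{0..r}|lborel. L * norm (D i r) + 2 * B * (\<Sum>j<n. \<bar>s i j r\<bar>))"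
        by (rule norm_set_integral_le)
           (use \<phi>b iD iss \<phi>le in \<open>auto intro!: set_integrable_bounded_interval[where B = "2 * B"] set_integral_add\<close>)
      also have "\<dots> = (LINT r:{0..r}|lborel. L * norm (D i r)) + (LINT r:{0..r}|lborel. 2 * B * (\<Sum>j<n. \<bar>s i j r\<bar>))"
        by (rule set_integral_add(2)[OF iD iss])
      also have "(LINT r:{0..r}|lborel. 2 * B * (\<Sum>j<n. \<bar>s i j r\<bar>)) = 2 * B * (\<Sum>j<n. LINT r:{0..r}|lborel. \<bar>s i j r\<bar>)"
        by (subst set_integral_mult_right, subst set_integral_finite_sum(2)) (use s_int(1) in auto)
      also have "\<dots> \<le> 2 * B * \<eta> i"
        unfolding \<eta>_def using B_nonneg s_le by (intro mult_left_mono sum_mono) auto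
      finally show "norm (D i r) \<le> 2 * B * \<eta> i + L * (LINT r:{0..r}|lborel. norm (D i r))" by simp
    qed (use Lpos in simp)
    also have "\<dots> \<le> (2 * B * \<eta> i) * exp (L * t)"
      using r Lpos B_nonneg \<eta>pos[of i] by (intro mult_left_mono) auto
    finally show ?thesis by (simp add: C_def mult_ac)
  qed
  have qb: "norm (q r) \<le> Q" if "r \<in> {0..t}" for r
  proof -
    have "norm (q r) \<le> norm b * exp (L * r)"
      unfolding q_def using that by (intro costate_bound) auto
    also have "\<dots> \<le> Q" unfolding Q_def using that Lpos by (intro mult_left_mono) auto
    finally show ?thesis .
  qed
  \<comment> \<open>H is the integrand of the quantity to be estimated, see \<open>H_int\<close>.
    Off the windows it is bounded by K, which measures the linearization error of a at y r.\<close>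
  define H where "H i r = q r \<bullet> (\<phi> i r - a' (y r) (D i r)) + (\<Sum>j<n. s i j r * (q (?\<tau> j) \<bullet> \<Delta> j))" for i r
  define K where "K i r = Q * norm (a (y r + D i r) - a (y r) - a' (y r) (D i r))" for i r
  have [measurable]: "H i \<in> borel_measurable borel" "K i \<in> borel_measurable borel" for i
    unfolding H_def[abs_def] K_def[abs_def] by measurable
  have lin_b: "norm (a (y r + D i r) - a (y r) - a' (y r) (D i r)) \<le> 2 * L * norm (D i r)" for i r
    using norm_triangle_ineq4[of "a (y r + D i r) - a (y r)" "a' (y r) (D i r)"] lip[of "y r + D i r" "y r"]
      a'b[of "y r" "D i r"] by simp
  have Kb: "norm (K i r) \<le> Q * (2 * L * (C * \<eta> i))" if "r \<in> {0..t}" for i r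
  proof -
    have "2 * L * norm (D i r) \<le> 2 * L * (C * \<eta> i)" using Dle[OF that, of i] Lpos by (intro mult_left_mono) auto
    then have "norm (a (y r + D i r) - a (y r) - a' (y r) (D i r)) \<le> 2 * L * (C * \<eta> i)"
      using lin_b[of r i] by linarith
    then show ?thesis using C0 by (simp add: K_def abs_mult mult_left_mono)
  qed
  have K_int: "set_integrable lborel {0..t} (K i)" for i
    by (rule set_integrable_bounded_interval[OF _ Kb]) auto
  \<comment> \<open>Dominated convergence asks for differentiability of a only at each single point
    y r: K / \<eta> tends to 0 pointwise and is bounded because D is of order \<eta>.\<close>
  have K_lim: "(\<lambda>i. (LINT r:{0..t}|lborel. K i r) / \<eta> i) \<longlonglongrightarrow> 0"
  proof -
    have "(\<lambda>i. LINT r|lborel. indicator {0..t} r *\<^sub>R (K i r / \<eta> i)) \<longlonglongrightarrow> (LINT r::real|lborel. (0::real))"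
    proof (rule integral_dominated_convergence[where w = "\<lambda>r. indicator {0..t} r *\<^sub>R (Q * (2 * L * C))"])
      show "integrable lborel (\<lambda>r. indicator {0..t} r *\<^sub>R (Q * (2 * L * C)))"
        by (rule set_integrable_bounded_interval[unfolded set_integrable_def]) auto
      show "AE r in lborel. norm (indicator {0..t} r *\<^sub>R (K i r / \<eta> i)) \<le> indicator {0..t} r *\<^sub>R (Q * (2 * L * C))" for i
      proof (rule AE_I2)
        fix r show "norm (indicator {0..t} r *\<^sub>R (K i r / \<eta> i)) \<le> indicator {0..t} r *\<^sub>R (Q * (2 * L * C))"
          using Kb[of r i] \<eta>pos[of i] by (cases "r \<in> {0..t}") (auto simp: divide_le_eq mult_ac)
      qed
      show "AE r in lborel. (\<lambda>i. indicator {0..t} r *\<^sub>R (K i r / \<eta> i)) \<longlonglongrightarrow> 0"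
      proof (rule AE_I2)
        fix r
        show "(\<lambda>i. indicator {0..t} r *\<^sub>R (K i r / \<eta> i)) \<longlonglongrightarrow> 0"
        proof (cases "r \<in> {0..t}")
          case True
          have D0: "(\<lambda>i. norm (D i r)) \<longlonglongrightarrow> 0"
          proof (rule Lim_null_comparison)
            show "\<forall>\<^sub>F i in sequentially. norm (norm (D i r)) \<le> C * \<eta> i" using Dle[OF True] by simp
            show "(\<lambda>i. C * \<eta> i) \<longlonglongrightarrow> 0" using tendsto_mult_right_zero[OF \<eta>0] by simp
          qed
          have "(\<lambda>i. K i r / \<eta> i) \<longlonglongrightarrow> 0"
          proof (rule LIMSEQ_I)
            fix e :: real assume e: "0 < e"
            \<comment> \<open>The added 1 keeps the denominator positive when Q or C
              vanishes.\<close>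
            define e1 where "e1 = e / (2 * (Q * C + 1))"
            have e1: "0 < e1" using e C0 by (auto simp: e1_def add_nonneg_pos)
            obtain d where d: "d > 0" "\<And>w. norm (w - y r) < d \<Longrightarrow> norm (a w - a (y r) - a' (y r) (w - y r)) \<le> e1 * norm (w - y r)"
              using deriv[of "y r"] e1 unfolding has_derivative_at_alt by blast
            have "\<forall>\<^sub>F i in sequentially. norm (D i r) < d"
              using order_tendstoD(2)[OF D0 d(1)] .
            then obtain N where N: "\<And>i. i \<ge> N \<Longrightarrow> norm (D i r) < d" by (auto simp: eventually_sequentially)
            have "norm (K i r / \<eta> i - 0) < e" if "i \<ge> N" for i
            proof -
              have "norm (a (y r + D i r) - a (y r) - a' (y r) (D i r)) \<le> e1 * norm (D i r)"
                using d(2)[of "y r + D i r"] N[OF that] by simp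
              also have "\<dots> \<le> e1 * (C * \<eta> i)" using Dle[OF True] e1 by (intro mult_left_mono) auto
              finally have "K i r \<le> Q * (e1 * (C * \<eta> i))" using C0 by (auto simp: K_def intro: mult_left_mono)
              then have "K i r / \<eta> i \<le> e1 * (Q * C)" using \<eta>pos[of i] by (simp add: divide_le_eq mult_ac)
              also have "\<dots> \<le> e1 * (Q * C + 1)" using e1 by (intro mult_left_mono) auto
              also have "\<dots> = e / 2"
              proof -
                have "0 < Q * C + 1" using C0 by (auto intro: add_nonneg_pos)
                then show ?thesis by (simp add: e1_def field_simps)
              qed
              finally have "K i r / \<eta> i < e" using e by linarith
              moreover have "0 \<le> K i r / \<eta> i" using C0 \<eta>pos[of i] by (auto simp: K_def)
              ultimately show ?thesis by simp
            qed
            then show "\<exists>N. \<forall>i\<ge>N. norm (K i r / \<eta> i - 0) < e" by blast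
          qed
          then show ?thesis using True by simp
        qed simp
      qed
    qed simp_all
    then show ?thesis by (simp add: set_lebesgue_integral_def)
  qed
  \<comment> \<open>On a window H is eventually below any e. As the windows have total length at
    most \<eta>, they contribute at most e times \<eta> to the integral.\<close>
  have H_le: "\<forall>\<^sub>F i in sequentially. \<forall>r\<in>{0..t}. norm (H i r) \<le> K i r + e * (\<Sum>j<n. \<bar>s i j r\<bar>)" if e: "0 < e" for e
  proof -
    have near: "\<forall>\<^sub>F i in sequentially. \<forall>r\<in>{0..t}. s i j r \<noteq> 0 \<longrightarrow> norm (H i r) \<le> e" if j: "j < n" for j
    proof -
      have tj: "0 < ?\<tau> j" "?\<tau> j \<in> {0..t}" using t[OF j] by auto
      \<comment> \<open>Bounds H on window j up to a term of order \<eta>. It vanishes at the jump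
        time and is continuous there, because \<open>yr j\<close> has jump j removed, the other
        jumps occur at other times and g is continuous there.\<close>
      define m where "m r = Q * (2 * L * norm (yr j r - yr j (?\<tau> j))) + 2 * B * norm (q r - q (?\<tau> j))" for r
      have "isCont (yr j) (?\<tau> j)"
      proof -
        have yrj: "yr j r = (flow x ?V r - ?V r) + g r + (\<Sum>k\<in>{..<n} - {j}. if ?\<tau> k \<le> r then snd (z k) else 0)" for r
          unfolding yr_def y_def noise_def using j by (simp add: sum.remove[of "{..<n}" j])
        have "isCont (\<lambda>r. if ?\<tau> k \<le> r then snd (z k) else 0) (?\<tau> j)" if "k \<in> {..<n} - {j}" for k
        proof -
          have ne: "?\<tau> k \<noteq> ?\<tau> j" using inj that j by (auto simp: inj_on_def)
          show ?thesis
          proof (cases "?\<tau> k < ?\<tau> j")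
            case True
            then have "\<forall>\<^sub>F r in nhds (?\<tau> j). r \<in> {?\<tau> k<..}" by (intro eventually_nhds_in_open) auto
            then have "\<forall>\<^sub>F r in nhds (?\<tau> j). (if ?\<tau> k \<le> r then snd (z k) else 0) = snd (z k)"
              by (rule eventually_mono) auto
            then show ?thesis by (subst isCont_cong) auto
          next
            case False
            then have "?\<tau> j < ?\<tau> k" using ne by simp
            then have "\<forall>\<^sub>F r in nhds (?\<tau> j). r \<in> {..<?\<tau> k}" by (intro eventually_nhds_in_open) auto
            then have "\<forall>\<^sub>F r in nhds (?\<tau> j). (if ?\<tau> k \<le> r then snd (z k) else 0) = 0"
              by (rule eventually_mono) auto
            then show ?thesis by (subst isCont_cong) auto
          qed
        qed
        then show ?thesis unfolding yrj[abs_def]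
          by (intro continuous_intros isCont_drift_part) (use t[OF j] in auto)
      qed
      moreover have "isCont q (?\<tau> j)" unfolding q_def by (rule isCont_costate) (use tj in auto)
      ultimately have "isCont m (?\<tau> j)" unfolding m_def[abs_def] by (intro continuous_intros)
      then have "(m \<longlongrightarrow> m (?\<tau> j)) (nhds (?\<tau> j))"
        unfolding isCont_def tendsto_at_iff_tendsto_nhds .
      moreover have "m (?\<tau> j) < e / 2" using e by (simp add: m_def)
      ultimately have "\<forall>\<^sub>F r in nhds (?\<tau> j). m r < e / 2" by (rule order_tendstoD(2))
      then obtain d where d: "d > 0" "\<And>r. dist r (?\<tau> j) < d \<Longrightarrow> m r < e / 2"
        unfolding eventually_nhds_metric by blast
      have ev1: "\<forall>\<^sub>F i in sequentially. \<eta> i < d" using order_tendstoD(2)[OF \<eta>0 d(1)] .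
      have ev2: "\<forall>\<^sub>F i in sequentially. Q * (2 * L * (C * \<eta> i)) < e / 2"
      proof -
        have "(\<lambda>i. Q * (2 * L * (C * \<eta> i))) \<longlonglongrightarrow> 0"
          using tendsto_mult_right_zero[OF \<eta>0, of "Q * (2 * L * C)"] by (simp add: mult_ac)
        then show ?thesis by (rule order_tendstoD(2)) (use e in simp)
      qed
      \<comment> \<open>Eventually the windows are disjoint, so that at any time at most one jump is
        displaced.\<close>
      have ev3: "\<forall>\<^sub>F i in sequentially. \<forall>k\<in>{..<n} - {j}. 2 * \<eta> i < \<bar>?\<tau> j - ?\<tau> k\<bar>"
      proof (rule eventually_ball_finite, simp, rule ballI)
        fix k assume "k \<in> {..<n} - {j}"
        then have "0 < \<bar>?\<tau> j - ?\<tau> k\<bar>" using inj j by (auto simp: inj_on_def)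
        moreover have "(\<lambda>i. 2 * \<eta> i) \<longlonglongrightarrow> 0" using tendsto_mult_right_zero[OF \<eta>0] by simp
        ultimately show "\<forall>\<^sub>F i in sequentially. 2 * \<eta> i < \<bar>?\<tau> j - ?\<tau> k\<bar>" by (intro order_tendstoD(2))
      qed
      show ?thesis using ev1 ev2 ev3
      proof eventually_elim
        case (elim i)
        show ?case
        proof (intro ballI impI)
          fix r assume r: "r \<in> {0..t}" and sj: "s i j r \<noteq> 0"
          have seg: "\<bar>r - ?\<tau> k\<bar> \<le> \<eta> i" if "s i k r \<noteq> 0" "k < n" for k
          proof -
            have "\<bar>r - ?\<tau> k\<bar> \<le> \<bar>\<theta> i k\<bar>" using that by (auto simp: s_def split: if_splits)
            also have "\<dots> \<le> \<eta> i" unfolding \<eta>_def using that by (intro member_le_sum) auto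
            finally show ?thesis .
          qed
          have s0: "s i k r = 0" if "k \<in> {..<n} - {j}" for k
            using seg[of k] seg[OF sj j] elim(3) that by force
          have sums: "(\<Sum>k<n. s i k r * c k) = s i j r * c j" for c :: "nat \<Rightarrow> real"
            using sum.mono_neutral_right[of "{..<n}" "{j}" "\<lambda>k. s i k r * c k"] s0 j by auto
          have sums': "(\<Sum>k<n. s i k r *\<^sub>R snd (z k)) = s i j r *\<^sub>R snd (z j)"
            using sum.mono_neutral_right[of "{..<n}" "{j}" "\<lambda>k. s i k r *\<^sub>R snd (z k)"] s0 j by auto
          let ?y = "yr j r" and ?yt = "yr j (?\<tau> j)" and ?u = "snd (z j)" and ?d = "D i r"
          have near: "norm (\<phi> i r + s i j r *\<^sub>R \<Delta> j) \<le> 2 * L * norm (?y - ?yt) + L * norm ?d"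
          proof -
            consider "s i j r = 1" "?\<tau> j \<le> r" | "s i j r = -1" "\<not> ?\<tau> j \<le> r"
              using sj by (auto simp: s_def split: if_splits)
            then show ?thesis
            proof cases
              case 1
              then have e1: "y r = ?y + ?u" "y' i r = ?y + ?d" by (auto simp: yr_def y'eq sums')
              have "\<phi> i r + s i j r *\<^sub>R \<Delta> j = (a (?y + ?d) - a ?yt) + (a (?yt + ?u) - a (?y + ?u))"
                using 1 by (simp add: \<phi>_def e1 \<Delta>_def)
              also have "norm \<dots> \<le> L * norm (?y + ?d - ?yt) + L * norm (?yt + ?u - (?y + ?u))"
                by (intro norm_triangle_mono lip)
              also have "L * norm (?y + ?d - ?yt) \<le> L * (norm (?y - ?yt) + norm ?d)"
                using norm_triangle_ineq[of "?y - ?yt" ?d] Lpos by (intro mult_left_mono) (auto simp: algebra_simps)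
              also have "L * norm (?yt + ?u - (?y + ?u)) = L * norm (?y - ?yt)" by (simp add: norm_minus_commute)
              finally show ?thesis by (simp add: algebra_simps)
            next
              case 2
              then have e1: "y r = ?y" "y' i r = ?y + ?d + ?u" by (auto simp: yr_def y'eq sums')
              have "\<phi> i r + s i j r *\<^sub>R \<Delta> j = (a (?y + ?d + ?u) - a (?yt + ?u)) + (a ?yt - a ?y)"
                using 2 by (simp add: \<phi>_def e1 \<Delta>_def)
              also have "norm \<dots> \<le> L * norm (?y + ?d + ?u - (?yt + ?u)) + L * norm (?yt - ?y)"
                by (intro norm_triangle_mono lip)
              also have "L * norm (?y + ?d + ?u - (?yt + ?u)) \<le> L * (norm (?y - ?yt) + norm ?d)"
                using norm_triangle_ineq[of "?y - ?yt" ?d] Lpos by (intro mult_left_mono) (auto simp: algebra_simps)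
              also have "L * norm (?yt - ?y) = L * norm (?y - ?yt)" by (simp add: norm_minus_commute)
              finally show ?thesis by (simp add: algebra_simps)
            qed
          qed
          have "H i r = q r \<bullet> ((\<phi> i r + s i j r *\<^sub>R \<Delta> j) - a' (y r) ?d) - s i j r * ((q r - q (?\<tau> j)) \<bullet> \<Delta> j)"
            unfolding H_def sums by (simp add: algebra_simps inner_diff_left inner_add_right inner_diff_right)
          also have "norm \<dots> \<le> norm (q r \<bullet> ((\<phi> i r + s i j r *\<^sub>R \<Delta> j) - a' (y r) ?d)) + norm (s i j r * ((q r - q (?\<tau> j)) \<bullet> \<Delta> j))"
            by (rule norm_triangle_ineq4)
          also have "norm (s i j r * ((q r - q (?\<tau> j)) \<bullet> \<Delta> j)) \<le> 1 * (norm (q r - q (?\<tau> j)) * (2 * B))"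
          proof -
            have "norm (\<Delta> j) \<le> 2 * B"
              using norm_triangle_ineq4[of "a (?yt + ?u)" "a ?yt"] bound[of "?yt + ?u"] bound[of ?yt] by (simp add: \<Delta>_def)
            then have "\<bar>(q r - q (?\<tau> j)) \<bullet> \<Delta> j\<bar> \<le> norm (q r - q (?\<tau> j)) * (2 * B)"
              by (intro order_trans[OF Cauchy_Schwarz_ineq2 mult_left_mono]) auto
            then show ?thesis unfolding real_norm_def abs_mult using s01[of i j r] by (intro mult_mono) auto
          qed
          also have "norm (q r \<bullet> ((\<phi> i r + s i j r *\<^sub>R \<Delta> j) - a' (y r) ?d)) \<le> Q * (2 * L * norm (?y - ?yt) + L * norm ?d + L * norm ?d)"
          proof -
            have "norm ((\<phi> i r + s i j r *\<^sub>R \<Delta> j) - a' (y r) ?d) \<le> 2 * L * norm (?y - ?yt) + L * norm ?d + L * norm ?d"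
              using norm_triangle_ineq4[of "\<phi> i r + s i j r *\<^sub>R \<Delta> j" "a' (y r) ?d"] near a'b[of "y r" ?d] by linarith
            then show ?thesis
              unfolding real_norm_def
              by (intro order_trans[OF Cauchy_Schwarz_ineq2 mult_mono]) (use qb[OF r] C0 in auto)
          qed
          also have "Q * (2 * L * norm (?y - ?yt) + L * norm ?d + L * norm ?d) + 1 * (norm (q r - q (?\<tau> j)) * (2 * B))
              = m r + Q * (2 * L * norm ?d)" by (simp add: m_def algebra_simps)
          also have "\<dots> \<le> m r + Q * (2 * L * (C * \<eta> i))"
            using Dle[OF r, of i] C0 Lpos by (intro add_left_mono mult_left_mono) auto
          also have "\<dots> \<le> e"
            using d(2)[of r] seg[OF sj j] elim(1,2) by (simp add: dist_real_def)
          finally show "norm (H i r) \<le> e" by simp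
        qed
      qed
    qed
    have "\<forall>\<^sub>F i in sequentially. \<forall>j\<in>{..<n}. \<forall>r\<in>{0..t}. s i j r \<noteq> 0 \<longrightarrow> norm (H i r) \<le> e"
      by (rule eventually_ball_finite) (use near in auto)
    then show ?thesis
    proof eventually_elim
      case (elim i)
      show ?case
      proof
        fix r assume r: "r \<in> {0..t}"
        show "norm (H i r) \<le> K i r + e * (\<Sum>j<n. \<bar>s i j r\<bar>)"
        proof (cases "\<exists>j<n. s i j r \<noteq> 0")
          case True
          then obtain j where j: "j < n" "s i j r \<noteq> 0" by auto
          then have "1 \<le> \<bar>s i j r\<bar>" by (auto simp: s_def split: if_splits)
          also have "\<dots> \<le> (\<Sum>j<n. \<bar>s i j r\<bar>)" using j by (intro member_le_sum) auto
          finally have "e * 1 \<le> e * (\<Sum>j<n. \<bar>s i j r\<bar>)" using e by (intro mult_left_mono) auto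
          moreover have "0 \<le> K i r" using C0 by (simp add: K_def)
          ultimately show ?thesis using elim j r by force
        next
          case False
          then have "y' i r = y r + D i r" by (simp add: y'eq)
          then have "H i r = q r \<bullet> (a (y r + D i r) - a (y r) - a' (y r) (D i r))"
            using False by (simp add: H_def \<phi>_def)
          then have "norm (H i r) \<le> norm (q r) * norm (a (y r + D i r) - a (y r) - a' (y r) (D i r))"
            by (simp add: Cauchy_Schwarz_ineq2)
          also have "\<dots> \<le> K i r" unfolding K_def using qb[OF r] by (intro mult_right_mono) auto
          finally show ?thesis using False by simp
        qed
      qed
    qed
  qed
  have q_solves: "solves (\<lambda>r p. - adjoint (y r) p) b t q" unfolding q_def by (rule costate_solves) measurable
  \<comment> \<open>Integration by parts: the derivative of q is minus the transposed linearized
    drift, and paired with D it yields the term a'(y) D inside H.\<close>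
  have H_int: "q t \<bullet> D i t + (\<Sum>j<n. \<theta> i j * (q (?\<tau> j) \<bullet> \<Delta> j)) = (LINT r:{0..t}|lborel. H i r)"
    if in_range: "\<And>j. j < n \<Longrightarrow> 0 \<le> ?\<tau> j + \<theta> i j \<and> ?\<tau> j + \<theta> i j \<le> t" for i
  proof -
    have [measurable]: "(\<lambda>r. adjoint (y r) (q r)) \<in> borel_measurable borel" unfolding adjoint_def by measurable
    have ab: "norm (adjoint (y r) (q r)) \<le> L * Q" if "r \<in> {0..t}" for r
      by (rule order_trans[OF norm_adjoint mult_left_mono]) (use qb[OF that] Lpos in auto)
    have ibp: "q t \<bullet> D i t = (LINT r:{0..t}|lborel. q r \<bullet> \<phi> i r) + (LINT r:{0..t}|lborel. (- adjoint (y r) (q r)) \<bullet> D i r)"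
      by (rule inner_integration_by_parts[where C = "2 * B" and D = "L * Q" and b = b])
         (use \<phi>b ab Deq q_solves tpos in \<open>auto simp: solves_def\<close>)
    have i1: "set_integrable lborel {0..t} (\<lambda>r. q r \<bullet> \<phi> i r)"
      by (rule set_integrable_bounded_interval[where B = "Q * (2 * B)"])
         (auto intro!: order_trans[OF Cauchy_Schwarz_ineq2 mult_mono] qb \<phi>b C0)
    have i2: "set_integrable lborel {0..t} (\<lambda>r. (- adjoint (y r) (q r)) \<bullet> D i r)"
      by (rule set_integrable_bounded_interval[where B = "(L * Q) * (C * \<eta> i)"])
         (use ab Dle C0 Lpos in \<open>auto intro!: order_trans[OF Cauchy_Schwarz_ineq2 mult_mono]\<close>)
    have i3: "set_integrable lborel {0..t} (\<lambda>r. \<Sum>j<n. s i j r * (q (?\<tau> j) \<bullet> \<Delta> j))"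
      by (intro set_integral_finite_sum(1) set_integrable_mult_left s_int)
    have "(LINT r:{0..t}|lborel. H i r) = (LINT r:{0..t}|lborel. (q r \<bullet> \<phi> i r + (- adjoint (y r) (q r)) \<bullet> D i r) + (\<Sum>j<n. s i j r * (q (?\<tau> j) \<bullet> \<Delta> j)))"
      by (simp add: H_def inner_diff_right adjoint_inner)
    also have "\<dots> = (LINT r:{0..t}|lborel. q r \<bullet> \<phi> i r + (- adjoint (y r) (q r)) \<bullet> D i r) + (LINT r:{0..t}|lborel. \<Sum>j<n. s i j r * (q (?\<tau> j) \<bullet> \<Delta> j))"
      by (rule set_integral_add(2)[OF set_integral_add(1)[OF i1 i2] i3])
    also have "(LINT r:{0..t}|lborel. q r \<bullet> \<phi> i r + (- adjoint (y r) (q r)) \<bullet> D i r) = q t \<bullet> D i t"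
      using ibp set_integral_add(2)[OF i1 i2] by simp
    also have "(LINT r:{0..t}|lborel. \<Sum>j<n. s i j r * (q (?\<tau> j) \<bullet> \<Delta> j)) = (\<Sum>j<n. (LINT r:{0..t}|lborel. s i j r) * (q (?\<tau> j) \<bullet> \<Delta> j))"
      by (subst set_integral_finite_sum(2)) (auto intro!: set_integrable_mult_left s_int)
    also have "\<dots> = (\<Sum>j<n. \<theta> i j * (q (?\<tau> j) \<bullet> \<Delta> j))" using s_eq in_range by simp
    finally show ?thesis by simp
  qed
  \<comment> \<open>Once every shifted time lies in [0, t), each window integrates to exactly
    \<theta>, and at time t no jump is displaced, so that D t is the true difference of the
    paths.\<close>
  have ev_range: "\<forall>\<^sub>F i in sequentially. \<forall>j\<in>{..<n}. 0 \<le> ?\<tau> j + \<theta> i j \<and> ?\<tau> j + \<theta> i j < t"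
  proof (rule eventually_ball_finite, simp, rule ballI)
    fix j assume j: "j \<in> {..<n}"
    have "0 < min (?\<tau> j) (t - ?\<tau> j)" using t j by auto
    then have "\<forall>\<^sub>F i in sequentially. \<eta> i < min (?\<tau> j) (t - ?\<tau> j)" by (rule order_tendstoD(2)[OF \<eta>0])
    then show "\<forall>\<^sub>F i in sequentially. 0 \<le> ?\<tau> j + \<theta> i j \<and> ?\<tau> j + \<theta> i j < t"
    proof eventually_elim
      case (elim i)
      have "\<bar>\<theta> i j\<bar> \<le> \<eta> i" unfolding \<eta>_def using j by (intro member_le_sum) auto
      then show ?case using elim by auto
    qed
  qed
  show ?thesis
  proof (rule LIMSEQ_I)
    fix e :: real assume e: "0 < e"
    have e4: "0 < e / 4" using e by simp
    have "\<forall>\<^sub>F i in sequentially. (LINT r:{0..t}|lborel. K i r) / \<eta> i < e / 2"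
      using order_tendstoD(2)[OF K_lim, of "e/2"] e by simp
    with H_le[OF e4] ev_range
    have "\<forall>\<^sub>F i in sequentially. norm ((q t \<bullet> (y' i t - y t) + (\<Sum>j<n. \<theta> i j * (q (?\<tau> j) \<bullet> \<Delta> j))) / \<eta> i) < e"
    proof eventually_elim
      case (elim i)
      have "s i j t = 0" if "j < n" for j
        using bspec[OF elim(2), of j] that t[OF that] by (auto simp: s_def)
      then have Dt: "D i t = y' i t - y t" by (simp add: y'eq)
      have iss: "set_integrable lborel {0..t} (\<lambda>r. e / 4 * (\<Sum>j<n. \<bar>s i j r\<bar>))"
        by (intro set_integrable_mult_right set_integral_finite_sum(1) s_int)
      have "norm (H i r) \<le> Q * (2 * L * (C * \<eta> i)) + e / 4 * n" if "r \<in> {0..t}" for r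
      proof -
        have "(\<Sum>j<n. \<bar>s i j r\<bar>) \<le> (\<Sum>j<n. 1)" using s01 by (intro sum_mono)
        then have "e / 4 * (\<Sum>j<n. \<bar>s i j r\<bar>) \<le> e / 4 * n" using e by (intro mult_left_mono) auto
        moreover have "K i r \<le> Q * (2 * L * (C * \<eta> i))" using Kb[OF that, of i] by simp
        ultimately show ?thesis using bspec[OF elim(1) that] by linarith
      qed
      then have iH: "set_integrable lborel {0..t} (H i)"
        by (intro set_integrable_bounded_interval) auto
      have "norm (LINT r:{0..t}|lborel. H i r) \<le> (LINT r:{0..t}|lborel. K i r + e / 4 * (\<Sum>j<n. \<bar>s i j r\<bar>))"
        by (rule norm_set_integral_le[OF iH set_integral_add(1)[OF K_int iss]]) (use elim(1) in auto)
      also have "\<dots> = (LINT r:{0..t}|lborel. K i r) + (LINT r:{0..t}|lborel. e / 4 * (\<Sum>j<n. \<bar>s i j r\<bar>))"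
        by (rule set_integral_add(2)[OF K_int iss])
      also have "(LINT r:{0..t}|lborel. e / 4 * (\<Sum>j<n. \<bar>s i j r\<bar>)) = e / 4 * (\<Sum>j<n. LINT r:{0..t}|lborel. \<bar>s i j r\<bar>)"
        by (subst set_integral_mult_right, subst set_integral_finite_sum(2)) (use s_int(1) in auto)
      also have "\<dots> \<le> e / 4 * \<eta> i"
        unfolding \<eta>_def using e s_le by (intro mult_left_mono sum_mono) auto
      finally have "norm (LINT r:{0..t}|lborel. H i r) / \<eta> i \<le> ((LINT r:{0..t}|lborel. K i r) + e / 4 * \<eta> i) / \<eta> i"
        using \<eta>pos[of i] by (intro divide_right_mono) auto
      also have "\<dots> = (LINT r:{0..t}|lborel. K i r) / \<eta> i + e / 4" using \<eta>pos[of i] by (simp add: field_simps)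
      also have "\<dots> < e" using elim(3) e by linarith
      finally show ?case using H_int[of i] elim(2) \<eta>pos[of i] by (simp add: Dt less_imp_le)
    qed
    then show "\<exists>N. \<forall>i\<ge>N. norm ((q t \<bullet> (y' i t - y t) + (\<Sum>j<n. \<theta> i j * (q (?\<tau> j) \<bullet> \<Delta> j))) / \<eta> i - 0) < e"
      by (auto simp: eventually_sequentially)
  qed
qed

end

section \<open>Perturbation of the jump times\<close>

text \<open>\<sigma> selects one jump for each coordinate, so the perturbation parameter lives in
  the space of positions and the terminal position becomes a map of that space into itself.\<close>

definition shift_times :: "('a \<Rightarrow> nat) \<Rightarrow> 'a \<Rightarrow> (nat \<Rightarrow> real \<times> 'a) \<Rightarrow> nat \<Rightarrow> real \<times> 'a::euclidean_space" where
  "shift_times \<sigma> \<theta> z j = (fst (z j) + (\<Sum>b\<in>Basis. if \<sigma> b = j then \<theta> \<bullet> b else 0), snd (z j))"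

lemma noise_before:
  assumes "\<And>i. j \<le> i \<Longrightarrow> i < n \<Longrightarrow> r < fst (z i)" "j \<le> n"
  shows "noise g n z r = noise g j z r"
proof -
  have "(\<Sum>i<n. if fst (z i) \<le> r then snd (z i) else 0) = (\<Sum>i<j. if fst (z i) \<le> r then snd (z i) else 0)"
  proof (rule sum.mono_neutral_right)
    show "\<forall>i\<in>{..<n} - {..<j}. (if fst (z i) \<le> r then snd (z i) else 0) = 0"
    proof
      fix i assume "i \<in> {..<n} - {..<j}"
      then have "r < fst (z i)" using assms(1)[of i] by auto
      then show "(if fst (z i) \<le> r then snd (z i) else 0) = 0" by simp
    qed
  qed (use assms(2) in auto)
  then show ?thesis by (simp add: noise_def)
qed

context smooth_drift begin

definition path :: "'a \<Rightarrow> (real \<Rightarrow> 'a) \<Rightarrow> nat \<Rightarrow> (nat \<Rightarrow> real \<times> 'a) \<Rightarrow> real \<Rightarrow> 'a" where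
  "path x g k z = flow x (noise g k z)"

text \<open>With G the inverse linearized flow of the path, this is G(\<tau>) (a(y + u) - a(y)),
  where y is the state just before a jump of size u at time \<tau>. The path is run with the first j
  jumps only, so that no later jump enters; for increasing jump times the value agrees with the one
  along the full path.\<close>

definition jump_grad :: "'a \<Rightarrow> (real \<Rightarrow> 'a) \<Rightarrow> (nat \<Rightarrow> real \<times> 'a) \<Rightarrow> nat \<Rightarrow> 'a" where
  "jump_grad x g z j = (let y = path x g j z; \<tau> = fst (z j) in
     \<Sum>b\<in>Basis. (costate y b \<tau> \<bullet> (a (y \<tau> + snd (z j)) - a (y \<tau>))) *\<^sub>R b)"

lemma measurable_path[measurable]:
  "g \<in> borel_measurable borel \<Longrightarrow> path x g k z \<in> borel_measurable borel"
  unfolding path_def by (intro measurable_flow_single measurable_noise)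

lemma path_before:
  assumes g[measurable]: "g \<in> borel_measurable borel"
    and T: "\<And>i. j \<le> i \<Longrightarrow> i < n \<Longrightarrow> T \<le> fst (z i)" and j: "j \<le> n" and s: "0 \<le> s" "s \<le> T"
  shows "path x g n z s - noise g n z s = path x g j z s - noise g j z s"
  unfolding path_def
proof (rule flow_cong[where T = T])
  fix r assume "0 \<le> r" "r < T"
  then show "noise g n z r = noise g j z r"
    by (intro noise_before) (use T j in \<open>auto intro: less_le_trans\<close>)
qed (use s in auto)

lemma path_before_strict:
  assumes g: "g \<in> borel_measurable borel"
    and T: "\<And>i. j \<le> i \<Longrightarrow> i < n \<Longrightarrow> s < fst (z i)" and j: "j \<le> n" and s: "0 \<le> s"
  shows "path x g n z s = path x g j z s"
proof -
  have "path x g n z s - noise g n z s = path x g j z s - noise g j z s"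
    by (rule path_before[where T = s]) (use assms in \<open>auto intro: less_imp_le\<close>)
  then show ?thesis using noise_before[of j n s z g] T j by simp
qed

text \<open>At its own time jump j has already been added to the full path but not to the truncated
  one; before that time the two paths coincide.\<close>

lemma path_at_jump:
  assumes g[measurable]: "g \<in> borel_measurable borel"
    and ord: "\<And>i k. i < k \<Longrightarrow> k < n \<Longrightarrow> fst (z i) < fst (z k)" and j: "j < n" and pos: "0 < fst (z j)"
  shows "path x g j z (fst (z j)) = path x g n z (fst (z j)) - snd (z j)"
    and "costate (path x g j z) b (fst (z j)) = costate (path x g n z) b (fst (z j))"
proof -
  have ge: "fst (z j) \<le> fst (z i)" if "j \<le> i" "i < n" for i
    using ord[of j i] that by (cases "i = j") (auto intro: less_imp_le)
  have e: "path x g n z (fst (z j)) - noise g n z (fst (z j)) = path x g j z (fst (z j)) - noise g j z (fst (z j))"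
    by (rule path_before[where T = "fst (z j)"]) (use ge j pos in auto)
  have "noise g n z (fst (z j)) = noise g (Suc j) z (fst (z j))"
    by (rule noise_before) (use ord j in auto)
  also have "\<dots> = noise g j z (fst (z j)) + snd (z j)" by (simp add: noise_def)
  finally show "path x g j z (fst (z j)) = path x g n z (fst (z j)) - snd (z j)"
    using e by (simp add: algebra_simps)
  show "costate (path x g j z) b (fst (z j)) = costate (path x g n z) b (fst (z j))"
  proof (rule costate_cong[where T = "fst (z j)"])
    fix r assume r: "0 \<le> r" "r < fst (z j)"
    show "path x g j z r = path x g n z r"
      by (rule path_before_strict[symmetric]) (use r ge j in \<open>auto intro: less_le_trans\<close>)
  qed (use pos in auto)
qed

text \<open>Up to sign and the linearized flow to time t, the derivative in \<theta> sends c to the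
  sum of (c \<bullet> b) times the gradient of jump \<sigma> b. This map is injective by assumption,
  hence bounded below. If the estimate failed, a sequence \<theta> with displacements o(norm
  \<theta>) would contradict that bound through the first-order expansion.\<close>

lemma path_expansive:
  fixes g :: "real \<Rightarrow> 'a" and z :: "nat \<Rightarrow> real \<times> 'a"
  assumes g[measurable]: "g \<in> borel_measurable borel"
    and t: "\<And>j. j < n \<Longrightarrow> 0 < fst (z j) \<and> fst (z j) < t \<and> isCont g (fst (z j))"
    and ord: "\<And>i k. i < k \<Longrightarrow> k < n \<Longrightarrow> fst (z i) < fst (z k)"
    and tpos: "0 < t"
    and \<sigma>: "inj_on \<sigma> Basis" "\<sigma> ` Basis \<subseteq> {..<n}"
    and indep: "\<And>c. (\<Sum>b\<in>Basis. (c \<bullet> b) *\<^sub>R jump_grad x g z (\<sigma> b)) = 0 \<Longrightarrow> c = 0"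
  shows "\<exists>c>0. \<exists>r>0. \<forall>\<theta>. norm \<theta> < r \<longrightarrow>
    c * norm \<theta> \<le> norm (path x g n (shift_times \<sigma> \<theta> z) t - path x g n z t)"
proof (rule ccontr)
  assume contr: "\<not> ?thesis"
  let ?y = "path x g n z" and ?y' = "\<lambda>\<theta>. path x g n (shift_times \<sigma> \<theta> z)"
  have "\<exists>\<theta>. norm \<theta> < 1 / Suc k \<and> norm (?y' \<theta> t - ?y t) < 1 / Suc k * norm \<theta>" for k
  proof -
    have "(0::real) < 1 / Suc k" by simp
    then show ?thesis using contr by (meson not_le)
  qed
  then obtain \<theta> where \<theta>: "\<And>k. norm (\<theta> k) < 1 / Suc k" "\<And>k. norm (?y' (\<theta> k) t - ?y t) < 1 / Suc k * norm (\<theta> k)"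
    by metis
  have \<theta>pos: "0 < norm (\<theta> k)" for k
  proof (rule ccontr)
    assume "\<not> 0 < norm (\<theta> k)"
    then show False using \<theta>(2)[of k] by simp
  qed
  define \<delta> where "\<delta> k j = (\<Sum>b\<in>Basis. if \<sigma> b = j then \<theta> k \<bullet> b else 0)" for k j
  define \<eta> where "\<eta> k = (\<Sum>j<n. \<bar>\<delta> k j\<bar>)" for k
  have \<delta>\<sigma>: "\<delta> k (\<sigma> b) = \<theta> k \<bullet> b" if "b \<in> Basis" for k b
  proof -
    have "\<delta> k (\<sigma> b) = (\<Sum>b'\<in>Basis. if b' = b then \<theta> k \<bullet> b' else 0)"
      unfolding \<delta>_def by (rule sum.cong[OF refl]) (use \<sigma>(1) that in \<open>auto simp: inj_on_def\<close>)
    then show ?thesis using that by simp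
  qed
  have \<delta>0: "\<delta> k j = 0" if "j \<notin> \<sigma> ` Basis" for k j
    unfolding \<delta>_def by (rule sum.neutral) (use that in auto)
  have reindex: "(\<Sum>j<n. f j) = (\<Sum>b\<in>Basis. f (\<sigma> b))" if "\<And>j. j \<notin> \<sigma> ` Basis \<Longrightarrow> f j = 0" for f :: "nat \<Rightarrow> real"
  proof -
    have "(\<Sum>j<n. f j) = (\<Sum>j\<in>\<sigma> ` Basis. f j)"
      by (rule sum.mono_neutral_right) (use \<sigma> that in auto)
    then show ?thesis by (simp add: sum.reindex[OF \<sigma>(1)])
  qed
  have \<eta>eq: "\<eta> k = (\<Sum>b\<in>Basis. \<bar>\<theta> k \<bullet> b\<bar>)" for k
    unfolding \<eta>_def by (subst reindex) (auto simp: \<delta>0 \<delta>\<sigma>)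
  have \<eta>ge: "norm (\<theta> k) \<le> \<eta> k" for k unfolding \<eta>eq by (rule norm_le_l1)
  have \<eta>le: "\<eta> k \<le> DIM('a) * norm (\<theta> k)" for k
  proof -
    have "\<eta> k \<le> (\<Sum>b\<in>(Basis::'a set). norm (\<theta> k))" unfolding \<eta>eq by (intro sum_mono Basis_le_norm)
    then show ?thesis by simp
  qed
  have \<eta>pos: "0 < \<eta> k" for k using \<eta>ge[of k] \<theta>pos[of k] by linarith
  have \<theta>0: "(\<lambda>k. norm (\<theta> k)) \<longlonglongrightarrow> 0"
  proof (rule Lim_null_comparison[OF _ LIMSEQ_inverse_real_of_nat])
    have "norm (norm (\<theta> k)) \<le> inverse (real (Suc k))" for k
      using \<theta>(1)[of k] by (simp add: inverse_eq_divide)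
    then show "\<forall>\<^sub>F k in sequentially. norm (norm (\<theta> k)) \<le> inverse (real (Suc k))" by simp
  qed
  have \<eta>0: "\<eta> \<longlonglongrightarrow> 0"
  proof (rule Lim_null_comparison)
    show "\<forall>\<^sub>F k in sequentially. norm (\<eta> k) \<le> DIM('a) * norm (\<theta> k)" using \<eta>le \<eta>pos by (simp add: less_imp_le)
    show "(\<lambda>k. DIM('a) * norm (\<theta> k)) \<longlonglongrightarrow> 0" using tendsto_mult_right_zero[OF \<theta>0] by simp
  qed
  define q where "q = costate ?y"
  define w where "w = jump_grad x g z"
  define \<Delta> where "\<Delta> j = (let yr = ?y (fst (z j)) - snd (z j) in a (yr + snd (z j)) - a yr)" for j
  have w: "w j = (\<Sum>b\<in>Basis. (q b (fst (z j)) \<bullet> \<Delta> j) *\<^sub>R b)" if "j < n" for j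
  proof -
    have "path x g j z (fst (z j)) = ?y (fst (z j)) - snd (z j)"
      by (rule path_at_jump(1)) (use t[OF that] that ord in auto)
    moreover have "costate (path x g j z) b (fst (z j)) = costate ?y b (fst (z j))" for b
      by (rule path_at_jump(2)[where n = n]) (use t[OF that] that ord in auto)
    ultimately show ?thesis by (simp add: w_def jump_grad_def q_def \<Delta>_def Let_def)
  qed
  have inj: "inj_on (\<lambda>j. fst (z j)) {..<n}"
  proof (rule inj_onI)
    fix i j assume "i \<in> {..<n}" "j \<in> {..<n}" "fst (z i) = fst (z j)"
    then show "i = j" using ord[of i j] ord[of j i] by (metis lessThan_iff less_irrefl nat_neq_iff)
  qed
  \<comment> \<open>The combination that the first-order expansion makes o(\<eta>). For a basis
    vector b its second summand is the b-coordinate of \<open>T (\<theta> k)\<close> for the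
    injective map T defined next.\<close>
  define X where "X b k = q b t \<bullet> (?y' (\<theta> k) t - ?y t) + (\<Sum>j<n. \<delta> k j * (q b (fst (z j)) \<bullet> \<Delta> j))" for b k
  have X0: "(\<lambda>k. X b k / \<eta> k) \<longlonglongrightarrow> 0" for b
    using flow_first_order[OF g t inj tpos, where \<theta> = \<delta> and x = x and b = b] \<eta>0 \<eta>pos
    unfolding X_def q_def \<Delta>_def path_def shift_times_def[abs_def] \<eta>_def[abs_def] \<delta>_def[abs_def] Let_def
    by simp
  define T where "T c = (\<Sum>b\<in>Basis. (c \<bullet> b) *\<^sub>R w (\<sigma> b))" for c
  have linT: "linear T"
    unfolding T_def
    by (intro linearI) (auto simp: inner_add_left sum.distrib scaleR_add_left scaleR_sum_right)
  moreover have "inj T"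
    using indep unfolding linear_injective_0[OF linT] T_def w_def by blast
  ultimately obtain B0 where B0: "B0 > 0" "\<And>c. B0 * norm c \<le> norm (T c)"
    using linear_inj_bounded_below_pos by blast
  have T\<theta>: "T (\<theta> k) \<bullet> b' = (\<Sum>j<n. \<delta> k j * (q b' (fst (z j)) \<bullet> \<Delta> j))" if b': "b' \<in> Basis" for k b'
  proof -
    have "(\<Sum>j<n. \<delta> k j * (q b' (fst (z j)) \<bullet> \<Delta> j)) = (\<Sum>b\<in>Basis. \<delta> k (\<sigma> b) * (q b' (fst (z (\<sigma> b))) \<bullet> \<Delta> (\<sigma> b)))"
      by (rule reindex) (simp add: \<delta>0)
    also have "\<dots> = (\<Sum>b\<in>Basis. (\<theta> k \<bullet> b) * (w (\<sigma> b) \<bullet> b'))"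
    proof (rule sum.cong[OF refl])
      fix b :: 'a assume b: "b \<in> Basis"
      then have "\<sigma> b < n" using \<sigma> by auto
      then show "\<delta> k (\<sigma> b) * (q b' (fst (z (\<sigma> b))) \<bullet> \<Delta> (\<sigma> b)) = (\<theta> k \<bullet> b) * (w (\<sigma> b) \<bullet> b')"
        using b' b by (simp add: \<delta>\<sigma> w inner_sum_left inner_Basis if_distrib sum.delta cong: if_cong)
    qed
    also have "\<dots> = T (\<theta> k) \<bullet> b'" by (simp add: T_def inner_sum_left)
    finally show ?thesis by simp
  qed
  define Q where "Q = (\<Sum>b\<in>(Basis::'a set). norm (q b t))"
  have main: "B0 \<le> (\<Sum>b\<in>(Basis::'a set). DIM('a) * \<bar>X b k / \<eta> k\<bar>) + Q * (1 / Suc k)" for k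
  proof -
    have "B0 * norm (\<theta> k) \<le> norm (T (\<theta> k))" by (rule B0)
    also have "\<dots> \<le> (\<Sum>b\<in>Basis. \<bar>T (\<theta> k) \<bullet> b\<bar>)" by (rule norm_le_l1)
    also have "\<dots> \<le> (\<Sum>b\<in>Basis. \<bar>X b k\<bar> + norm (q b t) * (1 / Suc k * norm (\<theta> k)))"
    proof (rule sum_mono)
      fix b :: 'a assume b: "b \<in> Basis"
      have "\<bar>q b t \<bullet> (?y' (\<theta> k) t - ?y t)\<bar> \<le> norm (q b t) * norm (?y' (\<theta> k) t - ?y t)"
        by (rule Cauchy_Schwarz_ineq2)
      also have "\<dots> \<le> norm (q b t) * (1 / Suc k * norm (\<theta> k))"
        using \<theta>(2)[of k] by (intro mult_left_mono) auto
      moreover have "T (\<theta> k) \<bullet> b = X b k - q b t \<bullet> (?y' (\<theta> k) t - ?y t)" using b by (simp add: T\<theta> X_def)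
      ultimately show "\<bar>T (\<theta> k) \<bullet> b\<bar> \<le> \<bar>X b k\<bar> + norm (q b t) * (1 / Suc k * norm (\<theta> k))" by linarith
    qed
    also have "\<dots> = (\<Sum>b\<in>Basis. \<bar>X b k\<bar>) + Q * (1 / Suc k * norm (\<theta> k))"
      by (simp only: sum.distrib Q_def sum_distrib_right)
    also have "(\<Sum>b\<in>Basis. \<bar>X b k\<bar>) \<le> (\<Sum>b\<in>Basis. DIM('a) * \<bar>X b k / \<eta> k\<bar> * norm (\<theta> k))"
    proof (rule sum_mono)
      fix b :: 'a
      have "\<bar>X b k\<bar> = \<bar>X b k / \<eta> k\<bar> * \<eta> k" using \<eta>pos[of k] by simp
      also have "\<dots> \<le> \<bar>X b k / \<eta> k\<bar> * (DIM('a) * norm (\<theta> k))" using \<eta>le[of k] by (intro mult_left_mono) auto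
      finally show "\<bar>X b k\<bar> \<le> DIM('a) * \<bar>X b k / \<eta> k\<bar> * norm (\<theta> k)" by (simp add: mult_ac)
    qed
    finally have "B0 * norm (\<theta> k) \<le> ((\<Sum>b\<in>(Basis::'a set). DIM('a) * \<bar>X b k / \<eta> k\<bar>) + Q * (1 / Suc k)) * norm (\<theta> k)"
      by (simp add: sum_distrib_right distrib_right mult.assoc)
    then show ?thesis using \<theta>pos[of k] by (simp only: mult_le_cancel_right)
  qed
  have "(\<lambda>k. (\<Sum>b\<in>(Basis::'a set). DIM('a) * \<bar>X b k / \<eta> k\<bar>) + Q * (1 / Suc k)) \<longlonglongrightarrow> (\<Sum>b\<in>(Basis::'a set). DIM('a) * \<bar>0::real\<bar>) + Q * 0"
    by (intro tendsto_add tendsto_sum tendsto_mult tendsto_const tendsto_rabs X0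
        LIMSEQ_inverse_real_of_nat[unfolded inverse_eq_divide])
  then have "B0 \<le> (\<Sum>b\<in>(Basis::'a set). DIM('a) * \<bar>0::real\<bar>) + Q * 0"
    by (rule LIMSEQ_le_const) (use main in auto)
  then show False using B0 by simp
qed

end

section \<open>Product measures: resampling one factor, translation, densities, null sets\<close>

lemma nn_integral_PiM_resample:
  assumes "product_prob_space M" and I: "finite I" "j \<in> I"
    and f[measurable]: "f \<in> borel_measurable (PiM I M)"
  shows "(\<integral>\<^sup>+x. f x \<partial>PiM I M) = (\<integral>\<^sup>+x. (\<integral>\<^sup>+y. f (x(j := y)) \<partial>M j) \<partial>PiM I M)"
proof -
  interpret product_prob_space M by fact
  have I': "insert j (I - {j}) = I" "finite (I - {j})" "j \<notin> I - {j}" using I by auto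
  have upd: "(\<lambda>(x, y). x(j := y)) \<in> PiM I M \<Otimes>\<^sub>M M j \<rightarrow>\<^sub>M PiM I M"
  proof -
    have "(\<lambda>p. (fst p)(j := snd p)) \<in> PiM I M \<Otimes>\<^sub>M M j \<rightarrow>\<^sub>M PiM I M"
      by (rule measurable_fun_upd[where J = I]) (use I in auto)
    then show ?thesis by (simp add: case_prod_unfold)
  qed
  have g[measurable]: "(\<lambda>x. \<integral>\<^sup>+y. f (x(j := y)) \<partial>M j) \<in> borel_measurable (PiM I M)"
    using M.borel_measurable_nn_integral[of "\<lambda>x y. f (x(j := y))" "PiM I M" j] measurable_compose[OF upd f]
    by (simp add: case_prod_unfold)
  have "(\<integral>\<^sup>+x. f x \<partial>PiM I M) = (\<integral>\<^sup>+x. (\<integral>\<^sup>+y. f (x(j := y)) \<partial>M j) \<partial>PiM (I - {j}) M)"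
    using product_nn_integral_insert[OF I'(2,3), of f] f I'(1) by simp
  also have "\<dots> = (\<integral>\<^sup>+x. (\<integral>\<^sup>+y'. (\<integral>\<^sup>+y. f ((x(j := y'))(j := y)) \<partial>M j) \<partial>M j) \<partial>PiM (I - {j}) M)"
    by (simp add: M.emeasure_space_1)
  also have "\<dots> = (\<integral>\<^sup>+x. (\<integral>\<^sup>+y. f (x(j := y)) \<partial>M j) \<partial>PiM I M)"
    using product_nn_integral_insert[OF I'(2,3), of "\<lambda>x. \<integral>\<^sup>+y. f (x(j := y)) \<partial>M j"] g I'(1) by simp
  finally show ?thesis .
qed

lemma distr_PiM_invariant:
  assumes "product_sigma_finite M" and I: "finite I"
    and f[measurable]: "\<And>i. i \<in> I \<Longrightarrow> f i \<in> M i \<rightarrow>\<^sub>M M i"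
    and inv: "\<And>i. i \<in> I \<Longrightarrow> distr (M i) (M i) (f i) = M i"
  shows "distr (PiM I M) (PiM I M) (\<lambda>x. \<lambda>i\<in>I. f i (x i)) = PiM I M"
proof -
  interpret product_sigma_finite M by fact
  have T[measurable]: "(\<lambda>x. \<lambda>i\<in>I. f i (x i)) \<in> PiM I M \<rightarrow>\<^sub>M PiM I M"
    by measurable
  show ?thesis
  proof (rule PiM_eqI[OF I])
    fix A assume A: "\<And>i. i \<in> I \<Longrightarrow> A i \<in> sets (M i)"
    then have "emeasure (distr (PiM I M) (PiM I M) (\<lambda>x. \<lambda>i\<in>I. f i (x i))) (Pi\<^sub>E I A)
        = emeasure (PiM I M) ((\<lambda>x. \<lambda>i\<in>I. f i (x i)) -` Pi\<^sub>E I A \<inter> space (PiM I M))"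
      by (intro emeasure_distr T sets_PiM_I_finite I) auto
    also have "(\<lambda>x. \<lambda>i\<in>I. f i (x i)) -` Pi\<^sub>E I A \<inter> space (PiM I M) = Pi\<^sub>E I (\<lambda>i. f i -` A i \<inter> space (M i))"
      by (auto simp: space_PiM PiE_iff)
    also have "emeasure (PiM I M) \<dots> = (\<Prod>i\<in>I. emeasure (M i) (f i -` A i \<inter> space (M i)))"
      using A f by (intro emeasure_PiM I) (auto intro: measurable_sets)
    also have "\<dots> = (\<Prod>i\<in>I. emeasure (M i) (A i))"
      by (rule prod.cong[OF refl]) (use A f inv in \<open>metis emeasure_distr\<close>)
    finally show "emeasure (distr (PiM I M) (PiM I M) (\<lambda>x. \<lambda>i\<in>I. f i (x i))) (Pi\<^sub>E I A) = (\<Prod>i\<in>I. emeasure (M i) (A i))" .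
  qed simp
qed

text \<open>Lets null sets be found under Lebesgue jump times, which are translation invariant, and
  then be carried over to jump times that are uniform in cells.\<close>

lemma AE_PiM_density:
  assumes M: "product_sigma_finite M" and D: "product_sigma_finite (\<lambda>i. density (M i) (f i))" and I: "finite I"
    and f[measurable]: "\<And>i. f i \<in> borel_measurable (M i)"
    and ae: "AE x in PiM I M. P x"
  shows "AE x in PiM I (\<lambda>i. density (M i) (f i)). P x"
proof -
  interpret M: product_sigma_finite M by fact
  interpret D: product_sigma_finite "\<lambda>i. density (M i) (f i)" by fact
  let ?F = "\<lambda>x. \<Prod>i\<in>I. f i (x i)"
  have F[measurable]: "?F \<in> borel_measurable (PiM I M)" by measurable
  have "density (PiM I M) ?F = PiM I (\<lambda>i. density (M i) (f i))"
  proof (rule D.PiM_eqI[OF I])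
    show "sets (density (PiM I M) ?F) = sets (PiM I (\<lambda>i. density (M i) (f i)))"
      by (simp, rule sets_PiM_cong) auto
    fix A assume "\<And>i. i \<in> I \<Longrightarrow> A i \<in> sets (density (M i) (f i))"
    then have A: "\<And>i. i \<in> I \<Longrightarrow> A i \<in> sets (M i)" by simp
    have PA: "Pi\<^sub>E I A \<in> sets (PiM I M)" using A I by (intro sets_PiM_I_finite) auto
    have "emeasure (density (PiM I M) ?F) (Pi\<^sub>E I A) = (\<integral>\<^sup>+x. ?F x * indicator (Pi\<^sub>E I A) x \<partial>PiM I M)"
      by (rule emeasure_density[OF F PA])
    also have "\<dots> = (\<integral>\<^sup>+x. (\<Prod>i\<in>I. f i (x i) * indicator (A i) (x i)) \<partial>PiM I M)"
    proof (rule nn_integral_cong)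
      fix x assume x: "x \<in> space (PiM I M)"
      have "indicator (Pi\<^sub>E I A) x = (\<Prod>i\<in>I. indicator (A i) (x i) :: ennreal)"
      proof (cases "x \<in> Pi\<^sub>E I A")
        case True
        then show ?thesis by (auto simp: PiE_iff intro!: prod.neutral[symmetric])
      next
        case False
        then obtain i where "i \<in> I" "x i \<notin> A i" using x by (auto simp: space_PiM PiE_iff)
        then have "(\<Prod>i\<in>I. indicator (A i) (x i) :: ennreal) = 0"
          by (intro prod_zero[OF I] bexI[of _ i]) auto
        then show ?thesis using False by simp
      qed
      then show "?F x * indicator (Pi\<^sub>E I A) x = (\<Prod>i\<in>I. f i (x i) * indicator (A i) (x i))"
        by (simp add: prod.distrib)
    qed
    also have "\<dots> = (\<Prod>i\<in>I. \<integral>\<^sup>+x. f i x * indicator (A i) x \<partial>M i)"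
      by (rule M.product_nn_integral_prod[OF I]) (use A in measurable)
    also have "\<dots> = (\<Prod>i\<in>I. emeasure (density (M i) (f i)) (A i))"
      by (rule prod.cong[OF refl]) (use A in \<open>simp add: emeasure_density\<close>)
    finally show "emeasure (density (PiM I M) ?F) (Pi\<^sub>E I A) = (\<Prod>i\<in>I. emeasure (density (M i) (f i)) (A i))" .
  qed
  moreover have "AE x in density (PiM I M) ?F. P x"
    unfolding AE_density[OF F] using ae by eventually_elim simp
  ultimately show ?thesis by (simp only:)
qed

lemma distr_lborel_pair_translate:
  fixes \<kappa> :: "'a::second_countable_topology measure"
  assumes "sigma_finite_measure \<kappa>"
  shows "distr (lborel \<Otimes>\<^sub>M \<kappa>) (lborel \<Otimes>\<^sub>M \<kappa>) (\<lambda>y. (fst y + (c::real), snd y)) = lborel \<Otimes>\<^sub>M \<kappa>"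
proof -
  interpret sigma_finite_measure \<kappa> by fact
  have "distr lborel lborel ((+) c) \<Otimes>\<^sub>M distr \<kappa> \<kappa> (\<lambda>x. x) = distr (lborel \<Otimes>\<^sub>M \<kappa>) (lborel \<Otimes>\<^sub>M \<kappa>) (\<lambda>(x, y). (c + x, y))"
    by (rule pair_measure_distr) (auto simp: distr_id2 assms)
  moreover have "distr lborel lborel ((+) c) = lborel"
    using lborel_distr_plus[of c] by (metis distr_cong sets_lborel)
  ultimately show ?thesis by (simp add: distr_id2 case_prod_unfold add.commute)
qed

lemma AE_lborel_pair_fst_countable:
  assumes "sigma_finite_measure \<kappa>" "countable (D :: real set)"
  shows "AE y in lborel \<Otimes>\<^sub>M \<kappa>. fst y \<notin> D"
proof (rule AE_I)
  interpret sigma_finite_measure \<kappa> by fact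
  have D: "D \<in> sets lborel" "emeasure lborel D = 0"
    using assms(2) by (auto simp: countable_imp_null_set_lborel null_setsD1 sets.countable)
  show "{y \<in> space (lborel \<Otimes>\<^sub>M \<kappa>). \<not> fst y \<notin> D} \<subseteq> D \<times> space \<kappa>" by (auto simp: space_pair_measure)
  show "D \<times> space \<kappa> \<in> sets (lborel \<Otimes>\<^sub>M \<kappa>)" using D by auto
  show "emeasure (lborel \<Otimes>\<^sub>M \<kappa>) (D \<times> space \<kappa>) = 0"
    using D by (subst emeasure_pair_measure_Times) auto
qed

text \<open>The other factors may have infinite mass; the box over a null set still has measure 0
  because 0 times \<infinity> is 0.\<close>

lemma AE_PiM_component_null:
  assumes "product_sigma_finite M" and I: "finite I" "j \<in> I" and ae: "AE y in M j. R y"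
  shows "AE x in PiM I M. R (x j)"
proof -
  interpret product_sigma_finite M by fact
  obtain A where A: "A \<in> null_sets (M j)" "{y \<in> space (M j). \<not> R y} \<subseteq> A"
    using ae by (auto simp: eventually_ae_filter)
  let ?B = "Pi\<^sub>E I (\<lambda>i. if i = j then A else space (M i))"
  show ?thesis
  proof (rule AE_I)
    show "?B \<in> sets (PiM I M)" using A I by (intro sets_PiM_I_finite) auto
    have "emeasure (PiM I M) ?B = (\<Prod>i\<in>I. emeasure (M i) (if i = j then A else space (M i)))"
      using A I by (intro emeasure_PiM) auto
    also have "\<dots> = 0" using A I by (intro prod_zero bexI[of _ j]) auto
    finally show "emeasure (PiM I M) ?B = 0" .
    show "{x \<in> space (PiM I M). \<not> R (x j)} \<subseteq> ?B" using A(2) I by (auto simp: space_PiM PiE_iff extensional_def)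
  qed
qed

section \<open>Null sets of positions under random jump times\<close>

lemma noise_cong: "(\<And>j. j < k \<Longrightarrow> z j = z' j) \<Longrightarrow> noise g k z = noise g k z'"
  unfolding noise_def by (intro ext arg_cong2[where f = "(+)"] sum.cong) auto

lemma measurable_noise_param:
  fixes g :: "'w \<Rightarrow> real \<Rightarrow> 'a::euclidean_space"
  assumes [measurable]: "(\<lambda>(w, s). g w s) \<in> borel_measurable (S \<Otimes>\<^sub>M borel)"
    and z: "\<And>j. j < k \<Longrightarrow> (\<lambda>w. fst (z w j)) \<in> borel_measurable S" "\<And>j. j < k \<Longrightarrow> (\<lambda>w. snd (z w j)) \<in> borel_measurable S"
  shows "(\<lambda>(w, s). noise (g w) k (z w) s) \<in> borel_measurable (S \<Otimes>\<^sub>M borel)"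
proof -
  have [measurable]: "(\<lambda>p. g (fst p) (snd p)) \<in> borel_measurable (S \<Otimes>\<^sub>M borel)"
    using assms(1) by (simp add: case_prod_unfold)
  have [measurable]: "(\<lambda>p. fst (z (fst p) j)) \<in> borel_measurable (S \<Otimes>\<^sub>M (borel::real measure))"
    "(\<lambda>p. snd (z (fst p) j)) \<in> borel_measurable (S \<Otimes>\<^sub>M (borel::real measure))" if "j \<in> {..<k}" for j
    using measurable_compose[OF measurable_fst z(1)] measurable_compose[OF measurable_fst z(2)] that by auto
  show ?thesis unfolding noise_def case_prod_unfold by measurable
qed

lemma shift_times_add: "shift_times \<sigma> \<theta>' (shift_times \<sigma> \<theta> z) = shift_times \<sigma> (\<theta> + \<theta>') z"
  by (auto simp: shift_times_def fun_eq_iff inner_add_left sum.distrib[symmetric] intro!: sum.cong)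

context smooth_drift begin

lemma path_cong: "(\<And>j. j < k \<Longrightarrow> z j = z' j) \<Longrightarrow> path x g k z = path x g k z'"
  unfolding path_def using noise_cong[of k z z' g] by simp

lemma jump_grad_cong: "(\<And>i. i \<le> j \<Longrightarrow> z i = z' i) \<Longrightarrow> jump_grad x g z j = jump_grad x g z' j"
  unfolding jump_grad_def using path_cong[of j z z' x g] by simp

lemma measurable_path_param:
  fixes g :: "'w \<Rightarrow> real \<Rightarrow> 'a"
  assumes "(\<lambda>(w, s). g w s) \<in> borel_measurable (S \<Otimes>\<^sub>M borel)"
    and "\<And>j. j < k \<Longrightarrow> (\<lambda>w. fst (z w j)) \<in> borel_measurable S" "\<And>j. j < k \<Longrightarrow> (\<lambda>w. snd (z w j)) \<in> borel_measurable S"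
  shows "(\<lambda>(w, s). path x (g w) k (z w) s) \<in> borel_measurable (S \<Otimes>\<^sub>M borel)"
  unfolding path_def by (rule measurable_flow[OF measurable_noise_param[OF assms]])

lemma measurable_path_at:
  fixes g :: "'w \<Rightarrow> real \<Rightarrow> 'a"
  assumes "(\<lambda>(w, s). g w s) \<in> borel_measurable (S \<Otimes>\<^sub>M borel)"
    and "\<And>j. j < k \<Longrightarrow> (\<lambda>w. fst (z w j)) \<in> borel_measurable S" "\<And>j. j < k \<Longrightarrow> (\<lambda>w. snd (z w j)) \<in> borel_measurable S"
    and [measurable]: "T \<in> borel_measurable S"
  shows "(\<lambda>w. path x (g w) k (z w) (T w)) \<in> borel_measurable S"
proof -
  have "(\<lambda>w. (\<lambda>(w, s). path x (g w) k (z w) s) (w, T w)) \<in> borel_measurable S"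
    by (rule measurable_compose[OF _ measurable_path_param[OF assms(1-3)]]) measurable
  then show ?thesis by simp
qed

lemma measurable_jump_grad:
  fixes g :: "'w \<Rightarrow> real \<Rightarrow> 'a"
  assumes g: "(\<lambda>(w, s). g w s) \<in> borel_measurable (S \<Otimes>\<^sub>M borel)"
    and z: "\<And>i. i \<le> j \<Longrightarrow> (\<lambda>w. fst (z w i)) \<in> borel_measurable S" "\<And>i. i \<le> j \<Longrightarrow> (\<lambda>w. snd (z w i)) \<in> borel_measurable S"
  shows "(\<lambda>w. jump_grad x (g w) (z w) j) \<in> borel_measurable S"
proof -
  note [measurable] = z[OF order_refl]
  have [measurable]: "(\<lambda>w. path x (g w) j (z w) (fst (z w j))) \<in> borel_measurable S"
    by (rule measurable_path_at[OF g]) (use z in auto)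
  have [measurable]: "(\<lambda>w. costate (path x (g w) j (z w)) b (fst (z w j))) \<in> borel_measurable S" for b
  proof -
    have "(\<lambda>(w, s). costate (path x (g w) j (z w)) b s) \<in> borel_measurable (S \<Otimes>\<^sub>M borel)"
      by (rule measurable_costate[OF measurable_path_param[OF g]]) (use z in auto)
    from measurable_compose[OF _ this, of "\<lambda>w. (w, fst (z w j))" S] show ?thesis by simp
  qed
  show ?thesis unfolding jump_grad_def Let_def by measurable
qed

lemma measurable_gs_jump_grad:
  fixes g :: "'w \<Rightarrow> real \<Rightarrow> 'a"
  assumes g: "(\<lambda>(w, s). g w s) \<in> borel_measurable (S \<Otimes>\<^sub>M borel)"
    and z: "\<And>i. i \<le> j \<Longrightarrow> (\<lambda>w. fst (z w i)) \<in> borel_measurable S" "\<And>i. i \<le> j \<Longrightarrow> (\<lambda>w. snd (z w i)) \<in> borel_measurable S"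
  shows "(\<lambda>w. gs (jump_grad x (g w) (z w)) j) \<in> borel_measurable S"
  by (rule measurable_gs, rule measurable_jump_grad[OF g]) (use z in auto)

lemma gs_jump_grad_cong: "(\<And>i. i \<le> j \<Longrightarrow> z i = z' i) \<Longrightarrow> gs (jump_grad x g z) j = gs (jump_grad x g z') j"
  by (rule gs_cong, rule jump_grad_cong) auto

text \<open>A translation argument in place of a change of variables formula. With Lebesgue jump
  times the product measure is invariant under shifts by \<theta>, so the measure of a bad set Q is
  the integral over z of the volume of those \<theta> in the unit cube for which the shifted z lies
  in Q. For fixed z these \<theta> are sent into N by a map that is expansive at each of them, hence
  they form a null set.\<close>

lemma AE_path_notin_null_set:
  fixes g :: "real \<Rightarrow> 'a" and \<kappa> :: "'a measure" and l t :: real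
  assumes g[measurable]: "g \<in> borel_measurable borel" and cg: "countable {s. 0 < s \<and> \<not> isCont g s}"
    and \<kappa>: "sigma_finite_measure \<kappa>" and s\<kappa>[measurable_cong]: "sets \<kappa> = sets borel"
    and l: "0 < l" and nt: "real n * l \<le> t" and t: "0 < t" and N: "N \<in> null_sets lborel"
  shows "AE z in PiM {..<n} (\<lambda>_. lborel \<Otimes>\<^sub>M \<kappa>). (\<forall>j<n. fst (z j) \<in> {real j * l<..<real (Suc j) * l}) \<longrightarrow>
      card {j. j < n \<and> gs (jump_grad x g z) j \<noteq> 0} = DIM('a) \<longrightarrow> path x g n z t \<notin> N"
proof -
  interpret \<kappa>: sigma_finite_measure \<kappa> by fact
  interpret lk: pair_sigma_finite lborel \<kappa> ..
  interpret psf: product_sigma_finite "\<lambda>_::nat. lborel \<Otimes>\<^sub>M \<kappa>"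
    by standard
  let ?K = "\<lambda>_::nat. (lborel :: real measure) \<Otimes>\<^sub>M \<kappa>"
  let ?P = "PiM {..<n} ?K"
  have psP: "product_sigma_finite ?K" by standard
  interpret P: sigma_finite_measure ?P by (rule psf.sigma_finite) simp
  interpret PL: pair_sigma_finite ?P "lborel :: 'a measure" ..
  have [measurable]: "N \<in> sets borel" using N by auto
  \<comment> \<open>Discontinuities of the background. The first-order expansion requires jump times
    outside this set, and they avoid it almost everywhere because it is countable.\<close>
  define D where "D = {s. 0 < s \<and> \<not> isCont g s}"
  have [measurable]: "D \<in> sets borel" using cg unfolding D_def by (rule sets.countable[rotated]) (rule borel_closed[OF closed_singleton])
  have mg: "(\<lambda>(w, s). g s) \<in> borel_measurable (?P \<Otimes>\<^sub>M borel)" by measurable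
  have mz[measurable]: "(\<lambda>z. fst (z j)) \<in> borel_measurable ?P" "(\<lambda>z. snd (z j)) \<in> borel_measurable ?P" if "j \<in> {..<n}" for j
  proof -
    have c: "(\<lambda>z. z j) \<in> ?P \<rightarrow>\<^sub>M lborel \<Otimes>\<^sub>M \<kappa>" by (rule measurable_component_singleton) (rule that)
    show "(\<lambda>z. fst (z j)) \<in> borel_measurable ?P" using measurable_compose[OF c measurable_fst] by simp
    have "(\<lambda>z. snd (z j)) \<in> ?P \<rightarrow>\<^sub>M \<kappa>" by (rule measurable_compose[OF c measurable_snd])
    then show "(\<lambda>z. snd (z j)) \<in> borel_measurable ?P" using measurable_cong_sets[OF refl s\<kappa>] by blast
  qed
  define good where "good z \<longleftrightarrow> (\<forall>j\<in>{..<n}. fst (z j) \<in> {real j * l<..<real (Suc j) * l} \<and> fst (z j) \<notin> D)" for z :: "nat \<Rightarrow> real \<times> 'a"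
  \<comment> \<open>For full rank the nonzero Gram-Schmidt indices are listed by an injective
    \<sigma>. There are finitely many such \<sigma>, and each is treated separately.\<close>
  define Q where "Q \<sigma> = {z \<in> space ?P. good z \<and> (\<forall>b\<in>Basis. gs (jump_grad x g z) (\<sigma> b) \<noteq> 0) \<and> path x g n z t \<in> N}" for \<sigma> :: "'a \<Rightarrow> nat"
  define \<Sigma> where "\<Sigma> = {\<sigma> \<in> (Basis::'a set) \<rightarrow>\<^sub>E {..<n}. inj_on \<sigma> Basis}"
  have fin: "finite \<Sigma>" unfolding \<Sigma>_def by (rule finite_subset[OF _ finite_PiE[of Basis "\<lambda>_. {..<n}"]]) auto
  have null: "Q \<sigma> \<in> null_sets ?P" if \<sigma>: "\<sigma> \<in> \<Sigma>" for \<sigma>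
  proof -
    have \<sigma>': "inj_on \<sigma> Basis" "\<sigma> ` Basis \<subseteq> {..<n}" using \<sigma> by (auto simp: \<Sigma>_def)
    have [measurable]: "(\<lambda>z. gs (jump_grad x g z) (\<sigma> b)) \<in> borel_measurable ?P" if b: "b \<in> Basis" for b
      by (rule measurable_gs_jump_grad[OF mg]) (use \<sigma>'(2) b mz in force)+
    have [measurable]: "(\<lambda>z. path x g n z t) \<in> borel_measurable ?P"
      by (rule measurable_path_at[OF mg]) (use mz in auto)
    have [measurable]: "Measurable.pred ?P good" unfolding good_def by measurable
    have Q[measurable]: "Q \<sigma> \<in> sets ?P" unfolding Q_def by measurable
    \<comment> \<open>\<open>shift_times\<close> is a function on all indices; the restriction
      returns to the extensional functions on which the product measure lives.\<close>
    define T where "T \<theta> z = (\<lambda>j\<in>{..<n}. shift_times \<sigma> \<theta> z j)" for \<theta> :: 'a and z :: "nat \<Rightarrow> real \<times> 'a"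
    have T2: "(\<lambda>p. T (snd p) (fst p)) \<in> (?P \<Otimes>\<^sub>M lborel) \<rightarrow>\<^sub>M ?P"
      unfolding T_def shift_times_def by measurable
    have T1[measurable]: "T \<theta> \<in> ?P \<rightarrow>\<^sub>M ?P" for \<theta>
      unfolding T_def[abs_def] shift_times_def by measurable
    have inv: "distr ?P ?P (T \<theta>) = ?P" for \<theta>
    proof -
      have "distr ?P ?P (\<lambda>z. \<lambda>j\<in>{..<n}. (fst (z j) + (\<Sum>b\<in>Basis. if \<sigma> b = j then \<theta> \<bullet> b else 0), snd (z j))) = ?P"
        by (rule distr_PiM_invariant[OF psP]) (auto intro!: distr_lborel_pair_translate \<kappa>)
      then show ?thesis by (simp add: T_def[abs_def] shift_times_def[abs_def])
    qed
    let ?f = "\<lambda>z \<theta>. indicator (cbox 0 (One::'a)) \<theta> * indicator (Q \<sigma>) (T \<theta> z) :: ennreal"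
    have fm: "(\<lambda>(z, \<theta>). ?f z \<theta>) \<in> borel_measurable (?P \<Otimes>\<^sub>M lborel)"
    proof -
      have [measurable]: "(\<lambda>p. indicator (Q \<sigma>) (T (snd p) (fst p)) :: ennreal) \<in> borel_measurable (?P \<Otimes>\<^sub>M lborel)"
        by (rule measurable_compose[OF T2]) measurable
      show ?thesis unfolding case_prod_unfold by measurable
    qed
    \<comment> \<open>The unit cube has volume 1, so averaging over \<theta> changes
      nothing.\<close>
    have "emeasure ?P (Q \<sigma>) = (\<integral>\<^sup>+\<theta>. indicator (cbox 0 (One::'a)) \<theta> * emeasure ?P (Q \<sigma>) \<partial>lborel)"
      by (simp add: nn_integral_multc emeasure_lborel_cbox_eq)
    also have "\<dots> = (\<integral>\<^sup>+\<theta>. (\<integral>\<^sup>+z. ?f z \<theta> \<partial>?P) \<partial>lborel)"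
    proof (rule nn_integral_cong)
      fix \<theta> :: 'a
      have "emeasure ?P (Q \<sigma>) = emeasure (distr ?P ?P (T \<theta>)) (Q \<sigma>)" by (simp add: inv)
      also have "\<dots> = (\<integral>\<^sup>+z. indicator (Q \<sigma>) z \<partial>distr ?P ?P (T \<theta>))" by simp
      also have "\<dots> = (\<integral>\<^sup>+z. indicator (Q \<sigma>) (T \<theta> z) \<partial>?P)" by (rule nn_integral_distr) measurable
      finally show "indicator (cbox 0 One) \<theta> * emeasure ?P (Q \<sigma>) = (\<integral>\<^sup>+z. ?f z \<theta> \<partial>?P)"
        by (simp add: nn_integral_cmult)
    qed
    also have "\<dots> = (\<integral>\<^sup>+z. (\<integral>\<^sup>+\<theta>. ?f z \<theta> \<partial>lborel) \<partial>?P)"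
      by (rule PL.Fubini'[OF fm])
    also have "\<dots> = (\<integral>\<^sup>+z. 0 \<partial>?P)"
    proof (rule nn_integral_cong)
      fix z assume z: "z \<in> space ?P"
      define F where "F \<theta> = path x g n (shift_times \<sigma> \<theta> z) t" for \<theta>
      define A where "A = {\<theta>. T \<theta> z \<in> Q \<sigma>}"
      have "(\<lambda>\<theta>. T \<theta> z) \<in> lborel \<rightarrow>\<^sub>M ?P"
        using measurable_compose[OF measurable_Pair1'[OF z] T2] by simp
      from measurable_sets[OF this Q] have A: "A \<in> sets lborel" by (simp add: A_def vimage_def)
      have "negligible A"
      proof (rule expansive_negligible[where F = F])
        show "negligible N" using N by (simp add: negligible_iff_null_sets null_sets_completionI)
        fix \<theta> assume "\<theta> \<in> A"
        then have q: "good (T \<theta> z)" "\<And>b. b \<in> Basis \<Longrightarrow> gs (jump_grad x g (T \<theta> z)) (\<sigma> b) \<noteq> 0" "path x g n (T \<theta> z) t \<in> N"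
          by (auto simp: A_def Q_def)
        \<comment> \<open>Expansiveness at \<theta> is obtained by taking the shifted configuration
          as base point; further shifts add up by \<open>shift_times_add\<close>.\<close>
        let ?z = "shift_times \<sigma> \<theta> z"
        have Tz: "T \<theta> z j = ?z j" if "j < n" for j using that by (simp add: T_def)
        have p: "path x g n (T \<theta> z) = path x g n ?z" by (rule path_cong) (rule Tz)
        have w: "gs (jump_grad x g ?z) (\<sigma> b) \<noteq> 0" if "b \<in> Basis" for b
        proof -
          have "\<sigma> b < n" using \<sigma>'(2) that by auto
          then have "gs (jump_grad x g (T \<theta> z)) (\<sigma> b) = gs (jump_grad x g ?z) (\<sigma> b)"
            by (intro gs_jump_grad_cong Tz) auto
          then show ?thesis using q(2)[OF that] by simp
        qed
        have \<tau>: "real j * l < fst (?z j)" "fst (?z j) < real (Suc j) * l" "fst (?z j) \<notin> D" if "j < n" for j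
          using bspec[OF q(1)[unfolded good_def], of j] Tz[OF that] that by auto
        have "\<exists>c>0. \<exists>r>0. \<forall>\<theta>'. norm \<theta>' < r \<longrightarrow> c * norm \<theta>' \<le> norm (path x g n (shift_times \<sigma> \<theta>' ?z) t - path x g n ?z t)"
        proof (rule path_expansive[OF g _ _ t \<sigma>'])
          fix j assume j: "j < n"
          have "0 \<le> real j * l" using l by simp
          then have pos: "0 < fst (?z j)" using \<tau>(1)[OF j] by linarith
          have "real (Suc j) * l \<le> real n * l" using j l by (intro mult_right_mono) auto
          then have "fst (?z j) < t" using \<tau>(2)[OF j] nt by linarith
          then show "0 < fst (?z j) \<and> fst (?z j) < t \<and> isCont g (fst (?z j))" using pos \<tau>(3)[OF j] by (simp add: D_def)
        next
          fix i k :: nat assume ik: "i < k" "k < n"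
          have "real (Suc i) * l \<le> real k * l" using ik l by (intro mult_right_mono) auto
          then show "fst (?z i) < fst (?z k)" using \<tau>(2)[of i] \<tau>(1)[of k] ik by linarith
        next
          fix c assume c: "(\<Sum>b\<in>Basis. (c \<bullet> b) *\<^sub>R jump_grad x g ?z (\<sigma> b)) = 0"
          define xc where "xc j = c \<bullet> inv_into Basis \<sigma> j" for j
          have xc: "xc (\<sigma> b) = c \<bullet> b" if "b \<in> Basis" for b using that \<sigma>'(1) by (simp add: xc_def)
          have s0: "(\<Sum>j\<in>\<sigma> ` Basis. xc j *\<^sub>R jump_grad x g ?z j) = 0"
            using c xc by (simp add: sum.reindex[OF \<sigma>'(1)])
          have nz: "gs (jump_grad x g ?z) j \<noteq> 0" if j: "j \<in> \<sigma> ` Basis" for j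
          proof -
            obtain b where "b \<in> Basis" "j = \<sigma> b" using j by (rule imageE)
            then show ?thesis using w[of b] by (simp only: not_False_eq_True)
          qed
          have "xc (\<sigma> b) = 0" if "b \<in> Basis" for b
            by (rule gs_independent[OF _ nz s0 imageI[OF that]]) simp_all
          then have "\<forall>b\<in>Basis. c \<bullet> b = 0" using xc by simp
          then show "c = 0" by (simp only: euclidean_all_zero_iff)
        qed
        then obtain c r where cr: "c > 0" "r > 0" "\<And>\<theta>'. norm \<theta>' < r \<Longrightarrow> c * norm \<theta>' \<le> norm (F (\<theta> + \<theta>') - F \<theta>)"
          by (auto simp: F_def shift_times_add)
        have "c * norm (y - \<theta>) \<le> norm (F y - F \<theta>)" if "norm (y - \<theta>) < r" for y
          using cr(3)[OF that] by simp
        then show "F \<theta> \<in> N \<and> (\<exists>c>0. \<exists>r>0. \<forall>y. norm (y - \<theta>) < r \<longrightarrow> c * norm (y - \<theta>) \<le> norm (F y - F \<theta>))"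
          using cr q(3) p by (auto simp: F_def)
      qed
      then have "A \<in> null_sets (completion lborel)" by (simp add: negligible_iff_null_sets)
      then have "emeasure lborel A = 0" using null_sets_completion_iff[OF A] by auto
      have "(\<integral>\<^sup>+\<theta>. ?f z \<theta> \<partial>lborel) \<le> (\<integral>\<^sup>+\<theta>. indicator A \<theta> \<partial>lborel)"
        by (rule nn_integral_mono) (auto simp: indicator_def A_def)
      also have "\<dots> = 0" using A \<open>emeasure lborel A = 0\<close> by simp
      finally show "(\<integral>\<^sup>+\<theta>. ?f z \<theta> \<partial>lborel) = 0" by simp
    qed
    finally show ?thesis using Q by auto
  qed
  have "AE z in ?P. \<forall>\<sigma>\<in>\<Sigma>. z \<notin> Q \<sigma>"
    using fin null by (intro AE_finite_allI AE_not_in) auto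
  moreover have "AE z in ?P. \<forall>j\<in>{..<n}. fst (z j) \<notin> D"
  proof (rule AE_finite_allI)
    have "countable D" using cg by (simp add: D_def)
    fix j assume "j \<in> {..<n}"
    then show "AE z in ?P. fst (z j) \<notin> D"
      by (intro AE_PiM_component_null[OF psP _ _ AE_lborel_pair_fst_countable[OF \<kappa> \<open>countable D\<close>]]) auto
  qed simp
  ultimately show ?thesis
    using AE_space
  proof eventually_elim
    case (elim z)
    show ?case
    proof (intro impI notI)
      assume I: "\<forall>j<n. fst (z j) \<in> {real j * l<..<real (Suc j) * l}"
        and card: "card {j. j < n \<and> gs (jump_grad x g z) j \<noteq> 0} = DIM('a)" and p: "path x g n z t \<in> N"
      let ?J = "{j. j < n \<and> gs (jump_grad x g z) j \<noteq> 0}"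
      obtain h where h: "bij_betw h (Basis::'a set) ?J"
        using card finite_same_card_bij[of "Basis::'a set" ?J] by auto
      define \<sigma> where "\<sigma> = restrict h Basis"
      have \<sigma>: "\<sigma> b \<in> ?J" if "b \<in> Basis" for b
        using h that by (auto simp: \<sigma>_def bij_betw_def)
      have "inj_on \<sigma> Basis" using h by (auto simp: \<sigma>_def bij_betw_def inj_on_def)
      then have "\<sigma> \<in> \<Sigma>" using \<sigma> by (auto simp: \<Sigma>_def) (simp add: \<sigma>_def)
      moreover have "z \<in> Q \<sigma>" using elim I p \<sigma> by (auto simp: Q_def good_def)
      ultimately show False using elim by blast
    qed
  qed
qed

end

section \<open>Rank of the jump gradients\<close>

text \<open>For a probability \<kappa>: a jump with time uniform in cell j and an independent mark
  of law \<kappa>. The form as a density is what lets null sets of Lebesgue times be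
  transferred.\<close>

definition cell_measure :: "'a::euclidean_space measure \<Rightarrow> real \<Rightarrow> nat \<Rightarrow> (real \<times> 'a) measure" where
  "cell_measure \<kappa> l j = density (lborel \<Otimes>\<^sub>M \<kappa>)
     (\<lambda>y. ennreal (1 / l) * indicator {real j * l<..<real (Suc j) * l} (fst y))"

lemma sets_cell_measure[measurable_cong]: "sets (cell_measure \<kappa> l j) = sets (lborel \<Otimes>\<^sub>M \<kappa>)"
  by (simp add: cell_measure_def)

lemma nn_integral_cell_measure:
  assumes "prob_space \<kappa>" and h[measurable]: "h \<in> borel_measurable (lborel \<Otimes>\<^sub>M \<kappa>)"
  shows "(\<integral>\<^sup>+y. h y \<partial>cell_measure \<kappa> l j) =
    (\<integral>\<^sup>+s. ennreal (1 / l) * indicator {real j * l<..<real (Suc j) * l} s * (\<integral>\<^sup>+u. h (s, u) \<partial>\<kappa>) \<partial>lborel)"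
proof -
  interpret prob_space \<kappa> by fact
  have "(\<integral>\<^sup>+y. h y \<partial>cell_measure \<kappa> l j) =
    (\<integral>\<^sup>+y. ennreal (1 / l) * indicator {real j * l<..<real (Suc j) * l} (fst y) * h y \<partial>(lborel \<Otimes>\<^sub>M \<kappa>))"
    unfolding cell_measure_def by (rule nn_integral_density) measurable
  also have "\<dots> = (\<integral>\<^sup>+s. (\<integral>\<^sup>+u. ennreal (1 / l) * indicator {real j * l<..<real (Suc j) * l} s * h (s, u) \<partial>\<kappa>) \<partial>lborel)"
    by (subst nn_integral_fst[symmetric]) (simp_all, measurable)
  also have "\<dots> = (\<integral>\<^sup>+s. ennreal (1 / l) * indicator {real j * l<..<real (Suc j) * l} s * (\<integral>\<^sup>+u. h (s, u) \<partial>\<kappa>) \<partial>lborel)"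
    by (intro nn_integral_cong nn_integral_cmult) measurable
  finally show ?thesis .
qed

lemma cell_length:
  assumes "0 < l"
  shows "(\<integral>\<^sup>+s. ennreal (1 / l) * indicator {real j * l<..<real (Suc j) * l} s \<partial>lborel) = 1"
proof -
  have "(\<integral>\<^sup>+s. ennreal (1 / l) * indicator {real j * l<..<real (Suc j) * l} s \<partial>lborel)
      = ennreal (1 / l) * ennreal (real (Suc j) * l - real j * l)"
    using assms by (subst nn_integral_cmult_indicator) (auto simp: algebra_simps)
  also have "real (Suc j) * l - real j * l = l" by (simp add: algebra_simps)
  finally show ?thesis using assms by (simp add: ennreal_mult[symmetric] del: ennreal_1 flip: ennreal_1)
qed

lemma prob_space_cell_measure:
  assumes "prob_space \<kappa>" "0 < l" shows "prob_space (cell_measure \<kappa> l j)"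
proof
  interpret prob_space \<kappa> by fact
  have "emeasure (cell_measure \<kappa> l j) (space (cell_measure \<kappa> l j)) = (\<integral>\<^sup>+y. 1 \<partial>cell_measure \<kappa> l j)" by simp
  also have "\<dots> = 1"
    using cell_length[OF assms(2), of j] by (subst nn_integral_cell_measure[OF assms(1)]) (auto simp: emeasure_space_1)
  finally show "emeasure (cell_measure \<kappa> l j) (space (cell_measure \<kappa> l j)) = 1" .
qed

lemma AE_cell_measure: "prob_space \<kappa> \<Longrightarrow> AE y in cell_measure \<kappa> l j. fst y \<in> {real j * l<..<real (Suc j) * l}"
  unfolding cell_measure_def by (subst AE_density) (auto simp: indicator_def split: if_splits)

lemma emeasure_cell_measure_snd:
  assumes "prob_space \<kappa>" "0 < l" "B \<in> sets \<kappa>"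
  shows "emeasure (cell_measure \<kappa> l j) (UNIV \<times> B) = emeasure \<kappa> B"
proof -
  have "UNIV \<times> B \<in> sets (cell_measure \<kappa> l j)" using assms by (simp add: sets_cell_measure)
  then have "emeasure (cell_measure \<kappa> l j) (UNIV \<times> B) = (\<integral>\<^sup>+y. indicator (UNIV \<times> B) y \<partial>cell_measure \<kappa> l j)" by simp
  also have "\<dots> = (\<integral>\<^sup>+s. ennreal (1 / l) * indicator {real j * l<..<real (Suc j) * l} s * emeasure \<kappa> B \<partial>lborel)"
    using assms by (subst nn_integral_cell_measure[OF assms(1)])
      (auto simp: indicator_times intro!: nn_integral_cong)
  also have "\<dots> = emeasure \<kappa> B" using cell_length[OF assms(2), of j] by (subst nn_integral_multc) auto
  finally show ?thesis .
qed

context smooth_drift begin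

text \<open>While the rank is deficient there is v \<noteq> 0 orthogonal to all gradients so far,
  and it does not depend on jump j. The new gradient has inner product pv \<bullet> (a(y + u) -
  a(y)) with v, where pv is v carried along by the transposed inverse flow. Short time gives pv
  \<noteq> 0, so nondegeneracy at y applies to pv, and \<open>gs_inner\<close> turns the outcome
  into a rank increase.\<close>

lemma nn_integral_gs_jump_grad_cell:
  fixes g :: "real \<Rightarrow> 'a" and \<kappa> :: "'a measure"
  assumes g[measurable]: "g \<in> borel_measurable borel"
    and \<kappa>: "prob_space \<kappa>" and s\<kappa>[measurable_cong]: "sets \<kappa> = sets borel"
    and l: "0 < l" and small: "DIM('a) * (exp (L * (real (Suc j) * l)) - 1) < 1"
    and nondeg: "\<And>y v. y \<in> cball x \<epsilon> \<Longrightarrow> v \<noteq> 0 \<Longrightarrow> c \<le> emeasure \<kappa> {u. (a (y + u) - a y) \<bullet> v \<noteq> 0}"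
    and card: "card {i. i < j \<and> gs (jump_grad x g z) i \<noteq> 0} < DIM('a)"
  shows "(\<integral>\<^sup>+s. ennreal (1 / l) * indicator {real j * l<..<real (Suc j) * l} s * (c * indicator (cball x \<epsilon>) (path x g j z s)) \<partial>lborel)
    \<le> (\<integral>\<^sup>+y. of_bool (gs (jump_grad x g (z(j := y))) j \<noteq> 0) \<partial>cell_measure \<kappa> l j)"
proof -
  interpret \<kappa>: prob_space \<kappa> by fact
  obtain v where v: "v \<noteq> 0" "\<And>i. i < j \<Longrightarrow> v \<bullet> gs (jump_grad x g z) i = 0"
    using gs_deficient[OF card] by blast
  let ?p = "path x g j z"
  have mg: "(\<lambda>(y, s). g s) \<in> borel_measurable ((lborel \<Otimes>\<^sub>M \<kappa>) \<Otimes>\<^sub>M borel)" by measurable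
  have m: "(\<lambda>y. gs (jump_grad x g (z(j := y))) j) \<in> borel_measurable (lborel \<Otimes>\<^sub>M \<kappa>)"
  proof (rule measurable_gs_jump_grad[OF mg])
    fix i
    show "(\<lambda>y. fst ((z(j := y)) i)) \<in> borel_measurable (lborel \<Otimes>\<^sub>M \<kappa>)"
      by (cases "i = j") simp_all
    show "(\<lambda>y. snd ((z(j := y)) i)) \<in> borel_measurable (lborel \<Otimes>\<^sub>M \<kappa>)"
      by (cases "i = j") (simp_all, measurable)
  qed
  have [measurable]: "(\<lambda>y. of_bool (gs (jump_grad x g (z(j := y))) j \<noteq> 0) :: ennreal) \<in> borel_measurable (lborel \<Otimes>\<^sub>M \<kappa>)"
  proof -
    have "Measurable.pred (lborel \<Otimes>\<^sub>M \<kappa>) (\<lambda>y. gs (jump_grad x g (z(j := y))) j \<noteq> 0)" using m by measurable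
    then show ?thesis by measurable
  qed
  have key: "c * indicator (cball x \<epsilon>) (?p s) \<le> (\<integral>\<^sup>+u. of_bool (gs (jump_grad x g (z(j := (s, u)))) j \<noteq> 0) \<partial>\<kappa>)"
    if s: "s \<in> {real j * l<..<real (Suc j) * l}" for s
  proof (cases "?p s \<in> cball x \<epsilon>")
    case True
    have "0 \<le> real j * l" using l by simp
    then have s0: "0 \<le> s" using s by (simp only: greaterThanLessThan_iff) linarith
    define pv where "pv = (\<Sum>b\<in>Basis. (v \<bullet> b) *\<^sub>R costate ?p b s)"
    have "pv - v = (\<Sum>b\<in>Basis. (v \<bullet> b) *\<^sub>R (costate ?p b s - b))"
      by (simp add: pv_def scaleR_diff_right sum_subtractf euclidean_representation)
    also have "norm \<dots> \<le> (\<Sum>b\<in>(Basis::'a set). norm v * (exp (L * s) - 1))"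
    proof (rule sum_norm_le)
      fix b :: 'a assume b: "b \<in> Basis"
      have "norm (costate ?p b s - b) \<le> norm b * (exp (L * s) - 1)"
        by (rule costate_bound) (use s0 in auto)
      then show "norm ((v \<bullet> b) *\<^sub>R (costate ?p b s - b)) \<le> norm v * (exp (L * s) - 1)"
        using Basis_le_norm[OF b, of v] b by (auto intro!: mult_mono)
    qed
    \<comment> \<open>The costate is estimated for each basis vector separately; this is the origin
      of the factor \<open>DIM('a)\<close> in the hypothesis \<open>small\<close>.\<close>
    also have "\<dots> = norm v * (DIM('a) * (exp (L * s) - 1))" by simp
    also have "\<dots> < norm v * 1"
    proof (rule mult_strict_left_mono)
      have "exp (L * s) \<le> exp (L * (real (Suc j) * l))" using s Lpos by (simp del: of_nat_Suc)
      then have "DIM('a) * (exp (L * s) - 1) \<le> DIM('a) * (exp (L * (real (Suc j) * l)) - 1)"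
        by (intro mult_left_mono) auto
      then show "DIM('a) * (exp (L * s) - 1) < 1" using small by linarith
    qed (use v in simp)
    finally have "norm (pv - v) < norm v" by simp
    then have pv: "pv \<noteq> 0" by auto
    have imp: "gs (jump_grad x g (z(j := (s, u)))) j \<noteq> 0" if u: "(a (?p s + u) - a (?p s)) \<bullet> pv \<noteq> 0" for u
    proof -
      let ?z = "z(j := (s, u))"
      have "path x g j ?z = ?p" by (rule path_cong) simp
      then have "jump_grad x g ?z j = (\<Sum>b\<in>Basis. (costate ?p b s \<bullet> (a (?p s + u) - a (?p s))) *\<^sub>R b)"
        by (simp add: jump_grad_def Let_def)
      then have "jump_grad x g ?z j \<bullet> v = pv \<bullet> (a (?p s + u) - a (?p s))"
        by (simp add: pv_def inner_sum_left inner_sum_right inner_commute[of _ v] mult.commute)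
      moreover have "jump_grad x g ?z j \<bullet> v = gs (jump_grad x g ?z) j \<bullet> v"
      proof (rule gs_inner)
        fix i assume "i < j"
        then have "gs (jump_grad x g ?z) i = gs (jump_grad x g z) i" by (intro gs_jump_grad_cong) auto
        then show "v \<bullet> gs (jump_grad x g ?z) i = 0" using v(2)[OF \<open>i < j\<close>] by simp
      qed
      ultimately show ?thesis using u by (auto simp: inner_commute)
    qed
    have [measurable]: "{u. (a (?p s + u) - a (?p s)) \<bullet> pv \<noteq> 0} \<in> sets \<kappa>"
      unfolding s\<kappa> by measurable
    have "c * indicator (cball x \<epsilon>) (?p s) \<le> emeasure \<kappa> {u. (a (?p s + u) - a (?p s)) \<bullet> pv \<noteq> 0}"
      using nondeg[OF True pv] True by simp
    also have "\<dots> = (\<integral>\<^sup>+u. indicator {u. (a (?p s + u) - a (?p s)) \<bullet> pv \<noteq> 0} u \<partial>\<kappa>)" by simp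
    also have "\<dots> \<le> (\<integral>\<^sup>+u. of_bool (gs (jump_grad x g (z(j := (s, u)))) j \<noteq> 0) \<partial>\<kappa>)"
      by (rule nn_integral_mono) (auto simp: indicator_def imp)
    finally show ?thesis .
  qed simp
  have "(\<integral>\<^sup>+s. ennreal (1 / l) * indicator {real j * l<..<real (Suc j) * l} s * (c * indicator (cball x \<epsilon>) (path x g j z s)) \<partial>lborel)
    \<le> (\<integral>\<^sup>+s. ennreal (1 / l) * indicator {real j * l<..<real (Suc j) * l} s *
       (\<integral>\<^sup>+u. of_bool (gs (jump_grad x g (z(j := (s, u)))) j \<noteq> 0) \<partial>\<kappa>) \<partial>lborel)"
  proof (rule nn_integral_mono)
    fix s :: real
    show "ennreal (1 / l) * indicator {real j * l<..<real (Suc j) * l} s * (c * indicator (cball x \<epsilon>) (path x g j z s))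
        \<le> ennreal (1 / l) * indicator {real j * l<..<real (Suc j) * l} s *
          (\<integral>\<^sup>+u. of_bool (gs (jump_grad x g (z(j := (s, u)))) j \<noteq> 0) \<partial>\<kappa>)"
    proof (cases "s \<in> {real j * l<..<real (Suc j) * l}")
      case True
      then show ?thesis by (intro mult_left_mono key) auto
    qed simp
  qed
  also have "\<dots> = (\<integral>\<^sup>+y. of_bool (gs (jump_grad x g (z(j := y))) j \<noteq> 0) \<partial>cell_measure \<kappa> l j)"
    by (rule nn_integral_cell_measure[OF \<kappa>, symmetric]) measurable
  finally show ?thesis .
qed

text \<open>The expected number of rank increases over n cells is at most \<open>DIM('a)\<close>. If
  the final rank is deficient, so was the rank before each cell; hence each cell contributes at
  least c times the probability of final deficiency, corrected by \<beta> and \<beta>'. Summation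
  over the cells gives the bound.\<close>

lemma deficiency_bound:
  fixes g :: "'w \<Rightarrow> real \<Rightarrow> 'a" and \<kappa> :: "'a measure" and l \<beta> \<beta>' \<epsilon> c :: real and W :: "'w measure" and n :: nat
  defines "Pn \<equiv> W \<Otimes>\<^sub>M PiM {..<n} (cell_measure \<kappa> l)"
  assumes W: "prob_space W" and g[measurable]: "(\<lambda>(w, s). g w s) \<in> borel_measurable (W \<Otimes>\<^sub>M borel)"
    and \<kappa>: "prob_space \<kappa>" and s\<kappa>[measurable_cong]: "sets \<kappa> = sets borel"
    and l: "0 < l" and small: "DIM('a) * (exp (L * (real n * l)) - 1) < 1"
    and c: "0 \<le> c"
    and nondeg: "\<And>y v. y \<in> cball x \<epsilon> \<Longrightarrow> v \<noteq> 0 \<Longrightarrow> ennreal c \<le> emeasure \<kappa> {u. (a (y + u) - a y) \<bullet> v \<noteq> 0}"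
    and jump: "measure \<kappa> {u. u \<noteq> 0} \<le> \<beta>"
    and leave: "\<And>s. 0 < s \<Longrightarrow> s < real n * l \<Longrightarrow>
        measure Pn {p \<in> space Pn. path x (g (fst p)) n (snd p) s \<notin> cball x \<epsilon>} \<le> \<beta>'"
  shows "c * real n * (measure Pn {p \<in> space Pn. card {j. j < n \<and> gs (jump_grad x (g (fst p)) (snd p)) j \<noteq> 0} < DIM('a)} - \<beta> - \<beta>') \<le> DIM('a)"
proof -
  interpret W: prob_space W by fact
  interpret \<kappa>: prob_space \<kappa> by fact
  interpret C: product_prob_space "cell_measure \<kappa> l"
    by (intro product_prob_spaceI prob_space_cell_measure \<kappa> l)
  interpret CP: prob_space "PiM {..<n} (cell_measure \<kappa> l)"
    by (rule prob_space_PiM) (rule prob_space_cell_measure[OF \<kappa> l])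
  let ?Z = "PiM {..<n} (cell_measure \<kappa> l)"
  interpret P: pair_prob_space W ?Z ..
  have Pn: "Pn = W \<Otimes>\<^sub>M ?Z" by (simp add: Pn_def)
  interpret PP: prob_space Pn unfolding Pn by (rule P.prob_space_axioms)
  define inc where "inc j w z \<longleftrightarrow> gs (jump_grad x (g w) z) j \<noteq> 0" for j w z
  define cnt where "cnt k w z = card {j. j < k \<and> inc j w z}" for k w z
  have mg: "(\<lambda>(p, s). g (fst p) s) \<in> borel_measurable (Pn \<Otimes>\<^sub>M borel)"
  proof -
    have "(\<lambda>p. (\<lambda>(w, s). g w s) (fst (fst p), snd p)) \<in> borel_measurable (Pn \<Otimes>\<^sub>M (borel::real measure))"
      unfolding Pn by measurable
    then show ?thesis by (simp add: case_prod_unfold)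
  qed
  have gw[measurable]: "g w \<in> borel_measurable borel" if "w \<in> space W" for w
    using measurable_compose[OF measurable_Pair1'[OF that] g] by simp
  have mz[measurable]: "(\<lambda>p. fst (snd p j)) \<in> borel_measurable Pn" "(\<lambda>p. snd (snd p j)) \<in> borel_measurable Pn" if "j \<in> {..<n}" for j
  proof -
    have c: "(\<lambda>p. snd p j) \<in> Pn \<rightarrow>\<^sub>M lborel \<Otimes>\<^sub>M \<kappa>"
      unfolding Pn
      by (rule measurable_compose[OF measurable_snd])
         (use measurable_component_singleton[OF that, of "cell_measure \<kappa> l"] in \<open>simp add: measurable_cong_sets[OF refl sets_cell_measure]\<close>)
    show "(\<lambda>p. fst (snd p j)) \<in> borel_measurable Pn" using measurable_compose[OF c measurable_fst] by simp
    have "(\<lambda>p. snd (snd p j)) \<in> Pn \<rightarrow>\<^sub>M \<kappa>" by (rule measurable_compose[OF c measurable_snd])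
    then show "(\<lambda>p. snd (snd p j)) \<in> borel_measurable Pn" using measurable_cong_sets[OF refl s\<kappa>] by blast
  qed
  have minc[measurable]: "Measurable.pred Pn (\<lambda>p. inc j (fst p) (snd p))" if "j \<in> {..<n}" for j
  proof -
    have [measurable]: "(\<lambda>p. gs (jump_grad x (g (fst p)) (snd p)) j) \<in> borel_measurable Pn"
      by (rule measurable_gs_jump_grad[OF mg]) (use that mz in auto)
    show ?thesis unfolding inc_def by measurable
  qed
  have mcnt[measurable]: "(\<lambda>p. cnt k (fst p) (snd p)) \<in> borel_measurable Pn" if "k \<le> n" for k
  proof -
    have e: "cnt k w z = (\<Sum>j\<in>{..<k}. of_bool (inc j w z))" for w z
      unfolding cnt_def by (simp add: sum.If_cases of_bool_def Int_def)
    have [measurable]: "Measurable.pred Pn (\<lambda>p. inc j (fst p) (snd p))" if "j \<in> {..<k}" for j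
      using minc[of j] that \<open>k \<le> n\<close> by auto
    show ?thesis unfolding e by measurable
  qed
  have mpath[measurable]: "(\<lambda>p. path x (g (fst (fst p))) k (snd (fst p)) (snd p)) \<in> borel_measurable (Pn \<Otimes>\<^sub>M borel)" if "k \<le> n" for k
    using measurable_path_param[OF mg, of k snd x] mz that by (auto simp: case_prod_unfold)
  have mpath'[measurable]: "(\<lambda>p. path x (g (fst p)) k (snd p) s) \<in> borel_measurable Pn" if "k \<le> n" for k s
    by (rule measurable_path_at[OF mg]) (use mz that in auto)
  define F where "F = {p \<in> space Pn. cnt n (fst p) (snd p) < DIM('a)}"
  have [measurable]: "F \<in> sets Pn" unfolding F_def by measurable
  \<comment> \<open>What is left of the deficiency probability after two corrections. The hypothesis
    \<open>leave\<close> concerns the path with all jumps at a fixed time, while cell j sees the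
    path without jump j. For s in cell j the two agree unless mark j is nonzero, which costs
    \<beta>; leaving the ball costs \<beta>'.\<close>
  define q where "q = measure Pn F - \<beta> - \<beta>'"
  have AEz: "AE p in Pn. \<forall>j\<in>{..<n}. fst (snd p j) \<in> {real j * l<..<real (Suc j) * l}"
  proof (rule AE_finite_allI)
    fix j assume j: "j \<in> {..<n}"
    have "AE z in ?Z. fst (z j) \<in> {real j * l<..<real (Suc j) * l}"
      by (rule AE_PiM_component[OF prob_space_cell_measure[OF \<kappa> l] j AE_cell_measure[OF \<kappa>]])
    then have "AE w in W. AE z in ?Z. fst (snd (w, z) j) \<in> {real j * l<..<real (Suc j) * l}" by simp
    moreover have "{p \<in> space (W \<Otimes>\<^sub>M ?Z). fst (snd p j) \<in> {real j * l<..<real (Suc j) * l}} \<in> sets (W \<Otimes>\<^sub>M ?Z)"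
      using mz[OF j] unfolding Pn by measurable
    ultimately show "AE p in Pn. fst (snd p j) \<in> {real j * l<..<real (Suc j) * l}"
      unfolding Pn by (intro P.AE_pair_measure)
  qed simp
  have step: "ennreal (c * q) \<le> emeasure Pn {p \<in> space Pn. inc j (fst p) (snd p)}" if j: "j < n" for j
  proof -
    have jj[simp]: "j \<le> n" "j \<in> {..<n}" using j by auto
    let ?I = "{real j * l<..<real (Suc j) * l}"
    have Suc_le: "real (Suc j) * l \<le> real n * l" using j l by (intro mult_right_mono) auto
    \<comment> \<open>Depends on the jumps before j only, so it is not affected when jump j is drawn
      afresh.\<close>
    define G where "G s = {p \<in> space Pn. cnt j (fst p) (snd p) < DIM('a) \<and> path x (g (fst p)) j (snd p) s \<in> cball x \<epsilon>}" for s
    have [measurable]: "G s \<in> sets Pn" for s unfolding G_def mem_cball by measurable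
    have Gq: "q \<le> measure Pn (G s)" if s: "s \<in> ?I" for s
    proof -
      have "0 \<le> real j * l" using l by simp
      then have s0: "0 < s" "s < real n * l" using s Suc_le by (auto simp del: of_nat_Suc)
      let ?J = "{p \<in> space Pn. snd (snd p j) \<noteq> 0}"
      let ?X = "{p \<in> space Pn. path x (g (fst p)) n (snd p) s \<notin> cball x \<epsilon>}"
      have "emeasure Pn ?J = emeasure \<kappa> {u. u \<noteq> 0}"
      proof -
        have spZ: "(\<lambda>z. z j) -` (UNIV \<times> {u. u \<noteq> 0}) \<inter> space ?Z \<in> sets ?Z"
          by (rule measurable_sets[OF measurable_component_singleton[of j]]) (use s\<kappa> j in \<open>auto simp: sets_cell_measure\<close>)
        have "?J = space W \<times> ((\<lambda>z. z j) -` (UNIV \<times> {u. u \<noteq> 0}) \<inter> space ?Z)"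
          unfolding Pn by (auto simp: space_pair_measure mem_Times_iff)
        also have "emeasure Pn \<dots> = emeasure ?Z ((\<lambda>z. z j) -` (UNIV \<times> {u. u \<noteq> 0}) \<inter> space ?Z)"
          unfolding Pn using spZ by (subst CP.emeasure_pair_measure_Times) (auto simp: W.emeasure_space_1)
        also have "\<dots> = emeasure (distr ?Z (cell_measure \<kappa> l j) (\<lambda>z. z j)) (UNIV \<times> {u. u \<noteq> 0})"
          by (rule emeasure_distr[symmetric]) (use s\<kappa> j in \<open>auto simp: sets_cell_measure\<close>)
        also have "distr ?Z (cell_measure \<kappa> l j) (\<lambda>z. z j) = cell_measure \<kappa> l j"
          by (rule distr_PiM_component) (simp_all add: prob_space_cell_measure[OF \<kappa> l] j)
        also have "emeasure (cell_measure \<kappa> l j) (UNIV \<times> {u. u \<noteq> 0}) = emeasure \<kappa> {u. u \<noteq> 0}"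
          by (rule emeasure_cell_measure_snd[OF \<kappa> l]) (simp add: s\<kappa>)
        finally show ?thesis .
      qed
      then have J: "measure Pn ?J \<le> \<beta>" using jump by (simp add: measure_def)
      have X: "measure Pn ?X \<le> \<beta>'" using leave[OF s0] .
      have [measurable]: "?J \<in> sets Pn"
      proof -
        have [measurable]: "(\<lambda>p. snd (snd p j)) \<in> borel_measurable Pn" by (rule mz(2)[OF jj(2)])
        show ?thesis by measurable
      qed
      have [measurable]: "?X \<in> sets Pn"
      proof -
        have [measurable]: "(\<lambda>p. path x (g (fst p)) n (snd p) s) \<in> borel_measurable Pn" by (rule mpath'[OF order_refl])
        show ?thesis unfolding mem_cball by measurable
      qed
      have "AE p in Pn. p \<in> F \<longrightarrow> p \<in> G s \<union> ?J \<union> ?X"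
        using AEz AE_space
      proof eventually_elim
        case (elim p)
        show ?case
        proof (intro impI, rule ccontr)
          assume pF: "p \<in> F" and "p \<notin> G s \<union> ?J \<union> ?X"
          then have n: "p \<notin> G s" "snd (snd p j) = 0" "path x (g (fst p)) n (snd p) s \<in> cball x \<epsilon>"
            using elim by auto
          have wS: "fst p \<in> space W" using elim by (auto simp: Pn space_pair_measure)
          have "cnt j (fst p) (snd p) \<le> cnt n (fst p) (snd p)"
            unfolding cnt_def by (rule card_mono) (use j in auto)
          then have c1: "cnt j (fst p) (snd p) < DIM('a)" using pF by (simp add: F_def)
          have "path x (g (fst p)) n (snd p) s = path x (g (fst p)) (Suc j) (snd p) s"
          proof (rule path_before_strict)
            fix i assume i: "Suc j \<le> i" "i < n"
            have "real (Suc j) * l \<le> real i * l" using i l by (intro mult_right_mono) auto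
            also have "\<dots> < fst (snd p i)" using bspec[OF elim(1), of i] i by auto
            finally show "s < fst (snd p i)" using s by simp
          qed (use wS j s0 in auto)
          also have "path x (g (fst p)) (Suc j) (snd p) = path x (g (fst p)) j (snd p)"
          proof -
            have "noise (g (fst p)) (Suc j) (snd p) = noise (g (fst p)) j (snd p)"
              by (rule ext) (use n(2) in \<open>auto simp: noise_def\<close>)
            then show ?thesis by (simp add: path_def)
          qed
          finally have "p \<in> G s" using c1 n(3) elim by (simp add: G_def)
          then show False using n by simp
        qed
      qed
      then have "measure Pn F \<le> measure Pn (G s \<union> ?J \<union> ?X)"
        by (intro PP.finite_measure_mono_AE) auto
      also have "\<dots> \<le> measure Pn (G s) + measure Pn ?J + measure Pn ?X"
        using measure_Un_le[of "G s \<union> ?J" Pn ?X] measure_Un_le[of "G s" Pn ?J] by fastforce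
      finally show ?thesis using J X by (simp add: q_def)
    qed
    let ?h = "\<lambda>s. ennreal (1 / l) * indicator ?I s :: ennreal"
    have h1: "(\<integral>\<^sup>+s. ?h s \<partial>lborel) = 1" by (rule cell_length[OF l])
    have [measurable]: "(\<lambda>p. inc j (fst p) (snd p)) \<in> Pn \<rightarrow>\<^sub>M count_space UNIV" by (rule minc[OF jj(2)])
    have "ennreal (c * q) = (\<integral>\<^sup>+s. ?h s * ennreal (c * q) \<partial>lborel)"
      using h1 by (subst nn_integral_multc) auto
    also have "\<dots> \<le> (\<integral>\<^sup>+s. ?h s * (ennreal c * emeasure Pn (G s)) \<partial>lborel)"
    proof (rule nn_integral_mono)
      fix s :: real
      have "s \<in> ?I \<Longrightarrow> ennreal (c * q) \<le> ennreal c * emeasure Pn (G s)"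
        using Gq[of s] c by (simp add: PP.emeasure_eq_measure ennreal_mult'[symmetric] mult_left_mono ennreal_leI)
      then show "?h s * ennreal (c * q) \<le> ?h s * (ennreal c * emeasure Pn (G s))"
        by (cases "s \<in> ?I") (auto intro!: mult_left_mono)
    qed
    also have "\<dots> = (\<integral>\<^sup>+s. (\<integral>\<^sup>+p. ?h s * (ennreal c * indicator (G s) p) \<partial>Pn) \<partial>lborel)"
      by (intro nn_integral_cong) (simp add: nn_integral_cmult)
    also have "\<dots> = (\<integral>\<^sup>+p. (\<integral>\<^sup>+s. ?h s * (ennreal c * indicator (G s) p) \<partial>lborel) \<partial>Pn)"
    proof -
      interpret PL: pair_sigma_finite Pn "lborel :: real measure" ..
      have "(\<lambda>(p, s). ?h s * (ennreal c * of_bool (cnt j (fst p) (snd p) < DIM('a) \<and> path x (g (fst p)) j (snd p) s \<in> cball x \<epsilon>)))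
          \<in> borel_measurable (Pn \<Otimes>\<^sub>M lborel)"
      proof -
        have [measurable]: "(\<lambda>p. cnt j (fst (fst p)) (snd (fst p))) \<in> borel_measurable (Pn \<Otimes>\<^sub>M (lborel :: real measure))"
          using measurable_compose[OF measurable_fst mcnt[OF jj(1)]] by simp
        have [measurable]: "(\<lambda>p. path x (g (fst (fst p))) j (snd (fst p)) (snd p)) \<in> borel_measurable (Pn \<Otimes>\<^sub>M lborel)"
          using mpath[OF jj(1)] by simp
        have [measurable]: "Measurable.pred (Pn \<Otimes>\<^sub>M lborel) (\<lambda>p. cnt j (fst (fst p)) (snd (fst p)) < DIM('a) \<and> path x (g (fst (fst p))) j (snd (fst p)) (snd p) \<in> cball x \<epsilon>)"
          unfolding mem_cball by measurable
        show ?thesis unfolding case_prod_unfold by measurable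
      qed
      then have "(\<integral>\<^sup>+s. (\<integral>\<^sup>+p. ?h s * (ennreal c * of_bool (cnt j (fst p) (snd p) < DIM('a) \<and> path x (g (fst p)) j (snd p) s \<in> cball x \<epsilon>)) \<partial>Pn) \<partial>lborel)
          = (\<integral>\<^sup>+p. (\<integral>\<^sup>+s. ?h s * (ennreal c * of_bool (cnt j (fst p) (snd p) < DIM('a) \<and> path x (g (fst p)) j (snd p) s \<in> cball x \<epsilon>)) \<partial>lborel) \<partial>Pn)"
        by (rule PL.Fubini')
      moreover have "p \<in> space Pn \<Longrightarrow> indicator (G s) p = (of_bool (cnt j (fst p) (snd p) < DIM('a) \<and> path x (g (fst p)) j (snd p) s \<in> cball x \<epsilon>) :: ennreal)" for p s
        by (auto simp: G_def indicator_def)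
      ultimately show ?thesis by (simp cong: nn_integral_cong_simp)
    qed
    also have "\<dots> \<le> (\<integral>\<^sup>+p. (\<integral>\<^sup>+y. of_bool (inc j (fst p) ((snd p)(j := y))) \<partial>cell_measure \<kappa> l j) \<partial>Pn)"
    proof (rule nn_integral_mono)
      fix p assume p: "p \<in> space Pn"
      then have wS: "fst p \<in> space W" by (auto simp: Pn space_pair_measure)
      show "(\<integral>\<^sup>+s. ?h s * (ennreal c * indicator (G s) p) \<partial>lborel) \<le> (\<integral>\<^sup>+y. of_bool (inc j (fst p) ((snd p)(j := y))) \<partial>cell_measure \<kappa> l j)"
      proof (cases "cnt j (fst p) (snd p) < DIM('a)")
        case True
        have "(\<integral>\<^sup>+s. ?h s * (ennreal c * indicator (G s) p) \<partial>lborel) = (\<integral>\<^sup>+s. ?h s * (ennreal c * indicator (cball x \<epsilon>) (path x (g (fst p)) j (snd p) s)) \<partial>lborel)"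
          using True p by (intro nn_integral_cong) (auto simp: G_def indicator_def)
        also have "\<dots> \<le> (\<integral>\<^sup>+y. of_bool (gs (jump_grad x (g (fst p)) ((snd p)(j := y))) j \<noteq> 0) \<partial>cell_measure \<kappa> l j)"
        proof (rule nn_integral_gs_jump_grad_cell[OF gw[OF wS] \<kappa> s\<kappa> l _ nondeg])
          have "exp (L * (real (Suc j) * l)) \<le> exp (L * (real n * l))" using Suc_le Lpos by (simp del: of_nat_Suc)
          then have "DIM('a) * (exp (L * (real (Suc j) * l)) - 1) \<le> DIM('a) * (exp (L * (real n * l)) - 1)"
            by (intro mult_left_mono) auto
          then show "DIM('a) * (exp (L * (real (Suc j) * l)) - 1) < 1" using small by linarith
          show "card {i. i < j \<and> gs (jump_grad x (g (fst p)) (snd p)) i \<noteq> 0} < DIM('a)"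
            using True by (simp add: cnt_def inc_def)
        qed
        finally show ?thesis by (simp add: inc_def)
      next
        case False
        then have "p \<notin> G s" for s by (simp add: G_def)
        then show ?thesis by simp
      qed
    qed
    also have "\<dots> = (\<integral>\<^sup>+w. (\<integral>\<^sup>+z. (\<integral>\<^sup>+y. of_bool (inc j w (z(j := y))) \<partial>cell_measure \<kappa> l j) \<partial>?Z) \<partial>W)"
    proof -
      have upd: "(\<lambda>q. (fst (fst q), (snd (fst q))(j := snd q))) \<in> Pn \<Otimes>\<^sub>M cell_measure \<kappa> l j \<rightarrow>\<^sub>M Pn"
        unfolding Pn
        by (intro measurable_Pair measurable_fun_upd[where J = "{..<n}"]) (use j in auto)
      have [measurable]: "Measurable.pred (Pn \<Otimes>\<^sub>M cell_measure \<kappa> l j) (\<lambda>q. inc j (fst (fst q)) ((snd (fst q))(j := snd q)))"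
        using measurable_compose[OF upd minc[OF jj(2)]] by simp
      have "(\<lambda>p. \<integral>\<^sup>+y. of_bool (inc j (fst p) ((snd p)(j := y))) \<partial>cell_measure \<kappa> l j) \<in> borel_measurable Pn"
        by (rule C.M.borel_measurable_nn_integral) (unfold case_prod_unfold, measurable)
      then show ?thesis unfolding Pn by (subst CP.nn_integral_fst[symmetric]) auto
    qed
    \<comment> \<open>Drawing jump j afresh leaves the joint law unchanged. This takes the place of
      conditioning on the other jumps.\<close>
    also have "\<dots> = (\<integral>\<^sup>+w. (\<integral>\<^sup>+z. of_bool (inc j w z) \<partial>?Z) \<partial>W)"
    proof (rule nn_integral_cong)
      fix w assume w: "w \<in> space W"
      have "Measurable.pred ?Z (\<lambda>z. inc j w z)"
        using measurable_compose[OF measurable_Pair1'[OF w] minc[OF jj(2), unfolded Pn]] by simp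
      then have "(\<lambda>z. of_bool (inc j w z) :: ennreal) \<in> borel_measurable ?Z" by measurable
      then show "(\<integral>\<^sup>+z. (\<integral>\<^sup>+y. of_bool (inc j w (z(j := y))) \<partial>cell_measure \<kappa> l j) \<partial>?Z) = (\<integral>\<^sup>+z. of_bool (inc j w z) \<partial>?Z)"
        by (intro nn_integral_PiM_resample[symmetric] C.product_prob_space_axioms) (use j in auto)
    qed
    also have "\<dots> = (\<integral>\<^sup>+p. of_bool (inc j (fst p) (snd p)) \<partial>Pn)"
      unfolding Pn by (subst CP.nn_integral_fst[symmetric]) (use minc[OF jj(2)] in \<open>auto simp: Pn\<close>)
    also have "\<dots> = (\<integral>\<^sup>+p. indicator {p \<in> space Pn. inc j (fst p) (snd p)} p \<partial>Pn)"
      by (rule nn_integral_cong) (auto simp: indicator_def)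
    also have "\<dots> = emeasure Pn {p \<in> space Pn. inc j (fst p) (snd p)}" by simp
    finally show ?thesis .
  qed
  have "(\<Sum>j<n. ennreal (c * q)) \<le> (\<Sum>j<n. emeasure Pn {p \<in> space Pn. inc j (fst p) (snd p)})"
    by (rule sum_mono) (use step in auto)
  also have "\<dots> = (\<Sum>j<n. \<integral>\<^sup>+p. indicator {p \<in> space Pn. inc j (fst p) (snd p)} p \<partial>Pn)"
    by (rule sum.cong[OF refl]) (use minc in simp)
  also have "\<dots> = (\<integral>\<^sup>+p. (\<Sum>j<n. indicator {p \<in> space Pn. inc j (fst p) (snd p)} p) \<partial>Pn)"
    by (rule nn_integral_sum[symmetric]) (use minc in measurable)
  also have "\<dots> \<le> (\<integral>\<^sup>+p. ennreal DIM('a) \<partial>Pn)"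
  proof (rule nn_integral_mono)
    fix p assume p: "p \<in> space Pn"
    have "(\<Sum>j<n. indicator {p \<in> space Pn. inc j (fst p) (snd p)} p :: ennreal) = of_nat (card {j. j < n \<and> inc j (fst p) (snd p)})"
      using p by (simp add: indicator_def of_bool_def sum.If_cases Int_def)
    also have "\<dots> \<le> of_nat DIM('a)"
      unfolding inc_def by (intro of_nat_mono gs_card_le)
    finally show "(\<Sum>j<n. indicator {p \<in> space Pn. inc j (fst p) (snd p)} p) \<le> ennreal DIM('a)"
      by (simp add: ennreal_of_nat_eq_real_of_nat)
  qed
  also have "\<dots> = ennreal DIM('a)" by (simp add: PP.emeasure_space_1)
  finally have "ennreal (real n * (c * q)) \<le> ennreal DIM('a)"
    by (simp add: ennreal_of_nat_eq_real_of_nat ennreal_mult'[symmetric])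
  then have "real n * (c * q) \<le> DIM('a)" by (simp add: ennreal_le_iff)
  then show ?thesis by (simp add: q_def F_def cnt_def inc_def mult_ac)
qed

end

section \<open>Poisson point measures\<close>

text \<open>Every measurable subset of C has mass 0 or 1. Remove from C the traces of all basic open
  sets that have mass 0 there: they are countably many and form a null set. Two remaining points
  would have disjoint neighbourhoods of mass 1 each, so exactly one point remains.\<close>

lemma integer_measure_atom:
  fixes m :: "'z::second_countable_topology measure"
  assumes sm: "\<And>A. open A \<Longrightarrow> A \<inter> C \<in> sets m" and C: "emeasure m C = 1" and Cs: "C \<in> sets m"
    and T: "\<And>x y :: 'z. x \<noteq> y \<Longrightarrow> \<exists>U V. open U \<and> open V \<and> x \<in> U \<and> y \<in> V \<and> U \<inter> V = {}"
    and int: "\<And>A. A \<in> sets m \<Longrightarrow> emeasure m A = \<infinity> \<or> (\<exists>k::nat. emeasure m A = of_nat k)"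
  shows "\<exists>\<xi>\<in>C. \<forall>A\<in>sets m. A \<subseteq> C \<longrightarrow> emeasure m A = indicator A \<xi>"
proof -
  have zo: "emeasure m A = 0 \<or> emeasure m A = 1" if "A \<in> sets m" "A \<subseteq> C" for A
  proof -
    have le: "emeasure m A \<le> 1" using emeasure_mono[OF that(2) Cs] C by simp
    have "emeasure m A = \<infinity> \<or> (\<exists>k::nat. emeasure m A = of_nat k)" by (rule int[OF that(1)])
    then obtain k :: nat where k: "emeasure m A = of_nat k" using le by (auto simp: top_unique)
    then have "of_nat k \<le> (of_nat 1 :: ennreal)" using le by simp
    then have "k \<le> 1" by (simp only: of_nat_le_iff)
    then show ?thesis using k by (cases k) auto
  qed
  obtain \<B> :: "'z set set" where \<B>: "countable \<B>" "topological_basis \<B>"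
    using ex_countable_basis by blast
  define G where "G = \<Union>{b \<inter> C | b. b \<in> \<B> \<and> emeasure m (b \<inter> C) = 0}"
  have op: "open b" if "b \<in> \<B>" for b using \<B>(2) that by (rule topological_basis_open)
  have Geq: "G = (\<Union>b\<in>{b \<in> \<B>. emeasure m (b \<inter> C) = 0}. b \<inter> C)" by (auto simp: G_def)
  have "G \<in> null_sets m"
    unfolding Geq by (rule null_sets_UN') (use \<B>(1) op sm in \<open>auto simp: countable_subset\<close>)
  then have G: "G \<in> sets m" "emeasure m G = 0" by auto
  have GC: "emeasure m (C - G) = 1"
    using C Cs G by (subst emeasure_Diff_null_set) auto
  then have "C - G \<noteq> {}" by (metis emeasure_empty zero_neq_one)
  then obtain \<xi> where \<xi>: "\<xi> \<in> C - G" by blast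
  have only: "C - G \<subseteq> {\<xi>}"
  proof
    fix x assume x: "x \<in> C - G"
    show "x \<in> {\<xi>}"
    proof (rule ccontr)
      assume "x \<notin> {\<xi>}"
      then obtain U V where UV: "open U" "open V" "x \<in> U" "\<xi> \<in> V" "U \<inter> V = {}" using T[of x \<xi>] by auto
      obtain b where b: "b \<in> \<B>" "x \<in> b" "b \<subseteq> U" using \<B>(2) UV(1,3) by (rule topological_basisE)
      obtain b' where b': "b' \<in> \<B>" "\<xi> \<in> b'" "b' \<subseteq> V" using \<B>(2) UV(2,4) by (rule topological_basisE)
      have s: "b \<inter> C \<in> sets m" "b' \<inter> C \<in> sets m" using b b' op sm by auto
      have "emeasure m (b \<inter> C) \<noteq> 0" "emeasure m (b' \<inter> C) \<noteq> 0" using x \<xi> b b' unfolding G_def by blast+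
      then have "emeasure m (b \<inter> C) = 1" "emeasure m (b' \<inter> C) = 1" using zo s by blast+
      moreover have "emeasure m (b \<inter> C) + emeasure m (b' \<inter> C) = emeasure m (b \<inter> C \<union> b' \<inter> C)"
        using s UV b b' by (intro plus_emeasure) auto
      moreover have "\<dots> \<le> emeasure m C" by (rule emeasure_mono) (use Cs in auto)
      ultimately have "(2::ennreal) \<le> 1" using C by (simp add: one_add_one[symmetric] del: one_add_one)
      then show False by (simp add: not_le)
    qed
  qed
  have "emeasure m A = indicator A \<xi>" if A: "A \<in> sets m" "A \<subseteq> C" for A
  proof (cases "\<xi> \<in> A")
    case True
    then have "C - G \<subseteq> A" using only by auto
    then have "1 \<le> emeasure m A" using GC emeasure_mono[of "C - G" A m] A by simp
    then show ?thesis using zo[OF A] True by auto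
  next
    case False
    then have "A \<subseteq> G" using only A by auto
    then have "emeasure m A \<le> 0" using G emeasure_mono[of A G m] by simp
    then show ?thesis using False by simp
  qed
  then show ?thesis using \<xi> by blast
qed

section \<open>The Levy intensity on time and marks\<close>

lemma levy_measure_finite_away:
  fixes \<mu> :: "'a::euclidean_space measure"
  assumes "levy_measure \<mu>" "0 < \<delta>"
  shows "emeasure \<mu> {u. \<delta> < norm u} < \<infinity>"
proof -
  have [measurable_cong]: "sets \<mu> = sets borel" using assms by (simp add: levy_measure_def)
  define c where "c = min (\<delta>\<^sup>2) 1"
  have c: "0 < c" using assms by (simp add: c_def)
  have [measurable]: "{u. \<delta> < norm u} \<in> sets \<mu>" by simp
  have "ennreal c * emeasure \<mu> {u. \<delta> < norm u} = (\<integral>\<^sup>+u. ennreal c * indicator {u. \<delta> < norm u} u \<partial>\<mu>)"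
    by (simp add: nn_integral_cmult_indicator)
  also have "\<dots> \<le> (\<integral>\<^sup>+u. ennreal (min ((norm u)\<^sup>2) 1) \<partial>\<mu>)"
  proof (rule nn_integral_mono)
    fix u :: 'a
    have "\<delta> < norm u \<Longrightarrow> \<delta>\<^sup>2 \<le> (norm u)\<^sup>2" using assms by (intro power_mono) auto
    then show "ennreal c * indicator {u. \<delta> < norm u} u \<le> ennreal (min ((norm u)\<^sup>2) 1)"
      by (auto simp: indicator_def c_def min_def intro!: ennreal_leI)
  qed
  also have "\<dots> < \<infinity>" using assms by (simp add: levy_measure_def)
  finally show ?thesis using c by (auto simp: ennreal_mult_less_top)
qed

lemma levy_measure_sigma_finite:
  fixes \<mu> :: "'a::euclidean_space measure"
  assumes "levy_measure \<mu>"
  shows "sigma_finite_measure (restrict_space \<mu> (- {0}))"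
proof
  have s: "sets \<mu> = sets borel" using assms by (simp add: levy_measure_def)
  have sp: "space \<mu> = UNIV" using sets_eq_imp_space_eq[OF s] by simp
  define A where "A k = {u::'a. 1 / Suc k < norm u}" for k :: nat
  have A: "A k \<subseteq> - {0}" "A k \<in> sets \<mu>" "emeasure \<mu> (A k) < \<infinity>" for k
    using levy_measure_finite_away[OF assms, of "1 / Suc k"] by (auto simp: A_def s)
  have C: "- {0::'a} \<inter> space \<mu> \<in> sets \<mu>" by (simp add: s sp)
  show "\<exists>B. countable B \<and> B \<subseteq> sets (restrict_space \<mu> (- {0})) \<and> \<Union>B = space (restrict_space \<mu> (- {0})) \<and>
      (\<forall>a\<in>B. emeasure (restrict_space \<mu> (- {0})) a \<noteq> \<infinity>)"
  proof (intro exI[of _ "range A"] conjI ballI)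
    show "range A \<subseteq> sets (restrict_space \<mu> (- {0}))"
      using A C by (auto simp: sets_restrict_space_iff)
    show "\<Union>(range A) = space (restrict_space \<mu> (- {0}))"
    proof -
      have "u \<in> \<Union>(range A)" if "u \<noteq> 0" for u :: 'a
        using nat_approx_posE[of "norm u"] that by (auto simp: A_def)
      then show ?thesis using A(1) by (auto simp: space_restrict_space sp)
    qed
    fix a assume "a \<in> range A"
    then obtain k where k: "a = A k" by blast
    have "emeasure (restrict_space \<mu> (- {0})) (A k) = emeasure \<mu> (A k)"
      by (rule emeasure_restrict_space[OF C A(1)])
    then show "emeasure (restrict_space \<mu> (- {0})) a \<noteq> \<infinity>"
      using A(3)[of k] by (simp add: k less_top[symmetric])
  qed simp
qed

text \<open>Turns later measurability questions about sets of jumps into questions about Borel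
  sets.\<close>

lemma sets_levy_intensity:
  fixes \<mu> :: "'a::euclidean_space measure"
  assumes "sets \<mu> = sets borel"
  shows "A \<in> sets (levy_intensity \<mu>) \<longleftrightarrow> A \<in> sets borel \<and> A \<subseteq> {0..} \<times> (- {0})"
proof -
  have sp: "space \<mu> = UNIV" using sets_eq_imp_space_eq[OF assms] by simp
  have space: "space (levy_intensity \<mu>) = {0..} \<times> (- {0})"
    by (simp add: levy_intensity_def space_pair_measure space_restrict_space sp)
  show ?thesis
  proof
    assume A: "A \<in> sets (levy_intensity \<mu>)"
    have "(\<lambda>z. (fst z, snd z)) \<in> restrict_space borel ({0..} \<times> (- {0})) \<rightarrow>\<^sub>M levy_intensity \<mu>"
      unfolding levy_intensity_def
    proof (intro measurable_Pair measurable_restrict_space2)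
      have [measurable]: "fst \<in> borel_measurable (restrict_space (borel :: (real \<times> 'a) measure) ({0..} \<times> (- {0})))"
        "snd \<in> borel_measurable (restrict_space (borel :: (real \<times> 'a) measure) ({0..} \<times> (- {0})))"
        by (intro measurable_restrict_space1; simp add: borel_prod[symmetric])+
      show "fst \<in> restrict_space (borel :: (real \<times> 'a) measure) ({0..} \<times> (- {0})) \<rightarrow>\<^sub>M lborel" by simp
      show "snd \<in> restrict_space (borel :: (real \<times> 'a) measure) ({0..} \<times> (- {0})) \<rightarrow>\<^sub>M \<mu>"
        by (subst measurable_cong_sets[OF refl assms]) simp
    qed (auto simp: space_restrict_space)
    from measurable_sets[OF this A]
    have "A \<inter> ({0..} \<times> (- {0})) \<in> sets (restrict_space borel ({0..} \<times> (- {0})))"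
      by (simp add: space_restrict_space vimage_def Int_def)
    moreover have "A \<subseteq> {0..} \<times> (- {0})" using sets.sets_into_space[OF A] space by simp
    moreover have "({0..} \<times> (- {0})) \<inter> space borel \<in> sets (borel :: (real \<times> 'a) measure)"
      by (simp add: borel_Times)
    ultimately show "A \<in> sets borel \<and> A \<subseteq> {0..} \<times> (- {0})"
      by (auto simp: sets_restrict_space_iff Int_absorb2)
  next
    assume A: "A \<in> sets borel \<and> A \<subseteq> {0..} \<times> (- {0})"
    have "(\<lambda>z. (fst z, snd z)) \<in> levy_intensity \<mu> \<rightarrow>\<^sub>M borel \<Otimes>\<^sub>M borel"
      unfolding levy_intensity_def
    proof (rule measurable_Pair)
      show "fst \<in> borel_measurable (restrict_space lborel {0::real..} \<Otimes>\<^sub>M restrict_space \<mu> (- {0}))"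
        by (rule measurable_compose[OF measurable_fst]) (intro measurable_restrict_space1, simp)
      have "(\<lambda>x. x) \<in> restrict_space \<mu> (- {0}) \<rightarrow>\<^sub>M borel"
        by (intro measurable_restrict_space1) (simp add: measurable_cong_sets[OF assms refl])
      then show "snd \<in> borel_measurable (restrict_space lborel {0::real..} \<Otimes>\<^sub>M restrict_space \<mu> (- {0}))"
        using measurable_compose[OF measurable_snd] by blast
    qed
    then have "(\<lambda>z. z) \<in> levy_intensity \<mu> \<rightarrow>\<^sub>M borel" by (simp add: borel_prod)
    from measurable_sets[OF this, of A] A have "(\<lambda>z. z) -` A \<inter> space (levy_intensity \<mu>) \<in> sets (levy_intensity \<mu>)"
      by simp
    moreover have "(\<lambda>z. z) -` A \<inter> space (levy_intensity \<mu>) = A" using A space by auto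
    ultimately show "A \<in> sets (levy_intensity \<mu>)" by simp
  qed
qed

lemma emeasure_levy_intensity:
  fixes \<mu> :: "'a::euclidean_space measure"
  assumes \<mu>: "levy_measure \<mu>" and D: "D \<in> sets borel" "D \<subseteq> {0..} \<times> (- {0})"
  shows "emeasure (levy_intensity \<mu>) D = (\<integral>\<^sup>+s. emeasure \<mu> {u. (s, u) \<in> D} \<partial>lborel)"
proof -
  have s: "sets \<mu> = sets borel" using \<mu> by (simp add: levy_measure_def)
  have sp: "space \<mu> = UNIV" using sets_eq_imp_space_eq[OF s] by simp
  interpret r: sigma_finite_measure "restrict_space \<mu> (- {0})" by (rule levy_measure_sigma_finite[OF \<mu>])
  have "D \<in> sets (levy_intensity \<mu>)" using D by (simp add: sets_levy_intensity[OF s])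
  then have "emeasure (levy_intensity \<mu>) D = (\<integral>\<^sup>+s. emeasure (restrict_space \<mu> (- {0})) (Pair s -` D) \<partial>restrict_space lborel {0..})"
    unfolding levy_intensity_def by (rule r.emeasure_pair_measure_alt)
  also have "\<dots> = (\<integral>\<^sup>+s. emeasure \<mu> {u. (s, u) \<in> D} \<partial>restrict_space lborel {0..})"
  proof (rule nn_integral_cong)
    fix s :: real
    have "Pair s -` D \<subseteq> - {0}" using D by auto
    then have "emeasure (restrict_space \<mu> (- {0})) (Pair s -` D) = emeasure \<mu> (Pair s -` D)"
      by (intro emeasure_restrict_space) (auto simp: s sp)
    then show "emeasure (restrict_space \<mu> (- {0})) (Pair s -` D) = emeasure \<mu> {u. (s, u) \<in> D}" by (simp add: vimage_def)
  qed
  also have "\<dots> = (\<integral>\<^sup>+s. emeasure \<mu> {u. (s, u) \<in> D} * indicator {0..} s \<partial>lborel)"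
    by (rule nn_integral_restrict_space) simp
  also have "\<dots> = (\<integral>\<^sup>+s. emeasure \<mu> {u. (s, u) \<in> D} \<partial>lborel)"
  proof (rule nn_integral_cong)
    fix s :: real
    have "s \<notin> {0..} \<Longrightarrow> {u. (s, u) \<in> D} = {}" using D by auto
    then show "emeasure \<mu> {u. (s, u) \<in> D} * indicator {0..} s = emeasure \<mu> {u. (s, u) \<in> D}"
      by (cases "s \<in> {0..}") auto
  qed
  finally show ?thesis .
qed

lemma (in prob_space) indep_vars_reindex_const:
  assumes inj: "inj_on f I" and ind: "indep_vars (\<lambda>_. N) X (f ` I)"
  shows "indep_vars (\<lambda>_. N) (\<lambda>i. X (f i)) I"
  unfolding indep_vars_def2
proof (intro conjI ballI)
  fix i assume "i \<in> I"
  then show "random_variable N (X (f i))" using ind by (auto simp: indep_vars_def2)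
next
  show "indep_sets (\<lambda>i. {X (f i) -` A \<inter> space M |A. A \<in> sets N}) I"
  proof (rule indep_setsI)
    fix i assume "i \<in> I"
    then have "random_variable N (X (f i))" using ind by (auto simp: indep_vars_def2)
    then show "{X (f i) -` A \<inter> space M |A. A \<in> sets N} \<subseteq> events" by auto
  next
    fix A J assume J: "J \<noteq> {}" "J \<subseteq> I" "finite J" and A: "\<forall>j\<in>J. A j \<in> {X (f j) -` A \<inter> space M |A. A \<in> sets N}"
    have injJ: "inj_on f J" using inj J(2) by (rule inj_on_subset)
    obtain Q where Q: "\<And>j. j \<in> J \<Longrightarrow> A j = X (f j) -` Q j \<inter> space M \<and> Q j \<in> sets N"
      using A by (simp add: Bex_def) metis
    define Q' where "Q' k = Q (inv_into J f k)" for k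
    have Q': "Q' (f j) = Q j" if "j \<in> J" for j using injJ that by (simp add: Q'_def)
    have p: "prob (\<Inter>k\<in>f ` J. X k -` Q' k \<inter> space M) = (\<Prod>k\<in>f ` J. prob (X k -` Q' k \<inter> space M))"
      by (rule indep_varsD[OF ind]) (use J Q Q' in auto)
    have e: "X (f j) -` Q' (f j) \<inter> space M = A j" if "j \<in> J" for j using Q[OF that] Q'[OF that] by simp
    have eqI: "(\<Inter>k\<in>f ` J. X k -` Q' k \<inter> space M) = (\<Inter>j\<in>J. A j)"
      unfolding image_image by (rule INF_cong[OF refl e])
    have eqP: "(\<Prod>k\<in>f ` J. prob (X k -` Q' k \<inter> space M)) = (\<Prod>j\<in>J. prob (A j))"
      unfolding prod.reindex[OF injJ] o_def by (rule prod.cong[OF refl]) (simp only: e)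
    show "prob (\<Inter>j\<in>J. A j) = (\<Prod>j\<in>J. prob (A j))" using p unfolding eqI eqP .
  qed
qed

locale jump_noise = prob_space M for M :: "'w measure" +
  fixes \<mu> :: "'a::euclidean_space measure" and \<nu> :: "'w \<Rightarrow> (real \<times> 'a) measure"
  assumes \<mu>: "levy_measure \<mu>" and ppm: "poisson_point_measure M (levy_intensity \<mu>) \<nu>"
begin

section \<open>Counts of the point measure and the single jump of a cell\<close>

abbreviation "\<Lambda> \<equiv> levy_intensity \<mu>"

lemma sets_\<mu>: "sets \<mu> = sets borel" using \<mu> by (simp add: levy_measure_def)

lemma sets_\<nu>: "\<omega> \<in> space M \<Longrightarrow> sets (\<nu> \<omega>) = sets \<Lambda>"
  using ppm by (simp add: poisson_point_measure_def)

lemma \<nu>_integer: "\<omega> \<in> space M \<Longrightarrow> A \<in> sets \<Lambda> \<Longrightarrow> emeasure (\<nu> \<omega>) A = \<infinity> \<or> (\<exists>k::nat. emeasure (\<nu> \<omega>) A = of_nat k)"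
  using ppm by (simp add: poisson_point_measure_def)

lemma measurable_\<nu>[measurable]: "A \<in> sets \<Lambda> \<Longrightarrow> (\<lambda>\<omega>. emeasure (\<nu> \<omega>) A) \<in> borel_measurable M"
  using ppm by (simp add: poisson_point_measure_def)

lemma prob_\<nu>: "A \<in> sets \<Lambda> \<Longrightarrow> emeasure \<Lambda> A < \<infinity> \<Longrightarrow>
    prob {\<omega>\<in>space M. emeasure (\<nu> \<omega>) A = of_nat k} = exp (- measure \<Lambda> A) * measure \<Lambda> A ^ k / fact k"
  using ppm unfolding poisson_point_measure_def by blast

lemma indep_\<nu>_seq: "range A \<subseteq> sets \<Lambda> \<Longrightarrow> disjoint_family A \<Longrightarrow> indep_vars (\<lambda>_. borel) (\<lambda>i \<omega>. emeasure (\<nu> \<omega>) (A i)) (UNIV::nat set)"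
  using ppm unfolding poisson_point_measure_def by blast

text \<open>Independence is given for sequences; a finite family is enumerated and continued by
  empty sets.\<close>

lemma indep_\<nu>:
  assumes I: "finite I" and B: "\<And>i. i \<in> I \<Longrightarrow> B i \<in> sets \<Lambda>" and disj: "disjoint_family_on B I"
  shows "indep_vars (\<lambda>_. borel) (\<lambda>i \<omega>. emeasure (\<nu> \<omega>) (B i)) I"
proof -
  obtain f where f: "bij_betw f I {..<card I}"
    using ex_bij_betw_finite_nat[OF I] by (auto simp: atLeast0LessThan)
  define A where "A k = (if k < card I then B (inv_into I f k) else {})" for k
  have inv: "inv_into I f k \<in> I" "f (inv_into I f k) = k" if "k < card I" for k
    using f that by (auto simp: bij_betw_def inv_into_into f_inv_into_f)
  have "disjoint_family A"
    unfolding disjoint_family_on_def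
  proof (intro ballI impI)
    fix m k :: nat assume "m \<noteq> k"
    show "A m \<inter> A k = {}"
    proof (cases "m < card I \<and> k < card I")
      case True
      then have "inv_into I f m \<noteq> inv_into I f k" using inv(2)[of m] inv(2)[of k] \<open>m \<noteq> k\<close> by auto
      then have "B (inv_into I f m) \<inter> B (inv_into I f k) = {}"
        using disj inv(1)[of m] inv(1)[of k] True unfolding disjoint_family_on_def by simp
      then show ?thesis using True by (simp add: A_def)
    qed (auto simp: A_def)
  qed
  moreover have "range A \<subseteq> sets \<Lambda>" using B inv(1) by (auto simp: A_def)
  ultimately have "indep_vars (\<lambda>_. borel) (\<lambda>i \<omega>. emeasure (\<nu> \<omega>) (A i)) UNIV" by (intro indep_\<nu>_seq)
  then have "indep_vars (\<lambda>_. borel) (\<lambda>i \<omega>. emeasure (\<nu> \<omega>) (A i)) (f ` I)"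
    by (rule indep_vars_subset) simp
  then have "indep_vars (\<lambda>_. borel) (\<lambda>i \<omega>. emeasure (\<nu> \<omega>) (A (f i))) I"
    by (rule indep_vars_reindex_const[OF bij_betw_imp_inj_on[OF f], where X = "\<lambda>i \<omega>. emeasure (\<nu> \<omega>) (A i)"])
  moreover have "A (f i) = B i" if "i \<in> I" for i
  proof -
    have "f i < card I" using f that by (auto simp: bij_betw_def)
    then show ?thesis using f that by (simp add: A_def bij_betw_def)
  qed
  ultimately show ?thesis by (simp cong: indep_vars_cong)
qed

lemma atom_exists:
  assumes "\<omega> \<in> space M" "C \<in> sets \<Lambda>" "emeasure (\<nu> \<omega>) C = 1"
  shows "\<exists>\<xi>\<in>C. \<forall>A\<in>sets \<Lambda>. A \<subseteq> C \<longrightarrow> emeasure (\<nu> \<omega>) A = indicator A \<xi>"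
proof -
  have "\<exists>\<xi>\<in>C. \<forall>A\<in>sets (\<nu> \<omega>). A \<subseteq> C \<longrightarrow> emeasure (\<nu> \<omega>) A = indicator A \<xi>"
  proof (rule integer_measure_atom)
    show "A \<inter> C \<in> sets (\<nu> \<omega>)" if "open A" for A
      using that assms(2) by (auto simp: sets_\<nu>[OF assms(1)] sets_levy_intensity[OF sets_\<mu>])
    show "\<exists>U V. open U \<and> open V \<and> x \<in> U \<and> y \<in> V \<and> U \<inter> V = {}" if "x \<noteq> y" for x y :: "real \<times> 'a"
      using hausdorff[OF that] by blast
  qed (use assms \<nu>_integer in \<open>auto simp: sets_\<nu>\<close>)
  then show ?thesis by (simp add: sets_\<nu>[OF assms(1)])
qed

text \<open>The default value has mark \<open>0\<close>, so an empty cell acts as a jump of size \<open>0\<close>.\<close>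

definition atom :: "(real \<times> 'a) set \<Rightarrow> 'w \<Rightarrow> real \<times> 'a" where
  "atom C \<omega> = (if emeasure (\<nu> \<omega>) C = 1
     then (SOME \<xi>. \<xi> \<in> C \<and> (\<forall>A\<in>sets \<Lambda>. A \<subseteq> C \<longrightarrow> emeasure (\<nu> \<omega>) A = indicator A \<xi>)) else (0, 0))"

lemma atom_single:
  assumes "\<omega> \<in> space M" "C \<in> sets \<Lambda>" "emeasure (\<nu> \<omega>) C = 1"
  shows "atom C \<omega> \<in> C" "\<And>A. A \<in> sets \<Lambda> \<Longrightarrow> A \<subseteq> C \<Longrightarrow> emeasure (\<nu> \<omega>) A = indicator A (atom C \<omega>)"
proof -
  have "atom C \<omega> \<in> C \<and> (\<forall>A\<in>sets \<Lambda>. A \<subseteq> C \<longrightarrow> emeasure (\<nu> \<omega>) A = indicator A (atom C \<omega>))"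
    using someI_ex[of "\<lambda>\<xi>. \<xi> \<in> C \<and> (\<forall>A\<in>sets \<Lambda>. A \<subseteq> C \<longrightarrow> emeasure (\<nu> \<omega>) A = indicator A \<xi>)"] atom_exists[OF assms] assms(3)
    unfolding atom_def by auto
  then show "atom C \<omega> \<in> C" "\<And>A. A \<in> sets \<Lambda> \<Longrightarrow> A \<subseteq> C \<Longrightarrow> emeasure (\<nu> \<omega>) A = indicator A (atom C \<omega>)" by auto
qed

text \<open>Only the counts of two disjoint sets are involved. So the position of the jump is
  measurable, and independence of counts passes to it, with no selection argument.\<close>

lemma atom_in_iff:
  assumes \<omega>: "\<omega> \<in> space M" and C: "C \<in> sets \<Lambda>" and D: "D \<in> sets borel"
  shows "atom C \<omega> \<in> D \<longleftrightarrow> (if emeasure (\<nu> \<omega>) (D \<inter> C) + emeasure (\<nu> \<omega>) (C - D) = 1 then emeasure (\<nu> \<omega>) (D \<inter> C) = 1 else (0, 0) \<in> D)"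
proof -
  have s: "D \<inter> C \<in> sets \<Lambda>" "C - D \<in> sets \<Lambda>" using C D by (auto simp: sets_levy_intensity[OF sets_\<mu>])
  have sum: "emeasure (\<nu> \<omega>) (D \<inter> C) + emeasure (\<nu> \<omega>) (C - D) = emeasure (\<nu> \<omega>) C"
  proof -
    have "emeasure (\<nu> \<omega>) (D \<inter> C) + emeasure (\<nu> \<omega>) (C - D) = emeasure (\<nu> \<omega>) (D \<inter> C \<union> (C - D))"
      using s sets_\<nu>[OF \<omega>] by (intro plus_emeasure) auto
    also have "D \<inter> C \<union> (C - D) = C" by auto
    finally show ?thesis .
  qed
  show ?thesis
  proof (cases "emeasure (\<nu> \<omega>) C = 1")
    case True
    have "emeasure (\<nu> \<omega>) (D \<inter> C) = indicator (D \<inter> C) (atom C \<omega>)"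
      by (rule atom_single(2)[OF \<omega> C True s(1)]) auto
    then show ?thesis using sum True atom_single(1)[OF \<omega> C True] by (auto simp: indicator_def)
  next
    case False
    then show ?thesis using sum by (simp add: atom_def)
  qed
qed

lemma measurable_atom[measurable]: 
  assumes C: "C \<in> sets \<Lambda>" shows "atom C \<in> borel_measurable M"
proof (rule measurableI)
  fix D :: "(real \<times> 'a) set" assume D: "D \<in> sets borel"
  have [measurable]: "D \<inter> C \<in> sets \<Lambda>" "C - D \<in> sets \<Lambda>" using C D by (auto simp: sets_levy_intensity[OF sets_\<mu>])
  define P where "P \<omega> \<longleftrightarrow> (if emeasure (\<nu> \<omega>) (D \<inter> C) + emeasure (\<nu> \<omega>) (C - D) = 1 then emeasure (\<nu> \<omega>) (D \<inter> C) = 1 else (0, 0) \<in> D)" for \<omega>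
  have "{\<omega> \<in> space M. P \<omega>} \<in> sets M" unfolding P_def by measurable
  moreover have "atom C \<omega> \<in> D \<longleftrightarrow> P \<omega>" if "\<omega> \<in> space M" for \<omega>
    using atom_in_iff[OF that C D] by (simp add: P_def)
  then have "atom C -` D \<inter> space M = {\<omega> \<in> space M. P \<omega>}" by blast
  ultimately show "atom C -` D \<inter> space M \<in> sets M" by simp
qed simp

text \<open>One jump in D and none in C - D: a product of two independent Poisson weights, whose
  exponentials combine to the one for C.\<close>

lemma prob_atom:
  assumes C: "C \<in> sets \<Lambda>" "emeasure \<Lambda> C < \<infinity>" and D: "D \<in> sets borel" "D \<subseteq> C"
  shows "prob {\<omega> \<in> space M. atom C \<omega> \<in> D} = exp (- measure \<Lambda> C) * measure \<Lambda> D"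
proof -
  have s: "D \<in> sets \<Lambda>" "C - D \<in> sets \<Lambda>" using C D by (auto simp: sets_levy_intensity[OF sets_\<mu>])
  have f: "emeasure \<Lambda> D < \<infinity>" "emeasure \<Lambda> (C - D) < \<infinity>"
    using C D emeasure_mono[of D C \<Lambda>] emeasure_mono[of "C - D" C \<Lambda>] by (auto intro: le_less_trans)
  have "(0, 0) \<notin> D" using D C by (auto simp: sets_levy_intensity[OF sets_\<mu>])
  have [simp]: "D \<inter> C = D" using D by auto
  let ?X = "\<lambda>b::bool. \<lambda>\<omega>. emeasure (\<nu> \<omega>) (if b then D else C - D)"
  have ind: "indep_vars (\<lambda>_. borel) ?X UNIV"
    by (rule indep_\<nu>) (use s in \<open>auto simp: disjoint_family_on_def\<close>)
  have "{\<omega> \<in> space M. atom C \<omega> \<in> D} = (\<Inter>b\<in>UNIV. ?X b -` {if b then 1 else 0} \<inter> space M)"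
  proof -
    have "atom C \<omega> \<in> D \<longleftrightarrow> emeasure (\<nu> \<omega>) D = 1 \<and> emeasure (\<nu> \<omega>) (C - D) = 0" if "\<omega> \<in> space M" for \<omega>
    proof -
      have "(1::ennreal) + x = 1 \<longleftrightarrow> x = 0" for x by (cases x) (auto simp flip: ennreal_1 ennreal_plus)
      then show ?thesis using atom_in_iff[OF that C(1) D(1)] \<open>(0, 0) \<notin> D\<close> by auto
    qed
    then show ?thesis by (auto simp: UNIV_bool)
  qed
  also have "prob \<dots> = (\<Prod>b\<in>UNIV. prob (?X b -` {if b then 1 else 0} \<inter> space M))"
    by (rule indep_varsD[OF ind]) auto
  also have "\<dots> = prob {\<omega> \<in> space M. emeasure (\<nu> \<omega>) D = of_nat 1} * prob {\<omega> \<in> space M. emeasure (\<nu> \<omega>) (C - D) = of_nat 0}"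
    by (simp add: UNIV_bool vimage_def Int_def conj_commute mult.commute)
  also have "\<dots> = exp (- (measure \<Lambda> D + measure \<Lambda> (C - D))) * measure \<Lambda> D"
    unfolding prob_\<nu>[OF s(1) f(1)] prob_\<nu>[OF s(2) f(2)] by (simp add: exp_add[symmetric] exp_minus field_simps exp_diff)
  also have "measure \<Lambda> D + measure \<Lambda> (C - D) = measure \<Lambda> C"
    using measure_Diff[of \<Lambda> C D] C D s f by (simp add: less_top[symmetric])
  finally show ?thesis .
qed

text \<open>From exp(-p) \<ge> 1 - p one gets 1 - exp(-p) (1 + p) \<le> p^2. The quadratic order
  makes the sum over n cells, each of mass p of order 1/n, tend to 0.\<close>

lemma prob_multi:
  assumes C: "C \<in> sets \<Lambda>" "emeasure \<Lambda> C < \<infinity>"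
  shows "prob {\<omega> \<in> space M. emeasure (\<nu> \<omega>) C \<noteq> 0 \<and> emeasure (\<nu> \<omega>) C \<noteq> 1} \<le> (measure \<Lambda> C)\<^sup>2"
proof -
  let ?p = "measure \<Lambda> C"
  let ?E = "\<lambda>k::nat. {\<omega> \<in> space M. emeasure (\<nu> \<omega>) C = of_nat k}"
  note [measurable] = measurable_\<nu>[OF C(1)]
  have "{\<omega> \<in> space M. emeasure (\<nu> \<omega>) C \<noteq> 0 \<and> emeasure (\<nu> \<omega>) C \<noteq> 1} = space M - (?E 0 \<union> ?E 1)" by auto
  also have "prob \<dots> = 1 - prob (?E 0 \<union> ?E 1)" by (rule prob_compl) measurable
  also have "prob (?E 0 \<union> ?E 1) = prob (?E 0) + prob (?E 1)"
    by (rule finite_measure_Union) (measurable, auto)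
  also have "\<dots> = exp (- ?p) * (1 + ?p)" unfolding prob_\<nu>[OF C] by (simp add: algebra_simps)
  also have "1 - exp (- ?p) * (1 + ?p) \<le> ?p\<^sup>2"
  proof -
    have "(1 - ?p) * (1 + ?p) \<le> exp (- ?p) * (1 + ?p)"
      using exp_ge_add_one_self[of "- ?p"] by (intro mult_right_mono) auto
    then show ?thesis by (simp add: algebra_simps power2_eq_square)
  qed
  finally show ?thesis .
qed

text \<open>The Poisson weights of the finite counts already sum to 1.\<close>

lemma AE_finite_\<nu>:
  assumes C: "C \<in> sets \<Lambda>" "emeasure \<Lambda> C < \<infinity>"
  shows "AE \<omega> in M. emeasure (\<nu> \<omega>) C < \<infinity>"
proof -
  let ?p = "measure \<Lambda> C"
  let ?E = "\<lambda>k::nat. {\<omega> \<in> space M. emeasure (\<nu> \<omega>) C = of_nat k}"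
  note [measurable] = measurable_\<nu>[OF C(1)]
  have "(\<lambda>k. prob (?E k)) sums prob (\<Union>k. ?E k)"
    by (rule finite_measure_UNION) (auto simp: disjoint_family_on_def)
  moreover have "(\<lambda>k. prob (?E k)) sums 1"
  proof -
    have "(\<lambda>k. exp (- ?p) * (?p ^ k /\<^sub>R fact k)) sums (exp (- ?p) * exp ?p)"
      by (intro sums_mult exp_converges)
    then show ?thesis unfolding prob_\<nu>[OF C] by (simp add: exp_minus divide_inverse mult_ac)
  qed
  ultimately have "prob (\<Union>k. ?E k) = 1" using sums_unique2 by blast
  then have "AE \<omega> in M. \<omega> \<in> (\<Union>k. ?E k)" by (subst (asm) prob_eq_1) measurable
  then show ?thesis by eventually_elim (auto simp: of_nat_less_top)
qed

text \<open>A generator of the information that the point measure carries outside U. Finitely many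
  counts are constrained at once, so that stability under intersection is immediate.\<close>

definition gen :: "(real \<times> 'a) set \<Rightarrow> 'w set set" where
  "gen U = {{\<omega> \<in> space M. \<forall>B\<in>\<F>. emeasure (\<nu> \<omega>) B \<in> E B} | \<F> E.
     finite \<F> \<and> \<F> \<subseteq> {B \<in> sets \<Lambda>. B \<inter> U = {}} \<and> (\<forall>B. E B \<in> sets borel)}"

lemma gen_sets: "gen U \<subseteq> sets M"
proof
  fix G assume "G \<in> gen U"
  then obtain \<F> E where G: "G = {\<omega> \<in> space M. \<forall>B\<in>\<F>. emeasure (\<nu> \<omega>) B \<in> E B}" "finite \<F>" "\<F> \<subseteq> sets \<Lambda>" "\<And>B. E B \<in> sets borel"
    by (auto simp: gen_def)
  have "Measurable.pred M (\<lambda>\<omega>. emeasure (\<nu> \<omega>) B \<in> E B)" if "B \<in> \<F>" for B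
  proof -
    have [measurable]: "(\<lambda>\<omega>. emeasure (\<nu> \<omega>) B) \<in> borel_measurable M" "E B \<in> sets borel" using G that by auto
    show ?thesis by measurable
  qed
  then have "Measurable.pred M (\<lambda>\<omega>. \<forall>B\<in>\<F>. emeasure (\<nu> \<omega>) B \<in> E B)" using G(2) by (intro pred_intros_finite(3))
  then show "G \<in> sets M" unfolding G(1) by measurable
qed

lemma gen_Int_stable: "Int_stable (gen U)"
  unfolding Int_stable_def
proof (intro ballI)
  fix G G' assume "G \<in> gen U" "G' \<in> gen U"
  then obtain \<F> E \<F>' E' where G: "G = {\<omega> \<in> space M. \<forall>B\<in>\<F>. emeasure (\<nu> \<omega>) B \<in> E B}" "finite \<F>" "\<F> \<subseteq> {B \<in> sets \<Lambda>. B \<inter> U = {}}" "\<And>B. E B \<in> sets borel"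
    and G': "G' = {\<omega> \<in> space M. \<forall>B\<in>\<F>'. emeasure (\<nu> \<omega>) B \<in> E' B}" "finite \<F>'" "\<F>' \<subseteq> {B \<in> sets \<Lambda>. B \<inter> U = {}}" "\<And>B. E' B \<in> sets borel"
    by (auto simp: gen_def)
  have "G \<inter> G' = {\<omega> \<in> space M. \<forall>B\<in>\<F> \<union> \<F>'. emeasure (\<nu> \<omega>) B \<in> (if B \<in> \<F> then E B else UNIV) \<inter> (if B \<in> \<F>' then E' B else UNIV)}"
    unfolding G(1) G'(1) by auto
  moreover have "\<forall>B. (if B \<in> \<F> then E B else UNIV) \<inter> (if B \<in> \<F>' then E' B else UNIV) \<in> sets borel" using G(4) G'(4) by auto
  ultimately show "G \<inter> G' \<in> gen U"
    unfolding gen_def mem_Collect_eq using G(2,3) G'(2,3)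
    by (intro exI[of _ "\<F> \<union> \<F>'"] exI[of _ "\<lambda>B. (if B \<in> \<F> then E B else UNIV) \<inter> (if B \<in> \<F>' then E' B else UNIV)"]) auto
qed

text \<open>The sets of the family \<F> behind G may overlap, while independence of counts is
  available for disjoint sets only. So \<F> is refined to the atoms of the finite algebra it
  generates off U. The counts of these atoms and of the sets D j \<inter> C j and C j - D j are
  independent, and G and the cell events are functions of disjoint groups of them.\<close>

lemma prob_gen_atoms:
  fixes C :: "nat \<Rightarrow> (real \<times> 'a) set"
  assumes C: "\<And>j. C j \<in> sets \<Lambda>" and disj: "disjoint_family C"
    and G: "G \<in> gen (\<Union>j<n. C j)" and D: "\<And>j. D j \<in> sets borel"
  shows "prob (G \<inter> {\<omega> \<in> space M. \<forall>j<n. atom (C j) \<omega> \<in> D j}) = prob G * (\<Prod>j<n. prob {\<omega> \<in> space M. atom (C j) \<omega> \<in> D j})"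
proof -
  let ?U = "\<Union>j<n. C j"
  obtain \<F> E where G: "G = {\<omega> \<in> space M. \<forall>B\<in>\<F>. emeasure (\<nu> \<omega>) B \<in> E B}" "finite \<F>" "\<F> \<subseteq> {B \<in> sets \<Lambda>. B \<inter> ?U = {}}" "\<And>B. E B \<in> sets borel"
    using G by (auto simp: gen_def)
  \<comment> \<open>Atoms of the algebra generated by \<F>, labelled by the set S of those members
    that contain the point.\<close>
  define At where "At S = {z \<in> space \<Lambda> - ?U. \<forall>B\<in>\<F>. z \<in> B \<longleftrightarrow> B \<in> S}" for S
  have At_sets: "At S \<in> sets \<Lambda>" for S
  proof -
    have "Measurable.pred \<Lambda> (\<lambda>z. \<forall>B\<in>\<F>. z \<in> B \<longleftrightarrow> B \<in> S)"
    proof (rule pred_intros_finite(3)[OF G(2)])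
      fix B assume "B \<in> \<F>"
      then have [measurable]: "B \<in> sets \<Lambda>" using G by auto
      show "Measurable.pred \<Lambda> (\<lambda>z. z \<in> B \<longleftrightarrow> B \<in> S)" by measurable
    qed
    then have "{z \<in> space \<Lambda>. \<forall>B\<in>\<F>. z \<in> B \<longleftrightarrow> B \<in> S} \<in> sets \<Lambda>" by measurable
    moreover have "At S = {z \<in> space \<Lambda>. \<forall>B\<in>\<F>. z \<in> B \<longleftrightarrow> B \<in> S} - ?U" by (auto simp: At_def)
    moreover have "?U \<in> sets \<Lambda>" using C by auto
    ultimately show ?thesis by auto
  qed
  define B where "B i = (case i of Inl (j, b) \<Rightarrow> (if b then D j \<inter> C j else C j - D j) | Inr S \<Rightarrow> At S)" for i :: "(nat \<times> bool) + (real \<times> 'a) set set"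
  define I where "I = Inl ` ({..<n} \<times> (UNIV :: bool set)) \<union> Inr ` Pow \<F>"
  have fI: "finite I" unfolding I_def using G(2) by (intro finite_UnI finite_imageI finite_cartesian_product) auto
  have BI: "B i \<in> sets \<Lambda>" for i
  proof (cases i)
    case (Inl p)
    have "D j \<inter> C j \<in> sets \<Lambda>" "C j - D j \<in> sets \<Lambda>" for j
      using C D by (auto simp: sets_levy_intensity[OF sets_\<mu>])
    then show ?thesis using Inl by (cases p) (auto simp: B_def)
  qed (simp add: B_def At_sets)
  have B_sub: "B (Inl (j, b)) \<subseteq> C j" for j b by (auto simp: B_def)
  have dB: "disjoint_family_on B I"
    unfolding disjoint_family_on_def
  proof (intro ballI impI)
    fix i i' assume i: "i \<in> I" "i' \<in> I" "i \<noteq> i'"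
    have mixed: "B (Inl (j, b)) \<inter> At S = {}" if "j < n" for j b S
      using B_sub[of j b] that by (auto simp: At_def)
    have ll: "B (Inl (j, b)) \<inter> B (Inl (j', b')) = {}" if "(j, b) \<noteq> (j', b')" for j b j' b'
    proof (cases "j = j'")
      case True
      then show ?thesis using that by (auto simp: B_def)
    next
      case False
      then have "C j \<inter> C j' = {}" using disj by (auto simp: disjoint_family_on_def)
      then show ?thesis using B_sub[of j b] B_sub[of j' b'] by blast
    qed
    have rr: "At S \<inter> At S' = {}" if "S \<subseteq> \<F>" "S' \<subseteq> \<F>" "S \<noteq> S'" for S S'
      using that by (auto simp: At_def)
    consider j b j' b' where "i = Inl (j, b)" "i' = Inl (j', b')"
      | j b S where "i = Inl (j, b)" "i' = Inr S" "j < n" | j b S where "i' = Inl (j, b)" "i = Inr S" "j < n"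
      | S S' where "i = Inr S" "i' = Inr S'" "S \<subseteq> \<F>" "S' \<subseteq> \<F>"
      using i(1,2) unfolding I_def by blast
    then show "B i \<inter> B i' = {}"
    proof cases
      case 1 then show ?thesis using ll i(3) by auto
    next
      case 2 then show ?thesis using mixed by (simp add: B_def)
    next
      case 3 then show ?thesis using mixed by (simp add: B_def Int_commute)
    next
      case 4 then show ?thesis using rr i(3) by (simp add: B_def)
    qed
  qed
  let ?X = "\<lambda>i \<omega>. emeasure (\<nu> \<omega>) (B i)"
  have ind: "indep_vars (\<lambda>_. borel) ?X I" by (rule indep_\<nu>[OF fI BI dB])
  define Lx where "Lx = insert None (Some ` {..<n})"
  \<comment> \<open>The grouping: the label \<open>None\<close> collects all atoms outside the
    cells, \<open>Some j\<close> the two parts of cell j.\<close>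
  define Kx where "Kx l = (case l of None \<Rightarrow> Inr ` Pow \<F> | Some j \<Rightarrow> {Inl (j, True), Inl (j, False)})" for l :: "nat option"
  have "indep_vars (\<lambda>l. PiM (Kx l) (\<lambda>_. borel)) (\<lambda>l \<omega>. restrict (\<lambda>i. ?X i \<omega>) (Kx l)) Lx"
  proof (rule indep_vars_restrict[OF ind])
    show "Kx l \<subseteq> I" if "l \<in> Lx" for l using that by (auto simp: Lx_def Kx_def I_def)
    show "disjoint_family_on Kx Lx" by (auto simp: disjoint_family_on_def Lx_def Kx_def)
  qed
  note ind2 = this
  \<comment> \<open>The events rewritten for vectors of counts: the count of A is the sum over the
    atoms inside A, and the case \<open>Some j\<close> is the criterion of
    \<open>atom_in_iff\<close>.\<close>
  define Ex where "Ex l = (case l of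
      None \<Rightarrow> {f \<in> space (PiM (Kx None) (\<lambda>_. borel)). \<forall>A\<in>\<F>. (\<Sum>S\<in>{S \<in> Pow \<F>. A \<in> S}. f (Inr S)) \<in> E A}
    | Some j \<Rightarrow> {f \<in> space (PiM (Kx (Some j)) (\<lambda>_. borel)). if f (Inl (j, True)) + f (Inl (j, False)) = 1 then f (Inl (j, True)) = 1 else (0, 0) \<in> D j})" for l
  have Ex_sets: "Ex l \<in> sets (PiM (Kx l) (\<lambda>_. borel))" for l
  proof (cases l)
    case None
    have "Measurable.pred (PiM (Kx None) (\<lambda>_. borel)) (\<lambda>f. \<forall>A\<in>\<F>. (\<Sum>S\<in>{S \<in> Pow \<F>. A \<in> S}. f (Inr S) :: ennreal) \<in> E A)"
    proof (rule pred_intros_finite(3)[OF G(2)])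
      fix A assume "A \<in> \<F>"
      have [measurable]: "E A \<in> sets borel" by (rule G(4))
      have [measurable]: "(\<lambda>f. f (Inr S)) \<in> borel_measurable (PiM (Kx None) (\<lambda>_. borel))" if "S \<in> {S \<in> Pow \<F>. A \<in> S}" for S
        by (rule measurable_component_singleton) (use that in \<open>auto simp: Kx_def\<close>)
      have [measurable]: "(\<lambda>f. \<Sum>S\<in>{S \<in> Pow \<F>. A \<in> S}. f (Inr S) :: ennreal) \<in> borel_measurable (PiM (Kx None) (\<lambda>_. borel))"
        by measurable
      show "Measurable.pred (PiM (Kx None) (\<lambda>_. borel)) (\<lambda>f. (\<Sum>S\<in>{S \<in> Pow \<F>. A \<in> S}. f (Inr S) :: ennreal) \<in> E A)"
        by measurable
    qed
    then show ?thesis unfolding None Ex_def by simp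
  next
    case (Some j)
    have [measurable]: "(\<lambda>f. f (Inl (j, b))) \<in> borel_measurable (PiM (Kx (Some j)) (\<lambda>_. borel :: ennreal measure))" for b
      by (rule measurable_component_singleton) (cases b; simp add: Kx_def)
    show ?thesis unfolding Some Ex_def option.case by measurable
  qed
  have XSome: "(\<lambda>\<omega>. restrict (\<lambda>i. ?X i \<omega>) (Kx (Some j))) -` Ex (Some j) \<inter> space M = {\<omega> \<in> space M. atom (C j) \<omega> \<in> D j}" for j
    using atom_in_iff[OF _ C[of j] D[of j]] by (auto simp: Ex_def Kx_def space_PiM PiE_iff B_def)
  have XNone: "(\<lambda>\<omega>. restrict (\<lambda>i. ?X i \<omega>) (Kx None)) -` Ex None \<inter> space M = G"
  proof -
    have "(\<Sum>S\<in>{S \<in> Pow \<F>. A \<in> S}. emeasure (\<nu> \<omega>) (At S)) = emeasure (\<nu> \<omega>) A" if \<omega>: "\<omega> \<in> space M" and A: "A \<in> \<F>" for \<omega> A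
    proof -
      have "(\<Sum>S\<in>{S \<in> Pow \<F>. A \<in> S}. emeasure (\<nu> \<omega>) (At S)) = emeasure (\<nu> \<omega>) (\<Union>S\<in>{S \<in> Pow \<F>. A \<in> S}. At S)"
      proof (rule sum_emeasure)
        show "At ` {S \<in> Pow \<F>. A \<in> S} \<subseteq> sets (\<nu> \<omega>)" using At_sets sets_\<nu>[OF \<omega>] by auto
        show "disjoint_family_on At {S \<in> Pow \<F>. A \<in> S}" by (auto simp: disjoint_family_on_def At_def)
      qed (use G(2) in auto)
      also have "(\<Union>S\<in>{S \<in> Pow \<F>. A \<in> S}. At S) = A"
      proof (intro equalityI subsetI)
        fix z assume z: "z \<in> A"
        have "z \<in> space \<Lambda> - ?U" using z A G(3) sets.sets_into_space[of A \<Lambda>] by blast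
        then have "z \<in> At {B \<in> \<F>. z \<in> B}" by (auto simp: At_def)
        then show "z \<in> (\<Union>S\<in>{S \<in> Pow \<F>. A \<in> S}. At S)"
          by (rule UN_I[rotated]) (use z A in simp)
      qed (use A in \<open>auto simp: At_def\<close>)
      finally show ?thesis .
    qed
    note sumeq = this
    have "(restrict (\<lambda>i. ?X i \<omega>) (Kx None) \<in> Ex None) \<longleftrightarrow> (\<forall>B\<in>\<F>. emeasure (\<nu> \<omega>) B \<in> E B)" if \<omega>: "\<omega> \<in> space M" for \<omega>
    proof -
      have "(\<Sum>S\<in>{S \<in> Pow \<F>. A \<in> S}. restrict (\<lambda>i. ?X i \<omega>) (Kx None) (Inr S)) = emeasure (\<nu> \<omega>) A" if "A \<in> \<F>" for A
      proof -
        have "(\<Sum>S\<in>{S \<in> Pow \<F>. A \<in> S}. restrict (\<lambda>i. ?X i \<omega>) (Kx None) (Inr S)) = (\<Sum>S\<in>{S \<in> Pow \<F>. A \<in> S}. emeasure (\<nu> \<omega>) (At S))"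
          by (rule sum.cong[OF refl]) (auto simp: Kx_def B_def)
        then show ?thesis using sumeq[OF \<omega> that] by simp
      qed
      moreover have "restrict (\<lambda>i. ?X i \<omega>) (Kx None) \<in> space (PiM (Kx None) (\<lambda>_. borel))" by (simp add: space_PiM)
      ultimately show ?thesis unfolding Ex_def option.case mem_Collect_eq by (simp cong: ball_cong)
    qed
    then show ?thesis unfolding G(1) by blast
  qed
  have "G \<inter> {\<omega> \<in> space M. \<forall>j<n. atom (C j) \<omega> \<in> D j} = (\<Inter>l\<in>Lx. (\<lambda>\<omega>. restrict (\<lambda>i. ?X i \<omega>) (Kx l)) -` Ex l \<inter> space M)"
  proof -
    have "(\<Inter>l\<in>Lx. (\<lambda>\<omega>. restrict (\<lambda>i. ?X i \<omega>) (Kx l)) -` Ex l \<inter> space M)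
        = G \<inter> (\<Inter>j\<in>{..<n}. {\<omega> \<in> space M. atom (C j) \<omega> \<in> D j})"
      unfolding Lx_def INF_insert image_image XNone by (simp only: image_image XSome)
    moreover have "G \<subseteq> space M" unfolding G(1) by blast
    ultimately show ?thesis by blast
  qed
  also have "prob \<dots> = (\<Prod>l\<in>Lx. prob ((\<lambda>\<omega>. restrict (\<lambda>i. ?X i \<omega>) (Kx l)) -` Ex l \<inter> space M))"
    by (rule indep_varsD[OF ind2]) (use Ex_sets in \<open>auto simp: Lx_def\<close>)
  also have "\<dots> = prob G * (\<Prod>j<n. prob {\<omega> \<in> space M. atom (C j) \<omega> \<in> D j})"
    unfolding Lx_def by (subst prod.insert) (auto simp: XNone XSome prod.reindex)
  finally show ?thesis .
qed

end

text \<open>An empty cell is represented in two ways: \<open>atom\<close> returns (0, 0), while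
  \<open>cell_measure\<close> still draws a uniform time for the mark 0. Collapsing these values
  reconciles the two laws and leaves the noise unchanged.\<close>

definition strip :: "real \<times> 'a::real_normed_vector \<Rightarrow> real \<times> 'a" where
  "strip y = (if snd y = 0 then (0, 0) else y)"

lemma measurable_strip[measurable]: "strip \<in> borel_measurable (borel :: (real \<times> 'a::euclidean_space) measure)"
proof -
  have [measurable]: "(\<lambda>y. snd y) \<in> borel_measurable (borel :: (real \<times> 'a) measure)" by (simp add: borel_prod[symmetric])
  show ?thesis unfolding strip_def[abs_def] by measurable
qed

lemma sets_cell_measure_borel:
  fixes \<kappa> :: "'a::euclidean_space measure"
  assumes "sets \<kappa> = sets borel" shows "sets (cell_measure \<kappa> l j) = sets borel"
proof -
  have "sets ((lborel :: real measure) \<Otimes>\<^sub>M \<kappa>) = sets ((borel :: real measure) \<Otimes>\<^sub>M (borel :: 'a measure))"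
    by (rule sets_pair_measure_cong) (simp_all add: assms)
  also have "\<dots> = sets (borel :: (real \<times> 'a) measure)" by (simp only: borel_prod)
  finally show ?thesis by (simp only: sets_cell_measure)
qed

context jump_noise begin

definition past :: "(real \<times> 'a) set \<Rightarrow> 'w measure" where
  "past U = distr M (sigma (space M) (gen U)) (\<lambda>\<omega>. \<omega>)"

lemma gen_Pow: "gen U \<subseteq> Pow (space M)" using gen_sets sets.sets_into_space by blast

lemma sets_past: "sets (past U) = sigma_sets (space M) (gen U)"
  by (simp add: past_def sets_measure_of[OF gen_Pow])

lemma space_past[simp]: "space (past U) = space M"
  by (simp add: past_def space_measure_of[OF gen_Pow])

lemma measurable_id_past: "(\<lambda>\<omega>. \<omega>) \<in> M \<rightarrow>\<^sub>M sigma (space M) (gen U)"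
  by (rule measurable_measure_of[OF gen_Pow]) (use gen_sets in \<open>auto simp: Int_absorb2 sets.sets_into_space\<close>)

lemma measurable_id_past': "(\<lambda>\<omega>. \<omega>) \<in> M \<rightarrow>\<^sub>M past U"
  using measurable_id_past by (simp add: past_def)

lemma measurable_past: "f \<in> past U \<rightarrow>\<^sub>M N \<Longrightarrow> f \<in> M \<rightarrow>\<^sub>M N"
  using measurable_compose[OF measurable_id_past'] by blast

lemma prob_space_past: "prob_space (past U)"
  unfolding past_def by (rule prob_space_distr) (rule measurable_id_past)

lemma nn_integral_past: "f \<in> borel_measurable (past U) \<Longrightarrow> (\<integral>\<^sup>+\<omega>. f \<omega> \<partial>past U) = (\<integral>\<^sup>+\<omega>. f \<omega> \<partial>M)"
  unfolding past_def by (subst nn_integral_distr) (auto intro: measurable_id_past)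

lemma distr_past: "distr M (past U) (\<lambda>\<omega>. \<omega>) = past U"
  unfolding past_def by (rule distr_cong) simp_all

lemma measurable_\<nu>_past:
  assumes "B \<in> sets \<Lambda>" "B \<inter> U = {}"
  shows "(\<lambda>\<omega>. emeasure (\<nu> \<omega>) B) \<in> borel_measurable (past U)"
proof (rule measurableI)
  fix E :: "ennreal set" assume E: "E \<in> sets borel"
  have "(\<lambda>\<omega>. emeasure (\<nu> \<omega>) B) -` E \<inter> space M = {\<omega> \<in> space M. \<forall>B'\<in>{B}. emeasure (\<nu> \<omega>) B' \<in> E}" by auto
  then have "(\<lambda>\<omega>. emeasure (\<nu> \<omega>) B) -` E \<inter> space M \<in> gen U"
    unfolding gen_def using assms E by (intro CollectI exI[of _ "{B}"] exI[of _ "\<lambda>_. E"]) auto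
  then show "(\<lambda>\<omega>. emeasure (\<nu> \<omega>) B) -` E \<inter> space (past U) \<in> sets (past U)"
    by (simp add: sets_past sigma_sets.Basic)
qed simp

text \<open>This is what freezing the noise means. The generators \<open>gen U\<close> and
  \<open>\<D>\<close> are stable under intersection and satisfy the product rule by
  \<open>prob_gen_atoms\<close>, so the sigma-algebras they generate are independent; the jumps of
  different cells are independent of each other by the same rule.\<close>

lemma joint_law:
  fixes C :: "nat \<Rightarrow> (real \<times> 'a) set" and n :: nat
  assumes C: "\<And>j. C j \<in> sets \<Lambda>" and disj: "disjoint_family C"
  defines "U \<equiv> \<Union>j<n. C j"
  shows "distr M (past U \<Otimes>\<^sub>M PiM {..<n} (\<lambda>_. borel)) (\<lambda>\<omega>. (\<omega>, \<lambda>j\<in>{..<n}. atom (C j) \<omega>))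
    = past U \<Otimes>\<^sub>M PiM {..<n} (\<lambda>j. distr M borel (atom (C j)))"
proof -
  let ?Z = "\<lambda>\<omega>. \<lambda>j\<in>{..<n}. atom (C j) \<omega>"
  let ?P = "PiM {..<n} (\<lambda>_. borel :: (real \<times> 'a) measure)"
  define \<D> where "\<D> = {{\<omega> \<in> space M. \<forall>j<n. atom (C j) \<omega> \<in> D j} | D. \<forall>j. D j \<in> sets borel}"
  have mZ: "?Z \<in> M \<rightarrow>\<^sub>M ?P" using measurable_atom[OF C] by measurable
  have vim: "?Z -` Pi\<^sub>E {..<n} D \<inter> space M = {\<omega> \<in> space M. \<forall>j<n. atom (C j) \<omega> \<in> D j}" for D
    unfolding vimage_def restrict_PiE_iff Ball_def lessThan_iff by blast
  have \<D>_sets: "\<D> \<subseteq> sets M"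
  proof
    fix X assume "X \<in> \<D>"
    then obtain D where D: "X = {\<omega> \<in> space M. \<forall>j<n. atom (C j) \<omega> \<in> D j}" "\<And>j. D j \<in> sets borel" by (auto simp: \<D>_def)
    have X: "X = ?Z -` Pi\<^sub>E {..<n} D \<inter> space M" unfolding D(1) by (rule vim[symmetric])
    have "Pi\<^sub>E {..<n} D \<in> sets ?P" by (rule sets_PiM_I_finite) (use D(2) in simp_all)
    from measurable_sets[OF mZ this] show "X \<in> sets M" unfolding X .
  qed
  have spgen: "space M \<in> gen U" unfolding gen_def by (intro CollectI exI[of _ "{}"] exI[of _ "\<lambda>_. UNIV"]) auto
  have pD: "prob {\<omega> \<in> space M. \<forall>j<n. atom (C j) \<omega> \<in> D j} = (\<Prod>j<n. prob {\<omega> \<in> space M. atom (C j) \<omega> \<in> D j})"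
    if "\<And>j. D j \<in> sets borel" for D
    using prob_gen_atoms[OF C disj spgen[unfolded U_def] that] by (simp add: prob_space Int_absorb1 Collect_conj_eq Int_assoc[symmetric])
  have "indep_set (gen U) \<D>"
  proof (rule indep_setI[OF gen_sets \<D>_sets])
    fix G X assume G: "G \<in> gen U" and "X \<in> \<D>"
    then obtain D where D: "X = {\<omega> \<in> space M. \<forall>j<n. atom (C j) \<omega> \<in> D j}" "\<And>j. D j \<in> sets borel" by (auto simp: \<D>_def)
    show "prob (G \<inter> X) = prob G * prob X"
      unfolding D(1) using prob_gen_atoms[OF C disj G[unfolded U_def] D(2)] pD[OF D(2)] by simp
  qed
  moreover have "Int_stable \<D>"
    unfolding Int_stable_def
  proof (intro ballI)
    fix X Y assume "X \<in> \<D>" "Y \<in> \<D>"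
    then obtain D E where D: "X = {\<omega> \<in> space M. \<forall>j<n. atom (C j) \<omega> \<in> D j}" "\<And>j. D j \<in> sets borel"
      and E: "Y = {\<omega> \<in> space M. \<forall>j<n. atom (C j) \<omega> \<in> E j}" "\<And>j. E j \<in> sets borel" by (auto simp: \<D>_def)
    have "X \<inter> Y = {\<omega> \<in> space M. \<forall>j<n. atom (C j) \<omega> \<in> D j \<inter> E j}" unfolding D(1) E(1) by auto
    then show "X \<inter> Y \<in> \<D>" unfolding \<D>_def using D(2) E(2) by (intro CollectI exI[of _ "\<lambda>j. D j \<inter> E j"]) auto
  qed
  ultimately have ind: "indep_set (sigma_sets (space M) (gen U)) (sigma_sets (space M) \<D>)"
    by (intro indep_set_sigma_sets gen_Int_stable)
  have \<D>_Pow: "\<D> \<subseteq> Pow (space M)" by (auto simp: \<D>_def)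
  have "?Z \<in> sigma (space M) \<D> \<rightarrow>\<^sub>M ?P"
  proof (rule measurable_restrict)
    fix j assume j: "j \<in> {..<n}"
    show "atom (C j) \<in> borel_measurable (sigma (space M) \<D>)"
    proof (rule measurableI)
      fix D :: "(real \<times> 'a) set" assume D: "D \<in> sets borel"
      have "atom (C j) -` D \<inter> space M = {\<omega> \<in> space M. \<forall>i<n. atom (C i) \<omega> \<in> (if i = j then D else UNIV)}"
        using j by auto
      then have "atom (C j) -` D \<inter> space M \<in> \<D>"
        unfolding \<D>_def using D by (intro CollectI exI[of _ "\<lambda>i. if i = j then D else UNIV"]) auto
      then show "atom (C j) -` D \<inter> space (sigma (space M) \<D>) \<in> sets (sigma (space M) \<D>)"
        by (simp add: sets_measure_of[OF \<D>_Pow] space_measure_of[OF \<D>_Pow] sigma_sets.Basic)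
    qed simp
  qed
  from measurable_sets[OF this]
  have Zs: "?Z -` A \<inter> space M \<in> sigma_sets (space M) \<D>" if "A \<in> sets ?P" for A
    using that by (simp add: sets_measure_of[OF \<D>_Pow] space_measure_of[OF \<D>_Pow])
  have mpair: "(\<lambda>\<omega>. (\<omega>, ?Z \<omega>)) \<in> M \<rightarrow>\<^sub>M past U \<Otimes>\<^sub>M ?P"
    by (intro measurable_Pair measurable_id_past' mZ)
  have "past U \<Otimes>\<^sub>M distr M ?P ?Z = distr M (past U \<Otimes>\<^sub>M ?P) (\<lambda>\<omega>. (\<omega>, ?Z \<omega>))"
  proof (rule pair_measure_eqI)
    interpret W: prob_space "past U" by (rule prob_space_past)
    interpret Z: prob_space "distr M ?P ?Z" by (rule prob_space_distr[OF mZ])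
    show "sigma_finite_measure (past U)" "sigma_finite_measure (distr M ?P ?Z)" by unfold_locales
    show "sets (past U \<Otimes>\<^sub>M distr M ?P ?Z) = sets (distr M (past U \<Otimes>\<^sub>M ?P) (\<lambda>\<omega>. (\<omega>, ?Z \<omega>)))"
      unfolding sets_distr by (rule sets_pair_measure_cong) simp_all
    fix A B assume A: "A \<in> sets (past U)" and B: "B \<in> sets (distr M ?P ?Z)"
    have Asp: "A \<subseteq> space M" using sets.sets_into_space[OF A] by simp
    have eA: "emeasure (past U) A = emeasure M A"
    proof -
      have "emeasure (past U) A = emeasure (distr M (past U) (\<lambda>\<omega>. \<omega>)) A" by (simp only: distr_past)
      also have "\<dots> = emeasure M ((\<lambda>\<omega>. \<omega>) -` A \<inter> space M)" by (rule emeasure_distr[OF measurable_id_past' A])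
      also have "(\<lambda>\<omega>. \<omega>) -` A \<inter> space M = A" using Asp by auto
      finally show ?thesis .
    qed
    have eB: "emeasure (distr M ?P ?Z) B = emeasure M (?Z -` B \<inter> space M)"
      by (rule emeasure_distr[OF mZ]) (use B in simp)
    have B': "B \<in> sets ?P" using B by simp
    have "emeasure (distr M (past U \<Otimes>\<^sub>M ?P) (\<lambda>\<omega>. (\<omega>, ?Z \<omega>))) (A \<times> B) = emeasure M ((\<lambda>\<omega>. (\<omega>, ?Z \<omega>)) -` (A \<times> B) \<inter> space M)"
      by (rule emeasure_distr[OF mpair pair_measureI[OF A B']])
    also have "(\<lambda>\<omega>. (\<omega>, ?Z \<omega>)) -` (A \<times> B) \<inter> space M = A \<inter> (?Z -` B \<inter> space M)" using Asp by blast
    also have "emeasure M \<dots> = ennreal (prob A * prob (?Z -` B \<inter> space M))"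
      using indep_setD[OF ind, of A "?Z -` B \<inter> space M"] A Zs[OF B'] by (simp add: emeasure_eq_measure sets_past)
    finally show "emeasure (past U) A * emeasure (distr M ?P ?Z) B = emeasure (distr M (past U \<Otimes>\<^sub>M ?P) (\<lambda>\<omega>. (\<omega>, ?Z \<omega>))) (A \<times> B)"
      by (simp only: eA eB emeasure_eq_measure ennreal_mult'[OF measure_nonneg])
  qed
  moreover have "distr M ?P ?Z = PiM {..<n} (\<lambda>j. distr M borel (atom (C j)))"
  proof -
    interpret A: product_prob_space "\<lambda>j. distr M borel (atom (C j))"
      by (intro product_prob_spaceI prob_space_distr measurable_atom C)
    show ?thesis
    proof (rule A.PiM_eqI)
      show "sets (distr M ?P ?Z) = sets (PiM {..<n} (\<lambda>j. distr M borel (atom (C j))))"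
        by (simp, rule sets_PiM_cong) auto
      fix D assume D: "\<And>i. i \<in> {..<n} \<Longrightarrow> D i \<in> sets (distr M borel (atom (C i)))"
      define D' where "D' j = (if j < n then D j else UNIV)" for j
      have D': "D' j \<in> sets borel" for j using D by (auto simp: D'_def)
      have "emeasure (distr M ?P ?Z) (Pi\<^sub>E {..<n} D) = emeasure M (?Z -` Pi\<^sub>E {..<n} D \<inter> space M)"
      proof (rule emeasure_distr[OF mZ])
        show "Pi\<^sub>E {..<n} D \<in> sets ?P" by (rule sets_PiM_I_finite) (use D in simp_all)
      qed
      also have "?Z -` Pi\<^sub>E {..<n} D \<inter> space M = {\<omega> \<in> space M. \<forall>j<n. atom (C j) \<omega> \<in> D' j}"
        unfolding vim D'_def by simp
      also have "emeasure M \<dots> = (\<Prod>j<n. ennreal (prob {\<omega> \<in> space M. atom (C j) \<omega> \<in> D' j}))"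
        unfolding emeasure_eq_measure pD[OF D'] by (simp add: prod_ennreal)
      also have "\<dots> = (\<Prod>j<n. emeasure (distr M borel (atom (C j))) (D j))"
      proof (rule prod.cong[OF refl])
        fix j assume j: "j \<in> {..<n}"
        have "emeasure (distr M borel (atom (C j))) (D j) = emeasure M (atom (C j) -` D j \<inter> space M)"
          by (rule emeasure_distr[OF measurable_atom[OF C]]) (use D[OF j] in simp)
        also have "atom (C j) -` D j \<inter> space M = {\<omega> \<in> space M. atom (C j) \<omega> \<in> D' j}" using j by (auto simp: D'_def)
        finally show "ennreal (prob {\<omega> \<in> space M. atom (C j) \<omega> \<in> D' j}) = emeasure (distr M borel (atom (C j))) (D j)"
          by (simp add: emeasure_eq_measure)
      qed
      finally show "emeasure (distr M ?P ?Z) (Pi\<^sub>E {..<n} D) = (\<Prod>i<n. emeasure (distr M borel (atom (C i))) (D i))" .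
    qed simp
  qed
  ultimately show ?thesis by simp
qed

section \<open>Cells and the law of their jumps\<close>

definition cell :: "real \<Rightarrow> real \<Rightarrow> nat \<Rightarrow> (real \<times> 'a) set" where
  "cell l \<delta> j = {real j * l<..real (Suc j) * l} \<times> {u. \<delta> < norm u}"

definition cell_mass :: "real \<Rightarrow> real \<Rightarrow> real" where
  "cell_mass l \<delta> = l * measure \<mu> {u. \<delta> < norm u}"

text \<open>Law of the mark found in a cell, with an atom at 0 for cells that do not hold exactly
  one jump. Cell 0 stands for all cells, since the intensity is stationary in time.\<close>

definition mark_law :: "real \<Rightarrow> real \<Rightarrow> 'a measure" where
  "mark_law l \<delta> = distr M borel (\<lambda>\<omega>. snd (atom (cell l \<delta> 0) \<omega>))"

lemma emeasure_\<mu>_away: "0 < \<delta> \<Longrightarrow> emeasure \<mu> {u. \<delta> < norm u} = ennreal (measure \<mu> {u. \<delta> < norm u})"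
  using levy_measure_finite_away[OF \<mu>] by (intro emeasure_eq_ennreal_measure) (simp add: less_top[symmetric])

context
  fixes l \<delta> :: real
  assumes l: "0 < l" and \<delta>: "0 < \<delta>"
begin

lemma cell_borel: "cell l \<delta> j \<in> sets borel" unfolding cell_def by (intro borel_Times) auto

lemma cell_subset: "cell l \<delta> j \<subseteq> {0..} \<times> (- {0})"
proof -
  have "0 \<le> real j * l" using l by simp
  then show ?thesis using \<delta> by (auto simp: cell_def simp del: of_nat_Suc)
qed

lemma cell_sets: "cell l \<delta> j \<in> sets \<Lambda>"
  using cell_borel cell_subset by (simp add: sets_levy_intensity[OF sets_\<mu>])

lemma disjoint_cells: "disjoint_family (cell l \<delta>)"
  unfolding disjoint_family_on_def
proof (intro ballI impI)
  fix i j :: nat assume "i \<noteq> j"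
  have *: "cell l \<delta> i \<inter> cell l \<delta> j = {}" if "i < j" for i j
  proof -
    have "real (Suc i) * l \<le> real j * l" using that l by (intro mult_right_mono) auto
    then show ?thesis by (auto simp: cell_def simp del: of_nat_Suc)
  qed
  consider "i < j" | "j < i" using \<open>i \<noteq> j\<close> by linarith
  then show "cell l \<delta> i \<inter> cell l \<delta> j = {}" by cases (use * in \<open>blast+\<close>)
qed

lemma emeasure_cell_Times:
  assumes B: "B \<in> sets borel"
  shows "emeasure \<Lambda> ((UNIV \<times> B) \<inter> cell l \<delta> j) = ennreal l * emeasure \<mu> (B \<inter> {u. \<delta> < norm u})"
proof -
  let ?I = "{real j * l<..real (Suc j) * l}"
  have "emeasure \<Lambda> ((UNIV \<times> B) \<inter> cell l \<delta> j) = (\<integral>\<^sup>+s. emeasure \<mu> {u. (s, u) \<in> (UNIV \<times> B) \<inter> cell l \<delta> j} \<partial>lborel)"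
    by (rule emeasure_levy_intensity[OF \<mu>]) (use cell_subset in \<open>auto intro!: sets.Int borel_Times B cell_borel\<close>)
  also have "\<dots> = (\<integral>\<^sup>+s. emeasure \<mu> (B \<inter> {u. \<delta> < norm u}) * indicator ?I s \<partial>lborel)"
  proof (rule nn_integral_cong)
    fix s :: real
    have "{u. (s, u) \<in> (UNIV \<times> B) \<inter> cell l \<delta> j} = (if s \<in> ?I then B \<inter> {u. \<delta> < norm u} else {})" by (auto simp: cell_def)
    then show "emeasure \<mu> {u. (s, u) \<in> (UNIV \<times> B) \<inter> cell l \<delta> j} = emeasure \<mu> (B \<inter> {u. \<delta> < norm u}) * indicator ?I s" by simp
  qed
  also have "\<dots> = emeasure \<mu> (B \<inter> {u. \<delta> < norm u}) * emeasure lborel ?I" by (rule nn_integral_cmult_indicator) simp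
  also have "emeasure lborel ?I = ennreal l" using l by (simp add: algebra_simps)
  finally show ?thesis by (simp add: mult.commute)
qed

lemma emeasure_cell: "emeasure \<Lambda> (cell l \<delta> j) = ennreal (cell_mass l \<delta>)"
  using emeasure_cell_Times[of UNIV j] l emeasure_\<mu>_away[OF \<delta>] by (simp add: cell_mass_def ennreal_mult')

lemma measure_cell: "measure \<Lambda> (cell l \<delta> j) = cell_mass l \<delta>"
  using emeasure_cell[of j] l by (simp add: measure_def cell_mass_def)

text \<open>A set without zero marks does not see the default value, so only its part inside the
  cell counts.\<close>

lemma prob_atom_cell:
  assumes "D \<in> sets borel" "D \<subseteq> UNIV \<times> (- {0})"
  shows "emeasure M {\<omega> \<in> space M. atom (cell l \<delta> j) \<omega> \<in> D} = ennreal (exp (- cell_mass l \<delta>)) * emeasure \<Lambda> (D \<inter> cell l \<delta> j)"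
proof -
  have DC: "D \<inter> cell l \<delta> j \<in> sets borel" using assms cell_borel by auto
  have "atom (cell l \<delta> j) \<omega> \<in> D \<longleftrightarrow> atom (cell l \<delta> j) \<omega> \<in> D \<inter> cell l \<delta> j" if "\<omega> \<in> space M" for \<omega>
  proof (cases "emeasure (\<nu> \<omega>) (cell l \<delta> j) = 1")
    case True
    then show ?thesis using atom_single(1)[OF that cell_sets True] by auto
  next
    case False
    then have "atom (cell l \<delta> j) \<omega> = (0, 0)" by (simp add: atom_def)
    then show ?thesis using assms(2) by auto
  qed
  then have "{\<omega> \<in> space M. atom (cell l \<delta> j) \<omega> \<in> D} = {\<omega> \<in> space M. atom (cell l \<delta> j) \<omega> \<in> D \<inter> cell l \<delta> j}" by blast
  then have "emeasure M {\<omega> \<in> space M. atom (cell l \<delta> j) \<omega> \<in> D} = ennreal (exp (- cell_mass l \<delta>) * measure \<Lambda> (D \<inter> cell l \<delta> j))"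
    using prob_atom[OF cell_sets _ DC] by (simp add: emeasure_eq_measure emeasure_cell measure_cell)
  moreover have "emeasure \<Lambda> (D \<inter> cell l \<delta> j) = ennreal (measure \<Lambda> (D \<inter> cell l \<delta> j))"
    using emeasure_mono[of "D \<inter> cell l \<delta> j" "cell l \<delta> j" \<Lambda>] cell_sets[of j]
    by (intro emeasure_eq_ennreal_measure) (auto simp: emeasure_cell top_unique)
  ultimately show ?thesis by (simp add: ennreal_mult')
qed

lemma measurable_snd_atom[measurable]: "(\<lambda>\<omega>. snd (atom (cell l \<delta> j) \<omega>)) \<in> borel_measurable M"
  by (rule measurable_compose[OF measurable_atom[OF cell_sets]]) (simp add: borel_prod[symmetric])

lemma sets_mark_law[measurable_cong]: "sets (mark_law l \<delta>) = sets borel" by (simp add: mark_law_def)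

lemma prob_space_mark_law: "prob_space (mark_law l \<delta>)"
  unfolding mark_law_def by (rule prob_space_distr) measurable

lemma emeasure_mark_law:
  assumes B: "B \<in> sets borel" "0 \<notin> B"
  shows "emeasure (mark_law l \<delta>) B = ennreal (exp (- cell_mass l \<delta>) * l) * emeasure \<mu> (B \<inter> {u. \<delta> < norm u})"
proof -
  have "emeasure (mark_law l \<delta>) B = emeasure M {\<omega> \<in> space M. atom (cell l \<delta> 0) \<omega> \<in> UNIV \<times> B}"
    unfolding mark_law_def using B by (subst emeasure_distr) (auto simp: vimage_def Int_def conj_commute mem_Times_iff)
  also have "\<dots> = ennreal (exp (- cell_mass l \<delta>)) * emeasure \<Lambda> ((UNIV \<times> B) \<inter> cell l \<delta> 0)"
    by (rule prob_atom_cell) (use B in \<open>auto intro: borel_Times\<close>)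
  also have "\<dots> = ennreal (exp (- cell_mass l \<delta>)) * (ennreal l * emeasure \<mu> (B \<inter> {u. \<delta> < norm u}))"
    by (simp only: emeasure_cell_Times[OF B(1)])
  finally show ?thesis by (simp add: ennreal_mult' mult.assoc)
qed

text \<open>On sets avoiding (0, 0) both laws equal exp(-p) times the intensity on the cell, p being
  the cell mass: the factor l in the mark law cancels the density 1/l of the time. Sets containing
  (0, 0) follow by complements, since both laws are probabilities. The half-open cell and the open
  interval in \<open>cell_measure\<close> differ by one instant.\<close>

lemma atom_law: "distr M borel (atom (cell l \<delta> j)) = distr (cell_measure (mark_law l \<delta>) l j) borel strip"
proof -
  let ?\<kappa> = "mark_law l \<delta>" and ?c = "cell_measure (mark_law l \<delta>) l j"
  interpret \<kappa>: prob_space ?\<kappa> by (rule prob_space_mark_law)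
  interpret c: prob_space ?c by (rule prob_space_cell_measure[OF prob_space_mark_law l])
  have sc: "sets ?c = sets borel" by (rule sets_cell_measure_borel[OF sets_mark_law])
  have ms: "strip \<in> ?c \<rightarrow>\<^sub>M borel" by (simp add: measurable_cong_sets[OF sc refl])
  interpret d: prob_space "distr ?c borel strip" by (rule c.prob_space_distr[OF ms])
  interpret e: prob_space "distr M borel (atom (cell l \<delta> j))" by (rule prob_space_distr[OF measurable_atom[OF cell_sets]])
  have main: "emeasure (distr M borel (atom (cell l \<delta> j))) D = emeasure (distr ?c borel strip) D"
    if D: "D \<in> sets borel" "(0, 0) \<notin> D" for D
  proof -
    define D' where "D' = D \<inter> UNIV \<times> (- {0})"
    have D'b: "D' \<in> sets borel" unfolding D'_def using D by (auto intro!: borel_Times sets.Int)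
    have a0: "atom (cell l \<delta> j) \<omega> \<in> D \<longleftrightarrow> atom (cell l \<delta> j) \<omega> \<in> D'" if "\<omega> \<in> space M" for \<omega>
    proof (cases "emeasure (\<nu> \<omega>) (cell l \<delta> j) = 1")
      case True
      have "atom (cell l \<delta> j) \<omega> \<in> {0..} \<times> (- {0})" by (rule subsetD[OF cell_subset atom_single(1)[OF that cell_sets True]])
      then show ?thesis by (simp add: D'_def mem_Times_iff)
    next
      case False
      then have "atom (cell l \<delta> j) \<omega> = (0, 0)" by (simp add: atom_def)
      then show ?thesis using D(2) by (auto simp: D'_def)
    qed
    have "emeasure (distr M borel (atom (cell l \<delta> j))) D = emeasure M (atom (cell l \<delta> j) -` D \<inter> space M)"
      by (rule emeasure_distr[OF measurable_atom[OF cell_sets] D(1)])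
    also have "atom (cell l \<delta> j) -` D \<inter> space M = {\<omega> \<in> space M. atom (cell l \<delta> j) \<omega> \<in> D'}" using a0 by blast
    also have "emeasure M \<dots> = ennreal (exp (- cell_mass l \<delta>)) * emeasure \<Lambda> (D' \<inter> cell l \<delta> j)"
      by (rule prob_atom_cell[OF D'b]) (auto simp: D'_def)
    also have "emeasure \<Lambda> (D' \<inter> cell l \<delta> j) = (\<integral>\<^sup>+s. emeasure \<mu> {u. (s, u) \<in> D' \<inter> cell l \<delta> j} \<partial>lborel)"
      by (rule emeasure_levy_intensity[OF \<mu>]) (use D'b cell_borel cell_subset in auto)
    finally have lhs: "emeasure (distr M borel (atom (cell l \<delta> j))) D =
      ennreal (exp (- cell_mass l \<delta>)) * (\<integral>\<^sup>+s. emeasure \<mu> {u. (s, u) \<in> D' \<inter> cell l \<delta> j} \<partial>lborel)" .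
    have "emeasure (distr ?c borel strip) D = emeasure ?c (strip -` D \<inter> space ?c)"
      by (rule emeasure_distr[OF ms D(1)])
    also have "strip -` D \<inter> space ?c = D'"
      using D(2) sets_eq_imp_space_eq[OF sc] by (auto simp: strip_def D'_def split: if_splits)
    also have "emeasure ?c D' = (\<integral>\<^sup>+y. indicator D' y \<partial>?c)" using D'b sc by simp
    also have "\<dots> = (\<integral>\<^sup>+s. ennreal (1 / l) * indicator {real j * l<..<real (Suc j) * l} s * (\<integral>\<^sup>+u. indicator D' (s, u) \<partial>?\<kappa>) \<partial>lborel)"
    proof (rule nn_integral_cell_measure[OF prob_space_mark_law])
      have "D' \<in> sets (lborel \<Otimes>\<^sub>M ?\<kappa>)" using D'b sc by (simp add: sets_cell_measure)
      then show "indicator D' \<in> borel_measurable (lborel \<Otimes>\<^sub>M ?\<kappa>)" by simp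
    qed
    also have "\<dots> = (\<integral>\<^sup>+s. ennreal (exp (- cell_mass l \<delta>)) * emeasure \<mu> {u. (s, u) \<in> D' \<inter> cell l \<delta> j} \<partial>lborel)"
    proof (rule nn_integral_cong_AE)
      show "AE s in lborel. ennreal (1 / l) * indicator {real j * l<..<real (Suc j) * l} s * (\<integral>\<^sup>+u. indicator D' (s, u) \<partial>?\<kappa>)
          = ennreal (exp (- cell_mass l \<delta>)) * emeasure \<mu> {u. (s, u) \<in> D' \<inter> cell l \<delta> j}"
        using AE_lborel_singleton[of "real (Suc j) * l"]
      proof eventually_elim
        case (elim s)
        let ?Ds = "{u. (s, u) \<in> D'}"
        have Ds: "?Ds \<in> sets borel"
        proof -
          have "(\<lambda>u. (s, u)) \<in> borel \<rightarrow>\<^sub>M (borel :: (real \<times> 'a) measure)" by (simp add: borel_prod[symmetric])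
          from measurable_sets[OF this D'b] show ?thesis by (simp add: vimage_def)
        qed
        have "(\<integral>\<^sup>+u. indicator D' (s, u) \<partial>?\<kappa>) = (\<integral>\<^sup>+u. indicator ?Ds u \<partial>?\<kappa>)" by (rule nn_integral_cong) (simp add: indicator_def)
        also have "\<dots> = emeasure ?\<kappa> ?Ds" using Ds by (simp add: sets_mark_law)
        also have "\<dots> = ennreal (exp (- cell_mass l \<delta>) * l) * emeasure \<mu> (?Ds \<inter> {u. \<delta> < norm u})"
          by (rule emeasure_mark_law[OF Ds]) (simp add: D'_def)
        finally have i: "(\<integral>\<^sup>+u. indicator D' (s, u) \<partial>?\<kappa>) = ennreal (exp (- cell_mass l \<delta>) * l) * emeasure \<mu> (?Ds \<inter> {u. \<delta> < norm u})" .
        have "ennreal (1 / l) * ennreal (exp (- cell_mass l \<delta>) * l) = ennreal (exp (- cell_mass l \<delta>))"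
          using l by (subst ennreal_mult[symmetric]) auto
        then have j2: "ennreal (1 / l) * (ennreal (exp (- cell_mass l \<delta>) * l) * X) = ennreal (exp (- cell_mass l \<delta>)) * X" for X
          by (simp add: mult.assoc[symmetric])
        show ?case
        proof (cases "s \<in> {real j * l<..<real (Suc j) * l}")
          case True
          then have "{u. (s, u) \<in> D' \<inter> cell l \<delta> j} = ?Ds \<inter> {u. \<delta> < norm u}" by (auto simp: cell_def)
          then show ?thesis using True by (simp only: i j2 indicator_simps mult_1_right)
        next
          case False
          then have "{u. (s, u) \<in> D' \<inter> cell l \<delta> j} = {}" using elim by (auto simp: cell_def simp del: of_nat_Suc)
          moreover have "indicator {real j * l<..<real (Suc j) * l} s = (0::ennreal)" using False by (rule indicator_simps(2))
          ultimately show ?thesis by (simp only: emeasure_empty mult_zero_right mult_zero_left)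
        qed
      qed
    qed
    also have "\<dots> = ennreal (exp (- cell_mass l \<delta>)) * (\<integral>\<^sup>+s. emeasure \<mu> {u. (s, u) \<in> D' \<inter> cell l \<delta> j} \<partial>lborel)"
    proof (rule nn_integral_cmult)
      have DC: "D' \<inter> cell l \<delta> j \<in> sets borel" using D'b cell_borel by auto
      interpret r: sigma_finite_measure "restrict_space \<mu> (- {0})" by (rule levy_measure_sigma_finite[OF \<mu>])
      have "D' \<inter> cell l \<delta> j \<in> sets (borel \<Otimes>\<^sub>M restrict_space \<mu> (- {0}))"
      proof -
        have "(\<lambda>z. (fst z, snd z)) \<in> (borel :: real measure) \<Otimes>\<^sub>M restrict_space \<mu> (- {0}) \<rightarrow>\<^sub>M borel \<Otimes>\<^sub>M borel"
        proof (rule measurable_Pair)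
          have "(\<lambda>x. x) \<in> restrict_space \<mu> (- {0}) \<rightarrow>\<^sub>M borel"
            by (intro measurable_restrict_space1) (subst measurable_cong_sets[OF sets_\<mu> refl], simp)
          then show "snd \<in> borel_measurable ((borel :: real measure) \<Otimes>\<^sub>M restrict_space \<mu> (- {0}))"
            using measurable_compose[OF measurable_snd] by blast
        qed simp
        then have "(\<lambda>z. z) \<in> (borel :: real measure) \<Otimes>\<^sub>M restrict_space \<mu> (- {0}) \<rightarrow>\<^sub>M borel" by (simp add: borel_prod)
        from measurable_sets[OF this DC] have "(\<lambda>z. z) -` (D' \<inter> cell l \<delta> j) \<inter> space ((borel :: real measure) \<Otimes>\<^sub>M restrict_space \<mu> (- {0})) \<in> sets (borel \<Otimes>\<^sub>M restrict_space \<mu> (- {0}))" .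
        moreover have "(\<lambda>z. z) -` (D' \<inter> cell l \<delta> j) \<inter> space ((borel :: real measure) \<Otimes>\<^sub>M restrict_space \<mu> (- {0})) = D' \<inter> cell l \<delta> j"
          using cell_subset[of j] sets_eq_imp_space_eq[OF sets_\<mu>] by (auto simp: space_pair_measure space_restrict_space)
        ultimately show ?thesis by simp
      qed
      from r.measurable_emeasure_Pair[OF this]
      have "(\<lambda>s. emeasure (restrict_space \<mu> (- {0})) (Pair s -` (D' \<inter> cell l \<delta> j))) \<in> borel_measurable borel" .
      moreover have "emeasure (restrict_space \<mu> (- {0})) (Pair s -` (D' \<inter> cell l \<delta> j)) = emeasure \<mu> {u. (s, u) \<in> D' \<inter> cell l \<delta> j}" for s
      proof -
        have "Pair s -` (D' \<inter> cell l \<delta> j) \<subseteq> - {0}" using cell_subset[of j] by auto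
        then have "emeasure (restrict_space \<mu> (- {0})) (Pair s -` (D' \<inter> cell l \<delta> j)) = emeasure \<mu> (Pair s -` (D' \<inter> cell l \<delta> j))"
          using sets_eq_imp_space_eq[OF sets_\<mu>] by (intro emeasure_restrict_space) (auto simp: sets_\<mu>)
        then show ?thesis by (simp add: vimage_def)
      qed
      ultimately show "(\<lambda>s. emeasure \<mu> {u. (s, u) \<in> D' \<inter> cell l \<delta> j}) \<in> borel_measurable lborel" by simp
    qed
    finally show ?thesis using lhs by simp
  qed
  show ?thesis
  proof (rule measure_eqI)
    fix D assume "D \<in> sets (distr M borel (atom (cell l \<delta> j)))"
    then have D: "D \<in> sets borel" by simp
    show "emeasure (distr M borel (atom (cell l \<delta> j))) D = emeasure (distr ?c borel strip) D"
    proof (cases "(0, 0) \<in> D")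
      case False then show ?thesis by (rule main[OF D])
    next
      case True
      have m: "emeasure (distr M borel (atom (cell l \<delta> j))) (UNIV - D) = emeasure (distr ?c borel strip) (UNIV - D)"
        by (rule main) (use D True in auto)
      have "measure (distr M borel (atom (cell l \<delta> j))) (UNIV - D) = 1 - measure (distr M borel (atom (cell l \<delta> j))) D"
        using e.prob_compl[of D] D by simp
      moreover have "measure (distr ?c borel strip) (UNIV - D) = 1 - measure (distr ?c borel strip) D"
        using d.prob_compl[of D] D by simp
      ultimately have "measure (distr M borel (atom (cell l \<delta> j))) D = measure (distr ?c borel strip) D"
        using m by (simp add: measure_def)
      then show ?thesis by (simp add: e.emeasure_eq_measure d.emeasure_eq_measure)
    qed
  qed simp
qed

text \<open>Moves a probability from the given space to the product model, where frozen noise and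
  jumps are independent and the times are uniform. Invariance of Q under \<open>strip\<close> says
  that the event ignores the time attached to a zero mark.\<close>

lemma transfer_law:
  fixes n :: nat
  defines "U \<equiv> \<Union>j<n. cell l \<delta> j"
  assumes Q: "Q \<in> sets (past U \<Otimes>\<^sub>M PiM {..<n} (cell_measure (mark_law l \<delta>) l))"
    and inv: "\<And>\<omega> z. \<omega> \<in> space M \<Longrightarrow> z \<in> extensional {..<n} \<Longrightarrow> (\<omega>, \<lambda>j\<in>{..<n}. strip (z j)) \<in> Q \<longleftrightarrow> (\<omega>, z) \<in> Q"
  shows "prob {\<omega> \<in> space M. (\<omega>, \<lambda>j\<in>{..<n}. atom (cell l \<delta> j) \<omega>) \<in> Q}
    = measure (past U \<Otimes>\<^sub>M PiM {..<n} (cell_measure (mark_law l \<delta>) l)) Q"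
proof -
  let ?c = "cell_measure (mark_law l \<delta>) l"
  let ?Z = "PiM {..<n} ?c" and ?P = "PiM {..<n} (\<lambda>_. borel :: (real \<times> 'a) measure)"
  have sc: "sets (?c j) = sets borel" for j by (rule sets_cell_measure_borel[OF sets_mark_law])
  have pc: "prob_space (?c j)" for j by (rule prob_space_cell_measure[OF prob_space_mark_law l])
  have sZ: "sets ?Z = sets ?P" by (rule sets_PiM_cong) (simp_all add: sc)
  have sQ: "sets (past U \<Otimes>\<^sub>M ?Z) = sets (past U \<Otimes>\<^sub>M ?P)" by (rule sets_pair_measure_cong) (simp_all add: sZ)
  have ms: "strip \<in> ?c j \<rightarrow>\<^sub>M borel" for j by (simp add: measurable_cong_sets[OF sc refl])
  have Zlaw: "PiM {..<n} (\<lambda>j. distr M borel (atom (cell l \<delta> j))) = distr ?Z ?P (compose {..<n} strip)"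
  proof -
    have "PiM {..<n} (\<lambda>j. distr M borel (atom (cell l \<delta> j))) = PiM {..<n} (\<lambda>j. distr (?c j) (?c j) strip)"
    proof (rule PiM_cong[OF refl])
      fix j
      have "distr (?c j) borel strip = distr (?c j) (?c j) strip" by (rule distr_cong) (simp_all add: sc)
      then show "distr M borel (atom (cell l \<delta> j)) = distr (?c j) (?c j) strip" using atom_law[of j] by simp
    qed
    also have "\<dots> = distr ?Z ?Z (compose {..<n} strip)"
      by (rule distr_PiM_finite_prob_space'[symmetric]) (simp_all add: pc measurable_cong_sets[OF sc sc])
    also have "\<dots> = distr ?Z ?P (compose {..<n} strip)" by (rule distr_cong) (simp_all add: sZ)
    finally show ?thesis .
  qed
  have mcomp: "compose {..<n} strip \<in> ?Z \<rightarrow>\<^sub>M ?P"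
    unfolding compose_def
  proof (rule measurable_restrict)
    fix i assume i: "i \<in> {..<n}"
    have c: "(\<lambda>x. x i) \<in> ?Z \<rightarrow>\<^sub>M ?c i" by (rule measurable_component_singleton[OF i])
    show "(\<lambda>x. strip (x i)) \<in> ?Z \<rightarrow>\<^sub>M borel" by (rule measurable_compose[OF c ms])
  qed
  interpret W: prob_space "past U" by (rule prob_space_past)
  interpret Z: prob_space ?Z by (rule prob_space_PiM) (rule pc)
  interpret dZ: prob_space "distr ?Z ?P (compose {..<n} strip)" by (rule Z.prob_space_distr[OF mcomp])
  have mZ: "(\<lambda>\<omega>. (\<omega>, \<lambda>j\<in>{..<n}. atom (cell l \<delta> j) \<omega>)) \<in> M \<rightarrow>\<^sub>M past U \<Otimes>\<^sub>M ?P"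
    by (intro measurable_Pair measurable_id_past' measurable_restrict measurable_atom cell_sets)
  have "prob {\<omega> \<in> space M. (\<omega>, \<lambda>j\<in>{..<n}. atom (cell l \<delta> j) \<omega>) \<in> Q}
      = measure (distr M (past U \<Otimes>\<^sub>M ?P) (\<lambda>\<omega>. (\<omega>, \<lambda>j\<in>{..<n}. atom (cell l \<delta> j) \<omega>))) Q"
  proof -
    have "Q \<in> sets (past U \<Otimes>\<^sub>M ?P)" using Q unfolding sQ .
    from measure_distr[OF mZ this] show ?thesis by (simp only: vimage_def Int_def mem_Collect_eq conj_commute)
  qed
  also have "\<dots> = measure (past U \<Otimes>\<^sub>M distr ?Z ?P (compose {..<n} strip)) Q"
    using joint_law[OF cell_sets disjoint_cells, of n] by (simp add: Zlaw U_def)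
  also have "past U \<Otimes>\<^sub>M distr ?Z ?P (compose {..<n} strip)
      = distr (past U) (past U) (\<lambda>x. x) \<Otimes>\<^sub>M distr ?Z ?P (compose {..<n} strip)" by (simp add: distr_id2)
  also have "\<dots> = distr (past U \<Otimes>\<^sub>M ?Z) (past U \<Otimes>\<^sub>M ?P) (\<lambda>(x, z). (x, compose {..<n} strip z))"
    by (rule pair_measure_distr[OF measurable_ident mcomp dZ.sigma_finite_measure_axioms, unfolded id_def])
  also have "measure \<dots> Q = measure (past U \<Otimes>\<^sub>M ?Z) ((\<lambda>(x, z). (x, compose {..<n} strip z)) -` Q \<inter> space (past U \<Otimes>\<^sub>M ?Z))"
  proof (rule measure_distr)
    have "(\<lambda>p. (fst p, compose {..<n} strip (snd p))) \<in> past U \<Otimes>\<^sub>M ?Z \<rightarrow>\<^sub>M past U \<Otimes>\<^sub>M ?P"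
      by (intro measurable_Pair measurable_fst measurable_compose[OF measurable_snd mcomp])
    then show "(\<lambda>(x, z). (x, compose {..<n} strip z)) \<in> past U \<Otimes>\<^sub>M ?Z \<rightarrow>\<^sub>M past U \<Otimes>\<^sub>M ?P" by (simp add: case_prod_unfold)
  qed (use Q sQ in simp)
  also have "(\<lambda>(x, z). (x, compose {..<n} strip z)) -` Q \<inter> space (past U \<Otimes>\<^sub>M ?Z) = Q"
  proof -
    have "(\<omega>, compose {..<n} strip z) \<in> Q \<longleftrightarrow> (\<omega>, z) \<in> Q" if "(\<omega>, z) \<in> space (past U \<Otimes>\<^sub>M ?Z)" for \<omega> z
      using inv[of \<omega> z] that by (simp add: space_pair_measure space_PiM compose_def PiE_iff)
    moreover have "Q \<subseteq> space (past U \<Otimes>\<^sub>M ?Z)" using sets.sets_into_space[OF Q] .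
    ultimately have "p \<in> (\<lambda>(x, z). (x, compose {..<n} strip z)) -` Q \<inter> space (past U \<Otimes>\<^sub>M ?Z) \<longleftrightarrow> p \<in> Q" for p
      by (cases p) (simp only: vimage_eq Int_iff case_prod_conv, blast)
    then show ?thesis by (rule set_eqI)
  qed
  finally show ?thesis .
qed

end

end

section \<open>Representation of the noise\<close>

lemma cadlag_cong:
  assumes "\<And>s. 0 \<le> s \<Longrightarrow> f s = g s" "cadlag f" shows "cadlag g"
  unfolding cadlag_def
proof (intro conjI allI impI)
  fix t :: real assume t: "0 \<le> t"
  have "(f \<longlongrightarrow> f t) (at_right t)" using assms(2) t by (simp add: cadlag_def)
  then have "(g \<longlongrightarrow> f t) (at_right t)"
  proof (rule Lim_transform_eventually)
    show "\<forall>\<^sub>F s in at_right t. f s = g s"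
      using t by (intro eventually_at_rightI[of t "t + 1"] assms(1)) auto
  qed
  then show "(g \<longlongrightarrow> g t) (at_right t)" using assms(1)[OF t] by simp
next
  fix t :: real assume t: "0 < t"
  then obtain l where "(f \<longlongrightarrow> l) (at_left t)" using assms(2) unfolding cadlag_def by blast
  then have "(g \<longlongrightarrow> l) (at_left t)"
  proof (rule Lim_transform_eventually)
    show "\<forall>\<^sub>F s in at_left t. f s = g s"
      using t by (intro eventually_at_leftI[of 0 t] assms(1)) auto
  qed
  then show "\<exists>l. (g \<longlongrightarrow> l) (at_left t)" by blast
qed

text \<open>Always strictly above s, so that right limits can be taken along it. A right-continuous
  path is thereby recovered from its values at countably many times, with an index that is a
  measurable function of s.\<close>

definition dyadic_above :: "nat \<Rightarrow> real \<Rightarrow> real" where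
  "dyadic_above k s = real (nat \<lfloor>2 ^ k * s\<rfloor> + 1) / 2 ^ k"

lemma dyadic_above_bounds:
  assumes "0 \<le> s" shows "s < dyadic_above k s" "dyadic_above k s \<le> s + 1 / 2 ^ k"
proof -
  have n: "real (nat \<lfloor>2 ^ k * s\<rfloor>) = of_int \<lfloor>2 ^ k * s\<rfloor>" using assms by simp
  have "2 ^ k * s < real (nat \<lfloor>2 ^ k * s\<rfloor> + 1)" unfolding of_nat_add n by simp
  then show "s < dyadic_above k s" by (simp add: dyadic_above_def field_simps del: of_nat_add)
  have "real (nat \<lfloor>2 ^ k * s\<rfloor> + 1) \<le> 2 ^ k * s + 1" unfolding of_nat_add n by simp
  then show "dyadic_above k s \<le> s + 1 / 2 ^ k" by (simp add: dyadic_above_def field_simps del: of_nat_add)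
qed

lemma filterlim_dyadic_above: "0 \<le> s \<Longrightarrow> filterlim (\<lambda>k. dyadic_above k s) (at_right s) sequentially"
  unfolding filterlim_at
proof (intro conjI)
  assume s: "0 \<le> s"
  show "\<forall>\<^sub>F k in sequentially. dyadic_above k s \<in> {s<..} \<and> dyadic_above k s \<noteq> s"
    using dyadic_above_bounds(1)[OF s] by (intro always_eventually) (auto simp: less_imp_neq[symmetric])
  have "(\<lambda>k. s + (1/2) ^ k) \<longlonglongrightarrow> s + 0" by (intro tendsto_intros LIMSEQ_power_zero) simp
  then have u: "(\<lambda>k. s + 1 / 2 ^ k) \<longlonglongrightarrow> s" by (simp add: power_one_over)
  show "(\<lambda>k. dyadic_above k s) \<longlonglongrightarrow> s"
    by (rule tendsto_sandwich[OF _ _ tendsto_const u])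
       (use dyadic_above_bounds[OF s] in \<open>auto intro!: always_eventually less_imp_le\<close>)
qed

context jump_noise begin

section \<open>Integrals of marks against the point measure\<close>

lemma measurable_nn_integral_past:
  assumes S: "S \<in> sets \<Lambda>" "S \<inter> U = {}" and f: "f \<in> borel_measurable \<Lambda>"
  shows "(\<lambda>\<omega>. \<integral>\<^sup>+z. indicator S z * f z \<partial>\<nu> \<omega>) \<in> borel_measurable (past U)"
  using f
proof (induction f rule: borel_measurable_induct)
  case (cong f g)
  have "(\<integral>\<^sup>+z. indicator S z * f z \<partial>\<nu> \<omega>) = (\<integral>\<^sup>+z. indicator S z * g z \<partial>\<nu> \<omega>)" if "\<omega> \<in> space (past U)" for \<omega>
    using cong(3) sets_eq_imp_space_eq[OF sets_\<nu>] that by (intro nn_integral_cong) simp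
  then show ?case using cong(4) by (subst measurable_cong) auto
next
  case (set A)
  have "(\<integral>\<^sup>+z. indicator S z * indicator A z \<partial>\<nu> \<omega>) = emeasure (\<nu> \<omega>) (S \<inter> A)" if "\<omega> \<in> space (past U)" for \<omega>
  proof -
    have "S \<inter> A \<in> sets (\<nu> \<omega>)" using S set sets_\<nu> that by auto
    then show ?thesis by (simp add: indicator_inter_arith[symmetric])
  qed
  moreover have "(\<lambda>\<omega>. emeasure (\<nu> \<omega>) (S \<inter> A)) \<in> borel_measurable (past U)"
    by (rule measurable_\<nu>_past) (use S set in auto)
  ultimately show ?case by (subst measurable_cong) auto
next
  case (mult u c)
  have "(\<integral>\<^sup>+z. indicator S z * (c * u z) \<partial>\<nu> \<omega>) = c * (\<integral>\<^sup>+z. indicator S z * u z \<partial>\<nu> \<omega>)" if "\<omega> \<in> space (past U)" for \<omega>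
  proof -
    have sn: "sets (\<nu> \<omega>) = sets \<Lambda>" using sets_\<nu> that by simp
    have [measurable]: "u \<in> borel_measurable (\<nu> \<omega>)" "S \<in> sets (\<nu> \<omega>)"
      using mult(2) S sn by (simp_all add: measurable_cong_sets[OF sn refl])
    have "(\<integral>\<^sup>+z. c * (indicator S z * u z) \<partial>\<nu> \<omega>) = c * (\<integral>\<^sup>+z. indicator S z * u z \<partial>\<nu> \<omega>)" by (rule nn_integral_cmult) measurable
    then show ?thesis by (simp add: mult_ac)
  qed
  moreover have "(\<lambda>\<omega>. c * (\<integral>\<^sup>+z. indicator S z * u z \<partial>\<nu> \<omega>)) \<in> borel_measurable (past U)" using mult(4) by measurable
  ultimately show ?case by (subst measurable_cong) auto
next
  case (add u v)
  have "(\<integral>\<^sup>+z. indicator S z * (v z + u z) \<partial>\<nu> \<omega>) = (\<integral>\<^sup>+z. indicator S z * v z \<partial>\<nu> \<omega>) + (\<integral>\<^sup>+z. indicator S z * u z \<partial>\<nu> \<omega>)" if "\<omega> \<in> space (past U)" for \<omega>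
  proof -
    have sn: "sets (\<nu> \<omega>) = sets \<Lambda>" using sets_\<nu> that by simp
    have [measurable]: "u \<in> borel_measurable (\<nu> \<omega>)" "v \<in> borel_measurable (\<nu> \<omega>)" "S \<in> sets (\<nu> \<omega>)"
      using add S sn by (simp_all add: measurable_cong_sets[OF sn refl])
    show ?thesis unfolding distrib_left by (rule nn_integral_add) measurable
  qed
  moreover have "(\<lambda>\<omega>. (\<integral>\<^sup>+z. indicator S z * v z \<partial>\<nu> \<omega>) + (\<integral>\<^sup>+z. indicator S z * u z \<partial>\<nu> \<omega>)) \<in> borel_measurable (past U)"
    using add by measurable
  ultimately show ?case by (subst measurable_cong) auto
next
  case (seq F)
  have "(\<integral>\<^sup>+z. indicator S z * (SUP i. F i) z \<partial>\<nu> \<omega>) = (SUP i. \<integral>\<^sup>+z. indicator S z * F i z \<partial>\<nu> \<omega>)" if "\<omega> \<in> space (past U)" for \<omega>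
  proof -
    have sn: "sets (\<nu> \<omega>) = sets \<Lambda>" using sets_\<nu> that by simp
    have m: "F i \<in> borel_measurable (\<nu> \<omega>)" "S \<in> sets (\<nu> \<omega>)" for i
      using seq(1) S sn by (simp_all add: measurable_cong_sets[OF sn refl])
    have "(\<integral>\<^sup>+z. (SUP i. indicator S z * F i z) \<partial>\<nu> \<omega>) = (SUP i. \<integral>\<^sup>+z. indicator S z * F i z \<partial>\<nu> \<omega>)"
    proof (rule nn_integral_monotone_convergence_SUP)
      show "incseq (\<lambda>i z. indicator S z * F i z)"
        using \<open>incseq F\<close> by (auto simp: incseq_def le_fun_def intro!: mult_left_mono)
      show "(\<lambda>z. indicator S z * F i z) \<in> borel_measurable (\<nu> \<omega>)" for i using m by measurable
    qed
    then show ?thesis by (simp add: SUP_mult_left_ennreal[symmetric] image_comp)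
  qed
  moreover have "(\<lambda>\<omega>. SUP i. \<integral>\<^sup>+z. indicator S z * F i z \<partial>\<nu> \<omega>) \<in> borel_measurable (past U)"
    by (rule borel_measurable_SUP[OF _ seq.IH]) simp
  ultimately show ?case by (subst measurable_cong) auto
qed

lemma measurable_snd_\<Lambda>: "snd \<in> borel_measurable \<Lambda>"
proof -
  have "(\<lambda>z. z) \<in> \<Lambda> \<rightarrow>\<^sub>M borel"
  proof (rule measurableI)
    fix A :: "(real \<times> 'a) set" assume A: "A \<in> sets borel"
    have "space \<Lambda> \<in> sets \<Lambda>" by simp
    then have "A \<inter> space \<Lambda> \<in> sets \<Lambda>" using A by (auto simp: sets_levy_intensity[OF sets_\<mu>])
    then show "(\<lambda>z. z) -` A \<inter> space \<Lambda> \<in> sets \<Lambda>" by simp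
  qed simp
  then show ?thesis using measurable_compose[of "\<lambda>z. z" \<Lambda> borel snd borel] by (simp add: borel_prod[symmetric])
qed

text \<open>Unlike the Bochner integral, this expression is measurable in \<open>\<omega>\<close> without any integrability.\<close>

definition mark_int :: "(real \<times> 'a) set \<Rightarrow> 'w \<Rightarrow> 'a" where
  "mark_int S \<omega> = (\<Sum>b\<in>Basis. (enn2real (\<integral>\<^sup>+z. indicator S z * ennreal (snd z \<bullet> b) \<partial>\<nu> \<omega>)
     - enn2real (\<integral>\<^sup>+z. indicator S z * ennreal (- (snd z \<bullet> b)) \<partial>\<nu> \<omega>)) *\<^sub>R b)"

lemma measurable_mark_int:
  assumes "S \<in> sets \<Lambda>" "S \<inter> U = {}"
  shows "mark_int S \<in> borel_measurable (past U)"
proof -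
  have i: "(\<lambda>z. snd z \<bullet> b) \<in> borel_measurable \<Lambda>" for b :: 'a
    by (rule borel_measurable_inner[OF measurable_snd_\<Lambda>]) simp
  have [measurable]: "(\<lambda>\<omega>. \<integral>\<^sup>+z. indicator S z * ennreal (snd z \<bullet> b) \<partial>\<nu> \<omega>) \<in> borel_measurable (past U)" for b :: 'a
    by (rule measurable_nn_integral_past[OF assms measurable_compose[OF i measurable_ennreal]])
  have [measurable]: "(\<lambda>\<omega>. \<integral>\<^sup>+z. indicator S z * ennreal (- (snd z \<bullet> b)) \<partial>\<nu> \<omega>) \<in> borel_measurable (past U)" for b :: 'a
    by (rule measurable_nn_integral_past[OF assms measurable_compose[OF borel_measurable_uminus[OF i] measurable_ennreal]])
  show ?thesis unfolding mark_int_def[abs_def] by measurable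
qed

text \<open>The marks in T need not be bounded a priori. But the masses of the parts where the norm
  of the mark exceeds k are integers that tend to 0 by continuity from above, hence vanish for some
  k; so the marks are bounded almost everywhere on T.\<close>

lemma integrable_mark:
  assumes \<omega>: "\<omega> \<in> space M" and T: "T \<in> sets \<Lambda>" and fin: "emeasure (\<nu> \<omega>) T < \<infinity>"
  shows "set_integrable (\<nu> \<omega>) T snd"
proof -
  have sn: "sets (\<nu> \<omega>) = sets \<Lambda>" using sets_\<nu>[OF \<omega>] .
  have sm: "snd \<in> borel_measurable (\<nu> \<omega>)" using measurable_snd_\<Lambda> by (simp add: measurable_cong_sets[OF sn refl])
  have Ts: "T \<in> sets (\<nu> \<omega>)" using T sn by simp
  define A where "A k = {z \<in> space (\<nu> \<omega>). real k < norm (snd z)} \<inter> T" for k :: nat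
  have A: "A k \<in> sets (\<nu> \<omega>)" for k
  proof -
    have "(\<lambda>z. norm (snd z)) -` {real k<..} \<inter> space (\<nu> \<omega>) \<in> sets (\<nu> \<omega>)"
      by (rule measurable_sets[OF measurable_compose[OF sm borel_measurable_norm]]) simp
    moreover have "(\<lambda>z. norm (snd z)) -` {real k<..} \<inter> space (\<nu> \<omega>) \<inter> T = A k" by (auto simp: A_def)
    ultimately show ?thesis using Ts by (metis sets.Int)
  qed
  have "(\<lambda>k. emeasure (\<nu> \<omega>) (A k)) \<longlonglongrightarrow> emeasure (\<nu> \<omega>) (\<Inter>k. A k)"
  proof (rule Lim_emeasure_decseq)
    show "range A \<subseteq> sets (\<nu> \<omega>)" using A by auto
    show "decseq A" by (auto simp: decseq_def A_def intro: le_less_trans)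
    show "emeasure (\<nu> \<omega>) (A k) \<noteq> \<infinity>" for k
      using emeasure_mono[of "A k" T "\<nu> \<omega>"] Ts fin by (auto simp: A_def top_unique)
  qed
  moreover have "(\<Inter>k. A k) = {}"
  proof -
    have "\<exists>k. norm (snd z) \<le> real k" for z :: "real \<times> 'a" by (rule real_arch_simple)
    then show ?thesis by (auto simp: A_def not_less) (meson not_less)
  qed
  ultimately have "(\<lambda>k. emeasure (\<nu> \<omega>) (A k)) \<longlonglongrightarrow> 0" by simp
  then have "\<forall>\<^sub>F k in sequentially. emeasure (\<nu> \<omega>) (A k) < 1" by (rule order_tendstoD(2)) simp
  then obtain k where k: "emeasure (\<nu> \<omega>) (A k) < 1" by (auto simp: eventually_sequentially)
  have A0: "emeasure (\<nu> \<omega>) (A k) = 0"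
  proof -
    have "A k \<in> sets \<Lambda>" using A sn by simp
    from \<nu>_integer[OF \<omega> this] obtain i :: nat where i: "emeasure (\<nu> \<omega>) (A k) = of_nat i" using k by auto
    then have "of_nat i < (of_nat 1 :: ennreal)" using k by simp
    then have "i < 1" by (simp only: of_nat_less_iff)
    then show ?thesis using i by simp
  qed
  show ?thesis
    unfolding set_integrable_def
  proof (rule integrableI_bounded_set_indicator[where B = "real k"])
    show "AE z in \<nu> \<omega>. z \<in> T \<longrightarrow> norm (snd z) \<le> real k"
      by (rule AE_I[OF _ A0 A]) (auto simp: A_def)
  qed (use Ts fin sm in auto)
qed

lemma mark_int_eq:
  assumes \<omega>: "\<omega> \<in> space M" and T: "T \<in> sets \<Lambda>" and fin: "emeasure (\<nu> \<omega>) T < \<infinity>"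
  shows "(LINT z:T|\<nu> \<omega>. snd z) = mark_int T \<omega>"
proof -
  have int: "integrable (\<nu> \<omega>) (\<lambda>z. indicator T z *\<^sub>R snd z)"
    using integrable_mark[OF assms] by (simp add: set_integrable_def)
  have "(LINT z:T|\<nu> \<omega>. snd z) \<bullet> b = enn2real (\<integral>\<^sup>+z. indicator T z * ennreal (snd z \<bullet> b) \<partial>\<nu> \<omega>)
     - enn2real (\<integral>\<^sup>+z. indicator T z * ennreal (- (snd z \<bullet> b)) \<partial>\<nu> \<omega>)" for b
  proof -
    have "(LINT z:T|\<nu> \<omega>. snd z) \<bullet> b = (\<integral>z. (indicator T z *\<^sub>R snd z) \<bullet> b \<partial>\<nu> \<omega>)"
      unfolding set_lebesgue_integral_def by (rule integral_inner_left[symmetric]) (rule int)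
    also have "\<dots> = enn2real (\<integral>\<^sup>+z. ennreal ((indicator T z *\<^sub>R snd z) \<bullet> b) \<partial>\<nu> \<omega>) - enn2real (\<integral>\<^sup>+z. ennreal (- ((indicator T z *\<^sub>R snd z) \<bullet> b)) \<partial>\<nu> \<omega>)"
      by (rule real_lebesgue_integral_def) (rule integrable_inner_left[OF int])
    also have "(\<integral>\<^sup>+z. ennreal ((indicator T z *\<^sub>R snd z) \<bullet> b) \<partial>\<nu> \<omega>) = (\<integral>\<^sup>+z. indicator T z * ennreal (snd z \<bullet> b) \<partial>\<nu> \<omega>)"
      by (rule nn_integral_cong) (simp add: indicator_def)
    also have "(\<integral>\<^sup>+z. ennreal (- ((indicator T z *\<^sub>R snd z) \<bullet> b)) \<partial>\<nu> \<omega>) = (\<integral>\<^sup>+z. indicator T z * ennreal (- (snd z \<bullet> b)) \<partial>\<nu> \<omega>)"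
      by (rule nn_integral_cong) (simp add: indicator_def)
    finally show ?thesis .
  qed
  then have "(\<Sum>b\<in>Basis. ((LINT z:T|\<nu> \<omega>. snd z) \<bullet> b) *\<^sub>R b) = mark_int T \<omega>" by (simp add: mark_int_def)
  then show ?thesis by (simp add: euclidean_representation)
qed

lemma slab_sets:
  assumes "0 < e" "I \<in> sets borel" "I \<subseteq> {0..}"
  shows "I \<times> {u. e < norm u} \<in> sets \<Lambda>"
  using assms by (auto simp: sets_levy_intensity[OF sets_\<mu>] intro!: borel_Times)

lemma slab_finite:
  assumes e: "0 < e" and t: "0 \<le> t" shows "emeasure \<Lambda> ({0<..t} \<times> {u. e < norm u}) < \<infinity>"
proof -
  have "emeasure \<Lambda> ({0<..t} \<times> {u. e < norm u}) = (\<integral>\<^sup>+s. emeasure \<mu> {u. (s, u) \<in> {0<..t} \<times> {u. e < norm u}} \<partial>lborel)"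
    by (rule emeasure_levy_intensity[OF \<mu>]) (use e in \<open>auto intro!: borel_Times\<close>)
  also have "\<dots> = (\<integral>\<^sup>+s. emeasure \<mu> {u. e < norm u} * indicator {0<..t} s \<partial>lborel)"
    by (rule nn_integral_cong) (auto simp: indicator_def)
  also have "\<dots> = emeasure \<mu> {u. e < norm u} * emeasure lborel {0<..t}" by (rule nn_integral_cmult_indicator) simp
  also have "\<dots> < \<infinity>" using levy_measure_finite_away[OF \<mu> e] t by (simp add: ennreal_mult_less_top)
  finally show ?thesis .
qed

lemma cells_Union:
  assumes "0 < l" shows "(\<Union>j<n. cell l \<delta> j) = {0<..real n * l} \<times> {u. \<delta> < norm u}"
proof (induction n)
  case (Suc n)
  have "{0<..real (Suc n) * l} = {0<..real n * l} \<union> {real n * l<..real (Suc n) * l}"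
  proof -
    have "0 \<le> real n * l" "real n * l \<le> real (Suc n) * l" using assms by (auto simp: algebra_simps)
    then show ?thesis by (simp add: ivl_disj_un_two(6))
  qed
  then show ?case using Suc by (simp add: lessThan_Suc cell_def Un_commute Sigma_Un_distrib1 del: of_nat_Suc)
qed simp

section \<open>The path of the large jumps\<close>

definition jumps :: "(real \<times> 'a) set \<Rightarrow> 'w \<Rightarrow> real \<Rightarrow> 'a" where
  "jumps U \<omega> s = (LINT z:U \<inter> ({0<..s} \<times> UNIV)|\<nu> \<omega>. snd z)"

lemma slice_sets: "U \<in> sets \<Lambda> \<Longrightarrow> I \<in> sets borel \<Longrightarrow> U \<inter> (I \<times> UNIV) \<in> sets \<Lambda>"
  by (auto simp: sets_levy_intensity[OF sets_\<mu>] intro!: sets.Int borel_Times)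

text \<open>Dominated convergence, with the marks on U as integrable bound: the indicators of
  {0<..s} converge to that of {0<..t} as s decreases to t, and to that of {0<..<t} as s increases to
  t.\<close>

lemma cadlag_jumps:
  assumes \<omega>: "\<omega> \<in> space M" and U: "U \<in> sets \<Lambda>" "emeasure (\<nu> \<omega>) U < \<infinity>"
  shows "cadlag (jumps U \<omega>)"
proof -
  have sn: "sets (\<nu> \<omega>) = sets \<Lambda>" using sets_\<nu>[OF \<omega>] .
  have int: "integrable (\<nu> \<omega>) (\<lambda>z. indicator U z *\<^sub>R snd z)"
    using integrable_mark[OF \<omega> U] by (simp add: set_integrable_def)
  have sm: "snd \<in> borel_measurable (\<nu> \<omega>)" using measurable_snd_\<Lambda> by (simp add: measurable_cong_sets[OF sn refl])
  have lim: "(\<lambda>k. jumps U \<omega> (s k)) \<longlonglongrightarrow> (LINT z:U \<inter> (I \<times> UNIV)|\<nu> \<omega>. snd z)"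
    if pt: "\<And>r. r > 0 \<Longrightarrow> (\<lambda>k. indicator {0<..s k} r :: real) \<longlonglongrightarrow> indicator I r" and I: "I \<in> sets borel" "I \<subseteq> {0<..}" for s I
    unfolding jumps_def set_lebesgue_integral_def
  proof (rule integral_dominated_convergence[where w = "\<lambda>z. norm (indicator U z *\<^sub>R snd z)"])
    have m: "U \<inter> (I' \<times> UNIV) \<in> sets (\<nu> \<omega>)" if "I' \<in> sets borel" for I' using slice_sets[OF U(1) that] sn by simp
    show "(\<lambda>z. indicator (U \<inter> (I \<times> UNIV)) z *\<^sub>R snd z) \<in> borel_measurable (\<nu> \<omega>)" by (rule borel_measurable_scaleR[OF borel_measurable_indicator[OF m[OF I(1)]] sm])
    show "(\<lambda>z. indicator (U \<inter> ({0<..s k} \<times> UNIV)) z *\<^sub>R snd z) \<in> borel_measurable (\<nu> \<omega>)" for k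
      by (rule borel_measurable_scaleR[OF borel_measurable_indicator[OF m] sm]) simp
    show "integrable (\<nu> \<omega>) (\<lambda>z. norm (indicator U z *\<^sub>R snd z))" by (rule integrable_norm[OF int])
    show "AE z in \<nu> \<omega>. norm (indicator (U \<inter> ({0<..s k} \<times> UNIV)) z *\<^sub>R snd z) \<le> norm (indicator U z *\<^sub>R snd z)" for k
      by (rule AE_I2) (auto simp: indicator_def)
    show "AE z in \<nu> \<omega>. (\<lambda>k. indicator (U \<inter> ({0<..s k} \<times> UNIV)) z *\<^sub>R snd z) \<longlonglongrightarrow> indicator (U \<inter> (I \<times> UNIV)) z *\<^sub>R snd z"
    proof (rule AE_I2)
      fix z :: "real \<times> 'a"
      have e: "indicator (U \<inter> (I' \<times> UNIV)) z = (indicator U z * indicator I' (fst z) :: real)" for I'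
        by (cases z) (auto simp: indicator_def)
      show "(\<lambda>k. indicator (U \<inter> ({0<..s k} \<times> UNIV)) z *\<^sub>R snd z) \<longlonglongrightarrow> indicator (U \<inter> (I \<times> UNIV)) z *\<^sub>R snd z"
      proof (cases "fst z > 0")
        case True
        show ?thesis unfolding e by (intro tendsto_intros pt True)
      next
        case False
        then have "indicator {0<..s k} (fst z) = (0::real)" "indicator I (fst z) = (0::real)" for k using I(2) by (auto simp: indicator_def)
        then show ?thesis unfolding e by simp
      qed
    qed
  qed
  show ?thesis
    unfolding cadlag_def
  proof (intro conjI allI impI)
    fix t :: real assume t: "0 \<le> t"
    show "(jumps U \<omega> \<longlongrightarrow> jumps U \<omega> t) (at_right t)"
      unfolding tendsto_at_iff_sequentially
    proof (intro allI impI)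
      fix s :: "nat \<Rightarrow> real" assume s: "\<forall>i. s i \<in> {t<..} - {t}" "s \<longlonglongrightarrow> t"
      have "(\<lambda>k. jumps U \<omega> (s k)) \<longlonglongrightarrow> (LINT z:U \<inter> ({0<..t} \<times> UNIV)|\<nu> \<omega>. snd z)"
      proof (rule lim)
        fix r :: real assume r: "0 < r"
        show "(\<lambda>k. indicator {0<..s k} r :: real) \<longlonglongrightarrow> indicator {0<..t} r"
        proof (cases "r \<le> t")
          case True
          have "r \<le> s k" for k using s(1) True by (metis DiffD1 greaterThan_iff less_imp_le order_trans)
          then show ?thesis using True r by (simp add: indicator_def)
        next
          case False
          then have "\<forall>\<^sub>F k in sequentially. s k < r" using order_tendstoD(2)[OF s(2)] by simp
          then have "\<forall>\<^sub>F k in sequentially. indicator {0<..s k} r = (indicator {0<..t} r :: real)"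
            by (rule eventually_mono) (use False in \<open>auto simp: indicator_def\<close>)
          then show ?thesis by (rule tendsto_eventually)
        qed
      qed auto
      then show "((jumps U \<omega>) \<circ> s) \<longlonglongrightarrow> jumps U \<omega> t" by (simp add: o_def jumps_def)
    qed
  next
    fix t :: real assume t: "0 < t"
    show "\<exists>l. (jumps U \<omega> \<longlongrightarrow> l) (at_left t)"
      unfolding tendsto_at_iff_sequentially
    proof (intro exI allI impI)
      fix s :: "nat \<Rightarrow> real" assume s: "\<forall>i. s i \<in> {..<t} - {t}" "s \<longlonglongrightarrow> t"
      have "(\<lambda>k. jumps U \<omega> (s k)) \<longlonglongrightarrow> (LINT z:U \<inter> ({0<..<t} \<times> UNIV)|\<nu> \<omega>. snd z)"
      proof (rule lim)
        fix r :: real assume r: "0 < r"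
        show "(\<lambda>k. indicator {0<..s k} r :: real) \<longlonglongrightarrow> indicator {0<..<t} r"
        proof (cases "r < t")
          case False
          have "\<not> r \<le> s k" for k using s(1) False by (metis DiffD1 lessThan_iff not_less order_trans)
          then show ?thesis using False r by (simp add: indicator_def)
        next
          case True
          then have "\<forall>\<^sub>F k in sequentially. r < s k" using order_tendstoD(1)[OF s(2)] by simp
          then have "\<forall>\<^sub>F k in sequentially. indicator {0<..s k} r = (indicator {0<..<t} r :: real)"
            by (rule eventually_mono) (use True r in \<open>auto simp: indicator_def\<close>)
          then show ?thesis by (rule tendsto_eventually)
        qed
      qed auto
      then show "((jumps U \<omega>) \<circ> s) \<longlonglongrightarrow> (LINT z:U \<inter> ({0<..<t} \<times> UNIV)|\<nu> \<omega>. snd z)" by (simp add: o_def)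
    qed
  qed
qed

text \<open>On a cell with count 1 the point measure is a point mass at the atom. A cell with count
  0 adds nothing to the integral, and its default mark 0 adds nothing to the sum.\<close>

lemma jumps_cells:
  fixes n :: nat
  assumes l: "0 < l" and \<delta>: "0 < \<delta>" and \<omega>: "\<omega> \<in> space M"
    and single: "\<And>j. j < n \<Longrightarrow> emeasure (\<nu> \<omega>) (cell l \<delta> j) = 0 \<or> emeasure (\<nu> \<omega>) (cell l \<delta> j) = 1"
  shows "jumps (\<Union>j<n. cell l \<delta> j) \<omega> s
    = (\<Sum>j<n. if fst (atom (cell l \<delta> j) \<omega>) \<le> s then snd (atom (cell l \<delta> j) \<omega>) else 0)"
proof -
  let ?C = "cell l \<delta>" and ?T = "{0<..s} \<times> (UNIV :: 'a set)"
  have sn: "sets (\<nu> \<omega>) = sets \<Lambda>" using sets_\<nu>[OF \<omega>] .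
  have cs: "?C j \<in> sets \<Lambda>" for j by (rule cell_sets[OF l \<delta>])
  have ts: "?C j \<inter> ?T \<in> sets \<Lambda>" for j by (rule slice_sets[OF cs]) simp
  have fin: "emeasure (\<nu> \<omega>) (?C j \<inter> ?T) < \<infinity>" if "j < n" for j
  proof -
    have "emeasure (\<nu> \<omega>) (?C j \<inter> ?T) \<le> emeasure (\<nu> \<omega>) (?C j)" by (rule emeasure_mono) (use cs sn in auto)
    also have "\<dots> < \<infinity>" using single[OF that] by auto
    finally show ?thesis .
  qed
  have "jumps (\<Union>j<n. ?C j) \<omega> s = (\<integral>z. (\<Sum>j<n. indicator (?C j \<inter> ?T) z *\<^sub>R snd z) \<partial>\<nu> \<omega>)"
    unfolding jumps_def set_lebesgue_integral_def
  proof (rule Bochner_Integration.integral_cong[OF refl])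
    fix z :: "real \<times> 'a"
    have "indicator (\<Union>j<n. ?C j) z = (\<Sum>j<n. indicator (?C j) z :: real)"
      by (rule indicator_UN_disjoint[OF finite_lessThan disjoint_family_on_mono[OF subset_UNIV disjoint_cells[OF l \<delta>]]])
    then have "indicator ((\<Union>j<n. ?C j) \<inter> ?T) z = (\<Sum>j<n. indicator (?C j \<inter> ?T) z :: real)"
      by (simp add: indicator_inter_arith sum_distrib_right)
    then show "indicator ((\<Union>j<n. ?C j) \<inter> ?T) z *\<^sub>R snd z = (\<Sum>j<n. indicator (?C j \<inter> ?T) z *\<^sub>R snd z)"
      by (simp add: scaleR_left.sum)
  qed
  also have "\<dots> = (\<Sum>j<n. LINT z:?C j \<inter> ?T|\<nu> \<omega>. snd z)"
    unfolding set_lebesgue_integral_def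
    by (rule Bochner_Integration.integral_sum)
       (use integrable_mark[OF \<omega> ts fin] in \<open>auto simp: set_integrable_def\<close>)
  also have "\<dots> = (\<Sum>j<n. if fst (atom (?C j) \<omega>) \<le> s then snd (atom (?C j) \<omega>) else 0)"
  proof (rule sum.cong[OF refl])
    fix j assume "j \<in> {..<n}"
    then have j: "j < n" by simp
    show "(LINT z:?C j \<inter> ?T|\<nu> \<omega>. snd z) = (if fst (atom (?C j) \<omega>) \<le> s then snd (atom (?C j) \<omega>) else 0)"
    proof (cases "emeasure (\<nu> \<omega>) (?C j) = 1")
      case True
      let ?\<xi> = "atom (?C j) \<omega>"
      have \<xi>: "?\<xi> \<in> ?C j" by (rule atom_single(1)[OF \<omega> cs True])
      have xs: "{?\<xi>} \<in> sets \<Lambda>" using \<xi> cell_subset[OF l \<delta>, of j] by (auto simp: sets_levy_intensity[OF sets_\<mu>])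
      have nul: "emeasure (\<nu> \<omega>) (?C j - {?\<xi>}) = 0"
      proof -
        have "?C j - {?\<xi>} \<in> sets \<Lambda>" using cs xs by (intro sets.Diff)
        from atom_single(2)[OF \<omega> cs True this] show ?thesis by (simp add: indicator_def)
      qed
      have one: "emeasure (\<nu> \<omega>) {?\<xi>} = 1"
        using atom_single(2)[OF \<omega> cs True xs] \<xi> by (simp add: indicator_def)
      have pos: "0 < fst ?\<xi>"
      proof -
        have "0 \<le> real j * l" using l by simp
        then show ?thesis using \<xi> by (cases ?\<xi>) (auto simp: cell_def simp del: of_nat_Suc)
      qed
      have "?C j - {?\<xi>} \<in> sets (\<nu> \<omega>)" unfolding sn using cs xs by (intro sets.Diff)
      then have "?C j - {?\<xi>} \<in> null_sets (\<nu> \<omega>)" using nul by (simp add: null_setsI)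
      then have "AE z in \<nu> \<omega>. z \<notin> ?C j - {?\<xi>}" by (rule AE_not_in)
      then have ae: "AE z in \<nu> \<omega>. indicator (?C j \<inter> ?T) z *\<^sub>R snd z = indicator {?\<xi>} z *\<^sub>R (indicator ?T ?\<xi> *\<^sub>R snd ?\<xi>)"
      proof eventually_elim
        case (elim z)
        show ?case
        proof (cases "z = ?\<xi>")
          case True
          have "indicator (?C j \<inter> ?T) ?\<xi> = (indicator ?T ?\<xi> :: real)" using \<xi> by (simp only: indicator_inter_arith indicator_simps mult_1_left)
          moreover have "indicator {?\<xi>} ?\<xi> = (1::real)" by simp
          ultimately show ?thesis by (simp only: True scaleR_one)
        next
          case False
          then have "z \<notin> ?C j" using elim by blast
          then have "indicator (?C j \<inter> ?T) z = (0::real)" "indicator {?\<xi>} z = (0::real)" using False by (simp_all only: indicator_eq_0_iff) blast+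
          then show ?thesis by (simp only: scaleR_zero_left)
        qed
      qed
      have sm: "snd \<in> borel_measurable (\<nu> \<omega>)" using measurable_snd_\<Lambda> by (simp add: measurable_cong_sets[OF sn refl])
      have "(LINT z:?C j \<inter> ?T|\<nu> \<omega>. snd z) = (\<integral>z. indicator {?\<xi>} z *\<^sub>R (indicator ?T ?\<xi> *\<^sub>R snd ?\<xi>) \<partial>\<nu> \<omega>)"
        unfolding set_lebesgue_integral_def
      proof (rule integral_cong_AE[OF _ _ ae])
        have t': "?C j \<inter> ?T \<in> sets (\<nu> \<omega>)" using ts[of j] sn by simp
        have x': "{?\<xi>} \<in> sets (\<nu> \<omega>)" using xs sn by simp
        show "(\<lambda>z. indicator (?C j \<inter> ?T) z *\<^sub>R snd z) \<in> borel_measurable (\<nu> \<omega>)"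
          by (rule borel_measurable_scaleR[OF borel_measurable_indicator[OF t'] sm])
        show "(\<lambda>z. indicator {?\<xi>} z *\<^sub>R (indicator ?T ?\<xi> *\<^sub>R snd ?\<xi>)) \<in> borel_measurable (\<nu> \<omega>)"
          by (rule borel_measurable_scaleR[OF borel_measurable_indicator[OF x'] borel_measurable_const])
      qed
      also have "\<dots> = (indicator ?T ?\<xi> *\<^sub>R snd ?\<xi>)"
        using one xs sn by (simp add: measure_def)
      finally show ?thesis using pos by (cases ?\<xi>) (auto simp: indicator_def)
    next
      case False
      then have z: "emeasure (\<nu> \<omega>) (?C j) = 0" using single[OF j] by blast
      have "AE z in \<nu> \<omega>. z \<notin> ?C j" by (rule AE_not_in) (use z cs sn in auto)
      then have "(LINT z:?C j \<inter> ?T|\<nu> \<omega>. snd z) = 0"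
        unfolding set_lebesgue_integral_def by (intro integral_eq_zero_AE) (auto elim!: eventually_mono)
      then show ?thesis using False by (simp add: atom_def)
    qed
  qed
  finally show ?thesis .
qed

end

context jump_noise begin

section \<open>Splitting the Levy process into the jumps of the cells and a frozen
  background\<close>

lemma space_\<Lambda>: "space \<Lambda> = {0..} \<times> (- {0})"
  using sets_eq_imp_space_eq[OF sets_\<mu>] by (simp add: levy_intensity_def space_pair_measure space_restrict_space)

text \<open>The compensated integral is a mean square limit of sums over the jumps above a
  threshold, with deterministic compensators. Taking the jumps in U out of these sums leaves
  functions of the point measure off U, and along a subsequence they converge almost surely.\<close>

lemma past_version:
  assumes lp: "levy_process M \<mu> \<nu> Y" and \<delta>: "0 < \<delta>" "\<delta> < 1" and t: "0 \<le> t"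
    and U: "U = {0<..h} \<times> {u. \<delta> < norm u}"
  shows "\<exists>R\<in>borel_measurable (past U). AE \<omega> in M. R \<omega> = Y t \<omega> - Y 0 \<omega> - jumps U \<omega> t"
proof -
  define f :: "real \<times> 'a \<Rightarrow> 'a" where "f z = indicator ({0<..t} \<times> {u. norm u \<le> 1}) z *\<^sub>R snd z" for z
  obtain Z where Z: "has_compensated_integral M \<Lambda> \<nu> f Z"
    and YZ: "AE \<omega> in M. Y t \<omega> = Y 0 \<omega> + (LINT z:{0<..t} \<times> {u. norm u > 1}|\<nu> \<omega>. snd z) + Z \<omega>"
    using lp t unfolding levy_process_def f_def[abs_def] by blast
  have [measurable]: "Z \<in> borel_measurable M" using Z by (simp add: has_compensated_integral_def)
  \<comment> \<open>Thresholds below both \<delta> and 1, so that the region \<open>T k\<close>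
    contains the jumps of U up to time t as well as all jumps above 1 up to t.\<close>
  define e where "e k = \<delta> / real (k + 2)" for k :: nat
  have e: "0 < e k" "e k < \<delta>" "e k < 1" for k
  proof -
    show "0 < e k" using \<delta> by (simp add: e_def)
    have "\<delta> / real (k + 2) < \<delta> / 1" using \<delta> by (intro divide_strict_left_mono) auto
    then show "e k < \<delta>" by (simp add: e_def)
    then show "e k < 1" using \<delta> by simp
  qed
  have fe: "filterlim e (at_right 0) sequentially"
    unfolding filterlim_at
  proof (intro conjI always_eventually allI)
    show "e k \<in> {0<..}" "e k \<noteq> 0" for k using e(1)[of k] by auto
    have "(\<lambda>k. \<delta> * inverse (real (Suc (k + 1)))) \<longlonglongrightarrow> \<delta> * 0"
      by (intro tendsto_mult tendsto_const LIMSEQ_ignore_initial_segment[OF LIMSEQ_inverse_real_of_nat, of 1])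
    then show "e \<longlonglongrightarrow> 0" unfolding e_def[abs_def] divide_inverse by (simp add: algebra_simps)
  qed
  define S where "S k = {0<..t} \<times> {u::'a. e k < norm u \<and> norm u \<le> 1}" for k
  define T where "T k = {0<..t} \<times> {u::'a. e k < norm u}" for k
  define big where "big = {0<..t} \<times> {u::'a. 1 < norm u}"
  have Seq: "{z \<in> space \<Lambda>. e k < norm (f z)} = S k" for k
    using e(1)[of k] by (auto simp: space_\<Lambda> S_def f_def indicator_def split: if_splits)
  have T_sets: "T k \<in> sets \<Lambda>" for k unfolding T_def by (rule slab_sets) (use e in auto)
  have big_sets: "big \<in> sets \<Lambda>" unfolding big_def by (rule slab_sets) auto
  have STb: "S k = T k - big" for k by (auto simp: S_def T_def big_def)
  have S_sets: "S k \<in> sets \<Lambda>" for k unfolding STb using T_sets big_sets by auto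
  have U_sets: "U \<in> sets \<Lambda>" unfolding U by (rule slab_sets) (use \<delta> in auto)
  have Ut_sets: "U \<inter> ({0<..t} \<times> UNIV) \<in> sets \<Lambda>" by (rule slice_sets[OF U_sets]) simp
  define b where "b k = (LINT z:S k|\<Lambda>. f z)" for k
  define V where "V k = mark_int (S k)" for k
  have [measurable]: "V k \<in> borel_measurable M" for k
    unfolding V_def by (rule measurable_past[where U = "{}"]) (rule measurable_mark_int[OF S_sets], simp)
  have fin: "AE \<omega> in M. \<forall>k. emeasure (\<nu> \<omega>) (T k) < \<infinity>"
    unfolding AE_all_countable T_def by (intro allI AE_finite_\<nu> slab_sets slab_finite t e) auto
  have sub_fin: "emeasure (\<nu> \<omega>) X < \<infinity>" if "\<omega> \<in> space M" "X \<subseteq> T k" "emeasure (\<nu> \<omega>) (T k) < \<infinity>" for \<omega> X k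
    using emeasure_mono[OF that(2), of "\<nu> \<omega>"] T_sets[of k] sets_\<nu>[OF that(1)] that(3) by (auto intro: le_less_trans)
  define q where "q k \<omega> = (norm (Z \<omega> - (V k \<omega> - b k)))\<^sup>2" for k \<omega>
  have [measurable]: "q k \<in> borel_measurable M" for k unfolding q_def[abs_def] by measurable
  define F where "F k = (\<integral>\<^sup>+\<omega>. ennreal (q k \<omega>) \<partial>M)" for k
  have F0: "F \<longlonglongrightarrow> 0"
  proof -
    have "((\<lambda>\<epsilon>. \<integral>\<^sup>+\<omega>. ennreal ((norm (Z \<omega> - ((LINT z:{z \<in> space \<Lambda>. \<epsilon> < norm (f z)}|\<nu> \<omega>. f z)
           - (LINT z:{z \<in> space \<Lambda>. \<epsilon> < norm (f z)}|\<Lambda>. f z))))\<^sup>2) \<partial>M) \<longlongrightarrow> 0) (at_right 0)"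
      using Z by (simp add: has_compensated_integral_def)
    from filterlim_compose[OF this fe]
    have "(\<lambda>k. \<integral>\<^sup>+\<omega>. ennreal ((norm (Z \<omega> - ((LINT z:S k|\<nu> \<omega>. f z) - b k)))\<^sup>2) \<partial>M) \<longlonglongrightarrow> 0"
      by (simp only: Seq b_def)
    moreover have "(\<integral>\<^sup>+\<omega>. ennreal ((norm (Z \<omega> - ((LINT z:S k|\<nu> \<omega>. f z) - b k)))\<^sup>2) \<partial>M) = F k" for k
      unfolding F_def
    proof (rule nn_integral_cong_AE)
      show "AE \<omega> in M. ennreal ((norm (Z \<omega> - ((LINT z:S k|\<nu> \<omega>. f z) - b k)))\<^sup>2) = ennreal (q k \<omega>)"
        using fin AE_space
      proof eventually_elim
        case (elim \<omega>)
        have "S k \<subseteq> T k" unfolding STb by blast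
        then have "emeasure (\<nu> \<omega>) (S k) < \<infinity>" using sub_fin[OF elim(2)] elim(1) by blast
        from mark_int_eq[OF elim(2) S_sets this] have "(LINT z:S k|\<nu> \<omega>. snd z) = V k \<omega>" by (simp add: V_def)
        moreover have "(LINT z:S k|\<nu> \<omega>. f z) = (LINT z:S k|\<nu> \<omega>. snd z)"
          unfolding set_lebesgue_integral_def
          by (rule Bochner_Integration.integral_cong[OF refl]) (auto simp: indicator_def f_def S_def)
        ultimately show ?case by (simp add: q_def)
      qed
    qed
    ultimately show ?thesis by simp
  qed
  have "\<forall>\<^sub>F k in sequentially. F k < 1" using order_tendstoD(2)[OF F0, of 1] by simp
  \<comment> \<open>The expectations are known to be finite only once they have dropped below 1, so
    the sequence is started at N.\<close>
  then obtain N where N: "\<And>k. N \<le> k \<Longrightarrow> F k < 1" by (auto simp: eventually_sequentially)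
  have q0: "0 \<le> q k \<omega>" for k \<omega> by (simp add: q_def)
  have "\<exists>r. strict_mono r \<and> (AE \<omega> in M. (\<lambda>k. q (r k + N) \<omega>) \<longlonglongrightarrow> 0)"
  proof (rule tendsto_L1_AE_subseq)
    show "integrable M (q (k + N))" for k
      by (rule integrableI_nonneg) (use q0 N[of "k + N"] in \<open>auto simp: F_def intro: less_trans[OF _ ennreal_one_less_top]\<close>)
    have "(LINT \<omega>|M. norm (q (k + N) \<omega>)) = enn2real (F (k + N))" for k
      using q0 by (simp add: F_def integral_eq_nn_integral)
    moreover have "(\<lambda>k. enn2real (F (k + N))) \<longlonglongrightarrow> 0"
      using LIMSEQ_ignore_initial_segment[OF F0, of N] by (intro tendsto_enn2real) auto
    ultimately show "(\<lambda>k. LINT \<omega>|M. norm (q (k + N) \<omega>)) \<longlonglongrightarrow> 0" by simp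
  qed
  then obtain r where r: "AE \<omega> in M. (\<lambda>k. q (r k + N) \<omega>) \<longlonglongrightarrow> 0" by blast
  define m where "m k = r k + N" for k
  \<comment> \<open>A limit of functions measurable off U is measurable off U on the whole space;
    only its value is identified almost surely.\<close>
  define R where "R \<omega> = lim (\<lambda>k. mark_int (T (m k) - U) \<omega> - b (m k))" for \<omega>
  have "R \<in> borel_measurable (past U)"
    unfolding R_def[abs_def]
  proof (rule borel_measurable_lim_metric)
    fix k
    have "T (m k) - U \<in> sets \<Lambda>" using T_sets U_sets by auto
    then have "mark_int (T (m k) - U) \<in> borel_measurable (past U)" by (rule measurable_mark_int) auto
    then show "(\<lambda>\<omega>. mark_int (T (m k) - U) \<omega> - b (m k)) \<in> borel_measurable (past U)" by simp
  qed
  moreover have "AE \<omega> in M. R \<omega> = Y t \<omega> - Y 0 \<omega> - jumps U \<omega> t"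
    using YZ r fin AE_space
  proof eventually_elim
    case (elim \<omega>)
    have "(\<lambda>k. norm (Z \<omega> - (V (m k) \<omega> - b (m k)))) \<longlonglongrightarrow> 0"
      using tendsto_real_sqrt[OF elim(2)] by (simp add: q_def m_def)
    then have "(\<lambda>k. Z \<omega> - (Z \<omega> - (V (m k) \<omega> - b (m k)))) \<longlonglongrightarrow> Z \<omega> - 0"
      by (intro tendsto_diff tendsto_const) (simp add: tendsto_norm_zero_iff)
    then have VZ: "(\<lambda>k. V (m k) \<omega> - b (m k)) \<longlonglongrightarrow> Z \<omega>" by simp
    \<comment> \<open>The jumps in \<open>T k\<close> are summed in two ways: above 1 and at most 1
      in norm, inside U and outside U.\<close>
    have key: "mark_int (T k - U) \<omega> = (LINT z:big|\<nu> \<omega>. snd z) + V k \<omega> - jumps U \<omega> t" for k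
    proof -
      have Tf: "emeasure (\<nu> \<omega>) (T k) < \<infinity>" using elim(3) by blast
      have int: "set_integrable (\<nu> \<omega>) X snd" if "X \<in> sets \<Lambda>" "X \<subseteq> T k" for X
        by (rule integrable_mark[OF elim(4) that(1) sub_fin[OF elim(4) that(2) Tf]])
      have sb: "S k \<subseteq> T k" "big \<subseteq> T k" "T k - U \<subseteq> T k" "U \<inter> ({0<..t} \<times> UNIV) \<subseteq> T k"
        using e(2,3)[of k] by (auto simp: STb T_def big_def U)
      have TU: "T k - U \<in> sets \<Lambda>" using T_sets U_sets by auto
      have "(LINT z:big \<union> S k|\<nu> \<omega>. snd z) = (LINT z:big|\<nu> \<omega>. snd z) + (LINT z:S k|\<nu> \<omega>. snd z)"
        by (rule set_integral_Un) (use int big_sets S_sets sb in \<open>auto simp: STb\<close>)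
      moreover have "big \<union> S k = T k" using sb(2) by (auto simp: STb)
      moreover have "(LINT z:(U \<inter> ({0<..t} \<times> UNIV)) \<union> (T k - U)|\<nu> \<omega>. snd z) = jumps U \<omega> t + (LINT z:T k - U|\<nu> \<omega>. snd z)"
        unfolding jumps_def by (rule set_integral_Un) (use int Ut_sets TU sb in auto)
      moreover have "(U \<inter> ({0<..t} \<times> UNIV)) \<union> (T k - U) = T k" using sb(4) by (auto simp: T_def)
      moreover have "(LINT z:T k - U|\<nu> \<omega>. snd z) = mark_int (T k - U) \<omega>"
        by (rule mark_int_eq[OF elim(4) TU sub_fin[OF elim(4) sb(3) Tf]])
      moreover have "(LINT z:S k|\<nu> \<omega>. snd z) = V k \<omega>"
        unfolding V_def by (rule mark_int_eq[OF elim(4) S_sets sub_fin[OF elim(4) sb(1) Tf]])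
      ultimately show ?thesis by (simp add: algebra_simps)
    qed
    have "(\<lambda>k. ((LINT z:big|\<nu> \<omega>. snd z) - jumps U \<omega> t) + (V (m k) \<omega> - b (m k))) \<longlonglongrightarrow> ((LINT z:big|\<nu> \<omega>. snd z) - jumps U \<omega> t) + Z \<omega>"
      by (intro tendsto_add tendsto_const VZ)
    then have "(\<lambda>k. mark_int (T (m k) - U) \<omega> - b (m k)) \<longlonglongrightarrow> ((LINT z:big|\<nu> \<omega>. snd z) - jumps U \<omega> t) + Z \<omega>"
      by (simp add: key algebra_simps)
    then have "R \<omega> = ((LINT z:big|\<nu> \<omega>. snd z) - jumps U \<omega> t) + Z \<omega>" unfolding R_def by (rule limI)
    then show ?case using elim(1) by (simp add: big_def algebra_simps)
  qed
  ultimately show ?thesis by blast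
qed

text \<open>The versions at single times are joined into one path, jointly measurable in \<omega>
  and s, by right limits along dyadic times. Almost surely this changes nothing, since Y and the
  path of large jumps are cadlag.\<close>

lemma noise_representation:
  fixes n :: nat
  assumes lp: "levy_process M \<mu> \<nu> Y" and l: "0 < l" and \<delta>: "0 < \<delta>" "\<delta> < 1"
  defines "U \<equiv> \<Union>j<n. cell l \<delta> j"
  shows "\<exists>g. (\<lambda>(\<omega>, s). g \<omega> s) \<in> borel_measurable (past U \<Otimes>\<^sub>M borel) \<and>
    (AE \<omega> in M. cadlag (g \<omega>) \<and> ((\<forall>j<n. emeasure (\<nu> \<omega>) (cell l \<delta> j) = 0 \<or> emeasure (\<nu> \<omega>) (cell l \<delta> j) = 1) \<longrightarrow>
      (\<forall>s\<ge>0. Y s \<omega> - Y 0 \<omega> = noise (g \<omega>) n (\<lambda>j. atom (cell l \<delta> j) \<omega>) s)))"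
proof -
  have Ueq: "U = {0<..real n * l} \<times> {u. \<delta> < norm u}" unfolding U_def by (rule cells_Union[OF l])
  have U_sets: "U \<in> sets \<Lambda>" unfolding Ueq by (rule slab_sets) (use \<delta> in auto)
  have "\<forall>t. \<exists>R. 0 \<le> t \<longrightarrow> R \<in> borel_measurable (past U) \<and> (AE \<omega> in M. R \<omega> = Y t \<omega> - Y 0 \<omega> - jumps U \<omega> t)"
    using past_version[OF lp \<delta> _ Ueq] by blast
  then obtain R where R: "\<And>t. 0 \<le> t \<Longrightarrow> R t \<in> borel_measurable (past U)"
    "\<And>t. 0 \<le> t \<Longrightarrow> AE \<omega> in M. R t \<omega> = Y t \<omega> - Y 0 \<omega> - jumps U \<omega> t" by metis
  define g where "g \<omega> s = lim (\<lambda>k. R (dyadic_above k s) \<omega>)" for \<omega> s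
  have "(\<lambda>p. g (fst p) (snd p)) \<in> borel_measurable (past U \<Otimes>\<^sub>M borel)"
    unfolding g_def
  proof (rule borel_measurable_lim_metric)
    fix k
    have "(\<lambda>p. (\<lambda>i p. R (real (i + 1) / 2 ^ k) (fst p)) (nat \<lfloor>2 ^ k * snd p\<rfloor>) p) \<in> borel_measurable (past U \<Otimes>\<^sub>M (borel :: real measure))"
    proof (rule measurable_compose_countable[where f = "\<lambda>i p. R (real (i + 1) / 2 ^ k) (fst p)" and g = "\<lambda>p. nat \<lfloor>2 ^ k * snd p\<rfloor>"])
      fix i :: nat
      show "(\<lambda>p. R (real (i + 1) / 2 ^ k) (fst p)) \<in> borel_measurable (past U \<Otimes>\<^sub>M (borel :: real measure))"
        by (rule measurable_compose[OF measurable_fst R(1)]) simp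
    next
      show "(\<lambda>p. nat \<lfloor>2 ^ k * snd p\<rfloor>) \<in> past U \<Otimes>\<^sub>M (borel :: real measure) \<rightarrow>\<^sub>M count_space UNIV"
        by measurable
    qed
    then show "(\<lambda>p. R (dyadic_above k (snd p)) (fst p)) \<in> borel_measurable (past U \<Otimes>\<^sub>M borel)"
      by (simp add: dyadic_above_def)
  qed
  then have gm: "(\<lambda>(\<omega>, s). g \<omega> s) \<in> borel_measurable (past U \<Otimes>\<^sub>M borel)" by (simp add: case_prod_unfold)
  have dy: "AE \<omega> in M. \<forall>k i. R (real (i + 1) / 2 ^ k) \<omega> = Y (real (i + 1) / 2 ^ k) \<omega> - Y 0 \<omega> - jumps U \<omega> (real (i + 1) / 2 ^ k)"
    unfolding AE_all_countable by (intro allI R(2)) simp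
  have cY: "AE \<omega> in M. cadlag (\<lambda>t. Y t \<omega>)" using lp by (simp add: levy_process_def)
  have Uf: "AE \<omega> in M. emeasure (\<nu> \<omega>) U < \<infinity>"
    unfolding Ueq by (intro AE_finite_\<nu> slab_sets slab_finite) (use \<delta> l in auto)
  have "AE \<omega> in M. cadlag (g \<omega>) \<and> ((\<forall>j<n. emeasure (\<nu> \<omega>) (cell l \<delta> j) = 0 \<or> emeasure (\<nu> \<omega>) (cell l \<delta> j) = 1) \<longrightarrow>
      (\<forall>s\<ge>0. Y s \<omega> - Y 0 \<omega> = noise (g \<omega>) n (\<lambda>j. atom (cell l \<delta> j) \<omega>) s))"
    using dy cY Uf AE_space
  proof eventually_elim
    case (elim \<omega>)
    let ?R = "\<lambda>s. Y s \<omega> - Y 0 \<omega> - jumps U \<omega> s"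
    have cR: "cadlag ?R"
    proof -
      have cJ: "cadlag (jumps U \<omega>)" by (rule cadlag_jumps[OF elim(4) U_sets elim(3)])
      have "cadlag (\<lambda>s. - Y 0 \<omega> - jumps U \<omega> s)"
        unfolding cadlag_def
      proof (intro conjI allI impI)
        fix t :: real assume "0 \<le> t"
        then show "((\<lambda>s. - Y 0 \<omega> - jumps U \<omega> s) \<longlongrightarrow> - Y 0 \<omega> - jumps U \<omega> t) (at_right t)"
          using cJ by (intro tendsto_diff tendsto_const) (simp add: cadlag_def)
      next
        fix t :: real assume "0 < t"
        then obtain z where "(jumps U \<omega> \<longlongrightarrow> z) (at_left t)" using cJ unfolding cadlag_def by blast
        then have "((\<lambda>s. - Y 0 \<omega> - jumps U \<omega> s) \<longlongrightarrow> - Y 0 \<omega> - z) (at_left t)" by (intro tendsto_diff tendsto_const)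
        then show "\<exists>z. ((\<lambda>s. - Y 0 \<omega> - jumps U \<omega> s) \<longlongrightarrow> z) (at_left t)" ..
      qed
      from cadlag_add[OF elim(2) this] show ?thesis by (simp add: algebra_simps)
    qed
    have gR: "?R s = g \<omega> s" if s: "0 \<le> s" for s
    proof -
      have "(?R \<longlongrightarrow> ?R s) (at_right s)" using cR s by (simp add: cadlag_def)
      from filterlim_compose[OF this filterlim_dyadic_above[OF s]]
      have "(\<lambda>k. ?R (dyadic_above k s)) \<longlonglongrightarrow> ?R s" .
      moreover have "?R (dyadic_above k s) = R (dyadic_above k s) \<omega>" for k
        using elim(1) unfolding dyadic_above_def by simp
      ultimately have "(\<lambda>k. R (dyadic_above k s) \<omega>) \<longlonglongrightarrow> ?R s" by simp
      then show ?thesis unfolding g_def by (rule limI[symmetric])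
    qed
    show ?case
    proof (intro conjI impI allI)
      show "cadlag (g \<omega>)" by (rule cadlag_cong[OF gR cR])
      fix s :: real assume single: "\<forall>j<n. emeasure (\<nu> \<omega>) (cell l \<delta> j) = 0 \<or> emeasure (\<nu> \<omega>) (cell l \<delta> j) = 1" and s: "0 \<le> s"
      have "jumps U \<omega> s = (\<Sum>j<n. if fst (atom (cell l \<delta> j) \<omega>) \<le> s then snd (atom (cell l \<delta> j) \<omega>) else 0)"
        unfolding U_def by (rule jumps_cells[OF l \<delta>(1) elim(4)]) (use single in blast)
      then show "Y s \<omega> - Y 0 \<omega> = noise (g \<omega>) n (\<lambda>j. atom (cell l \<delta> j) \<omega>) s"
        using gR[OF s] by (simp add: noise_def algebra_simps)
    qed
  qed
  then show ?thesis using gm by blast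
qed

end

section \<open>Absolute continuity\<close>

text \<open>Compactness turns the pointwise nondegeneracy into a uniform one for the jumps of size
  above some \<open>\<delta>\<close>, which are the ones that occur at finite rate.\<close>

lemma nondegeneracy_uniform:
  fixes b :: "'a::euclidean_space \<Rightarrow> 'a" and c :: real
  assumes \<mu>: "levy_measure \<mu>" and b: "continuous_on UNIV b" and S: "compact S"
    and inf: "\<And>x v. x \<in> S \<Longrightarrow> v \<noteq> 0 \<Longrightarrow> emeasure \<mu> {u. (b (x + u) - b x) \<bullet> v \<noteq> 0} = \<infinity>"
  shows "\<exists>\<delta>. 0 < \<delta> \<and> \<delta> < 1 \<and> (\<forall>x\<in>S. \<forall>v. v \<noteq> 0 \<longrightarrow>
    ennreal c \<le> emeasure \<mu> ({u. (b (x + u) - b x) \<bullet> v \<noteq> 0} \<inter> {u. \<delta> < norm u}))"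
proof (rule ccontr)
  assume neg: "\<not> ?thesis"
  have s\<mu>[measurable_cong]: "sets \<mu> = sets borel" using \<mu> by (simp add: levy_measure_def)
  have [measurable]: "b \<in> borel_measurable borel" by (rule borel_measurable_continuous_onI[OF b])
  define E where "E x v = {u. (b (x + u) - b x) \<bullet> v \<noteq> 0}" for x v
  define \<delta> where "\<delta> k = 1 / real (k + 2)" for k
  have \<delta>: "0 < \<delta> k" "\<delta> k < 1" for k by (auto simp: \<delta>_def)
  have anti: "\<delta> k \<le> \<delta> m" if "m \<le> k" for k m using that by (simp add: \<delta>_def frac_le)
  have sE[measurable]: "E x v \<in> sets \<mu>" for x v
  proof -
    have "{u \<in> space borel. (b (x + u) - b x) \<bullet> v \<noteq> 0} \<in> sets borel" by measurable
    then show ?thesis by (simp add: E_def s\<mu>)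
  qed
  have sD[measurable]: "{u. d < norm u} \<in> sets \<mu>" for d by (simp add: s\<mu>)
  \<comment> \<open>The condition depends only on the direction of v, so v is normalized to the
    compact unit sphere.\<close>
  have "\<exists>p. p \<in> S \<times> sphere 0 1 \<and> emeasure \<mu> (E (fst p) (snd p) \<inter> {u. \<delta> k < norm u}) < ennreal c" for k
  proof -
    obtain x v where xv: "x \<in> S" "v \<noteq> 0" "emeasure \<mu> (E x v \<inter> {u. \<delta> k < norm u}) < ennreal c"
      using neg \<delta>[of k] unfolding E_def by (auto simp: not_le)
    have "E x (sgn v) = E x v" using xv(2) by (auto simp: E_def sgn_div_norm)
    then show ?thesis using xv by (intro exI[of _ "(x, sgn v)"]) (simp add: norm_sgn)
  qed
  then obtain p where p: "\<And>k. p k \<in> S \<times> sphere 0 1"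
    "\<And>k. emeasure \<mu> (E (fst (p k)) (snd (p k)) \<inter> {u. \<delta> k < norm u}) < ennreal c" by metis
  have "compact (S \<times> sphere (0::'a) 1)" by (intro compact_Times S compact_sphere)
  then obtain q r where q: "q \<in> S \<times> sphere 0 1" and r: "strict_mono r" and lim: "(p \<circ> r) \<longlonglongrightarrow> q"
    using p(1) unfolding compact_def by metis
  obtain x v where xv: "q = (x, v)" "x \<in> S" "norm v = 1" using q by (cases q) auto
  have lx: "(\<lambda>k. fst (p (r k))) \<longlonglongrightarrow> x" and lv: "(\<lambda>k. snd (p (r k))) \<longlonglongrightarrow> v"
    using tendsto_fst[OF lim] tendsto_snd[OF lim] xv(1) by (simp_all add: o_def)
  \<comment> \<open>Fatou's lemma: being nonzero is an open condition, so the mass is lower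
    semicontinuous in (x, v). The limit point inherits the bound c at every threshold, and therefore
    for the total mass.\<close>
  have le: "emeasure \<mu> (E x v \<inter> {u. \<delta> m < norm u}) \<le> ennreal c" for m
  proof -
    let ?D = "{u. \<delta> m < norm u}" and ?X = "\<lambda>k. fst (p (r k))" and ?V = "\<lambda>k. snd (p (r k))"
    have "emeasure \<mu> (E x v \<inter> ?D) = (\<integral>\<^sup>+u. indicator (E x v \<inter> ?D) u \<partial>\<mu>)" by simp
    also have "\<dots> \<le> (\<integral>\<^sup>+u. liminf (\<lambda>k. indicator (E (?X k) (?V k) \<inter> ?D) u) \<partial>\<mu>)"
    proof (rule nn_integral_mono)
      fix u
      show "indicator (E x v \<inter> ?D) u \<le> liminf (\<lambda>k. indicator (E (?X k) (?V k) \<inter> ?D) u :: ennreal)"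
      proof (cases "u \<in> E x v \<inter> ?D")
        case True
        have cb: "isCont b y" for y using b by (simp add: continuous_on_eq_continuous_at)
        have "(\<lambda>k. (b (?X k + u) - b (?X k)) \<bullet> ?V k) \<longlonglongrightarrow> (b (x + u) - b x) \<bullet> v"
          by (intro tendsto_inner tendsto_diff isCont_tendsto_compose[OF cb] tendsto_add tendsto_const lx lv)
        then have "\<forall>\<^sub>F k in sequentially. (b (?X k + u) - b (?X k)) \<bullet> ?V k \<noteq> 0"
          by (rule tendsto_imp_eventually_ne) (use True in \<open>simp add: E_def\<close>)
        then have "\<forall>\<^sub>F k in sequentially. (1::ennreal) \<le> indicator (E (?X k) (?V k) \<inter> ?D) u"
          by eventually_elim (use True in \<open>simp add: E_def\<close>)
        then have "(1::ennreal) \<le> liminf (\<lambda>k. indicator (E (?X k) (?V k) \<inter> ?D) u)" by (rule Liminf_bounded)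
        then show ?thesis using True by simp
      qed simp
    qed
    also have "\<dots> \<le> liminf (\<lambda>k. \<integral>\<^sup>+u. indicator (E (?X k) (?V k) \<inter> ?D) u \<partial>\<mu>)"
      by (rule nn_integral_liminf) measurable
    also have "\<dots> \<le> ennreal c"
    proof (rule Liminf_le)
      have "(\<integral>\<^sup>+u. indicator (E (?X k) (?V k) \<inter> ?D) u \<partial>\<mu>) \<le> ennreal c" if "m \<le> k" for k
      proof -
        have "\<delta> (r k) \<le> \<delta> m" using that seq_suble[OF r, of k] by (intro anti) simp
        then have "E (?X k) (?V k) \<inter> ?D \<subseteq> E (?X k) (?V k) \<inter> {u. \<delta> (r k) < norm u}" by auto
        then have "emeasure \<mu> (E (?X k) (?V k) \<inter> ?D) \<le> emeasure \<mu> (E (?X k) (?V k) \<inter> {u. \<delta> (r k) < norm u})"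
          by (rule emeasure_mono) measurable
        also have "\<dots> \<le> ennreal c" using p(2) by (rule less_imp_le)
        finally show ?thesis by simp
      qed
      then show "\<forall>\<^sub>F k in sequentially. (\<integral>\<^sup>+u. indicator (E (?X k) (?V k) \<inter> ?D) u \<partial>\<mu>) \<le> ennreal c"
        by (auto simp: eventually_sequentially)
    qed simp
    finally show ?thesis .
  qed
  have Eq: "E x v = (\<Union>m. E x v \<inter> {u. \<delta> m < norm u})"
  proof safe
    fix u assume u: "u \<in> E x v"
    then have "u \<noteq> 0" by (auto simp: E_def)
    then obtain m where "inverse (real (Suc m)) < norm u" using reals_Archimedean[of "norm u"] by auto
    moreover have "\<delta> m \<le> inverse (real (Suc m))" by (simp add: \<delta>_def divide_inverse)
    ultimately show "u \<in> (\<Union>m. E x v \<inter> {u. \<delta> m < norm u})"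
      using u le_less_trans by blast
  qed
  have "emeasure \<mu> (E x v) = (SUP m. emeasure \<mu> (E x v \<inter> {u. \<delta> m < norm u}))"
    by (subst Eq, rule SUP_emeasure_incseq[symmetric]) (auto intro!: monoI dest: anti)
  also have "\<dots> \<le> ennreal c" by (intro SUP_least le)
  finally have "emeasure \<mu> (E x v) < \<infinity>" by (auto simp: le_less_trans)
  moreover have "v \<noteq> 0" using xv(3) by auto
  ultimately show False using inf[OF xv(2)] by (simp add: E_def)
qed

lemma (in smooth_drift) path_drift_bound:
  assumes g[measurable]: "g \<in> borel_measurable borel" and s: "0 \<le> s"
  shows "norm (path x g n z s - noise g n z s - x) \<le> B * s"
proof -
  let ?V = "noise g n z"
  let ?f = "\<lambda>r. a (flow x ?V r - ?V r + ?V r)"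
  have "solves (\<lambda>r z. a (z + ?V r)) x s (\<lambda>s. flow x ?V s - ?V s)" by (rule flow_solves) measurable
  then have int: "set_integrable lborel {0..s} ?f" and eq: "flow x ?V s - ?V s - x = (LINT r:{0..s}|lborel. ?f r)"
    using s by (auto simp: solves_def)
  have "(?f has_integral (LINT r:{0..s}|lborel. ?f r)) (cbox 0 s)"
    using set_borel_integral_eq_integral[OF int] by (simp add: has_integral_iff)
  from has_integral_bound[OF B_nonneg this bound]
  show ?thesis using s unfolding path_def eq by (simp add: content_real)
qed

lemma noise_strip: "noise g n (\<lambda>j. strip (z j)) = noise g n z"
  unfolding noise_def strip_def by (intro ext arg_cong2[where f = "(+)"] sum.cong) auto

context jump_noise begin

text \<open>G consists of the outcomes where some cell holds several jumps, of probability at most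
  \<eta>, and of those where the model path lies in N at time t. The latter has at most the
  probability of deficient rank, which is at most 4 \<eta>: p \<le> \<eta> for a jump in a given
  cell, 2 \<eta> for leaving the ball and \<eta> from the rank count. The null set of the last
  statement is fixed before y, so that y may afterwards be chosen depending on \<omega>.\<close>

lemma exceptional_event:
  fixes b :: "'a \<Rightarrow> 'a" and \<epsilon> \<eta> h t L B :: real
  assumes sd: "smooth_drift b b' L B" and lp: "levy_process M \<mu> \<nu> Y"
    and nd: "\<And>y v. y \<in> cball x \<epsilon> \<Longrightarrow> v \<noteq> 0 \<Longrightarrow> emeasure \<mu> {u. (b (y + u) - b y) \<bullet> v \<noteq> 0} = \<infinity>"
    and N: "N \<in> null_sets lborel" and \<eta>: "0 < \<eta>"
    and h: "0 < h" "h \<le> t" "DIM('a) * (exp (L * h) - 1) < 1" "B * h \<le> \<epsilon> / 2"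
    and start: "\<And>s. 0 < s \<Longrightarrow> s < h \<Longrightarrow> prob {\<omega> \<in> space M. \<epsilon> / 2 < norm (Y s \<omega> - Y 0 \<omega>)} \<le> \<eta>"
  shows "\<exists>G\<in>sets M. prob G \<le> 5 * \<eta> \<and> (AE \<omega> in M. \<forall>y. (\<forall>s\<in>{0..t}. set_integrable lborel {0..s} (\<lambda>r. b (y r)) \<and>
      y s = x + (LINT r:{0..s}|lborel. b (y r)) + Y s \<omega> - Y 0 \<omega>) \<longrightarrow> y t \<in> N \<longrightarrow> \<omega> \<in> G)"
proof -
  interpret sd: smooth_drift b b' L B by fact
  define D where "D = real DIM('a)"
  have D: "0 < D" by (simp add: D_def)
  \<comment> \<open>Chosen so that c n = exp(-p) h c0 is at least D / \<eta>; the 3 absorbs exp(-p),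
    which is at least 1/3 for p \<le> 1.\<close>
  define c0 where "c0 = 3 * D / (\<eta> * h)"
  have c0: "0 < c0" using D \<eta> h by (simp add: c0_def)
  have "continuous_on UNIV b" by (rule has_derivative_continuous_on) (use sd.deriv in auto)
  from nondegeneracy_uniform[OF \<mu> this compact_cball nd, of x \<epsilon> c0]
  obtain \<delta> where \<delta>: "0 < \<delta>" "\<delta> < 1" and nd': "\<And>y v. y \<in> cball x \<epsilon> \<Longrightarrow> v \<noteq> 0 \<Longrightarrow>
      ennreal c0 \<le> emeasure \<mu> ({u. (b (y + u) - b y) \<bullet> v \<noteq> 0} \<inter> {u. \<delta> < norm u})" by blast
  define m where "m = measure \<mu> {u. \<delta> < norm u}"
  have m: "0 \<le> m" by (simp add: m_def)
  \<comment> \<open>For the cell mass p = h m / n the summands provide p \<le> \<eta>, n p^2 \<le>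
    \<eta> and p \<le> 1.\<close>
  obtain n :: nat where n: "h * m / \<eta> + (h * m)\<^sup>2 / \<eta> + h * m + 1 < real n" using reals_Archimedean2 by blast
  have nn: "0 \<le> h * m / \<eta>" "0 \<le> (h * m)\<^sup>2 / \<eta>" "0 \<le> h * m" using h m \<eta> by auto
  have n0: "0 < real n" using n nn by linarith
  define l where "l = h / real n"
  have l: "0 < l" and nl: "real n * l = h" using n0 h by (auto simp: l_def)
  define p where "p = cell_mass l \<delta>"
  have p: "p = h * m / real n" by (simp add: p_def cell_mass_def l_def m_def)
  have p0: "0 \<le> p" using nn n0 by (simp add: p)
  have "h * m / \<eta> \<le> real n" using n nn by linarith
  then have p\<eta>: "p \<le> \<eta>" using \<eta> n0 by (simp add: p field_simps)
  have p1: "p \<le> 1" using n nn n0 by (simp add: p)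
  have "(h * m)\<^sup>2 / \<eta> \<le> real n" using n nn by linarith
  then have "(h * m)\<^sup>2 / real n \<le> \<eta>" using \<eta> n0 by (simp add: field_simps)
  then have np: "real n * p\<^sup>2 \<le> \<eta>" using n0 by (simp add: p power_divide power2_eq_square field_simps)
  let ?\<kappa> = "mark_law l \<delta>"
  let ?Z = "PiM {..<n} (cell_measure ?\<kappa> l)"
  define A where "A = (\<Union>j<n. cell l \<delta> j)"
  note \<kappa> = prob_space_mark_law[OF l \<delta>(1)] and s\<kappa> = sets_mark_law[OF l \<delta>(1)]
  interpret \<kappa>: prob_space ?\<kappa> by (rule \<kappa>)
  interpret W: prob_space "past A" by (rule prob_space_past)
  interpret CP: prob_space ?Z by (rule prob_space_PiM) (rule prob_space_cell_measure[OF \<kappa> l])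
  interpret P: pair_prob_space "past A" ?Z ..
  define Pn where "Pn = past A \<Otimes>\<^sub>M ?Z"
  interpret PP: prob_space Pn unfolding Pn_def by (rule P.prob_space_axioms)
  obtain g where g: "(\<lambda>(\<omega>, s). g \<omega> s) \<in> borel_measurable (past A \<Otimes>\<^sub>M borel)"
    and rep: "AE \<omega> in M. cadlag (g \<omega>) \<and> ((\<forall>j<n. emeasure (\<nu> \<omega>) (cell l \<delta> j) = 0 \<or> emeasure (\<nu> \<omega>) (cell l \<delta> j) = 1) \<longrightarrow>
      (\<forall>s\<ge>0. Y s \<omega> - Y 0 \<omega> = noise (g \<omega>) n (\<lambda>j. atom (cell l \<delta> j) \<omega>) s))"
    using noise_representation[OF lp l \<delta>, of n] unfolding A_def by blast
  have gM: "(\<lambda>(\<omega>, s). g \<omega> s) \<in> borel_measurable (M \<Otimes>\<^sub>M borel)"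
  proof -
    have "(\<lambda>q. (fst q, snd q)) \<in> M \<Otimes>\<^sub>M (borel :: real measure) \<rightarrow>\<^sub>M past A \<Otimes>\<^sub>M borel"
      by (intro measurable_Pair measurable_compose[OF measurable_fst measurable_id_past'] measurable_snd)
    from measurable_compose[OF this g] show ?thesis by (simp add: case_prod_unfold)
  qed
  have gw[measurable]: "g w \<in> borel_measurable borel" if "w \<in> space M" for w
    using measurable_compose[OF measurable_Pair1'[OF that] gM] by simp
  have mg: "(\<lambda>(p, s). g (fst p) s) \<in> borel_measurable (Pn \<Otimes>\<^sub>M borel)"
  proof -
    have "(\<lambda>p. (fst (fst p), snd p)) \<in> Pn \<Otimes>\<^sub>M (borel::real measure) \<rightarrow>\<^sub>M past A \<Otimes>\<^sub>M borel"
      unfolding Pn_def by measurable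
    from measurable_compose[OF this g] show ?thesis by (simp add: case_prod_unfold)
  qed
  have mz: "(\<lambda>p. fst (snd p j)) \<in> borel_measurable Pn" "(\<lambda>p. snd (snd p j)) \<in> borel_measurable Pn" if "j \<in> {..<n}" for j
  proof -
    have c: "(\<lambda>p. snd p j) \<in> Pn \<rightarrow>\<^sub>M lborel \<Otimes>\<^sub>M ?\<kappa>"
      unfolding Pn_def
      by (rule measurable_compose[OF measurable_snd])
         (use measurable_component_singleton[OF that, of "cell_measure ?\<kappa> l"] in \<open>simp add: measurable_cong_sets[OF refl sets_cell_measure]\<close>)
    show "(\<lambda>p. fst (snd p j)) \<in> borel_measurable Pn" using measurable_compose[OF c measurable_fst] by simp
    have "(\<lambda>p. snd (snd p j)) \<in> Pn \<rightarrow>\<^sub>M ?\<kappa>" by (rule measurable_compose[OF c measurable_snd])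
    then show "(\<lambda>p. snd (snd p j)) \<in> borel_measurable Pn" using measurable_cong_sets[OF refl s\<kappa>] by blast
  qed
  have mpath: "(\<lambda>p. sd.path x (g (fst p)) n (snd p) s) \<in> borel_measurable Pn" for s
    by (rule sd.measurable_path_at[OF mg]) (use mz in auto)
  define Q where "Q s S = {q \<in> space Pn. sd.path x (g (fst q)) n (snd q) s \<in> S}" for s S
  have Qs: "Q s S \<in> sets Pn" if "S \<in> sets borel" for s S
    using measurable_sets[OF mpath that] by (simp add: Q_def vimage_def Int_def conj_commute)
  \<comment> \<open>The path driven by the representation of the noise, defined and measurable
    whether or not the representation is valid. Almost surely outside the event E below it is the
    actual solution.\<close>
  define X where "X \<omega> = sd.path x (g \<omega>) n (\<lambda>j. atom (cell l \<delta> j) \<omega>)" for \<omega>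
  have Xm: "(\<lambda>\<omega>. X \<omega> s) \<in> borel_measurable M" for s
    unfolding X_def
  proof (rule sd.measurable_path_at[OF gM])
    fix j
    have "atom (cell l \<delta> j) \<in> borel_measurable M" by (rule measurable_atom[OF cell_sets[OF l \<delta>(1)]])
    then have "atom (cell l \<delta> j) \<in> M \<rightarrow>\<^sub>M borel \<Otimes>\<^sub>M borel" by (simp add: borel_prod)
    then show "(\<lambda>\<omega>. fst (atom (cell l \<delta> j) \<omega>)) \<in> borel_measurable M" "(\<lambda>\<omega>. snd (atom (cell l \<delta> j) \<omega>)) \<in> borel_measurable M"
      by measurable
  qed simp
  have XS: "{\<omega> \<in> space M. X \<omega> s \<in> S} \<in> sets M" if "S \<in> sets borel" for s S
    using measurable_sets[OF Xm that] by (simp add: vimage_def Int_def conj_commute)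
  have spZ: "space ?Z = extensional {..<n}"
  proof -
    have "space (cell_measure ?\<kappa> l j) = UNIV" for j
      using sets_eq_imp_space_eq[OF sets_cell_measure_borel[OF s\<kappa>]] by simp
    then show ?thesis by (simp add: space_PiM PiE_def)
  qed
  \<comment> \<open>The path does not see the times of zero marks; this is the invariance that
    \<open>transfer_law\<close> asks for.\<close>
  have law: "prob {\<omega> \<in> space M. X \<omega> s \<in> S} = measure Pn (Q s S)" if S: "S \<in> sets borel" for s S
  proof -
    have "prob {\<omega> \<in> space M. (\<omega>, \<lambda>j\<in>{..<n}. atom (cell l \<delta> j) \<omega>) \<in> Q s S} = measure Pn (Q s S)"
      unfolding Pn_def A_def
    proof (rule transfer_law[OF l \<delta>(1)])
      show "Q s S \<in> sets (past (\<Union>j<n. cell l \<delta> j) \<Otimes>\<^sub>M ?Z)" using Qs[OF S] by (simp add: Pn_def A_def)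
      fix \<omega> and z :: "nat \<Rightarrow> real \<times> 'a" assume "\<omega> \<in> space M" "z \<in> extensional {..<n}"
      moreover have "sd.path x (g \<omega>) n (\<lambda>j\<in>{..<n}. strip (z j)) = sd.path x (g \<omega>) n (\<lambda>j. strip (z j))"
        by (rule sd.path_cong) simp
      moreover have "sd.path x (g \<omega>) n (\<lambda>j. strip (z j)) = sd.path x (g \<omega>) n z"
        by (simp add: sd.path_def noise_strip)
      ultimately show "(\<omega>, \<lambda>j\<in>{..<n}. strip (z j)) \<in> Q s S \<longleftrightarrow> (\<omega>, z) \<in> Q s S"
        by (simp add: Q_def Pn_def space_pair_measure spZ)
    qed
    moreover have "(\<omega>, \<lambda>j\<in>{..<n}. atom (cell l \<delta> j) \<omega>) \<in> Q s S \<longleftrightarrow> X \<omega> s \<in> S" if "\<omega> \<in> space M" for \<omega>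
    proof -
      have "sd.path x (g \<omega>) n (\<lambda>j\<in>{..<n}. atom (cell l \<delta> j) \<omega>) = X \<omega>"
        unfolding X_def by (rule sd.path_cong) simp
      then show ?thesis using that by (simp add: Q_def Pn_def space_pair_measure spZ)
    qed
    ultimately show ?thesis by (simp cong: conj_cong)
  qed
  define E where "E = (\<Union>j<n. {\<omega> \<in> space M. emeasure (\<nu> \<omega>) (cell l \<delta> j) \<noteq> 0 \<and> emeasure (\<nu> \<omega>) (cell l \<delta> j) \<noteq> 1})"
  have cs: "cell l \<delta> j \<in> sets \<Lambda>" for j by (rule cell_sets[OF l \<delta>(1)])
  have E1: "{\<omega> \<in> space M. emeasure (\<nu> \<omega>) (cell l \<delta> j) \<noteq> 0 \<and> emeasure (\<nu> \<omega>) (cell l \<delta> j) \<noteq> 1} \<in> sets M" for j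
  proof -
    note [measurable] = measurable_\<nu>[OF cs[of j]]
    show ?thesis by measurable
  qed
  have Es: "E \<in> sets M" unfolding E_def using E1 by auto
  have "prob E \<le> (\<Sum>j<n. prob {\<omega> \<in> space M. emeasure (\<nu> \<omega>) (cell l \<delta> j) \<noteq> 0 \<and> emeasure (\<nu> \<omega>) (cell l \<delta> j) \<noteq> 1})"
    unfolding E_def by (rule finite_measure_subadditive_finite) (use E1 in auto)
  also have "\<dots> \<le> (\<Sum>j<n. p\<^sup>2)"
    by (intro sum_mono order_trans[OF prob_multi[OF cs]])
       (auto simp: p_def measure_cell[OF l \<delta>(1)] emeasure_cell[OF l \<delta>(1)])
  finally have pE: "prob E \<le> \<eta>" using np by simp
  have repE: "AE \<omega> in M. cadlag (g \<omega>) \<and> (\<omega> \<notin> E \<longrightarrow> (\<forall>s\<ge>0. Y s \<omega> - Y 0 \<omega> = noise (g \<omega>) n (\<lambda>j. atom (cell l \<delta> j) \<omega>) s))"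
    using rep AE_space by eventually_elim (auto simp: E_def)
  \<comment> \<open>Outside E the noise is almost surely the increment of Y, which exceeds
    \<epsilon> / 2 with probability at most \<eta>; the drift moves the path by at most B s \<le>
    \<epsilon> / 2. The second \<eta> is the probability of E.\<close>
  have leave: "measure Pn (Q s (- cball x \<epsilon>)) \<le> 2 * \<eta>" if s: "0 < s" "s < h" for s
  proof -
    let ?J = "{\<omega> \<in> space M. \<epsilon> / 2 < norm (Y s \<omega> - Y 0 \<omega>)}"
    have Js: "?J \<in> sets M"
    proof -
      have [measurable]: "Y s \<in> borel_measurable M" "Y 0 \<in> borel_measurable M" using lp s by (auto simp: levy_process_def)
      show ?thesis by measurable
    qed
    have "measure Pn (Q s (- cball x \<epsilon>)) = prob {\<omega> \<in> space M. X \<omega> s \<in> - cball x \<epsilon>}" by (rule law[symmetric]) simp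
    also have "\<dots> \<le> prob (E \<union> ?J)"
    proof (rule finite_measure_mono_AE)
      show "AE \<omega> in M. \<omega> \<in> {\<omega> \<in> space M. X \<omega> s \<in> - cball x \<epsilon>} \<longrightarrow> \<omega> \<in> E \<union> ?J"
        using repE AE_space
      proof eventually_elim
        case (elim \<omega>)
        show ?case
        proof (rule impI, rule ccontr)
          assume X: "\<omega> \<in> {\<omega> \<in> space M. X \<omega> s \<in> - cball x \<epsilon>}" and "\<omega> \<notin> E \<union> ?J"
          then have "\<omega> \<notin> E" and J: "norm (Y s \<omega> - Y 0 \<omega>) \<le> \<epsilon> / 2" using elim(2) by auto
          then have eq: "Y s \<omega> - Y 0 \<omega> = noise (g \<omega>) n (\<lambda>j. atom (cell l \<delta> j) \<omega>) s" using elim(1) s by simp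
          have "norm (X \<omega> s - (Y s \<omega> - Y 0 \<omega>) - x) \<le> B * s"
            unfolding eq X_def by (rule sd.path_drift_bound[OF gw[OF elim(2)]]) (use s in simp)
          moreover have "B * s \<le> \<epsilon> / 2" using s h(4) mult_left_mono[of s h B] sd.B_nonneg by simp
          moreover have "norm (X \<omega> s - x) \<le> norm (X \<omega> s - (Y s \<omega> - Y 0 \<omega>) - x) + norm (Y s \<omega> - Y 0 \<omega>)"
            using norm_triangle_ineq[of "X \<omega> s - (Y s \<omega> - Y 0 \<omega>) - x" "Y s \<omega> - Y 0 \<omega>"] by (simp add: algebra_simps)
          ultimately have "norm (X \<omega> s - x) \<le> \<epsilon>" using J by linarith
          then show False using X by (simp add: dist_norm norm_minus_commute)
        qed
      qed
    qed (use Es Js in auto)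
    also have "\<dots> \<le> prob E + prob ?J" by (rule measure_Un_le[OF Es Js])
    also have "\<dots> \<le> 2 * \<eta>" using pE start[OF s] by simp
    finally show ?thesis .
  qed
  define F where "F = {q \<in> space Pn. card {j. j < n \<and> gs (sd.jump_grad x (g (fst q)) (snd q)) j \<noteq> 0} < DIM('a)}"
  \<comment> \<open>Lower bound for the probability of a useful jump in one cell: l is its length,
    c0 the intensity of useful jumps, and exp(-p) accounts for the absence of further jumps.\<close>
  define c where "c = exp (- p) * l * c0"
  have c: "0 \<le> c" using l c0 by (simp add: c_def)
  have "c * real n * (measure Pn F - p - 2 * \<eta>) \<le> D"
    unfolding F_def Pn_def D_def
  proof (rule sd.deficiency_bound[OF W.prob_space_axioms g \<kappa> s\<kappa> l _ c, where \<epsilon> = \<epsilon>])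
    show "real DIM('a) * (exp (L * (real n * l)) - 1) < 1" using h(3) by (simp only: nl)
    have K: "emeasure ?\<kappa> S = ennreal (exp (- p) * l) * emeasure \<mu> (S \<inter> {u. \<delta> < norm u})" if "S \<in> sets borel" "0 \<notin> S" for S
      unfolding p_def by (rule emeasure_mark_law[OF l \<delta>(1) that])
    show "ennreal c \<le> emeasure ?\<kappa> {u. (b (y + u) - b y) \<bullet> v \<noteq> 0}" if "y \<in> cball x \<epsilon>" "v \<noteq> 0" for y v
    proof -
      have [measurable]: "b \<in> borel_measurable borel" using \<open>continuous_on UNIV b\<close> by (rule borel_measurable_continuous_onI)
      have "{u \<in> space borel. (b (y + u) - b y) \<bullet> v \<noteq> 0} \<in> sets borel" by measurable
      then have "emeasure ?\<kappa> {u. (b (y + u) - b y) \<bullet> v \<noteq> 0} = ennreal (exp (- p) * l) * emeasure \<mu> ({u. (b (y + u) - b y) \<bullet> v \<noteq> 0} \<inter> {u. \<delta> < norm u})"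
        by (intro K) auto
      moreover have "ennreal c = ennreal (exp (- p) * l) * ennreal c0" unfolding c_def using l by (simp add: ennreal_mult')
      ultimately show ?thesis using mult_left_mono[OF nd'[OF that], of "ennreal (exp (- p) * l)"] by simp
    qed
    have "- {0::'a} \<inter> {u. \<delta> < norm u} = {u. \<delta> < norm u}" using \<delta> by auto
    then have "emeasure ?\<kappa> (- {0}) = ennreal (exp (- p) * l) * ennreal m"
      using K[of "- {0}"] emeasure_\<mu>_away[OF \<delta>(1)] by (simp add: m_def)
    also have "\<dots> = ennreal (exp (- p) * p)" using m l by (simp add: ennreal_mult'[symmetric] p_def cell_mass_def m_def mult_ac)
    finally have "measure ?\<kappa> (- {0}) = exp (- p) * p" using p0 by (simp add: measure_def)
    also have "\<dots> \<le> 1 * p" using p0 by (intro mult_right_mono) auto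
    finally show "measure ?\<kappa> {u. u \<noteq> 0} \<le> p" by (simp add: Compl_eq)
    show "measure (past A \<Otimes>\<^sub>M ?Z) {q \<in> space (past A \<Otimes>\<^sub>M ?Z). sd.path x (g (fst q)) n (snd q) s \<notin> cball x \<epsilon>} \<le> 2 * \<eta>"
      if "0 < s" "s < real n * l" for s
      using leave[of s] that unfolding nl Q_def Pn_def by simp
  qed
  moreover have "D / \<eta> \<le> c * real n"
  proof -
    have "exp p \<le> 3" using exp_le p1 by (meson exp_le_cancel_iff order_trans)
    then have "1 / 3 \<le> exp (- p)" by (simp add: exp_minus field_simps)
    then have "1 / 3 * (3 * D / \<eta>) \<le> exp (- p) * (3 * D / \<eta>)" using D \<eta> by (intro mult_right_mono) auto
    also have "\<dots> = c * real n" using h n0 by (simp add: c_def c0_def l_def field_simps)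
    finally show ?thesis by simp
  qed
  \<comment> \<open>If the left side exceeded \<eta>, the rank count would exceed (D / \<eta>)
    \<eta> = D.\<close>
  ultimately have "measure Pn F - p - 2 * \<eta> \<le> \<eta>"
  proof -
    assume 1: "c * real n * (measure Pn F - p - 2 * \<eta>) \<le> D" and 2: "D / \<eta> \<le> c * real n"
    show ?thesis
    proof (rule ccontr)
      assume "\<not> ?thesis"
      then have "\<eta> < measure Pn F - p - 2 * \<eta>" by simp
      then have "D / \<eta> * \<eta> < D / \<eta> * (measure Pn F - p - 2 * \<eta>)" using D \<eta> by (intro mult_strict_left_mono) auto
      also have "\<dots> \<le> c * real n * (measure Pn F - p - 2 * \<eta>)"
        using 2 \<open>\<eta> < _\<close> \<eta> by (intro mult_right_mono) auto
      finally show False using 1 \<eta> by simp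
    qed
  qed
  then have pF: "measure Pn F \<le> 4 * \<eta>" using p\<eta> by linarith
  have Fs: "F \<in> sets Pn"
  proof -
    have [measurable]: "(\<lambda>q. gs (sd.jump_grad x (g (fst q)) (snd q)) j) \<in> borel_measurable Pn" if "j \<in> {..<n}" for j
      by (rule sd.measurable_gs_jump_grad[OF mg]) (use that mz in auto)
    have e: "card {j. j < n \<and> gs (sd.jump_grad x (g (fst q)) (snd q)) j \<noteq> 0} = (\<Sum>j\<in>{..<n}. of_bool (gs (sd.jump_grad x (g (fst q)) (snd q)) j \<noteq> 0))" for q
      by (simp add: sum.If_cases of_bool_def Int_def)
    show ?thesis unfolding F_def e by measurable
  qed
  have Nb: "N \<in> sets borel" using N by auto
  have "measure Pn (Q t N) \<le> measure Pn F"
  proof (rule PP.finite_measure_mono_AE[OF _ Fs])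
    have Ts: "Q t N - F \<in> sets Pn" using Qs[OF Nb] Fs by auto
    have "emeasure Pn (Q t N - F) = (\<integral>\<^sup>+\<omega>. emeasure ?Z (Pair \<omega> -` (Q t N - F)) \<partial>past A)"
      unfolding Pn_def by (rule CP.emeasure_pair_measure_alt) (use Ts in \<open>simp add: Pn_def\<close>)
    also have "\<dots> = (\<integral>\<^sup>+\<omega>. emeasure ?Z (Pair \<omega> -` (Q t N - F)) \<partial>M)"
      by (rule nn_integral_past, rule CP.measurable_emeasure_Pair) (use Ts in \<open>simp add: Pn_def\<close>)
    also have "\<dots> = (\<integral>\<^sup>+\<omega>. 0 \<partial>M)"
    proof (rule nn_integral_cong_AE)
      show "AE \<omega> in M. emeasure ?Z (Pair \<omega> -` (Q t N - F)) = 0"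
        using repE AE_space
      proof eventually_elim
        case (elim \<omega>)
        let ?f = "\<lambda>j y. ennreal (1 / l) * indicator {real j * l<..<real (Suc j) * l} (fst y)"
        interpret lk: pair_sigma_finite lborel ?\<kappa> ..
        have cell: "cell_measure ?\<kappa> l = (\<lambda>j. density (lborel \<Otimes>\<^sub>M ?\<kappa>) (?f j))" by (simp add: cell_measure_def fun_eq_iff)
        interpret C: product_prob_space "cell_measure ?\<kappa> l" by (intro product_prob_spaceI prob_space_cell_measure \<kappa> l)
        have "AE z in PiM {..<n} (\<lambda>_. lborel \<Otimes>\<^sub>M ?\<kappa>). (\<forall>j<n. fst (z j) \<in> {real j * l<..<real (Suc j) * l}) \<longrightarrow>
            card {j. j < n \<and> gs (sd.jump_grad x (g \<omega>) z) j \<noteq> 0} = DIM('a) \<longrightarrow> sd.path x (g \<omega>) n z t \<notin> N"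
          by (rule sd.AE_path_notin_null_set[OF gw[OF elim(2)] cadlag_countable_discontinuities \<kappa>.sigma_finite_measure_axioms s\<kappa> l _ _ N])
             (use elim(1) nl h in auto)
        then have "AE z in ?Z. (\<forall>j<n. fst (z j) \<in> {real j * l<..<real (Suc j) * l}) \<longrightarrow>
            card {j. j < n \<and> gs (sd.jump_grad x (g \<omega>) z) j \<noteq> 0} = DIM('a) \<longrightarrow> sd.path x (g \<omega>) n z t \<notin> N"
          unfolding cell
        proof (intro AE_PiM_density[where M = "\<lambda>_. lborel \<Otimes>\<^sub>M ?\<kappa>"])
          show "product_sigma_finite (\<lambda>_::nat. (lborel :: real measure) \<Otimes>\<^sub>M ?\<kappa>)" by standard
          show "product_sigma_finite (\<lambda>j. density (lborel \<Otimes>\<^sub>M ?\<kappa>) (?f j))"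
            using C.product_sigma_finite_axioms unfolding cell .
          show "?f j \<in> borel_measurable (lborel \<Otimes>\<^sub>M ?\<kappa>)" for j
            by (rule measurable_compose[OF measurable_fst, where g = "\<lambda>s. ennreal (1 / l) * indicator {real j * l<..<real (Suc j) * l} s"]) measurable
        qed simp_all
        moreover have "AE z in ?Z. \<forall>j\<in>{..<n}. fst (z j) \<in> {real j * l<..<real (Suc j) * l}"
        proof (rule AE_finite_allI)
          fix j assume j: "j \<in> {..<n}"
          show "AE z in ?Z. fst (z j) \<in> {real j * l<..<real (Suc j) * l}"
            by (rule AE_PiM_component[OF prob_space_cell_measure[OF \<kappa> l] j AE_cell_measure[OF \<kappa>]])
        qed simp
        ultimately have "AE z in ?Z. \<not> (z \<in> Pair \<omega> -` (Q t N - F))"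
        proof eventually_elim
          case (elim z)
          then show ?case
            using gs_card_le[of n "sd.jump_grad x (g \<omega>) z"] by (auto simp: Q_def F_def)
        qed
        from emeasure_eq_0_AE[OF this]
        have "emeasure ?Z {z \<in> space ?Z. z \<in> Pair \<omega> -` (Q t N - F)} = 0" .
        moreover have "{z \<in> space ?Z. z \<in> Pair \<omega> -` (Q t N - F)} = Pair \<omega> -` (Q t N - F)"
          by (auto simp: Q_def Pn_def space_pair_measure)
        ultimately show ?case by simp
      qed
    qed
    finally have "Q t N - F \<in> null_sets Pn" using Ts by (simp add: null_sets_def)
    from AE_not_in[OF this] show "AE q in Pn. q \<in> Q t N \<longrightarrow> q \<in> F" by eventually_elim auto
  qed
  then have "prob {\<omega> \<in> space M. X \<omega> t \<in> N} \<le> 4 * \<eta>" using pF law[OF Nb] by simp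
  then have pG: "prob (E \<union> {\<omega> \<in> space M. X \<omega> t \<in> N}) \<le> 5 * \<eta>"
    using measure_Un_le[OF Es XS[OF Nb], of t] pE by simp
  have "AE \<omega> in M. \<forall>y. (\<forall>s\<in>{0..t}. set_integrable lborel {0..s} (\<lambda>r. b (y r)) \<and>
      y s = x + (LINT r:{0..s}|lborel. b (y r)) + Y s \<omega> - Y 0 \<omega>) \<longrightarrow> y t \<in> N \<longrightarrow> \<omega> \<in> E \<union> {\<omega> \<in> space M. X \<omega> t \<in> N}"
    using repE AE_space
  proof eventually_elim
    case (elim \<omega>)
    let ?V = "noise (g \<omega>) n (\<lambda>j. atom (cell l \<delta> j) \<omega>)"
    show ?case
    proof (intro allI impI)
      fix y assume y: "\<forall>s\<in>{0..t}. set_integrable lborel {0..s} (\<lambda>r. b (y r)) \<and>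
          y s = x + (LINT r:{0..s}|lborel. b (y r)) + Y s \<omega> - Y 0 \<omega>" and yN: "y t \<in> N"
      show "\<omega> \<in> E \<union> {\<omega> \<in> space M. X \<omega> t \<in> N}"
      proof (cases "\<omega> \<in> E")
        case False
        then have V: "?V s = Y s \<omega> - Y 0 \<omega>" if "0 \<le> s" for s using elim(1) that by simp
        have "solves (\<lambda>r z. b (z + ?V r)) x t (\<lambda>s. y s - ?V s)"
          unfolding solves_def
        proof
          fix s assume s: "s \<in> {0..t}"
          then have y1: "y s = x + (LINT r:{0..s}|lborel. b (y r)) + Y s \<omega> - Y 0 \<omega>" and s0: "0 \<le> s" using y by auto
          have "y s = x + (LINT r:{0..s}|lborel. b (y r)) + ?V s" unfolding V[OF s0] using y1 by (simp only: add_diff_eq)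
          then show "set_integrable lborel {0..s} (\<lambda>r. b (y r - ?V r + ?V r)) \<and>
              y s - ?V s = x + (LINT r:{0..s}|lborel. b (y r - ?V r + ?V r))" using y s by simp
        qed
        then have "X \<omega> t = y t"
          unfolding X_def sd.path_def
          by (intro sd.flow_eqI[where T = t] measurable_noise gw[OF elim(2)]) (use h in auto)
        then show ?thesis using yN elim(2) by simp
      qed simp
    qed
  qed
  then show ?thesis using pG Es XS[OF Nb] by (intro bexI[of _ "E \<union> {\<omega> \<in> space M. X \<omega> t \<in> N}"]) auto
qed

end

text \<open>Right continuity at 0 gives convergence in probability, by dominated convergence of the
  indicators along a sequence of times that would violate the claim.\<close>

lemma (in prob_space) cadlag_start:
  fixes Y :: "real \<Rightarrow> 'a \<Rightarrow> 'b::euclidean_space"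
  assumes Y: "\<And>s. 0 \<le> s \<Longrightarrow> Y s \<in> borel_measurable M" and c: "AE \<omega> in M. cadlag (\<lambda>s. Y s \<omega>)"
    and e: "0 < e" and \<eta>: "0 < \<eta>"
  shows "\<exists>d>0. \<forall>s. 0 < s \<longrightarrow> s < d \<longrightarrow> prob {\<omega> \<in> space M. e < norm (Y s \<omega> - Y 0 \<omega>)} \<le> \<eta>"
proof (rule ccontr)
  define A where "A s = {\<omega> \<in> space M. e < norm (Y s \<omega> - Y 0 \<omega>)}" for s
  assume "\<not> ?thesis"
  then have "\<exists>s. 0 < s \<and> s < inverse (real (Suc k)) \<and> \<eta> < prob (A s)" for k
    unfolding A_def by (auto simp: not_le dest: spec[of _ "inverse (real (Suc k))"])
  then obtain s where s: "\<And>k. 0 < s k" "\<And>k. s k < inverse (real (Suc k))" "\<And>k. \<eta> < prob (A (s k))" by metis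
  have As[measurable]: "A (s k) \<in> sets M" for k
  proof -
    have [measurable]: "Y (s k) \<in> borel_measurable M" "Y 0 \<in> borel_measurable M" using Y s(1)[of k] by auto
    show ?thesis unfolding A_def by measurable
  qed
  have s0: "s \<longlonglongrightarrow> 0"
    by (rule tendsto_sandwich[OF _ _ tendsto_const LIMSEQ_inverse_real_of_nat]) (use s(1,2) in \<open>auto intro: always_eventually less_imp_le\<close>)
  then have sr: "filterlim s (at_right 0) sequentially"
    using s(1) by (auto simp: filterlim_at less_imp_neq[THEN not_sym] intro!: always_eventually)
  have "(\<lambda>k. LINT \<omega>|M. indicator (A (s k)) \<omega>) \<longlonglongrightarrow> (LINT \<omega>|M. (0::real))"
  proof (rule integral_dominated_convergence[where w = "\<lambda>_. 1"])
    show "AE \<omega> in M. (\<lambda>k. indicator (A (s k)) \<omega> :: real) \<longlonglongrightarrow> 0"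
      using c
    proof eventually_elim
      case (elim \<omega>)
      have "((\<lambda>s. Y s \<omega>) \<longlongrightarrow> Y 0 \<omega>) (at_right 0)" using elim by (simp add: cadlag_def)
      from tendstoD[OF filterlim_compose[OF this sr] e]
      have "\<forall>\<^sub>F k in sequentially. indicator (A (s k)) \<omega> = (0::real)"
        by eventually_elim (simp add: A_def dist_norm)
      then show ?case by (rule tendsto_eventually)
    qed
  qed (auto simp: indicator_def)
  then have "(\<lambda>k. prob (A (s k))) \<longlonglongrightarrow> 0" by simp
  from order_tendstoD(2)[OF this \<eta>] obtain k where "prob (A (s k)) < \<eta>" by (auto simp: eventually_sequentially)
  then show False using s(3)[of k] by simp
qed

context jump_noise begin

text \<open>Solutions that stay in the ball of radius K also solve the equation with truncated
  drift. The exceptional events of arbitrarily small probability are then intersected to a null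
  set.\<close>

lemma bounded_solution_notin_null_set:
  fixes a :: "'a \<Rightarrow> 'a"
  assumes lp: "levy_process M \<mu> \<nu> Y" and a: "C1_map a" and \<epsilon>: "0 < \<epsilon>"
    and nd: "\<And>y v. y \<in> cball x \<epsilon> \<Longrightarrow> v \<noteq> 0 \<Longrightarrow> emeasure \<mu> {u. (a (y + u) - a y) \<bullet> v \<noteq> 0} = \<infinity>"
    and t: "0 < t" and N: "N \<in> null_sets lborel"
  shows "AE \<omega> in M. \<forall>y. (\<forall>s\<in>{0..t}. norm (y s) \<le> K \<and> set_integrable lborel {0..s} (\<lambda>r. a (y r)) \<and>
      y s = x + (LINT r:{0..s}|lborel. a (y r)) + Y s \<omega> - Y 0 \<omega>) \<longrightarrow> y t \<notin> N"
proof -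
  \<comment> \<open>Large enough that truncation leaves a unchanged at y and y + u for y in the ball
    and norm u \<le> 1. Only larger jumps can lose their effect, and these have finite mass, so the
    infinite mass survives.\<close>
  define K' where "K' = max K (norm x + \<epsilon> + 1)"
  obtain b b' B where b: "\<And>y. norm y \<le> K' \<Longrightarrow> b y = a y" "\<And>y. (b has_derivative blinfun_apply (b' y)) (at y)"
    "continuous_on UNIV b'" "\<And>y. norm (b y) \<le> B" "\<And>y. norm (b' y) \<le> B"
    using C1_truncation[OF a, of K'] by metis
  \<comment> \<open>The Lipschitz constant has to be positive, while B could be 0.\<close>
  define L where "L = max B 1"
  have sd: "smooth_drift b b' L B"
    by standard (use b in \<open>auto simp: L_def intro: max.coboundedI1\<close>)
  have [measurable]: "b \<in> borel_measurable borel"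
    by (intro borel_measurable_continuous_onI has_derivative_continuous_on[where f' = "\<lambda>y. blinfun_apply (b' y)"]) (simp add: b(2))
  have s\<mu>: "sets \<mu> = sets borel" using \<mu> by (simp add: levy_measure_def)
  have ndb: "emeasure \<mu> {u. (b (y + u) - b y) \<bullet> v \<noteq> 0} = \<infinity>" if y: "y \<in> cball x \<epsilon>" and v: "v \<noteq> 0" for y v
  proof -
    let ?E = "{u. (b (y + u) - b y) \<bullet> v \<noteq> 0}" and ?D = "{u::'a. 1 < norm u}"
    have "{u \<in> space borel. (b (y + u) - b y) \<bullet> v \<noteq> 0} \<in> sets borel" by measurable
    then have Es: "?E \<in> sets \<mu>" and Ds: "?D \<in> sets \<mu>" by (auto simp: s\<mu>)
    have ny: "norm y \<le> norm x + \<epsilon>"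
      using y norm_triangle_ineq[of x "y - x"] by (simp add: dist_norm norm_minus_commute)
    have "{u. (a (y + u) - a y) \<bullet> v \<noteq> 0} \<subseteq> ?E \<union> ?D"
    proof
      fix u assume u: "u \<in> {u. (a (y + u) - a y) \<bullet> v \<noteq> 0}"
      show "u \<in> ?E \<union> ?D"
      proof (cases "1 < norm u")
        case False
        then have "norm (y + u) \<le> K'" "norm y \<le> K'"
          using norm_triangle_ineq[of y u] ny \<epsilon> by (auto simp: K'_def)
        then show ?thesis using u b(1) by simp
      qed simp
    qed
    then have "emeasure \<mu> {u. (a (y + u) - a y) \<bullet> v \<noteq> 0} \<le> emeasure \<mu> (?E \<union> ?D)"
      by (rule emeasure_mono) (use Es Ds in auto)
    also have "\<dots> \<le> emeasure \<mu> ?E + emeasure \<mu> ?D" by (rule emeasure_subadditive[OF Es Ds])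
    finally have "\<infinity> \<le> emeasure \<mu> ?E + emeasure \<mu> ?D" using nd[OF y v] by simp
    moreover have "emeasure \<mu> ?D < \<infinity>" by (rule levy_measure_finite_away[OF \<mu>]) simp
    ultimately show ?thesis by (auto simp: top_unique)
  qed
  have Ym: "\<And>s. 0 \<le> s \<Longrightarrow> Y s \<in> borel_measurable M" and Yc: "AE \<omega> in M. cadlag (\<lambda>s. Y s \<omega>)"
    using lp by (auto simp: levy_process_def)
  let ?sol = "\<lambda>\<omega> y. \<forall>s\<in>{0..t}. set_integrable lborel {0..s} (\<lambda>r. b (y r)) \<and>
      y s = x + (LINT r:{0..s}|lborel. b (y r)) + Y s \<omega> - Y 0 \<omega>"
  define P where "P k G \<longleftrightarrow> G \<in> sets M \<and> prob G \<le> 5 * inverse (real (Suc k)) \<and>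
    (AE \<omega> in M. \<forall>y. ?sol \<omega> y \<longrightarrow> y t \<in> N \<longrightarrow> \<omega> \<in> G)" for k G
  have "\<exists>G. P k G" for k
  proof -
    define \<eta> where "\<eta> = inverse (real (Suc k))"
    have \<eta>: "0 < \<eta>" by (simp add: \<eta>_def)
    obtain d where d: "0 < d" "\<And>s. 0 < s \<Longrightarrow> s < d \<Longrightarrow> prob {\<omega> \<in> space M. \<epsilon> / 2 < norm (Y s \<omega> - Y 0 \<omega>)} \<le> \<eta>"
      using cadlag_start[OF Ym Yc, of "\<epsilon> / 2" \<eta>] \<epsilon> \<eta> by auto
    \<comment> \<open>All requirements on the horizon hold for every sufficiently small h > 0: the
      linearized flow near the identity, little drift, little noise.\<close>
    have "((\<lambda>h. real DIM('a) * (exp (L * h) - 1)) \<longlongrightarrow> real DIM('a) * (exp (L * 0) - 1)) (at_right 0)"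
      by (intro tendsto_intros)
    then have 1: "\<forall>\<^sub>F h in at_right 0. real DIM('a) * (exp (L * h) - 1) < 1" by (rule order_tendstoD) simp
    have "((\<lambda>h. B * h) \<longlongrightarrow> B * 0) (at_right 0)" by (intro tendsto_intros)
    then have 2: "\<forall>\<^sub>F h in at_right 0. B * h < \<epsilon> / 2" by (rule order_tendstoD) (use \<epsilon> in simp)
    have 3: "\<forall>\<^sub>F h in at_right 0. h \<in> {0<..<min t d}" by (rule eventually_at_right_real) (use t d in simp)
    from 1 2 3 have "\<forall>\<^sub>F h in at_right 0. 0 < h \<and> h \<le> t \<and> h \<le> d \<and> real DIM('a) * (exp (L * h) - 1) < 1 \<and> B * h \<le> \<epsilon> / 2"
      by eventually_elim auto
    from eventually_happens'[OF _ this] obtain h where "0 < h" "h \<le> t" "h \<le> d" "real DIM('a) * (exp (L * h) - 1) < 1" "B * h \<le> \<epsilon> / 2"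
      by auto
    note h = this
    have "prob {\<omega> \<in> space M. \<epsilon> / 2 < norm (Y s \<omega> - Y 0 \<omega>)} \<le> \<eta>" if "0 < s" "s < h" for s
      using d(2)[of s] that h(3) by simp
    from exceptional_event[OF sd lp ndb N \<eta> h(1,2,4,5) this]
    show ?thesis unfolding P_def \<eta>_def[symmetric] Bex_def .
  qed
  then have "\<forall>k. \<exists>G. P k G" ..
  from choice[OF this] obtain G where "\<And>k. P k (G k)" by auto
  then have G: "\<And>k. G k \<in> sets M" "\<And>k. prob (G k) \<le> 5 * inverse (real (Suc k))"
    "\<And>k. AE \<omega> in M. \<forall>y. ?sol \<omega> y \<longrightarrow> y t \<in> N \<longrightarrow> \<omega> \<in> G k" unfolding P_def by simp_all
  have Is: "(\<Inter>k. G k) \<in> sets M" using G(1) by auto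
  have "prob (\<Inter>k. G k) \<le> 5 * inverse (real (Suc k))" for k
    using finite_measure_mono[of "\<Inter>k. G k" "G k"] G(1,2)[of k] by (auto intro: order_trans)
  moreover have "(\<lambda>k. 5 * inverse (real (Suc k))) \<longlonglongrightarrow> 5 * 0" by (intro tendsto_mult tendsto_const LIMSEQ_inverse_real_of_nat)
  ultimately have "prob (\<Inter>k. G k) \<le> 5 * 0" by (meson LIMSEQ_le_const)
  then have "prob (\<Inter>k. G k) = 0" using measure_nonneg[of M "\<Inter>k. G k"] by linarith
  then have "(\<Inter>k. G k) \<in> null_sets M" using Is by (simp add: null_sets_def emeasure_eq_measure)
  then have "AE \<omega> in M. \<omega> \<notin> (\<Inter>k. G k)" by (rule AE_not_in)
  moreover have "AE \<omega> in M. \<forall>k y. ?sol \<omega> y \<longrightarrow> y t \<in> N \<longrightarrow> \<omega> \<in> G k" unfolding AE_all_countable using G(3) by blast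
  ultimately show ?thesis
  proof eventually_elim
    case (elim \<omega>)
    show ?case
    proof (intro allI impI notI)
      fix y assume y: "\<forall>s\<in>{0..t}. norm (y s) \<le> K \<and> set_integrable lborel {0..s} (\<lambda>r. a (y r)) \<and>
        y s = x + (LINT r:{0..s}|lborel. a (y r)) + Y s \<omega> - Y 0 \<omega>" and yN: "y t \<in> N"
      have "(\<lambda>r. indicator {0..s} r *\<^sub>R b (y r)) = (\<lambda>r. indicator {0..s} r *\<^sub>R a (y r))" if s: "s \<in> {0..t}" for s
      proof
        fix r
        show "indicator {0..s} r *\<^sub>R b (y r) = indicator {0..s} r *\<^sub>R a (y r)"
        proof (cases "r \<in> {0..s}")
          case True
          then have "r \<in> {0..t}" using s by simp
          then have "norm (y r) \<le> K" using y by blast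
          then have "norm (y r) \<le> K'" by (simp add: K'_def)
          then show ?thesis by (simp only: b(1))
        qed simp
      qed
      then have "?sol \<omega> y" using y by (simp add: set_integrable_def set_lebesgue_integral_def)
      then show False using elim yN by blast
    qed
  qed
qed

end

theorem theorem1p1:
  fixes M :: "'w measure"
    and \<mu> :: "(real ^ 'm) measure"
    and \<nu> :: "'w \<Rightarrow> (real \<times> (real ^ 'm)) measure"
    and U :: "real \<Rightarrow> 'w \<Rightarrow> real ^ 'm"
    and a :: "real ^ 'm \<Rightarrow> real ^ 'm"
    and X :: "real ^ 'm \<Rightarrow> real \<Rightarrow> 'w \<Rightarrow> real ^ 'm"
    and xs :: "real ^ 'm"
    and \<epsilon> :: real
  assumes "prob_space M"
    and "levy_measure \<mu>"
    and "poisson_point_measure M (levy_intensity \<mu>) \<nu>"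
    and "levy_process M \<mu> \<nu> U"
    and "C1_map a"
    and "linear_growth a"
    and "\<And>x. sde_solution M a U x (X x)"
    and "\<epsilon> > 0"
    and "\<And>v x. v \<noteq> 0 \<Longrightarrow> x \<in> cball xs \<epsilon> \<Longrightarrow>
           emeasure \<mu> {u. (a (x + u) - a x) \<bullet> v \<noteq> 0} = \<infinity>"
  shows "\<forall>t>0. absolutely_continuous lborel (distr M borel (X xs t))"
proof (intro allI impI)
  fix t :: real assume t: "0 < t"
  interpret jump_noise M \<mu> \<nu> by (intro jump_noise.intro jump_noise_axioms.intro assms)
  have Xm[measurable]: "X xs t \<in> borel_measurable M"
    and sol: "AE \<omega> in M. \<forall>t\<ge>0. set_integrable lborel {0..t} (\<lambda>s. a (X xs s \<omega>)) \<and>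
      X xs t \<omega> = xs + (LINT s:{0..t}|lborel. a (X xs s \<omega>)) + U t \<omega> - U 0 \<omega>"
    using assms(7)[of xs] t by (auto simp: sde_solution_def)
  have Uc: "AE \<omega> in M. cadlag (\<lambda>s. U s \<omega>)" using assms(4) by (simp add: levy_process_def)
  show "absolutely_continuous lborel (distr M borel (X xs t))"
    unfolding absolutely_continuous_def
  proof
    fix N :: "(real ^ 'm) set" assume N: "N \<in> null_sets lborel"
    \<comment> \<open>The size of the path is random, so all natural bounds K are treated under one
      null set. Each path is bounded on [0, t], its integral part being continuous and U cadlag, and
      picks its own K.\<close>
    have "AE \<omega> in M. \<forall>K::nat. \<forall>y. (\<forall>s\<in>{0..t}. norm (y s) \<le> real K \<and> set_integrable lborel {0..s} (\<lambda>r. a (y r)) \<and>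
      y s = xs + (LINT r:{0..s}|lborel. a (y r)) + U s \<omega> - U 0 \<omega>) \<longrightarrow> y t \<notin> N"
      unfolding AE_all_countable
      by (intro allI bounded_solution_notin_null_set[OF assms(4,5,8) assms(9) t N])
    then have "AE \<omega> in M. X xs t \<omega> \<notin> N"
      using sol Uc
    proof eventually_elim
      case (elim \<omega>)
      let ?I = "\<lambda>s. LINT r:{0..s}|lborel. a (X xs r \<omega>)"
      have "continuous_on {0..t} ?I" by (rule continuous_on_set_integral) (use elim(2) t in simp)
      then have "bounded (?I ` {0..t})" by (intro compact_imp_bounded compact_continuous_image) auto
      then obtain C where C: "\<And>s. s \<in> {0..t} \<Longrightarrow> norm (?I s) \<le> C" by (meson bounded_iff imageI)
      obtain C' where C': "\<And>s. s \<in> {0..t} \<Longrightarrow> norm (U s \<omega>) \<le> C'"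
        using cadlag_bounded[OF elim(3), of t] by (meson bounded_iff imageI)
      obtain K :: nat where K: "norm xs + C + C' + norm (U 0 \<omega>) \<le> real K" using real_arch_simple by blast
      have "norm (X xs s \<omega>) \<le> real K" if s: "s \<in> {0..t}" for s
      proof -
        have eq: "X xs s \<omega> = (xs + ?I s) + (U s \<omega> - U 0 \<omega>)" using elim(2) s by auto
        have "norm (X xs s \<omega>) \<le> norm (xs + ?I s) + norm (U s \<omega> - U 0 \<omega>)" unfolding eq by (rule norm_triangle_ineq)
        then show ?thesis
          using norm_triangle_ineq[of xs "?I s"] norm_triangle_ineq4[of "U s \<omega>" "U 0 \<omega>"] C[OF s] C'[OF s] K
          by linarith
      qed
      then have "\<forall>s\<in>{0..t}. norm (X xs s \<omega>) \<le> real K \<and> set_integrable lborel {0..s} (\<lambda>r. a (X xs r \<omega>)) \<and>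
        X xs s \<omega> = xs + (LINT r:{0..s}|lborel. a (X xs r \<omega>)) + U s \<omega> - U 0 \<omega>" using elim(2) by auto
      then show ?case using elim(1) by (auto dest!: spec[of _ K] spec[of _ "\<lambda>s. X xs s \<omega>"])
    qed
    then have "emeasure M {\<omega> \<in> space M. X xs t \<omega> \<in> N} = 0" by (intro emeasure_eq_0_AE) auto
    moreover have "N \<in> sets borel" using N by auto
    ultimately show "N \<in> null_sets (distr M borel (X xs t))"
      by (simp add: null_sets_def emeasure_distr vimage_def Int_def conj_commute)
  qed
qed

end
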